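(* Let $k\geq 3$ be an integer, let $f$ be the random multiplicative function supported on $k$-free integers (defined in the context), and let $\zeta(r):=\sum_{n\geq 1}n^{-r}$ for $r>1$. Then $$\Big(\frac{1}{(\log 1/s)^{1/2}}\Big(\log \sum_{n\geq 1} \frac{f(n)}{n^{1/2+s^t}}-\frac{\log \zeta(1+2s^t)}{2} \Big)\Big)_{t\geq 0}\ \Longrightarrow\ (B(t))_{t\geq 0},\qquad s\to 0+,$$ on $C[0,\infty)$, where $(B(t))_{t\ge0}$ is a standard Brownian motion, and $$C\Big(\Big(\Big(\frac{1}{2\log 1/s\, \log\log\log 1/s}\Big)^{1/2}\Big(\log \sum_{n\geq 1}\frac{f(n)}{n^{1/2+s}}-\frac{\log \zeta(1+2s)}{2}\Big):\ s\in(0,\mathrm{e}^{-\mathrm{e}})\Big)\Big)=[-1,1]\quad\text{a.s.}$$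
   Context: A positive integer is called $k$-free if it has no divisor (greater than $1$) which is a perfect $k$th power. Let $(f(p))_{p\text{ prime}}$ be independent random variables with $\mathbb{P}\{f(p)=1\}=\mathbb{P}\{f(p)=-1\}=1/2$. Put $f(1):=1$; for $k$-free $n$ with prime factorization $n=\prod_p p^{j_p}$ (so that every $j_p<k$) put $f(n):=\prod_p (f(p))^{j_p}$; and put $f(n):=0$ if $n$ is not $k$-free. For instance, if $k=3$, then $f(12)=f(3)(f(2))^2=f(3)$ and $f(24)=0$. For $s>0$ one has the Euler product representation $\sum_{n\ge1}f(n)n^{-1/2-s}=\prod_p\big(1+\frac{f(p)}{p^{1/2+s}}+\frac{(f(p))^2}{p^{1+2s}}+\ldots+\frac{(f(p))^{k-1}}{p^{(1/2+s)(k-1)}}\big)$ a.s. (product over primes), which is strictly positive, so that its logarithm is real-valued. In the first assertion $s\in(0,1)$. $C[0,\infty)$ is the space of real-valued continuous functions on $[0,\infty)$ with the topology of locally uniform convergence, and $\Longrightarrow$ denotes weak convergence in this function space. For a family $(x_s)$ of real numbers, $C((x_s))$ denotes the set of its limit points as $s\to 0+$. *)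

theory Defs
  imports "HOL-Probability.Probability" "HOL-Computational_Algebra.Primes"
begin

section \<open>The random multiplicative function\<close>

definition kfree :: "nat \<Rightarrow> nat \<Rightarrow> bool" where
  "kfree k n \<longleftrightarrow> n > 0 \<and> (\<forall>d>1. \<not> d ^ k dvd n)"

definition kfree_mult :: "nat \<Rightarrow> (nat \<Rightarrow> real) \<Rightarrow> nat \<Rightarrow> real" where
  "kfree_mult k x n =
     (if kfree k n then \<Prod>p\<in>prime_factors n. x p ^ multiplicity p n else 0)"

text \<open>Both series are indexed from \<open>0\<close>, so the \<open>n\<close>-th term belongs to the integer \<open>Suc n\<close>.\<close>

definition dirichlet_sum :: "(nat \<Rightarrow> real) \<Rightarrow> real \<Rightarrow> real" where
  "dirichlet_sum a r = (\<Sum>n. a (Suc n) / real (Suc n) powr r)"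

definition zeta :: "real \<Rightarrow> real" where
  "zeta r = (\<Sum>n. real (Suc n) powr (- r))"

definition centred_log_sum :: "nat \<Rightarrow> (nat \<Rightarrow> real) \<Rightarrow> real \<Rightarrow> real" where
  "centred_log_sum k x s =
     ln (dirichlet_sum (kfree_mult k x) (1/2 + s)) - ln (zeta (1 + 2 * s)) / 2"


section \<open>The space of continuous functions on the half-line\<close>

text \<open>Elements are normalised to be \<open>undefined\<close> on the negative half-line, so that equality
  in the type is equality on \<open>{0..}\<close>.\<close>

typedef cpath = "{x :: real \<Rightarrow> real. continuous_on {0..} x \<and> x \<in> extensional {0..}}"
  morphisms path_at Abs_cpath
proof (rule exI[of _ "restrict (\<lambda>_. 0) {0..}"])
  have "continuous_on {0..} (restrict (\<lambda>_. 0 :: real) {0 :: real..})"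
    by (rule continuous_on_eq[OF continuous_on_const[of _ 0]]) simp
  then show "restrict (\<lambda>_. 0) {0..} \<in> {x :: real \<Rightarrow> real. continuous_on {0..} x \<and> x \<in> extensional {0..}}"
    by simp
qed

instantiation cpath :: topological_space
begin

text \<open>Locally uniform convergence: the sets of all \<open>y\<close> that are uniformly \<open>e\<close>-close to \<open>x\<close> on
  \<open>{0..T}\<close> form a neighbourhood base at \<open>x\<close>.\<close>

definition open_cpath :: "cpath set \<Rightarrow> bool" where
  "open_cpath U \<longleftrightarrow>
     (\<forall>x\<in>U. \<exists>T\<ge>0. \<exists>e>0. \<forall>y. (\<forall>t\<in>{0..T}. \<bar>path_at y t - path_at x t\<bar> < e) \<longrightarrow> y \<in> U)"

instance
proof
  show "open (UNIV :: cpath set)"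
    unfolding open_cpath_def by (auto intro: exI[of _ "0::real"] exI[of _ "1::real"])
next
  fix S T :: "cpath set"
  assume S: "open S" and T: "open T"
  show "open (S \<inter> T)"
    unfolding open_cpath_def
  proof
    fix x assume x: "x \<in> S \<inter> T"
    obtain a d where a: "a \<ge> 0" "d > 0"
        "\<And>y. (\<forall>t\<in>{0..a}. \<bar>path_at y t - path_at x t\<bar> < d) \<Longrightarrow> y \<in> S"
      using S x unfolding open_cpath_def by blast
    obtain b e where b: "b \<ge> 0" "e > 0"
        "\<And>y. (\<forall>t\<in>{0..b}. \<bar>path_at y t - path_at x t\<bar> < e) \<Longrightarrow> y \<in> T"
      using T x unfolding open_cpath_def by blast
    have "\<forall>y. (\<forall>t\<in>{0..max a b}. \<bar>path_at y t - path_at x t\<bar> < min d e) \<longrightarrow> y \<in> S \<inter> T"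
      by (intro allI impI IntI a(3) b(3)) auto
    moreover have "max a b \<ge> 0" "min d e > 0"
      using a b by auto
    ultimately show "\<exists>c\<ge>0. \<exists>r>0. \<forall>y. (\<forall>t\<in>{0..c}. \<bar>path_at y t - path_at x t\<bar> < r) \<longrightarrow> y \<in> S \<inter> T"
      by blast
  qed
next
  fix K :: "cpath set set"
  assume "\<forall>S\<in>K. open S"
  then show "open (\<Union>K)"
    unfolding open_cpath_def by (meson UnionE UnionI)
qed

end

text \<open>The zero path is returned for arguments that are not continuous on \<open>{0..}\<close>.\<close>

definition to_cpath :: "(real \<Rightarrow> real) \<Rightarrow> cpath" where
  "to_cpath x = Abs_cpath (restrict (if continuous_on {0..} x then x else (\<lambda>_. 0)) {0..})"

lemma path_at_to_cpath:
  assumes "continuous_on {0..} x" and "t \<ge> 0"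
  shows "path_at (to_cpath x) t = x t"
proof -
  have "continuous_on {0..} (restrict x {0..})"
    by (rule continuous_on_eq[OF assms(1)]) simp
  then show ?thesis
    using assms by (simp add: to_cpath_def Abs_cpath_inverse)
qed


section \<open>Processes, Brownian motion, and weak convergence\<close>

text \<open>A process is a map \<open>X\<close> taking a time \<open>t\<close> and a sample point; only times \<open>t \<ge> 0\<close> matter.\<close>

definition continuous_process :: "'a measure \<Rightarrow> (real \<Rightarrow> 'a \<Rightarrow> real) \<Rightarrow> bool" where
  "continuous_process M X \<longleftrightarrow>
     (\<forall>t\<ge>0. X t \<in> borel_measurable M) \<and> (AE \<omega> in M. continuous_on {0..} (\<lambda>t. X t \<omega>))"

text \<open>Paths are continuous only almost surely, and the exceptional set need not be measurable;
  with the completion of \<open>M\<close>, the path map of a continuous process is Borel measurable whatever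
  happens on that set.\<close>

definition path_law :: "'a measure \<Rightarrow> (real \<Rightarrow> 'a \<Rightarrow> real) \<Rightarrow> cpath measure" where
  "path_law M X = distr (completion M) borel (\<lambda>\<omega>. to_cpath (\<lambda>t. X t \<omega>))"

definition weak_conv_measures ::
    "('i \<Rightarrow> 'a::topological_space measure) \<Rightarrow> 'a measure \<Rightarrow> 'i filter \<Rightarrow> bool" where
  "weak_conv_measures \<mu> \<nu> G \<longleftrightarrow>
     (\<forall>F :: 'a \<Rightarrow> real. continuous_on UNIV F \<and> bounded (range F) \<longrightarrow>
        ((\<lambda>i. integral\<^sup>L (\<mu> i) F) \<longlongrightarrow> integral\<^sup>L \<nu> F) G)"

text \<open>The parameter tends to \<open>0\<close> inside \<open>I\<close>; for \<open>I = {0<..<1}\<close> this is \<open>s \<rightarrow> 0+\<close>.\<close>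

definition weak_conv_processes ::
    "'a measure \<Rightarrow> (real \<Rightarrow> real \<Rightarrow> 'a \<Rightarrow> real) \<Rightarrow> real set \<Rightarrow>
     'b measure \<Rightarrow> (real \<Rightarrow> 'b \<Rightarrow> real) \<Rightarrow> bool" where
  "weak_conv_processes M X I N Y \<longleftrightarrow>
     (\<forall>s\<in>I. continuous_process M (X s)) \<and> continuous_process N Y \<and>
     weak_conv_measures (\<lambda>s. path_law M (X s)) (path_law N Y) (at 0 within I)"

definition standard_brownian_motion :: "'b measure \<Rightarrow> (real \<Rightarrow> 'b \<Rightarrow> real) \<Rightarrow> bool" where
  "standard_brownian_motion N B \<longleftrightarrow>
     prob_space N \<and> continuous_process N B \<and>
     (AE \<omega> in N. B 0 \<omega> = 0) \<and>
     (\<forall>s t. 0 \<le> s \<and> s < t \<longrightarrow>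
        distributed N lborel (\<lambda>\<omega>. B t \<omega> - B s \<omega>) (normal_density 0 (sqrt (t - s)))) \<and>
     (\<forall>(n::nat) (\<tau> :: nat \<Rightarrow> real). 0 \<le> \<tau> 0 \<and> strict_mono_on {..n} \<tau> \<longrightarrow>
        prob_space.indep_vars N (\<lambda>_. borel) (\<lambda>i \<omega>. B (\<tau> (Suc i)) \<omega> - B (\<tau> i) \<omega>) {..<n})"


section \<open>Limit points of a family as the parameter decreases to zero\<close>

definition limit_points :: "real set \<Rightarrow> (real \<Rightarrow> real) \<Rightarrow> real set" where
  "limit_points I x =
     {c. \<exists>\<sigma> :: nat \<Rightarrow> real. (\<forall>n. \<sigma> n \<in> I \<and> 0 < \<sigma> n) \<and> \<sigma> \<longlonglongrightarrow> 0 \<and> (\<lambda>n. x (\<sigma> n)) \<longlonglongrightarrow> c}"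

end

theory Submission
  imports Defs "HOL-Computational_Algebra.Nth_Powers" "HOL-Real_Asymp.Real_Asymp"
begin

text \<open>Write \<open>G(h) = \<Sum>p. \<epsilon>(p) / p powr (1/2 + h)\<close> and \<open>P(h) = \<Sum>p. 1 / p powr (1 + h)\<close>, both sums
  over the primes. As \<open>\<epsilon>(p)\<^sup>2 = 1\<close>, the logarithm of the Euler factor at \<open>p\<close> is
  \<open>\<epsilon>(p) / p powr (1/2 + h) + 1 / (2 * p powr (1 + 2 * h))\<close> up to a term of third order; for
  \<open>k \<ge> 3\<close> the truncation of the geometric series at \<open>k\<close> is itself of third order. The third order
  terms are summable, uniformly in \<open>h\<close>, so the logarithm of the random Dirichlet series is
  \<open>G(h) + P(2 * h) / 2 + O(1)\<close>, and \<open>ln (zeta (1 + 2 * h)) = P(2 * h) + O(1)\<close>. Hence the centred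
  logarithm differs from \<open>G\<close> by a bounded amount (\<open>AE_centred_log_sum\<close>), which neither of the two
  normalisations sees. What remains is a statement about sums of independent signs.

  The series converge only conditionally, so the Euler product formula needs an argument. The product
  \<open>f(n) * f(m)\<close> has mean at most \<open>1\<close> if \<open>n * m\<close> is a square and mean \<open>0\<close> otherwise, and
  such pairs have the form \<open>n = a * b\<^sup>2\<close>, \<open>m = a * c\<^sup>2\<close>, so that second moments of sums of
  \<open>f(n) / n powr r\<close> are bounded by \<open>zeta (2 * r) ^ 3\<close>, with a gain for large \<open>n\<close>. With a dyadic
  maximal inequality in the manner of Rademacher and Menshov this gives almost sure convergence for
  \<open>r > 1/2\<close> (\<open>AE_dirichlet_summable\<close>), and it also shows that partial sums and partial products
  have the same limit (\<open>AE_euler_identity\<close>).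

  In the time \<open>\<tau> = ln (1/h)\<close> the process \<open>G\<close> resembles a random walk. The only fact about primes that
  enters is \<open>P(h) = ln (1/h) + O(1)\<close>, a consequence of \<open>zeta (1 + h)\<close> being \<open>1/h\<close> up to a bounded
  error. From it the increments of \<open>G\<close> have mean square \<open>O(\<tau>' - \<tau>)\<close> (\<open>var_diff\<close>); replacing the
  smooth weight \<open>p powr (-h)\<close> by the indicator of \<open>h * ln p \<le> 1\<close> changes \<open>G\<close> by \<open>O(1)\<close> in mean
  square (\<open>var_trunc\<close>); and the truncated sum, the walk, has independent increments and variance
  \<open>\<tau> + O(1)\<close> (\<open>early_primes_sum\<close>). Weighted sign sums are sub-Gaussian, so all these bounds
  hold with Gaussian tails, and dyadic chaining (\<open>chaining\<close>) controls \<open>G\<close> between the points of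
  a grid.

  For the functional limit theorem, the walk increments over a dyadic grid satisfy the central limit
  theorem (\<open>clt_rsum\<close>) and are independent, so the polygons that they define converge jointly to those
  of the Brownian motion; chaining shows that the polygons are uniformly close to the rescaled process
  (\<open>scaled_process_approximation\<close>). This settles functionals that are Lipschitz for the uniform
  distance on a bounded time interval, and every bounded continuous functional on \<open>C[0,\<infinity>)\<close> is a limit
  from below of such functionals (\<open>inf_conv\<close>).

  For the law of the iterated logarithm, the upper bound is Borel-Cantelli along times
  \<open>exp (n powr \<alpha>)\<close> with chaining in between (\<open>AE_lil_upper\<close>). The lower bound takes times that grow
  faster than geometrically, an exponential lower tail bound for sign sums (\<open>rsum_lower_tail\<close>) and the
  second Borel-Cantelli lemma for the independent increments (\<open>AE_lil_lower\<close>); the symmetry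
  \<open>\<epsilon> \<rightarrow> -\<epsilon>\<close> gives the other sign. Continuity fills the interval between the two
  extreme limit points (\<open>limit_points_lil\<close>).\<close>

section \<open>Finite Euler products over k-free integers\<close>

abbreviation primes_le :: "nat \<Rightarrow> nat set" where
  "primes_le N \<equiv> {p. prime p \<and> p \<le> N}"

text \<open>The integers that occur when the Euler factors of the primes up to \<open>N\<close> are multiplied out.\<close>

definition smooth_kfree :: "nat \<Rightarrow> nat \<Rightarrow> nat set" where
  "smooth_kfree k N = {n. kfree k n \<and> prime_factors n \<subseteq> primes_le N}"

definition prime_part :: "(nat \<Rightarrow> real) \<Rightarrow> nat \<Rightarrow> real" where
  "prime_part x n = (if prime n then x n else 0)"

abbreviation prime_zeta :: "real \<Rightarrow> real" where
  "prime_zeta r \<equiv> dirichlet_sum (prime_part (\<lambda>_. 1)) r"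

lemma finite_primes_le [simp]: "finite (primes_le N)"
  by simp

lemma kfree_iff_multiplicity:
  assumes "k \<ge> 1" "n > 0"
  shows "kfree k n \<longleftrightarrow> (\<forall>p. prime p \<longrightarrow> multiplicity p n < k)"
proof
  assume kf: "kfree k n"
  show "\<forall>p. prime p \<longrightarrow> multiplicity p n < k"
  proof (intro allI impI, rule ccontr)
    fix p :: nat assume p: "prime p" and "\<not> multiplicity p n < k"
    then have "p ^ k dvd n" by (simp add: multiplicity_dvd')
    with kf p show False unfolding kfree_def using prime_gt_1_nat by blast
  qed
next
  assume m: "\<forall>p. prime p \<longrightarrow> multiplicity p n < k"
  show "kfree k n" unfolding kfree_def
  proof (intro conjI allI impI notI)
    fix d :: nat assume "d > 1" and d: "d ^ k dvd n"
    then obtain p where p: "prime p" "p dvd d" using prime_factor_nat[of d] by auto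
    then have "p ^ k dvd n" using d dvd_power_same dvd_trans by blast
    then have "k \<le> multiplicity p n"
      using p assms by (intro multiplicity_geI) (auto dest: prime_gt_1_nat)
    moreover have "multiplicity p n < k" using m p by blast
    ultimately show False by simp
  qed (use assms in auto)
qed

text \<open>Unique factorisation identifies these integers with the exponent vectors
  \<open>g p < k\<close> indexed by the primes up to \<open>N\<close>; the identity is then the expansion of a product of sums.\<close>

lemma euler_product_finite_aux:
  fixes x :: "nat \<Rightarrow> real"
  assumes k: "k \<ge> 1"
  shows "finite (smooth_kfree k N)"
    and "(\<Sum>n\<in>smooth_kfree k N. \<Prod>p\<in>prime_factors n. x p ^ multiplicity p n)
           = (\<Prod>p\<in>primes_le N. \<Sum>j<k. x p ^ j)"
proof -
  let ?A = "primes_le N"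
  let ?I = "\<lambda>g :: nat \<Rightarrow> nat. \<Prod>p\<in>?A. p ^ g p"
  let ?J = "\<lambda>n. restrict (\<lambda>p. multiplicity p n) ?A"
  have mult: "multiplicity p (?I g) = (if p \<in> ?A then g p else 0)" if "prime p" for p g
    using that by (intro multiplicity_prod_prime_powers) auto
  have pos: "?I g > 0" for g by (intro prod_pos) (auto simp: prime_gt_0_nat)
  have J1: "?J n \<in> PiE ?A (\<lambda>_. {..<k})" if "n \<in> smooth_kfree k N" for n
    using that k kfree_iff_multiplicity[of k n] unfolding smooth_kfree_def kfree_def by auto
  have IJ: "?I (?J n) = n" if n: "n \<in> smooth_kfree k N" for n
  proof -
    have n0: "n > 0" using n by (auto simp: smooth_kfree_def kfree_def)
    have "n = (\<Prod>p\<in>prime_factors n. p ^ multiplicity p n)"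
      using n0 by (simp add: prime_factorization_nat)
    also have "\<dots> = (\<Prod>p\<in>?A. p ^ multiplicity p n)"
      by (rule prod.mono_neutral_left) (use n in \<open>auto simp: smooth_kfree_def prime_factors_multiplicity\<close>)
    finally show ?thesis by simp
  qed
  have JI: "?J (?I g) = g" if "g \<in> PiE ?A (\<lambda>_. {..<k})" for g
    using that by (intro ext) (auto simp: mult PiE_def extensional_def restrict_def)
  have I1: "?I g \<in> smooth_kfree k N" if g: "g \<in> PiE ?A (\<lambda>_. {..<k})" for g
  proof -
    have "kfree k (?I g)"
      using g k pos by (subst kfree_iff_multiplicity) (auto simp: mult PiE_iff)
    moreover have "prime_factors (?I g) \<subseteq> ?A"
      by (auto simp: prime_factors_multiplicity mult split: if_splits)
    ultimately show ?thesis by (simp add: smooth_kfree_def)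
  qed
  have eq: "smooth_kfree k N = ?I ` (PiE ?A (\<lambda>_. {..<k}))"
  proof (intro subset_antisym subsetI)
    fix n assume n: "n \<in> smooth_kfree k N"
    show "n \<in> ?I ` (PiE ?A (\<lambda>_. {..<k}))"
      by (rule image_eqI[of _ _ "?J n"]) (use IJ[OF n] J1[OF n] in auto)
  next
    fix n assume "n \<in> ?I ` (PiE ?A (\<lambda>_. {..<k}))"
    then show "n \<in> smooth_kfree k N" using I1 by (elim imageE) (simp only:)
  qed
  show "finite (smooth_kfree k N)" unfolding eq by (intro finite_imageI finite_PiE) auto
  have "(\<Prod>p\<in>?A. \<Sum>j<k. x p ^ j) = (\<Sum>g\<in>PiE ?A (\<lambda>_. {..<k}). \<Prod>p\<in>?A. x p ^ g p)"
    by (rule prod_sum_PiE) auto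
  also have "\<dots> = (\<Sum>n\<in>smooth_kfree k N. \<Prod>p\<in>prime_factors n. x p ^ multiplicity p n)"
  proof (rule sum.reindex_bij_witness[of _ ?J ?I])
    fix g assume g: "g \<in> PiE ?A (\<lambda>_. {..<k})"
    have sub: "prime_factors (?I g) \<subseteq> ?A" using I1[OF g] by (auto simp: smooth_kfree_def)
    have "(\<Prod>p\<in>prime_factors (?I g). x p ^ multiplicity p (?I g)) = (\<Prod>p\<in>?A. x p ^ multiplicity p (?I g))"
      by (rule prod.mono_neutral_left) (use sub in \<open>auto simp: prime_factors_multiplicity\<close>)
    also have "\<dots> = (\<Prod>p\<in>?A. x p ^ g p)" by (rule prod.cong) (auto simp: mult)
    finally show "(\<Prod>p\<in>prime_factors (?I g). x p ^ multiplicity p (?I g)) = (\<Prod>p\<in>?A. x p ^ g p)" .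
  qed (use I1 J1 IJ JI in auto)
  finally show "(\<Sum>n\<in>smooth_kfree k N. \<Prod>p\<in>prime_factors n. x p ^ multiplicity p n)
           = (\<Prod>p\<in>primes_le N. \<Sum>j<k. x p ^ j)" by simp
qed

lemma prod_prime_powers_powr:
  assumes "n > 0"
  shows "(\<Prod>p\<in>prime_factors n. (x p / real p powr r) ^ multiplicity p n)
           = (\<Prod>p\<in>prime_factors n. x p ^ multiplicity p n) / real n powr r"
proof -
  have "real n powr r = real (\<Prod>p\<in>prime_factors n. p ^ multiplicity p n) powr r"
    using assms by (simp add: prime_factorization_nat[symmetric])
  also have "\<dots> = (\<Prod>p\<in>prime_factors n. (real p ^ multiplicity p n) powr r)"
    by (simp add: prod_powr_distrib)
  also have "\<dots> = (\<Prod>p\<in>prime_factors n. (real p powr r) ^ multiplicity p n)"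
  proof (intro prod.cong refl)
    fix p assume "p \<in> prime_factors n"
    then have "real p > 0" by (simp add: in_prime_factors_iff prime_gt_0_nat)
    then show "(real p ^ multiplicity p n) powr r = (real p powr r) ^ multiplicity p n"
      by (simp add: powr_power powr_powr mult.commute flip: powr_realpow)
  qed
  finally show ?thesis by (simp add: power_divide prod_dividef)
qed

lemma euler_product_finite:
  assumes "k \<ge> 1"
  shows "(\<Sum>n\<in>smooth_kfree k N. kfree_mult k x n / real n powr r)
           = (\<Prod>p\<in>primes_le N. \<Sum>j<k. (x p / real p powr r) ^ j)"
proof -
  have "(\<Sum>n\<in>smooth_kfree k N. kfree_mult k x n / real n powr r) =
     (\<Sum>n\<in>smooth_kfree k N. \<Prod>p\<in>prime_factors n. (x p / real p powr r) ^ multiplicity p n)"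
    by (intro sum.cong refl)
       (auto simp: prod_prime_powers_powr smooth_kfree_def kfree_mult_def kfree_def)
  also have "\<dots> = (\<Prod>p\<in>primes_le N. \<Sum>j<k. (x p / real p powr r) ^ j)"
    by (rule euler_product_finite_aux(2)[OF assms])
  finally show ?thesis .
qed

text \<open>This allows untruncated sums over \<open>n \<le> N\<close> to be handled as \<open>k\<close>-free sums with a large \<open>k\<close>.\<close>

lemma kfree_large:
  assumes "n > 0" "n < 2 ^ k"
  shows "kfree k n"
  unfolding kfree_def
proof (intro conjI allI impI notI)
  fix d :: nat assume "d > 1" "d ^ k dvd n"
  then have "2 ^ k \<le> d ^ k" "d ^ k \<le> n" using assms by (auto intro: power_mono dvd_imp_le)
  then show False using assms by simp
qed (use assms in auto)

lemma subset_smooth_kfree: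
  "{n. kfree k n \<and> n \<le> N} \<subseteq> smooth_kfree k N"
  unfolding smooth_kfree_def by (auto simp: kfree_def in_prime_factors_iff dest!: dvd_imp_le)

lemma smooth_kfree_pos: "n \<in> smooth_kfree k N \<Longrightarrow> n > 0"
  by (auto simp: smooth_kfree_def kfree_def)

section \<open>Prime sums and the zeta function\<close>

lemma sum_prime_part:
  "(\<Sum>n<N. prime_part x (Suc n) * f (Suc n)) = (\<Sum>p\<in>primes_le N. x p * f p)"
proof -
  have "(\<Sum>n<N. prime_part x (Suc n) * f (Suc n)) = (\<Sum>n\<in>{1..N}. prime_part x n * f n)"
    by (rule sum.reindex_bij_witness[of _ "\<lambda>n. n - 1" Suc]) auto
  also have "\<dots> = (\<Sum>p\<in>primes_le N. prime_part x p * f p)"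
    by (rule sum.mono_neutral_right) (auto simp: prime_part_def dest: prime_gt_0_nat)
  also have "\<dots> = (\<Sum>p\<in>primes_le N. x p * f p)"
    by (rule sum.cong) (auto simp: prime_part_def)
  finally show ?thesis .
qed

lemma sum_prime_part_divide:
  "(\<Sum>n<N. prime_part x (Suc n) / f (Suc n)) = (\<Sum>p\<in>primes_le N. x p / f p)"
  using sum_prime_part[of x "\<lambda>n. inverse (f n)" N] by (simp add: field_simps)

lemma summable_powr_Suc: "r > 1 \<Longrightarrow> summable (\<lambda>n. real (Suc n) powr (- r))"
  using summable_real_powr_iff[of "-r"] summable_Suc_iff[of "\<lambda>n. real n powr (-r)"] by simp

lemma summable_prime_zeta:
  assumes "r > 1"
  shows "summable (\<lambda>n. prime_part (\<lambda>_. 1) (Suc n) / real (Suc n) powr r)"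
  by (rule summable_comparison_test'[OF summable_powr_Suc[OF assms], of 0])
     (auto simp: prime_part_def powr_minus field_simps)

lemma prime_zeta_tendsto:
  assumes "r > 1"
  shows "(\<lambda>N. \<Sum>p\<in>primes_le N. 1 / real p powr r) \<longlonglongrightarrow> prime_zeta r"
proof -
  have "(\<lambda>N. \<Sum>n<N. prime_part (\<lambda>_. 1) (Suc n) / real (Suc n) powr r) \<longlonglongrightarrow> prime_zeta r"
    using summable_LIMSEQ[OF summable_prime_zeta[OF assms]] by (simp add: dirichlet_sum_def)
  then show ?thesis by (subst (asm) sum_prime_part_divide) simp
qed

lemma sum_le_prime_zeta:
  assumes "r > 1" "finite A" "\<And>p. p \<in> A \<Longrightarrow> prime p"
  shows "(\<Sum>p\<in>A. 1 / real p powr r) \<le> prime_zeta r"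
proof (rule tendsto_lowerbound[OF prime_zeta_tendsto[OF assms(1)]])
  have "\<forall>N\<ge>Max (insert 0 A). A \<subseteq> primes_le N"
    using assms Max_ge[of "insert 0 A"] by (auto intro: order_trans)
  then have "\<forall>N\<ge>Max (insert 0 A). (\<Sum>p\<in>A. 1 / real p powr r) \<le> (\<Sum>p\<in>primes_le N. 1 / real p powr r)"
    by (auto intro!: sum_mono2)
  then show "\<forall>\<^sub>F N in sequentially. (\<Sum>p\<in>A. 1 / real p powr r) \<le> (\<Sum>p\<in>primes_le N. 1 / real p powr r)"
    by (auto simp: eventually_sequentially)
qed auto

text \<open>The sum is compared with the telescoping differences of \<open>n powr (- h)\<close>, which lie between
  \<open>h * (n + 1) powr (- 1 - h)\<close> and \<open>h * n powr (- 1 - h)\<close> by the mean value theorem.\<close>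

lemma zeta_bounds:
  assumes h: "h > 0"
  shows "1 / h \<le> zeta (1 + h)" "zeta (1 + h) \<le> 1 + 1 / h"
proof -
  define u where "u n = real (Suc n) powr (- h)" for n
  have lim: "u \<longlonglongrightarrow> 0" unfolding u_def using h by real_asymp
  have step: "h * real (Suc (Suc n)) powr (- (1 + h)) \<le> u n - u (Suc n) \<and>
     u n - u (Suc n) \<le> h * real (Suc n) powr (- (1 + h))" for n
  proof -
    have "\<exists>z>real (Suc n). z < real (Suc (Suc n)) \<and>
       real (Suc (Suc n)) powr (- h) - real (Suc n) powr (- h) =
       (real (Suc (Suc n)) - real (Suc n)) * (- h * z powr (- h - 1))"
      by (rule MVT2) (auto intro!: derivative_eq_intros)
    then obtain z where z: "real (Suc n) < z" "z < real (Suc (Suc n))"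
      and eq: "u (Suc n) - u n = - h * z powr (- h - 1)"
      unfolding u_def by auto
    have "z powr (-h-1) \<le> real (Suc n) powr (-h-1)" "real (Suc (Suc n)) powr (-h-1) \<le> z powr (-h-1)"
      using z h by (auto intro!: powr_mono2')
    then have "h * z powr (-h-1) \<le> h * real (Suc n) powr (-h-1)"
       "h * real (Suc (Suc n)) powr (-h-1) \<le> h * z powr (-h-1)" using h by auto
    moreover have "-h-1 = -(1+h)" by simp
    ultimately show ?thesis using eq by (simp only:) linarith
  qed
  have sm: "summable (\<lambda>n. real (Suc n) powr (- (1+h)))"
    using h by (intro summable_powr_Suc) auto
  have tel: "(\<lambda>n. u n - u (Suc n)) sums (u 0 - 0)" by (rule telescope_sums'[OF lim])
  have u0: "u 0 = 1" by (simp add: u_def)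
  have "1 \<le> h * zeta (1+h)"
  proof -
    have "(\<Sum>n. u n - u (Suc n)) \<le> (\<Sum>n. h * real (Suc n) powr (- (1+h)))"
      using step tel sm by (intro suminf_le summable_mult) (auto simp: sums_iff)
    then show ?thesis using tel u0 sm by (simp add: sums_iff zeta_def suminf_mult)
  qed
  then show "1 / h \<le> zeta (1 + h)" using h by (simp add: field_simps)
  have "h * (zeta (1+h) - 1) \<le> 1"
  proof -
    have sm': "summable (\<lambda>n. real (Suc (Suc n)) powr (- (1+h)))"
      using sm by (subst summable_Suc_iff)
    have "(\<Sum>n. h * real (Suc (Suc n)) powr (- (1+h))) \<le> (\<Sum>n. u n - u (Suc n))"
      using step tel sm' by (intro suminf_le summable_mult) (auto simp: sums_iff)
    moreover have "(\<Sum>n. real (Suc (Suc n)) powr (- (1+h))) = zeta (1+h) - 1"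
      unfolding zeta_def by (subst suminf_split_head[OF sm]) simp
    ultimately show ?thesis using tel u0 sm' by (simp add: sums_iff suminf_mult)
  qed
  then show "zeta (1 + h) \<le> 1 + 1 / h" using h by (simp add: field_simps)
qed

lemma ln_zeta_bounds:
  assumes h: "0 < h" "h \<le> 2"
  shows "\<bar>ln (zeta (1 + h)) - ln (1 / h)\<bar> \<le> 2"
proof -
  have z: "1 / h \<le> zeta (1 + h)" "zeta (1 + h) \<le> 1 + 1 / h" using zeta_bounds h by auto
  have "zeta (1+h) > 0" using z(1) h by (smt (verit) divide_pos_pos)
  then have a: "ln (1/h) \<le> ln (zeta (1+h))" using z h by (subst ln_le_cancel_iff) auto
  have "zeta (1+h) \<le> 3 * (1 / h)" using z h by (simp add: field_simps)
  also have "\<dots> \<le> exp 2 * (1/h)"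
    using exp_ge_add_one_self[of 2] h by (intro mult_right_mono) auto
  finally have "ln (zeta (1+h)) \<le> ln (exp 2 * (1/h))"
    using \<open>zeta (1+h) > 0\<close> h by (subst ln_le_cancel_iff) auto
  also have "\<dots> = 2 + ln (1/h)" using h by (subst ln_mult) auto
  finally show ?thesis using a by auto
qed

lemma zeta_eq_dirichlet_sum: "zeta r = dirichlet_sum (\<lambda>_. 1) r"
  by (simp add: zeta_def dirichlet_sum_def powr_minus field_simps)

lemma geometric_partial_le:
  fixes x :: real
  assumes "0 \<le> x" "x \<le> 1/2"
  shows "(\<Sum>j<k. x ^ j) \<le> exp (x + 2 * x\<^sup>2)"
proof -
  have "(\<Sum>j<k. x ^ j) \<le> (\<Sum>j. x ^ j)"
    using assms by (intro sum_le_suminf summable_geometric) auto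
  also have "\<dots> = 1 / (1 - x)" using assms by (intro suminf_geometric) auto
  also have "\<dots> = exp (- ln (1 - x))" using assms by (simp add: exp_minus field_simps)
  also have "\<dots> \<le> exp (x + 2 * x\<^sup>2)"
    using ln_one_minus_pos_lower_bound[OF assms] by simp
  finally show ?thesis .
qed

lemma prime_powr_le_half:
  assumes "prime p" "r \<ge> 1"
  shows "0 < 1 / real p powr r" "1 / real p powr r \<le> 1/2" "(1 / real p powr r)\<^sup>2 \<le> 1 / real p powr 2"
proof -
  have p: "real p \<ge> 2" using prime_ge_2_nat[OF assms(1)] by simp
  have "2 \<le> real p powr 1" using p by simp
  also have "\<dots> \<le> real p powr r" using p assms by (intro powr_mono) auto
  finally show "1 / real p powr r \<le> 1/2" "0 < 1 / real p powr r" using p by (simp_all add: field_simps)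
  have "real p powr 2 \<le> real p powr (r + r)" using p assms by (intro powr_mono) auto
  then show "(1 / real p powr r)\<^sup>2 \<le> 1 / real p powr 2"
    using p by (simp add: power2_eq_square powr_add[symmetric] divide_simps)
qed

lemma prime_zeta_nonneg: "r > 1 \<Longrightarrow> prime_zeta r \<ge> 0"
  using sum_le_prime_zeta[of r "{}"] by simp

text \<open>Every \<open>n \<le> N\<close> occurs in the product over the primes up to \<open>N\<close> of long enough
  geometric sums, and each of these sums is at most \<open>exp (x + 2 * x\<^sup>2)\<close> with \<open>x = 1 / p powr r\<close>.\<close>

lemma ln_zeta_le_prime_zeta:
  assumes r: "r > 1"
  shows "ln (zeta r) \<le> prime_zeta r + 2 * prime_zeta 2"
proof -
  have "(\<Sum>n<N. real (Suc n) powr (- r)) \<le> exp (prime_zeta r + 2 * prime_zeta 2)" for N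
  proof -
    (* Since 2 ^ Suc N exceeds N, truncation at k = Suc N excludes no n up to N. *)
    let ?k = "Suc N"
    have sub: "{1..N} \<subseteq> smooth_kfree ?k N"
    proof
      fix n assume n: "n \<in> {1..N}"
      have "N < 2 ^ Suc N" by (simp add: less_trans[OF less_exp])
      then have "kfree ?k n" using n by (intro kfree_large) auto
      then show "n \<in> smooth_kfree ?k N" using n subset_smooth_kfree by fastforce
    qed
    have one: "kfree_mult ?k (\<lambda>_. 1) n = 1" if "n \<in> smooth_kfree ?k N" for n
      using that by (simp add: kfree_mult_def smooth_kfree_def)
    have "(\<Sum>n<N. real (Suc n) powr (- r)) = (\<Sum>n\<in>{1..N}. real n powr (- r))"
      by (rule sum.reindex_bij_witness[of _ "\<lambda>n. n - 1" Suc]) auto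
    also have "\<dots> \<le> (\<Sum>n\<in>smooth_kfree ?k N. real n powr (- r))"
      using sub by (intro sum_mono2 euler_product_finite_aux(1)) auto
    also have "\<dots> = (\<Sum>n\<in>smooth_kfree ?k N. kfree_mult ?k (\<lambda>_. 1) n / real n powr r)"
      by (intro sum.cong) (auto simp: one powr_minus field_simps)
    also have "\<dots> = (\<Prod>p\<in>primes_le N. \<Sum>j<?k. (1 / real p powr r) ^ j)"
      by (rule euler_product_finite) auto
    also have "\<dots> \<le> (\<Prod>p\<in>primes_le N. exp (1 / real p powr r + 2 * (1 / real p powr 2)))"
    proof (rule prod_mono, intro conjI)
      fix p assume "p \<in> primes_le N"
      then have p: "prime p" by simp
      note b = prime_powr_le_half[OF p, of r]
      have "(\<Sum>j<?k. (1 / real p powr r) ^ j) \<le> exp (1 / real p powr r + 2 * (1 / real p powr r)\<^sup>2)"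
        using b r by (intro geometric_partial_le) auto
      also have "\<dots> \<le> exp (1 / real p powr r + 2 * (1 / real p powr 2))" using b r by simp
      finally show "(\<Sum>j<?k. (1 / real p powr r) ^ j) \<le> exp (1 / real p powr r + 2 * (1 / real p powr 2))" .
    qed (intro sum_nonneg, simp)
    also have "\<dots> = exp (\<Sum>p\<in>primes_le N. 1 / real p powr r + 2 * (1 / real p powr 2))"
      by (rule exp_sum[symmetric]) simp
    also have "\<dots> = exp ((\<Sum>p\<in>primes_le N. 1 / real p powr r) + 2 * (\<Sum>p\<in>primes_le N. 1 / real p powr 2))"
      by (simp only: sum.distrib sum_distrib_left)
    also have "\<dots> \<le> exp (prime_zeta r + 2 * prime_zeta 2)"
    proof -
      have "(\<Sum>p\<in>primes_le N. 1 / real p powr r) \<le> prime_zeta r"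
        by (rule sum_le_prime_zeta[OF r]) auto
      moreover have "(\<Sum>p\<in>primes_le N. 1 / real p powr 2) \<le> prime_zeta 2"
        by (rule sum_le_prime_zeta) auto
      ultimately show ?thesis by simp
    qed
    finally show ?thesis .
  qed
  then have "zeta r \<le> exp (prime_zeta r + 2 * prime_zeta 2)"
    unfolding zeta_def by (intro suminf_le_const summable_powr_Suc r)
  moreover have "zeta r > 0" using zeta_bounds(1)[of "r - 1"] r by (smt (verit) divide_pos_pos)
  ultimately have "ln (zeta r) \<le> ln (exp (prime_zeta r + 2 * prime_zeta 2))"
    by (subst ln_le_cancel_iff) auto
  then show ?thesis by simp
qed

text \<open>For the reverse inequality it suffices to keep the squarefree integers, whose Euler factor is
  \<open>1 + x \<ge> exp (x - 2 * x\<^sup>2)\<close>.\<close>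

lemma prime_zeta_le_ln_zeta:
  assumes r: "r > 1"
  shows "prime_zeta r \<le> ln (zeta r) + 2 * prime_zeta 2"
proof (rule tendsto_upperbound[OF prime_zeta_tendsto[OF r]])
  have "(\<Sum>p\<in>primes_le N. 1 / real p powr r) \<le> ln (zeta r) + 2 * prime_zeta 2" for N
  proof -
    have zp: "zeta r > 0" using zeta_bounds(1)[of "r - 1"] r by (smt (verit) divide_pos_pos)
    have "exp ((\<Sum>p\<in>primes_le N. 1 / real p powr r) - 2 * (\<Sum>p\<in>primes_le N. 1 / real p powr 2))
        = (\<Prod>p\<in>primes_le N. exp (1 / real p powr r - 2 * (1 / real p powr 2)))"
      by (subst exp_sum[symmetric]) (simp, simp only: sum_subtractf sum_distrib_left)
    also have "\<dots> \<le> (\<Prod>p\<in>primes_le N. \<Sum>j<2. (1 / real p powr r) ^ j)"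
    proof (rule prod_mono, intro conjI)
      fix p assume "p \<in> primes_le N"
      then have p: "prime p" by simp
      note b = prime_powr_le_half[OF p, of r]
      let ?x = "1 / real p powr r"
      have "\<bar>ln (1 + ?x) - ?x\<bar> \<le> 2 * ?x\<^sup>2"
        by (rule abs_ln_one_plus_x_minus_x_bound) (use b r in auto)
      then have "?x - 2 * (1 / real p powr 2) \<le> ln (1 + ?x)" using b r by linarith
      then have "exp (?x - 2 * (1 / real p powr 2)) \<le> 1 + ?x"
        using b(1) r by (subst (asm) ln_ge_iff) (simp_all add: add_pos_pos)
      then show "exp (?x - 2 * (1 / real p powr 2)) \<le> (\<Sum>j<2. ?x ^ j)"
        by (simp add: numeral_2_eq_2)
    qed simp
    also have "\<dots> = (\<Sum>n\<in>smooth_kfree 2 N. kfree_mult 2 (\<lambda>_. 1) n / real n powr r)"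
      by (rule euler_product_finite[symmetric]) auto
    also have "\<dots> = (\<Sum>n\<in>smooth_kfree 2 N. real n powr (- r))"
      by (intro sum.cong) (auto simp: kfree_mult_def smooth_kfree_def powr_minus field_simps)
    also have "\<dots> = (\<Sum>n\<in>(\<lambda>n. n - 1) ` smooth_kfree 2 N. real (Suc n) powr (- r))"
      by (subst sum.reindex) (auto simp: inj_on_def dest!: smooth_kfree_pos intro!: sum.cong)
    also have "\<dots> \<le> zeta r" unfolding zeta_def
      by (rule sum_le_suminf[OF summable_powr_Suc[OF r]]) (use euler_product_finite_aux(1)[of 2 N] in auto)
    finally have "(\<Sum>p\<in>primes_le N. 1 / real p powr r) - 2 * (\<Sum>p\<in>primes_le N. 1 / real p powr 2) \<le> ln (zeta r)"
      using zp by (subst ln_ge_iff) auto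
    moreover have "(\<Sum>p\<in>primes_le N. 1 / real p powr 2) \<le> prime_zeta 2"
      by (rule sum_le_prime_zeta) auto
    ultimately show ?thesis by linarith
  qed
  then show "\<forall>\<^sub>F N in sequentially. (\<Sum>p\<in>primes_le N. 1 / real p powr r) \<le> ln (zeta r) + 2 * prime_zeta 2"
    by simp
qed auto

definition mertens_const :: real where "mertens_const = 2 + 2 * prime_zeta 2"

lemma mertens_const_pos: "mertens_const > 0"
  using prime_zeta_nonneg[of 2] by (simp add: mertens_const_def)

text \<open>All that is used of the distribution of the primes.\<close>

lemma prime_zeta_ln:
  assumes "0 < h" "h \<le> 2"
  shows "\<bar>prime_zeta (1 + h) - ln (1 / h)\<bar> \<le> mertens_const"
  using ln_zeta_bounds[OF assms] ln_zeta_le_prime_zeta[of "1+h"] prime_zeta_le_ln_zeta[of "1+h"] assms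
  unfolding mertens_const_def by linarith

section \<open>Mean squares of weighted prime sums\<close>

definition prime_weight :: "real \<Rightarrow> nat \<Rightarrow> real" where
  "prime_weight h p = 1 / real p powr (1/2 + h)"

lemma prime_weight_mult:
  "prime_weight h p * prime_weight h' p = 1 / real p powr (1 + (h + h'))"
proof -
  have "1/2 + h + (1/2 + h') = 1 + (h + h')" by simp
  then show ?thesis by (simp add: prime_weight_def powr_add[symmetric])
qed

lemma prime_weight_exp:
  assumes "prime p"
  shows "prime_weight h p = exp (- (h * ln (real p))) * prime_weight 0 p"
proof -
  have p: "real p > 0" using prime_gt_0_nat[OF assms] by simp
  have "real p powr (1/2 + h) = real p powr (1/2) * exp (h * ln (real p))"
    using p by (simp only: powr_add) (simp add: powr_def)
  then show ?thesis by (simp add: prime_weight_def exp_minus field_simps)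
qed

lemma sum_prime_weight_sq:
  "(\<Sum>p\<in>A. (prime_weight h p)\<^sup>2) = (\<Sum>p\<in>A. 1 / real p powr (1 + 2 * h))"
  by (simp add: power2_eq_square prime_weight_mult)

lemma finite_subset_primes_le:
  assumes "finite A" "\<And>p. p \<in> A \<Longrightarrow> prime p"
  shows "\<exists>N0. \<forall>N\<ge>N0. A \<subseteq> primes_le N"
  using assms Max_ge[of "insert 0 A"]
  by (intro exI[of _ "Max (insert 0 A)"]) (auto intro: order_trans)

text \<open>Expanding the square leaves three prime zeta values, because the weights multiply as
  \<open>prime_weight h p * prime_weight h' p = 1 / p powr (1 + h + h')\<close>. The sum is extended to all primes.\<close>

lemma var_diff_le:
  assumes h: "h > 0" "h' > 0" and A: "finite A" "\<And>p. p \<in> A \<Longrightarrow> prime p"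
  shows "(\<Sum>p\<in>A. (prime_weight h p - prime_weight h' p)\<^sup>2)
          \<le> prime_zeta (1 + 2 * h) + prime_zeta (1 + 2 * h') - 2 * prime_zeta (1 + (h + h'))"
proof (rule tendsto_lowerbound)
  show "(\<lambda>N. (\<Sum>p\<in>primes_le N. 1 / real p powr (1 + 2 * h)) + (\<Sum>p\<in>primes_le N. 1 / real p powr (1 + 2 * h'))
       - 2 * (\<Sum>p\<in>primes_le N. 1 / real p powr (1 + (h + h'))))
     \<longlonglongrightarrow> prime_zeta (1 + 2 * h) + prime_zeta (1 + 2 * h') - 2 * prime_zeta (1 + (h + h'))"
    using h by (intro tendsto_intros prime_zeta_tendsto) auto
  obtain N0 where N0: "\<And>N. N \<ge> N0 \<Longrightarrow> A \<subseteq> primes_le N"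
    using finite_subset_primes_le[OF A] by blast
  have "(\<Sum>p\<in>A. (prime_weight h p - prime_weight h' p)\<^sup>2) \<le>
    (\<Sum>p\<in>primes_le N. 1 / real p powr (1 + 2 * h)) + (\<Sum>p\<in>primes_le N. 1 / real p powr (1 + 2 * h'))
       - 2 * (\<Sum>p\<in>primes_le N. 1 / real p powr (1 + (h + h')))" if "N \<ge> N0" for N
  proof -
    have "(\<Sum>p\<in>A. (prime_weight h p - prime_weight h' p)\<^sup>2)
        \<le> (\<Sum>p\<in>primes_le N. (prime_weight h p - prime_weight h' p)\<^sup>2)"
      using N0[OF that] by (intro sum_mono2) auto
    also have "\<dots> = (\<Sum>p\<in>primes_le N. (prime_weight h p)\<^sup>2 + (prime_weight h' p)\<^sup>2
         - 2 * (prime_weight h p * prime_weight h' p))"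
      by (simp add: power2_diff algebra_simps)
    also have "\<dots> = (\<Sum>p\<in>primes_le N. (prime_weight h p)\<^sup>2) + (\<Sum>p\<in>primes_le N. (prime_weight h' p)\<^sup>2)
         - 2 * (\<Sum>p\<in>primes_le N. prime_weight h p * prime_weight h' p)"
      by (simp only: sum.distrib sum_subtractf sum_distrib_left)
    finally show ?thesis by (simp only: sum_prime_weight_sq prime_weight_mult)
  qed
  then show "\<forall>\<^sub>F N in sequentially. (\<Sum>p\<in>A. (prime_weight h p - prime_weight h' p)\<^sup>2) \<le>
    (\<Sum>p\<in>primes_le N. 1 / real p powr (1 + 2 * h)) + (\<Sum>p\<in>primes_le N. 1 / real p powr (1 + 2 * h'))
       - 2 * (\<Sum>p\<in>primes_le N. 1 / real p powr (1 + (h + h')))"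
    by (auto simp: eventually_sequentially)
qed auto

text \<open>Inserting \<open>prime_zeta (1 + h) = ln (1/h) + O(1)\<close> leaves
  \<open>2 * ln (h + h') - ln (2 * h) - ln (2 * h')\<close>, which is at most \<open>ln (h' / h)\<close>. The additive error
  makes the bound useful only for \<open>h'\<close> at least a constant multiple of \<open>h\<close>.\<close>

lemma var_diff_far:
  assumes h: "0 < h" "h \<le> h'" "h' \<le> 1" and A: "finite A" "\<And>p. p \<in> A \<Longrightarrow> prime p"
  shows "(\<Sum>p\<in>A. (prime_weight h p - prime_weight h' p)\<^sup>2) \<le> ln (h' / h) + 4 * mertens_const"
proof -
  have "(\<Sum>p\<in>A. (prime_weight h p - prime_weight h' p)\<^sup>2)
          \<le> prime_zeta (1 + 2 * h) + prime_zeta (1 + 2 * h') - 2 * prime_zeta (1 + (h + h'))"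
    using h by (intro var_diff_le A) auto
  also have "\<dots> \<le> ln (1 / (2*h)) + ln (1 / (2*h')) - 2 * ln (1 / (h+h')) + 4 * mertens_const"
    using prime_zeta_ln[of "2*h"] prime_zeta_ln[of "2*h'"] prime_zeta_ln[of "h+h'"] h by auto
  also have "ln (1 / (2*h)) + ln (1 / (2*h')) - 2 * ln (1 / (h+h')) = 2 * ln (h + h') - ln (2*h) - ln (2*h')"
    using h by (simp add: ln_div)
  also have "\<dots> \<le> 2 * ln (2 * h') - ln (2*h) - ln (2*h')" using h by simp
  also have "\<dots> = ln (h' / h)" using h by (simp add: ln_div ln_mult)
  finally show ?thesis by simp
qed

lemma ln2_le_1: "ln (2::real) \<le> 1"
  using ln_le_minus_one[of "2::real"] by simp

text \<open>A single bounded mean square against which the other differences of weights are compared termwise.\<close>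

lemma var_half:
  assumes h: "0 < h" "h \<le> 1" and A: "finite A" "\<And>p. p \<in> A \<Longrightarrow> prime p"
  shows "(\<Sum>p\<in>A. (prime_weight (h/2) p - prime_weight h p)\<^sup>2) \<le> 1 + 4 * mertens_const"
  using var_diff_far[of "h/2" h A] h A ln2_le_1 by simp

lemma exp_half_diff_ge:
  fixes a :: real
  shows "a / 2 * exp (- a) \<le> exp (- (a/2)) - exp (- a)"
proof -
  have "(1 + a/2) * exp (- a) \<le> exp (a/2) * exp (- a)"
    using exp_ge_add_one_self[of "a/2"] by (intro mult_right_mono) auto
  also have "\<dots> = exp (- (a/2))" by (simp add: exp_add[symmetric])
  finally show ?thesis by (simp add: algebra_simps)
qed

text \<open>With \<open>a = h * ln p\<close> this compares the change of the weight from \<open>h\<close> to \<open>h * exp d\<close> with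
  that from \<open>h/2\<close> to \<open>h\<close>, at the price of a factor proportional to \<open>d\<close>.\<close>

lemma exp_diff_le_half_diff:
  fixes a d :: real
  assumes "a \<ge> 0" "0 \<le> d" "d \<le> 1"
  shows "exp (- a) - exp (- (a * exp d)) \<le> 4 * d * (exp (- (a/2)) - exp (- a))"
proof -
  have e: "exp d \<le> 1 + 2 * d" 
    using exp_bound[of d] assms power_decreasing[of 1 2 d] by (simp add: power2_eq_square)
  have "exp (- a) * (1 - a * (exp d - 1)) \<le> exp (- a) * exp (- (a * (exp d - 1)))"
    using exp_ge_add_one_self[of "- (a * (exp d - 1))"] by (intro mult_left_mono) auto
  also have "\<dots> = exp (- (a * exp d))" by (simp add: exp_add[symmetric] algebra_simps)
  finally have "exp (- a) - exp (- (a * exp d)) \<le> exp (- a) * (a * (exp d - 1))"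
    by (simp add: algebra_simps)
  also have "\<dots> \<le> exp (- a) * (a * (2 * d))"
    using e assms by (intro mult_left_mono) auto
  also have "\<dots> = 4 * d * (a / 2 * exp (- a))" by simp
  also have "\<dots> \<le> 4 * d * (exp (- (a/2)) - exp (- a))"
    using assms by (intro mult_left_mono exp_half_diff_ge) auto
  finally show ?thesis .
qed

definition var_const :: real where "var_const = 100 * (1 + 4 * mertens_const)"

lemma var_const_pos: "var_const > 0" "var_const \<ge> 1"
  using mertens_const_pos by (auto simp: var_const_def)

lemma var_near:
  assumes h: "0 < h" "h \<le> 1" "0 \<le> d" "d \<le> 1" and A: "finite A" "\<And>p. p \<in> A \<Longrightarrow> prime p"
  shows "(\<Sum>p\<in>A. (prime_weight h p - prime_weight (h * exp d) p)\<^sup>2) \<le> 16 * d\<^sup>2 * (1 + 4 * mertens_const)"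
proof -
  have "(\<Sum>p\<in>A. (prime_weight h p - prime_weight (h * exp d) p)\<^sup>2) \<le>
    (\<Sum>p\<in>A. 16 * d\<^sup>2 * (prime_weight (h/2) p - prime_weight h p)\<^sup>2)"
  proof (rule sum_mono)
    fix p assume "p \<in> A"
    then have p: "prime p" using A by auto
    have l: "ln (real p) \<ge> 0" using prime_ge_1_nat[OF p] by simp
    let ?a = "h * ln (real p)" and ?w = "prime_weight 0 p"
    have w: "?w \<ge> 0" by (simp add: prime_weight_def)
    have a: "?a \<ge> 0" using l h by simp
    have "prime_weight h p - prime_weight (h * exp d) p = (exp (- ?a) - exp (- (?a * exp d))) * ?w"
      by (simp add: prime_weight_exp[OF p, of h] prime_weight_exp[OF p, of "h * exp d"] algebra_simps)
    also have "\<dots> \<le> 4 * d * (exp (- (?a/2)) - exp (- ?a)) * ?w"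
      using exp_diff_le_half_diff[OF a] h w by (intro mult_right_mono) auto
    also have "\<dots> = 4 * d * (prime_weight (h/2) p - prime_weight h p)"
      by (simp add: prime_weight_exp[OF p, of h] prime_weight_exp[OF p, of "h/2"] algebra_simps)
    finally have 1: "prime_weight h p - prime_weight (h * exp d) p \<le> 4 * d * (prime_weight (h/2) p - prime_weight h p)" .
    have 2: "0 \<le> prime_weight h p - prime_weight (h * exp d) p"
      using prime_ge_1_nat[OF p] h unfolding prime_weight_def
      by (auto intro!: divide_left_mono powr_mono mult_pos_pos)
    show "(prime_weight h p - prime_weight (h * exp d) p)\<^sup>2 \<le> 16 * d\<^sup>2 * (prime_weight (h/2) p - prime_weight h p)\<^sup>2"
      using power_mono[OF 1 2, of 2] by (simp add: power_mult_distrib)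
  qed
  also have "\<dots> = 16 * d\<^sup>2 * (\<Sum>p\<in>A. (prime_weight (h/2) p - prime_weight h p)\<^sup>2)"
    by (simp add: sum_distrib_left)
  also have "\<dots> \<le> 16 * d\<^sup>2 * (1 + 4 * mertens_const)"
    using h by (intro mult_left_mono var_half A) auto
  finally show ?thesis .
qed

text \<open>For \<open>h' / h\<close> close to \<open>1\<close> the additive error of the bound for distant parameters is too large. There
  the termwise comparison with the step from \<open>h/2\<close> to \<open>h\<close> gives a quadratic bound in
  \<open>ln (h' / h)\<close>; for distant parameters the logarithm dominates the error.\<close>

lemma var_diff:
  assumes h: "0 < h" "h \<le> h'" "h' \<le> 1" and A: "finite A" "\<And>p. p \<in> A \<Longrightarrow> prime p"
  shows "(\<Sum>p\<in>A. (prime_weight h p - prime_weight h' p)\<^sup>2) \<le> var_const * ln (h' / h)"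
proof -
  define d where "d = ln (h' / h)"
  have d0: "d \<ge> 0" using h by (simp add: d_def)
  have hd: "h' = h * exp d" using h by (simp add: d_def)
  have m: "mertens_const > 0" by (rule mertens_const_pos)
  show ?thesis
  proof (cases "d \<le> 1")
    case True
    have "(\<Sum>p\<in>A. (prime_weight h p - prime_weight h' p)\<^sup>2) \<le> 16 * d\<^sup>2 * (1 + 4 * mertens_const)"
      unfolding hd using h True d0 by (intro var_near A) auto
    also have "\<dots> \<le> 16 * d * (1 + 4 * mertens_const)"
      using True d0 m by (intro mult_right_mono) (auto simp: power2_eq_square mult_left_le)
    also have "\<dots> \<le> 100 * d * (1 + 4 * mertens_const)"
      using d0 m by (intro mult_right_mono) auto
    finally show ?thesis by (simp add: var_const_def d_def[symmetric] mult_ac)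
  next
    case False
    have "(\<Sum>p\<in>A. (prime_weight h p - prime_weight h' p)\<^sup>2) \<le> d + 4 * mertens_const"
      using var_diff_far[OF h A] by (simp add: d_def)
    also have "\<dots> \<le> d * (1 + 4 * mertens_const)"
      using mult_right_mono[of 1 d "4 * mertens_const"] False m by (simp add: algebra_simps)
    also have "\<dots> \<le> var_const * d"
      using False m mult_right_mono[of d "100*d" "1 + 4 * mertens_const"] by (simp add: var_const_def mult_ac)
    finally show ?thesis by (simp add: d_def)
  qed
qed

lemma var_weight:
  assumes h: "0 < h" "h \<le> 1" and A: "finite A" "\<And>p. p \<in> A \<Longrightarrow> prime p"
  shows "(\<Sum>p\<in>A. (prime_weight h p)\<^sup>2) \<le> ln (1 / h) + var_const"
proof -
  have "(\<Sum>p\<in>A. (prime_weight h p)\<^sup>2) \<le> prime_zeta (1 + 2*h)"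
    unfolding sum_prime_weight_sq using h by (intro sum_le_prime_zeta A) auto
  also have "\<dots> \<le> ln (1 / (2*h)) + mertens_const" using prime_zeta_ln[of "2*h"] h by auto
  also have "ln (1 / (2*h)) \<le> ln (1 / h)" using h by (subst ln_le_cancel_iff) (auto simp: field_simps)
  finally show ?thesis using mertens_const_pos by (simp add: var_const_def)
qed

lemma exp1_le_3: "exp (1::real) \<le> 3"
  using exp_bound[of 1] by simp

text \<open>The smooth cutoff \<open>exp (- u)\<close> and the sharp cutoff at \<open>u = 1\<close> differ by \<open>O(u)\<close> near \<open>0\<close> and by
  \<open>O(exp (- u))\<close> at infinity, and \<open>exp (- u/2) - exp (- u)\<close> dominates both up to a constant.\<close>

lemma exp_trunc_diff_le:
  fixes u :: real
  assumes "u \<ge> 0"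
  shows "\<bar>exp (- u) - of_bool (u \<le> 1)\<bar> \<le> 6 * (exp (- (u/2)) - exp (- u))"
proof (cases "u \<le> 1")
  case True
  have "1 \<le> 3 * exp (- u)"
  proof -
    have "exp u \<le> exp 1" using True by simp
    then have "exp u \<le> 3" using exp1_le_3 by linarith
    then have "exp u * exp (-u) \<le> 3 * exp (-u)" by (intro mult_right_mono) auto
    then show ?thesis by (simp add: exp_add[symmetric])
  qed
  then have "u \<le> 6 * (u / 2 * exp (- u))" using assms mult_left_mono[of 1 "3 * exp (-u)" u] by simp
  moreover have "1 - exp (- u) \<le> u" using exp_ge_add_one_self[of "-u"] by simp
  ultimately show ?thesis using True assms exp_half_diff_ge[of u] by simp
next
  case False
  have "exp (- u) \<le> u * exp (- u)" using False mult_right_mono[of 1 u "exp (- u)"] by simp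
  moreover have "u / 2 * exp (- u) = (u * exp (- u)) / 2" by simp
  ultimately have "exp (- u) \<le> 2 * (exp (- (u/2)) - exp (- u))" using exp_half_diff_ge[of u] by argo
  moreover have "exp (- u) > 0" by simp
  ultimately have "exp (- u) \<le> 6 * (exp (- (u/2)) - exp (- u))" by argo
  then show ?thesis using False by simp
qed

text \<open>The termwise comparison with the step from \<open>h/2\<close> to \<open>h\<close> again, now for the passage from smooth to
  sharp cutoff.\<close>

lemma var_trunc:
  assumes h: "0 < h" "h \<le> 1" and A: "finite A" "\<And>p. p \<in> A \<Longrightarrow> prime p"
  shows "(\<Sum>p\<in>A. (prime_weight h p - of_bool (h * ln p \<le> 1) * prime_weight 0 p)\<^sup>2) \<le> var_const"
proof -
  have "(\<Sum>p\<in>A. (prime_weight h p - of_bool (h * ln p \<le> 1) * prime_weight 0 p)\<^sup>2) \<le>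
    (\<Sum>p\<in>A. 36 * (prime_weight (h/2) p - prime_weight h p)\<^sup>2)"
  proof (rule sum_mono)
    fix p assume "p \<in> A"
    then have p: "prime p" using A by auto
    have l: "ln (real p) \<ge> 0" using prime_ge_1_nat[OF p] by simp
    let ?a = "h * ln (real p)" and ?w = "prime_weight 0 p"
    have w: "?w \<ge> 0" by (simp add: prime_weight_def)
    have a: "?a \<ge> 0" using l h by simp
    have "\<bar>prime_weight h p - of_bool (h * ln p \<le> 1) * ?w\<bar> = \<bar>exp (- ?a) - of_bool (?a \<le> 1)\<bar> * ?w"
    proof -
      have "prime_weight h p - of_bool (h * ln p \<le> 1) * ?w = (exp (- ?a) - of_bool (?a \<le> 1)) * ?w"
        by (simp only: prime_weight_exp[OF p, of h] left_diff_distrib)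
      then show ?thesis using w by (simp only: abs_mult abs_of_nonneg)
    qed
    also have "\<dots> \<le> 6 * (exp (- (?a/2)) - exp (- ?a)) * ?w"
      using exp_trunc_diff_le[OF a] w by (intro mult_right_mono) auto
    also have "\<dots> = 6 * (prime_weight (h/2) p - prime_weight h p)"
      by (simp add: prime_weight_exp[OF p, of h] prime_weight_exp[OF p, of "h/2"] algebra_simps)
    finally have 1: "\<bar>prime_weight h p - of_bool (h * ln p \<le> 1) * ?w\<bar> \<le> 6 * (prime_weight (h/2) p - prime_weight h p)" .
    show "(prime_weight h p - of_bool (h * ln p \<le> 1) * ?w)\<^sup>2 \<le> 36 * (prime_weight (h/2) p - prime_weight h p)\<^sup>2"
    proof -
      have "(prime_weight h p - of_bool (h * ln p \<le> 1) * ?w)\<^sup>2 \<le> (6 * (prime_weight (h/2) p - prime_weight h p))\<^sup>2"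
        using power_mono[OF 1 abs_ge_zero, of 2] by (simp only: power2_abs)
      then show ?thesis by (simp only: power_mult_distrib) simp
    qed
  qed
  also have "\<dots> = 36 * (\<Sum>p\<in>A. (prime_weight (h/2) p - prime_weight h p)\<^sup>2)"
    by (simp add: sum_distrib_left)
  also have "\<dots> \<le> 36 * (1 + 4 * mertens_const)"
    using h by (intro mult_left_mono var_half A) auto
  also have "\<dots> \<le> var_const" using mertens_const_pos by (simp add: var_const_def)
  finally show ?thesis .
qed

text \<open>A prime enters at the time \<open>\<tau>\<close> with \<open>ln p = exp \<tau>\<close>: for \<open>h = exp (- \<tau>)\<close> these are
  the primes that the weight \<open>p powr (- h)\<close> leaves essentially undamped.\<close>

definition early_primes :: "real \<Rightarrow> nat set" where
  "early_primes \<tau> = {p. prime p \<and> exp (- \<tau>) * ln (real p) \<le> 1}"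

lemma early_primes_iff: "p \<in> early_primes \<tau> \<longleftrightarrow> prime p \<and> ln (real p) \<le> exp \<tau>"
  by (simp add: early_primes_def exp_minus field_simps)

lemma early_primes_prime: "p \<in> early_primes \<tau> \<Longrightarrow> prime p"
  by (simp add: early_primes_def)

lemma early_primes_mono: "\<tau> \<le> \<tau>' \<Longrightarrow> early_primes \<tau> \<subseteq> early_primes \<tau>'"
  by (auto simp: early_primes_iff) (meson exp_le_cancel_iff order_trans)

lemma finite_early_primes [simp]: "finite (early_primes \<tau>)"
proof (rule finite_subset)
  show "early_primes \<tau> \<subseteq> {..nat \<lceil>exp (exp \<tau>)\<rceil>}"
  proof
    fix p assume "p \<in> early_primes \<tau>"
    then have p: "prime p" "ln (real p) \<le> exp \<tau>" by (auto simp: early_primes_iff)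
    then have "real p \<le> exp (exp \<tau>)" using prime_gt_0_nat[OF p(1)]
      by (metis exp_le_cancel_iff exp_ln of_nat_0_less_iff)
    then show "p \<in> {..nat \<lceil>exp (exp \<tau>)\<rceil>}" by simp linarith
  qed
qed simp

text \<open>The sum over the early primes of \<open>1/p\<close>. Replacing the sharp cutoff by
  \<open>p powr (- 2 * h)\<close> turns it into \<open>prime_zeta (1 + 2 * h)\<close>, which is \<open>\<tau> + O(1)\<close>; the error is again
  compared with the step from \<open>h/2\<close> to \<open>h\<close>, this time in first order.\<close>

lemma early_primes_sum:
  assumes "\<tau> \<ge> 0"
  shows "\<bar>(\<Sum>p\<in>early_primes \<tau>. (prime_weight 0 p)\<^sup>2) - \<tau>\<bar> \<le> var_const"
proof -
  (* The cutoff defining early_primes is h * ln p <= 1 for this h. *)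
  define h where "h = exp (- \<tau>)"
  have h: "0 < h" "h \<le> 1" using assms by (auto simp: h_def)
  let ?\<theta> = "\<Sum>p\<in>early_primes \<tau>. (prime_weight 0 p)\<^sup>2"
  have "\<bar>?\<theta> - prime_zeta (1 + 2*h)\<bar> \<le> 12 * (prime_zeta (1 + h/2) - prime_zeta (1 + h))"
  proof (rule tendsto_le)
    show "(\<lambda>N. \<bar>?\<theta> - (\<Sum>p\<in>primes_le N. 1 / real p powr (1 + 2*h))\<bar>) \<longlonglongrightarrow> \<bar>?\<theta> - prime_zeta (1 + 2*h)\<bar>"
      using h by (intro tendsto_intros prime_zeta_tendsto) auto
    show "(\<lambda>N. 12 * ((\<Sum>p\<in>primes_le N. 1 / real p powr (1 + h/2)) - (\<Sum>p\<in>primes_le N. 1 / real p powr (1 + h))))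
      \<longlonglongrightarrow> 12 * (prime_zeta (1 + h/2) - prime_zeta (1 + h))"
      using h by (intro tendsto_intros prime_zeta_tendsto) auto
    obtain N0 where N0: "\<And>N. N \<ge> N0 \<Longrightarrow> early_primes \<tau> \<subseteq> primes_le N"
      using finite_subset_primes_le[OF finite_early_primes] early_primes_prime by metis
    have "\<bar>?\<theta> - (\<Sum>p\<in>primes_le N. 1 / real p powr (1 + 2*h))\<bar> \<le>
       12 * ((\<Sum>p\<in>primes_le N. 1 / real p powr (1 + h/2)) - (\<Sum>p\<in>primes_le N. 1 / real p powr (1 + h)))"
      if "N \<ge> N0" for N
    proof -
      have "?\<theta> = (\<Sum>p\<in>primes_le N. of_bool (h * ln (real p) \<le> 1) * (prime_weight 0 p)\<^sup>2)"
        using N0[OF that] by (intro sum.mono_neutral_cong_left) (auto simp: early_primes_def h_def)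
      then have "\<bar>?\<theta> - (\<Sum>p\<in>primes_le N. 1 / real p powr (1 + 2*h))\<bar> =
        \<bar>\<Sum>p\<in>primes_le N. of_bool (h * ln (real p) \<le> 1) * (prime_weight 0 p)\<^sup>2 - (prime_weight h p)\<^sup>2\<bar>"
        by (simp only: sum_subtractf sum_prime_weight_sq)
      also have "\<dots> \<le> (\<Sum>p\<in>primes_le N. \<bar>of_bool (h * ln (real p) \<le> 1) * (prime_weight 0 p)\<^sup>2 - (prime_weight h p)\<^sup>2\<bar>)"
        by (rule sum_abs)
      also have "\<dots> \<le> (\<Sum>p\<in>primes_le N. 12 * (1 / real p powr (1 + h/2) - 1 / real p powr (1 + h)))"
      proof (rule sum_mono)
        fix p assume "p \<in> primes_le N"
        then have p: "prime p" by auto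
        have l: "ln (real p) \<ge> 0" using prime_ge_1_nat[OF p] by simp
        let ?a = "h * ln (real p)" and ?W = "(prime_weight 0 p)\<^sup>2"
        have a: "?a \<ge> 0" using l h by simp
        have pw: "1 / real p powr (1 + r) = exp (- (r * ln (real p))) * ?W" for r
          using prime_weight_mult[of r p 0] prime_weight_exp[OF p, of r]
          by (simp add: power2_eq_square mult.assoc)
        have e2: "\<bar>of_bool (?a \<le> 1) - exp (- (2 * ?a))\<bar> \<le> 12 * (exp (- (?a/2)) - exp (- ?a))"
        proof (cases "?a \<le> 1")
          case True
          have "1 - exp (- (2*?a)) = (1 - exp (- ?a)) * (1 + exp (- ?a))"
            by (simp add: algebra_simps exp_add[symmetric])
          also have "\<dots> \<le> (1 - exp (- ?a)) * 2" using a by (intro mult_left_mono) auto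
          also have "\<dots> \<le> 6 * (exp (- (?a/2)) - exp (- ?a)) * 2"
            using exp_trunc_diff_le[OF a] True a by (intro mult_right_mono) auto
          finally show ?thesis using True a by simp
        next
          case False
          have "exp (- (2*?a)) \<le> exp (- ?a)" using a by simp
          also have "\<dots> \<le> 6 * (exp (- (?a/2)) - exp (- ?a))" using exp_trunc_diff_le[OF a] False by simp
          finally have "exp (- (2*?a)) \<le> 6 * (exp (- (?a/2)) - exp (- ?a))" .
          moreover have "exp (- (2*?a)) > 0" by simp
          ultimately have "exp (- (2*?a)) \<le> 12 * (exp (- (?a/2)) - exp (- ?a))" by argo
          then show ?thesis using False by simp
        qed
        have "\<bar>of_bool (?a \<le> 1) * ?W - (prime_weight h p)\<^sup>2\<bar> = \<bar>of_bool (?a \<le> 1) - exp (- (2 * ?a))\<bar> * ?W"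
        proof -
          have "(prime_weight h p)\<^sup>2 = exp (- (2 * ?a)) * ?W"
            using pw[of "2*h"] prime_weight_mult[of h p h] by (simp add: power2_eq_square mult.assoc)
          then have "of_bool (?a \<le> 1) * ?W - (prime_weight h p)\<^sup>2 = (of_bool (?a \<le> 1) - exp (- (2 * ?a))) * ?W"
            by (simp only: left_diff_distrib)
          then show ?thesis by (simp only: abs_mult abs_of_nonneg zero_le_power2)
        qed
        also have "\<dots> \<le> 12 * (exp (- (?a/2)) - exp (- ?a)) * ?W"
          by (rule mult_right_mono[OF e2]) simp
        also have "\<dots> = 12 * (1 / real p powr (1 + h/2) - 1 / real p powr (1 + h))"
          by (simp only: pw) (simp add: algebra_simps)
        finally show "\<bar>of_bool (?a \<le> 1) * ?W - (prime_weight h p)\<^sup>2\<bar> \<le> 12 * (1 / real p powr (1 + h/2) - 1 / real p powr (1 + h))" .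
      qed
      finally show ?thesis by (simp only: sum_subtractf sum_distrib_left[symmetric])
    qed
    then show "\<forall>\<^sub>F N in sequentially. \<bar>?\<theta> - (\<Sum>p\<in>primes_le N. 1 / real p powr (1 + 2*h))\<bar> \<le>
       12 * ((\<Sum>p\<in>primes_le N. 1 / real p powr (1 + h/2)) - (\<Sum>p\<in>primes_le N. 1 / real p powr (1 + h)))"
      by (auto simp: eventually_sequentially)
  qed auto
  moreover have "prime_zeta (1 + h/2) - prime_zeta (1 + h) \<le> 1 + 2 * mertens_const"
  proof -
    have "ln (1 / (h/2)) - ln (1 / h) \<le> 1" using h ln2_le_1 by (simp add: ln_div)
    then show ?thesis using prime_zeta_ln[of "h/2"] prime_zeta_ln[of h] h by auto
  qed
  moreover have "\<bar>prime_zeta (1 + 2*h) - \<tau>\<bar> \<le> 1 + mertens_const"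
  proof -
    have "ln (1 / (2*h)) = \<tau> - ln 2" by (simp add: h_def ln_div ln_mult)
    moreover have "ln (2::real) \<ge> 0" by simp
    moreover have "\<bar>prime_zeta (1 + 2*h) - ln (1 / (2*h))\<bar> \<le> mertens_const"
      using h by (intro prime_zeta_ln) auto
    ultimately show ?thesis using ln2_le_1 by linarith
  qed
  moreover have "\<bar>S - t\<bar> \<le> 100 * (1 + 4 * m)"
    if "\<bar>S - Z\<bar> \<le> 12 * D" "D \<le> 1 + 2 * m" "\<bar>Z - t\<bar> \<le> 1 + m" "m > 0" for S Z D t m :: real
    using that unfolding abs_le_iff by argo
  ultimately show ?thesis using mertens_const_pos unfolding var_const_def by blast
qed

section \<open>Dirichlet series to the right of a point of convergence\<close>

lemma abel_bound:
  fixes b w :: "nat \<Rightarrow> real"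
  assumes w: "\<And>i. w (Suc i) \<le> w i" "\<And>i. w i \<ge> 0"
    and B: "\<And>j. \<bar>\<Sum>i<j. b i\<bar> \<le> B"
  shows "\<bar>\<Sum>i<k. b i * w i\<bar> \<le> w 0 * B"
proof -
  define S where "S j = (\<Sum>i<j. b i)" for j
  have eq: "(\<Sum>i<k. b i * w i) = w k * S k + (\<Sum>i<k. S (Suc i) * (w i - w (Suc i)))"
    by (induction k) (auto simp: S_def algebra_simps)
  have "\<bar>\<Sum>i<k. b i * w i\<bar> \<le> \<bar>w k * S k\<bar> + (\<Sum>i<k. \<bar>S (Suc i) * (w i - w (Suc i))\<bar>)"
    unfolding eq by (rule order_trans[OF abs_triangle_ineq add_left_mono[OF sum_abs]])
  also have "\<dots> \<le> w k * B + (\<Sum>i<k. B * (w i - w (Suc i)))"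
  proof (intro add_mono sum_mono)
    have SB: "\<bar>S j\<bar> \<le> B" for j using B by (simp add: S_def)
    show "\<bar>w k * S k\<bar> \<le> w k * B" using w SB by (simp add: abs_mult mult_left_mono)
    show "\<bar>S (Suc i) * (w i - w (Suc i))\<bar> \<le> B * (w i - w (Suc i))" for i
      using w[of i] SB[of "Suc i"] by (simp add: abs_mult mult_right_mono)
  qed
  also have "(\<Sum>i<k. B * (w i - w (Suc i))) = B * (w 0 - w k)"
    by (simp only: sum_distrib_left[symmetric] sum_lessThan_telescope')
  finally show ?thesis by (simp add: algebra_simps)
qed

text \<open>Summation by parts against the decreasing factors \<open>n powr (r0 - r)\<close>. The uniformity in
  \<open>r \<ge> r0\<close> yields both convergence to the right of \<open>r0\<close> and continuity of the sum.\<close>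

lemma dirichlet_block_uniform:
  fixes a :: "nat \<Rightarrow> real"
  assumes sm: "summable (\<lambda>n. a (Suc n) / real (Suc n) powr r0)" and e: "e > 0"
  shows "\<exists>N. \<forall>m\<ge>N. \<forall>n. \<forall>r\<ge>r0. \<bar>\<Sum>i\<in>{m..<n}. a (Suc i) / real (Suc i) powr r\<bar> \<le> e"
proof -
  obtain N where N: "\<And>m n. m \<ge> N \<Longrightarrow> \<bar>\<Sum>i\<in>{m..<n}. a (Suc i) / real (Suc i) powr r0\<bar> < e"
    using sm e unfolding summable_Cauchy by (metis real_norm_def)
  have "\<bar>\<Sum>i\<in>{m..<n}. a (Suc i) / real (Suc i) powr r\<bar> \<le> e" if m: "m \<ge> N" and r: "r \<ge> r0" for m n r
  proof -
    define b where "b i = a (Suc (m + i)) / real (Suc (m + i)) powr r0" for i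
    define w where "w i = real (Suc (m + i)) powr (r0 - r)" for i
    have "(\<Sum>i\<in>{m..<n}. a (Suc i) / real (Suc i) powr r) = (\<Sum>i<n-m. b i * w i)"
      by (rule sum.reindex_bij_witness[of _ "\<lambda>i. m + i" "\<lambda>i. i - m"])
         (auto simp: b_def w_def powr_diff)
    also have "\<bar>\<dots>\<bar> \<le> w 0 * e"
    proof (rule abel_bound)
      show "w (Suc i) \<le> w i" "w i \<ge> 0" for i using r by (auto simp: w_def intro!: powr_mono2')
      fix j
      have "(\<Sum>i<j. b i) = (\<Sum>i\<in>{m..<m+j}. a (Suc i) / real (Suc i) powr r0)"
        by (rule sum.reindex_bij_witness[of _ "\<lambda>i. i - m" "\<lambda>i. m + i"]) (auto simp: b_def)
      then show "\<bar>\<Sum>i<j. b i\<bar> \<le> e" using N[OF m, of "m + j"] by simp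
    qed
    also have "\<dots> \<le> 1 * e"
    proof (rule mult_right_mono)
      have "real (Suc m) powr (r0 - r) \<le> real (Suc m) powr 0" using r by (intro powr_mono) auto
      then have "w 0 \<le> real (Suc m) powr 0" by (simp add: w_def)
      then show "w 0 \<le> 1" by simp
    qed (use e in auto)
    finally show ?thesis by simp
  qed
  then show ?thesis by blast
qed

lemma dirichlet_summable_mono:
  fixes a :: "nat \<Rightarrow> real"
  assumes sm: "summable (\<lambda>n. a (Suc n) / real (Suc n) powr r0)" and r: "r \<ge> r0"
  shows "summable (\<lambda>n. a (Suc n) / real (Suc n) powr r)"
  unfolding summable_Cauchy
proof (intro allI impI)
  fix e :: real assume "e > 0"
  then obtain N where "\<forall>m\<ge>N. \<forall>n. \<forall>r\<ge>r0. \<bar>\<Sum>i\<in>{m..<n}. a (Suc i) / real (Suc i) powr r\<bar> \<le> e/2"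
    using dirichlet_block_uniform[OF sm, of "e/2"] by auto
  then have N: "\<bar>\<Sum>i\<in>{m..<n}. a (Suc i) / real (Suc i) powr r\<bar> \<le> e/2" if "m \<ge> N" for m n
    using r that by blast
  show "\<exists>N. \<forall>m\<ge>N. \<forall>n. norm (\<Sum>i\<in>{m..<n}. a (Suc i) / real (Suc i) powr r) < e"
  proof (intro exI[of _ N] allI impI)
    fix m n assume "N \<le> m"
    then show "norm (\<Sum>i\<in>{m..<n}. a (Suc i) / real (Suc i) powr r) < e"
      using N[of m n] \<open>e > 0\<close> unfolding real_norm_def by linarith
  qed
qed

lemma continuous_on_dirichlet_sum:
  fixes a :: "nat \<Rightarrow> real"
  assumes sm: "summable (\<lambda>n. a (Suc n) / real (Suc n) powr r0)"
  shows "continuous_on {r0..} (dirichlet_sum a)"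
proof (rule uniform_limit_theorem)
  let ?f = "\<lambda>n r. \<Sum>i<n. a (Suc i) / real (Suc i) powr r"
  show "\<forall>\<^sub>F n in sequentially. continuous_on {r0..} (?f n)"
    by (intro always_eventually allI continuous_intros) auto
  show "uniform_limit {r0..} ?f (dirichlet_sum a) sequentially"
  proof (rule uniform_limitI)
    fix e :: real assume e: "e > 0"
    then obtain N where N: "\<And>m n r. m \<ge> N \<Longrightarrow> r \<ge> r0 \<Longrightarrow> \<bar>\<Sum>i\<in>{m..<n}. a (Suc i) / real (Suc i) powr r\<bar> \<le> e/2"
      using dirichlet_block_uniform[OF sm, of "e/2"] by auto
    have "dist (?f m r) (dirichlet_sum a r) < e" if m: "m \<ge> N" and r: "r \<in> {r0..}" for m r
    proof -
      have lim: "(\<lambda>n. \<bar>?f n r - ?f m r\<bar>) \<longlonglongrightarrow> \<bar>dirichlet_sum a r - ?f m r\<bar>"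
        using r unfolding dirichlet_sum_def
        by (intro tendsto_intros summable_LIMSEQ dirichlet_summable_mono[OF sm]) auto
      have "\<bar>?f n r - ?f m r\<bar> \<le> e/2" if "n \<ge> m" for n
      proof -
        have "?f n r - ?f m r = (\<Sum>i\<in>{m..<n}. a (Suc i) / real (Suc i) powr r)"
          using that by (simp add: sum_diff_nat_ivl lessThan_atLeast0)
        then show ?thesis using N[of m r n] m r by simp
      qed
      then have "\<bar>dirichlet_sum a r - ?f m r\<bar> \<le> e/2"
        by (intro tendsto_upperbound[OF lim]) (auto simp: eventually_sequentially)
      then show ?thesis using e by (simp add: dist_real_def abs_minus_commute)
    qed
    then show "\<forall>\<^sub>F n in sequentially. \<forall>r\<in>{r0..}. dist (?f n r) (dirichlet_sum a r) < e"
      by (auto simp: eventually_sequentially)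
  qed
qed simp

lemma continuous_on_dirichlet_sum_open:
  fixes a :: "nat \<Rightarrow> real"
  assumes sm: "\<And>r. r > c \<Longrightarrow> summable (\<lambda>n. a (Suc n) / real (Suc n) powr r)"
  shows "continuous_on {c<..} (dirichlet_sum a)"
proof (rule continuous_at_imp_continuous_on, rule ballI)
  fix r assume r: "r \<in> {c<..}"
  define r0 where "r0 = (c + r) / 2"
  have r0: "c < r0" "r0 < r" using r by (auto simp: r0_def)
  have "continuous_on {r0<..} (dirichlet_sum a)"
    by (rule continuous_on_subset[OF continuous_on_dirichlet_sum[OF sm[OF r0(1)]]]) auto
  moreover have "open {r0<..}" "r \<in> {r0<..}" using r0 by auto
  ultimately show "isCont (dirichlet_sum a) r" using continuous_on_eq_continuous_at by blast
qed

section \<open>The logarithm of an Euler factor\<close>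

lemma neg_ln_one_minus_cubic:
  fixes x :: real
  assumes x: "\<bar>x\<bar> \<le> 3/4"
  shows "\<bar>- ln (1 - x) - x - x\<^sup>2 / 2\<bar> \<le> 4 * \<bar>x\<bar> ^ 3"
proof -
  let ?f = "\<lambda>x::real. - ln (1 - x) - x - x\<^sup>2 / 2"
  (* The derivative of the function is z^2 / (1 - z), and 1 - z is at least 1/4. *)
  have "norm (?f x - ?f 0) \<le> (4 * \<bar>x\<bar>\<^sup>2) * norm (x - 0)"
  proof (rule field_differentiable_bound[of "cball 0 \<bar>x\<bar>" ?f "\<lambda>z. z\<^sup>2 / (1 - z)"])
    fix z :: real assume "z \<in> cball 0 \<bar>x\<bar>"
    then have z: "\<bar>z\<bar> \<le> \<bar>x\<bar>" by simp
    then have z1: "1 - z \<ge> 1/4" using x by linarith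
    show "(?f has_field_derivative z\<^sup>2 / (1 - z)) (at z within cball 0 \<bar>x\<bar>)"
      using z1 by (auto intro!: derivative_eq_intros simp: field_simps power2_eq_square)
    have "z\<^sup>2 / (1 - z) \<le> z\<^sup>2 / (1/4)" using z1 by (intro divide_left_mono) auto
    also have "\<dots> \<le> 4 * \<bar>x\<bar>\<^sup>2" using power_mono[OF z, of 2] by simp
    finally show "norm (z\<^sup>2 / (1 - z)) \<le> 4 * \<bar>x\<bar>\<^sup>2" using z1 by simp
  qed auto
  then show ?thesis by (simp add: power2_eq_square power3_eq_cube)
qed

definition euler_factor :: "nat \<Rightarrow> real \<Rightarrow> real" where
  "euler_factor k x = (\<Sum>j<k. x ^ j)"

lemma euler_factor_pos:
  assumes "k \<ge> 1" "\<bar>x\<bar> \<le> 3/4"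
  shows "euler_factor k x > 0"
proof -
  have "\<bar>x\<bar> ^ k \<le> \<bar>x\<bar> ^ 1" using assms by (intro power_decreasing) auto
  then have "\<bar>x ^ k\<bar> \<le> 3/4" using assms by (simp add: power_abs)
  then have "x ^ k < 1" by linarith
  moreover have "euler_factor k x = (1 - x ^ k) / (1 - x)"
    using assms sum_gp_strict[of x k] by (simp add: euler_factor_def)
  ultimately show ?thesis using assms by simp
qed

text \<open>The truncated geometric series is \<open>(1 - x ^ k) / (1 - x)\<close>, and for \<open>k \<ge> 3\<close> the numerator contributes
  to the logarithm only from the third order on. For \<open>k = 2\<close> the term \<open>x\<^sup>2 / 2\<close> would have the
  opposite sign.\<close>

lemma ln_euler_factor:
  assumes k: "k \<ge> 3" and x: "\<bar>x\<bar> \<le> 3/4"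
  shows "\<bar>ln (euler_factor k x) - x - x\<^sup>2 / 2\<bar> \<le> 8 * \<bar>x\<bar> ^ 3"
proof -
  have p: "\<bar>x ^ k\<bar> \<le> \<bar>x\<bar> ^ 3" unfolding power_abs using assms by (intro power_decreasing) auto
  have "\<bar>x\<bar> ^ 3 \<le> (3/4) ^ 3" using x by (intro power_mono) auto
  then have x3: "\<bar>x\<bar> ^ 3 \<le> 1/2" by (simp add: power3_eq_cube)
  then have xk: "\<bar>x ^ k\<bar> \<le> 1/2" using p by linarith
  define y where "y = - (x ^ k)"
  have y: "\<bar>y\<bar> \<le> 1/2" "\<bar>y\<bar> \<le> \<bar>x\<bar> ^ 3" using xk p by (auto simp: y_def)
  have "\<bar>ln (1 + y) - y\<bar> \<le> 2 * y\<^sup>2" by (rule abs_ln_one_plus_x_minus_x_bound[OF y(1)])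
  moreover have "2 * y\<^sup>2 \<le> \<bar>y\<bar>"
    using mult_right_mono[OF y(1), of "\<bar>y\<bar>"] by (simp add: power2_eq_square flip: abs_mult)
  ultimately have "\<bar>ln (1 + y)\<bar> \<le> 2 * \<bar>x\<bar> ^ 3" using y by linarith
  then have l: "\<bar>ln (1 - x ^ k)\<bar> \<le> 2 * \<bar>x\<bar> ^ 3" by (simp add: y_def)
  have "euler_factor k x = (1 - x ^ k) / (1 - x)"
    using x sum_gp_strict[of x k] by (simp add: euler_factor_def)
  then have "ln (euler_factor k x) = ln (1 - x ^ k) - ln (1 - x)"
    using x xk by (simp add: ln_div)
  then have eq: "ln (euler_factor k x) - x - x\<^sup>2/2 = ln (1 - x ^ k) + (- ln (1 - x) - x - x\<^sup>2 / 2)" by simp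
  have "\<bar>ln (euler_factor k x) - x - x\<^sup>2/2\<bar> \<le> \<bar>ln (1 - x ^ k)\<bar> + \<bar>- ln (1 - x) - x - x\<^sup>2 / 2\<bar>"
    unfolding eq by (rule abs_triangle_ineq)
  also have "\<dots> \<le> 2 * \<bar>x\<bar> ^ 3 + 4 * \<bar>x\<bar> ^ 3" using l neg_ln_one_minus_cubic[OF x] by (intro add_mono) auto
  also have "\<dots> \<le> 8 * \<bar>x\<bar> ^ 3" using zero_le_power_abs[of x 3] by linarith
  finally show ?thesis .
qed

section \<open>Pairs of integers whose product is a square\<close>

text \<open>The witness is \<open>a = gcd n m\<close>: the cofactors are coprime with a square product, hence squares.\<close>

lemma square_product_factor:
  fixes n m :: nat
  assumes "n > 0" "m > 0" "is_nth_power 2 (n * m)"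
  shows "\<exists>a b c. n = a * b\<^sup>2 \<and> m = a * c\<^sup>2"
proof -
  define g where "g = gcd n m"
  have g: "g > 0" using assms by (simp add: g_def)
  obtain n' m' where nm: "n = n' * g" "m = m' * g" "coprime n' m'"
    using gcd_coprime_exists[of n m] assms unfolding g_def by auto
  have "n * m = g ^ 2 * (n' * m')" using nm by (simp add: power2_eq_square)
  then have "is_nth_power 2 (n' * m')"
    using assms(3) g is_nth_power_mult_cancel_left[of 2 "g\<^sup>2" "n' * m'"] by auto
  then have "is_nth_power 2 n'" "is_nth_power 2 m'"
    using is_nth_power_mult_coprime_natD[of n' m' 2] nm assms by auto
  then obtain b c where "n' = b\<^sup>2" "m' = c\<^sup>2" by (auto elim!: is_nth_powerE)
  then show ?thesis using nm by (auto simp: mult.commute)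
qed

lemma sum_le_zeta:
  assumes "s > 1" shows "(\<Sum>a\<in>{1..N}. real a powr (- s)) \<le> zeta s"
proof -
  have "(\<Sum>a\<in>{1..N}. real a powr (- s)) = (\<Sum>n<N. real (Suc n) powr (- s))"
    by (rule sum.reindex_bij_witness[of _ Suc "\<lambda>n. n - 1"]) auto
  also have "\<dots> \<le> zeta s"
    unfolding zeta_def by (intro sum_le_suminf summable_powr_Suc assms) auto
  finally show ?thesis .
qed

lemma zeta_pos:
  assumes "s > 1" shows "zeta s > 0"
proof -
  have "0 < 1 / (s - 1)" using assms by simp
  also have "\<dots> \<le> zeta (1 + (s - 1))" using assms by (intro zeta_bounds(1)) auto
  finally show ?thesis by simp
qed

text \<open>Every admissible pair is \<open>(a * b\<^sup>2, a * c\<^sup>2)\<close>, with weight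
  \<open>(a * b * c) powr (- 2 * s)\<close>, so the sum is at most a product of three zeta sums.\<close>

lemma sum_square_pairs:
  assumes s: "s > 1/2" and I: "finite I" "0 \<notin> I"
  shows "(\<Sum>n\<in>I. \<Sum>m\<in>I. of_bool (is_nth_power 2 (n * m)) * (real n * real m) powr (- s)) \<le> (zeta (2 * s)) ^ 3"
proof -
  define N where "N = Max (insert 0 I)"
  have IN: "n \<in> I \<Longrightarrow> n \<le> N" for n using I by (simp add: N_def)
  define S where "S = {(n, m) \<in> I \<times> I. is_nth_power 2 (n * m)}"
  define T where "T = {1..N} \<times> {1..N} \<times> {1..N}"
  define \<phi> where "\<phi> = (\<lambda>(a, b, c). (a * b\<^sup>2, a * c\<^sup>2 :: nat))"
  define f where "f = (\<lambda>(n, m). (real n * real m) powr (- s))"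
  have S: "S \<subseteq> \<phi> ` T"
  proof
    fix z assume "z \<in> S"
    then obtain n m where z: "z = (n, m)" "n \<in> I" "m \<in> I" "is_nth_power 2 (n * m)" by (auto simp: S_def)
    then have pos: "n > 0" "m > 0" using I by (auto intro: Nat.gr0I)
    obtain a b c where abc: "n = a * b\<^sup>2" "m = a * c\<^sup>2" using square_product_factor[OF pos z(4)] by blast
    have "a > 0" "b > 0" "c > 0" using abc pos by (auto intro: Nat.gr0I)
    moreover have "a \<le> n" "b \<le> n" "c \<le> m"
      using abc \<open>a > 0\<close> \<open>b > 0\<close> \<open>c > 0\<close> by (auto simp: power2_eq_square)
    ultimately have "(a, b, c) \<in> T" using IN z pos by (auto simp: T_def intro: order_trans)
    then show "z \<in> \<phi> ` T" using z abc by (intro image_eqI[of _ _ "(a, b, c)"]) (auto simp: \<phi>_def)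
  qed
  have "(\<Sum>n\<in>I. \<Sum>m\<in>I. of_bool (is_nth_power 2 (n * m)) * (real n * real m) powr (- s))
     = (\<Sum>z\<in>I \<times> I. of_bool (z \<in> S) * f z)"
    by (subst sum.cartesian_product) (auto simp: S_def f_def intro!: sum.cong)
  also have "\<dots> = (\<Sum>z\<in>S. f z)"
    by (rule sum.mono_neutral_cong_right) (use I in \<open>auto simp: S_def\<close>)
  also have "\<dots> \<le> (\<Sum>z\<in>\<phi> ` T. f z)" by (intro sum_mono2 S) (auto simp: T_def f_def)
  also have "\<dots> \<le> (\<Sum>t\<in>T. f (\<phi> t))"
  proof -
    have "sum f (\<phi> ` T) \<le> (\<Sum>t\<in>T. f (\<phi> t))"
      using sum_image_le[of T f \<phi>] by (simp add: T_def f_def comp_def split: prod.split)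
    then show ?thesis .
  qed
  also have "\<dots> = (\<Sum>a\<in>{1..N}. \<Sum>b\<in>{1..N}. \<Sum>c\<in>{1..N}.
      real a powr (- (2 * s)) * (real b powr (- (2 * s)) * real c powr (- (2 * s))))"
  proof -
    have "(real a * (real b)\<^sup>2 * (real a * (real c)\<^sup>2)) powr (- s) = 
       real a powr (- (2 * s)) * (real b powr (- (2 * s)) * real c powr (- (2 * s)))"
      if "a > 0" "b > 0" "c > 0" for a b c :: nat
    proof -
      have "real a * (real b)\<^sup>2 * (real a * (real c)\<^sup>2) = (real a * real b * real c) powr 2"
        using that by (simp add: powr_numeral power2_eq_square)
      also have "\<dots> powr (- s) = (real a * real b * real c) powr (- (2 * s))" by (simp only: powr_powr) simp
      finally show ?thesis using that by (simp add: powr_mult mult.assoc)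
    qed
    then have "(\<Sum>t\<in>T. f (\<phi> t)) = (\<Sum>t\<in>T. case t of (a, b, c) \<Rightarrow>
        real a powr (- (2 * s)) * (real b powr (- (2 * s)) * real c powr (- (2 * s))))"
      by (intro sum.cong refl) (auto simp: T_def f_def \<phi>_def)
    then show ?thesis unfolding T_def by (simp only: sum.cartesian_product[symmetric])
  qed
  also have "\<dots> = (\<Sum>a\<in>{1..N}. real a powr (- (2 * s))) ^ 3"
    by (simp add: sum_distrib_left[symmetric] sum_distrib_right[symmetric] power3_eq_cube)
  also have "\<dots> \<le> (zeta (2 * s)) ^ 3"
    using s by (intro power_mono sum_le_zeta sum_nonneg) auto
  finally show ?thesis .
qed

text \<open>On integers from \<open>N\<close> on, part of the exponent is traded for a power of \<open>N\<close>.\<close>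

lemma sum_square_pairs_tail:
  assumes d: "d \<ge> 0" "s - d > 1/2" and I: "finite I" "\<And>n. n \<in> I \<Longrightarrow> N \<le> n" and N: "N \<ge> 1"
  shows "(\<Sum>n\<in>I. \<Sum>m\<in>I. of_bool (is_nth_power 2 (n * m)) * (real n * real m) powr (- s))
           \<le> real N powr (- (2*d)) * (zeta (2 * (s - d))) ^ 3"
proof -
  have "(\<Sum>n\<in>I. \<Sum>m\<in>I. of_bool (is_nth_power 2 (n * m)) * (real n * real m) powr (- s)) \<le>
   (\<Sum>n\<in>I. \<Sum>m\<in>I. real N powr (- (2*d)) * (of_bool (is_nth_power 2 (n * m)) * (real n * real m) powr (- (s - d))))"
  proof (intro sum_mono)
    fix n m assume nm: "n \<in> I" "m \<in> I"
    have NN: "real N * real N \<le> real n * real m" "real N > 0" using I(2)[OF nm(1)] I(2)[OF nm(2)] N by (auto intro: mult_mono)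
    have "(real n * real m) powr (- s) = (real n * real m) powr (- d) * (real n * real m) powr (- (s - d))"
      by (simp add: powr_add[symmetric])
    also have "\<dots> \<le> (real N * real N) powr (- d) * (real n * real m) powr (- (s - d))"
      using NN d by (intro mult_right_mono powr_mono2') auto
    also have "(real N * real N) powr (- d) = real N powr (- (2*d))"
      by (simp add: powr_mult powr_add[symmetric])
    finally show "of_bool (is_nth_power 2 (n * m)) * (real n * real m) powr (- s) \<le>
      real N powr (- (2*d)) * (of_bool (is_nth_power 2 (n * m)) * (real n * real m) powr (- (s - d)))"
      by simp
  qed
  also have "\<dots> = real N powr (- (2*d)) * (\<Sum>n\<in>I. \<Sum>m\<in>I. of_bool (is_nth_power 2 (n * m)) * (real n * real m) powr (- (s - d)))"
    by (simp add: sum_distrib_left)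
  also have "\<dots> \<le> real N powr (- (2*d)) * (zeta (2 * (s - d))) ^ 3"
    using I N d by (intro mult_left_mono sum_square_pairs) (auto dest: I(2))
  finally show ?thesis .
qed

section \<open>Dyadic chaining\<close>

abbreviation dyadic_floor :: "nat \<Rightarrow> real \<Rightarrow> real" where
  "dyadic_floor n t \<equiv> of_int \<lfloor>2 ^ n * t\<rfloor> / 2 ^ n"

text \<open>Consecutive dyadic approximations from below of \<open>t\<close> are equal or neighbours on the finer grid, so each level costs one
  increment.\<close>

lemma dyadic_chain:
  fixes x :: "real \<Rightarrow> real" and T :: nat
  assumes incr: "\<And>i j. n < i \<Longrightarrow> i \<le> N \<Longrightarrow> j < T * 2 ^ i \<Longrightarrow> \<bar>x (real (Suc j) / 2 ^ i) - x (real j / 2 ^ i)\<bar> \<le> d i"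
    and t: "0 \<le> t" "t < real T" and nN: "n \<le> N"
  shows "\<bar>x (dyadic_floor N t) - x (dyadic_floor n t)\<bar> \<le> (\<Sum>i\<in>{n<..N}. d i)"
  using nN incr
proof (induction N rule: dec_induct)
  case base
  then show ?case by simp
next
  case (step m)
  define j where "j = nat \<lfloor>2 ^ Suc m * t\<rfloor>"
  have T0: "T > 0" using t by (cases T) auto
  have jt: "real j \<le> 2 ^ Suc m * t" "2 ^ Suc m * t < real j + 1" "dyadic_floor (Suc m) t = real j / 2 ^ Suc m"
    using t by (auto simp: j_def)
  have "real j < 2 ^ Suc m * real T" using jt t by (smt (verit) mult_less_cancel_left_pos zero_less_power)
  then have "real j < real (T * 2 ^ Suc m)" by (simp add: mult.commute)
  then have jT: "j < T * 2 ^ Suc m" by (simp only: of_nat_less_iff)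
  have fl: "\<lfloor>2 ^ m * t\<rfloor> = int (j div 2)"
  proof -
    have "real (j div 2) \<le> 2 ^ m * t" "2 ^ m * t < real (j div 2) + 1"
      using jt by (cases "even j"; auto elim!: evenE oddE)+
    then show ?thesis by linarith
  qed
  have d0: "d (Suc m) \<ge> 0"
    using step.prems[of "Suc m" 0] step.hyps T0 by (smt (verit) abs_ge_zero less_Suc_eq_le mult_pos_pos order_refl zero_less_numeral zero_less_power)
  have last: "\<bar>x (dyadic_floor (Suc m) t) - x (dyadic_floor m t)\<bar> \<le> d (Suc m)"
  proof (cases "even j")
    case True
    then have "dyadic_floor (Suc m) t = dyadic_floor m t"
      unfolding jt(3) fl by (auto elim!: evenE)
    then show ?thesis using d0 by simp
  next
    case False
    then obtain q where q: "j = 2 * q + 1" by (auto elim: oddE)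
    have e: "dyadic_floor m t = real (2 * q) / 2 ^ Suc m" "dyadic_floor (Suc m) t = real (Suc (2 * q)) / 2 ^ Suc m"
      unfolding jt(3) fl by (auto simp: q)
    show ?thesis unfolding e
      by (rule step.prems) (use step.hyps jT q in auto)
  qed
  have IH: "\<bar>x (dyadic_floor m t) - x (dyadic_floor n t)\<bar> \<le> (\<Sum>i\<in>{n<..m}. d i)"
    by (rule step.IH) (use step.prems in auto)
  have "{n<..Suc m} = insert (Suc m) {n<..m}" using step.hyps by auto
  then show ?case using last IH by simp
qed

lemma convergent_of_dyadic_blocks:
  fixes S :: "nat \<Rightarrow> real"
  assumes e: "summable e" and S: "\<And>J y. J \<ge> J0 \<Longrightarrow> 2 ^ J \<le> y \<Longrightarrow> y \<le> 2 ^ Suc J \<Longrightarrow> \<bar>S y - S (2 ^ J)\<bar> \<le> e J"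
  shows "convergent S"
proof -
  have "summable (\<lambda>J. S (2 ^ Suc J) - S (2 ^ J))"
    by (rule summable_comparison_test'[OF e, of J0]) (use S in auto)
  then have "(\<lambda>n. S (2 ^ 0) + (\<Sum>J<n. S (2 ^ Suc J) - S (2 ^ J))) \<longlonglongrightarrow> S (2 ^ 0) + (\<Sum>J. S (2 ^ Suc J) - S (2 ^ J))"
    by (intro tendsto_intros summable_LIMSEQ)
  then obtain l where l: "(\<lambda>J. S (2 ^ J)) \<longlonglongrightarrow> l"
    by (subst (asm) sum_lessThan_telescope) auto
  have fl: "filterlim floor_log at_top sequentially"
    unfolding filterlim_at_top eventually_sequentially
  proof
    fix Z show "\<exists>N. \<forall>n\<ge>N. Z \<le> floor_log n"
      by (intro exI[of _ "2 ^ Z"] allI impI) (metis floor_log_mono floor_log_power monoD)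
  qed
  have "(\<lambda>y. S y - S (2 ^ floor_log y)) \<longlonglongrightarrow> 0"
  proof (rule Lim_null_comparison)
    show "(\<lambda>y. e (floor_log y)) \<longlonglongrightarrow> 0"
      using filterlim_compose[OF summable_LIMSEQ_zero[OF e] fl] .
    have "\<forall>\<^sub>F y in sequentially. J0 \<le> floor_log y" using fl by (auto simp: filterlim_at_top)
    then show "\<forall>\<^sub>F y in sequentially. norm (S y - S (2 ^ floor_log y)) \<le> e (floor_log y)"
      using eventually_gt_at_top[of 0]
    proof eventually_elim
      case (elim y)
      then show ?case
        using S[of "floor_log y" y] floor_log_exp2_le[of y] floor_log_exp2_gt[of y] by simp
    qed
  qed
  from tendsto_add[OF this filterlim_compose[OF l fl]] show ?thesis by (auto simp: convergent_def)
qed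

section \<open>Sub-Gaussian random variables\<close>

text \<open>The moment generating function of a random sign is \<open>cosh\<close>; this bound makes it sub-Gaussian with
  variance parameter \<open>1\<close>.\<close>

lemma cosh_le_exp_half_sq:
  fixes x :: real
  shows "cosh x \<le> exp (x\<^sup>2 / 2)"
proof -
  have *: "cosh y \<le> exp (y\<^sup>2 / 2)" if "y \<ge> 0" for y :: real
  proof -
    have "cosh y = exp (- y) * (1 + 1/2 * (exp (2*y) - 1))"
      by (simp add: cosh_def field_simps flip: exp_add)
    moreover have "1 + 1/2 * (exp (2*y) - 1) > 0" using that by (intro add_pos_nonneg) auto
    ultimately have "ln (cosh y) = ln (exp (- y)) + ln (1 + 1/2 * (exp (2*y) - 1))"
      by (simp only: ln_mult_pos exp_gt_zero)
    then have "ln (cosh y) \<le> y\<^sup>2 / 2"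
      using Hoeffdings_lemma_aux[of "2*y" "1/2"] that by (simp add: power_mult_distrib)
    then show ?thesis using cosh_real_pos[of y] by (metis exp_le_cancel_iff exp_ln)
  qed
  show ?thesis using *[of "\<bar>x\<bar>"] by simp
qed

lemma cosh_ge_quadratic:
  fixes x :: real
  shows "cosh x \<ge> 1 + x\<^sup>2 / 2"
proof -
  have "cosh x = 1 + 2 * (sinh (x/2))\<^sup>2"
    using cosh_double[of "x/2"] cosh_square_eq[of "x/2"] by simp
  moreover have "\<bar>x/2\<bar> \<le> sinh \<bar>x/2\<bar>"
    using real_le_x_sinh[of "\<bar>x/2\<bar>"] by (simp add: sinh_def exp_minus)
  then have "\<bar>x/2\<bar>\<^sup>2 \<le> (sinh \<bar>x/2\<bar>)\<^sup>2" by (intro power_mono) auto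
  then have "x\<^sup>2 / 4 \<le> (sinh (x/2))\<^sup>2" by (simp add: sinh_real_abs power_divide del: abs_divide)
  ultimately show ?thesis by simp
qed

text \<open>The exponential moments are written as nonnegative integrals, so that the condition includes their finiteness
  and passes to limits by Fatou's lemma.\<close>

definition subgaussian :: "'a measure \<Rightarrow> real \<Rightarrow> ('a \<Rightarrow> real) \<Rightarrow> bool" where
  "subgaussian M v Y \<longleftrightarrow> Y \<in> borel_measurable M \<and>
     (\<forall>l. (\<integral>\<^sup>+\<omega>. ennreal (exp (l * Y \<omega>)) \<partial>M) \<le> ennreal (exp (l\<^sup>2 * v / 2)))"

lemma subgaussian_measurable: "subgaussian M v Y \<Longrightarrow> Y \<in> borel_measurable M"
  by (simp add: subgaussian_def)

lemma subgaussian_scale: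
  assumes "subgaussian M v Y"
  shows "subgaussian M (c\<^sup>2 * v) (\<lambda>\<omega>. c * Y \<omega>)"
  using assms unfolding subgaussian_def
proof (intro conjI allI)
  fix l
  assume "Y \<in> borel_measurable M \<and> (\<forall>l. (\<integral>\<^sup>+\<omega>. ennreal (exp (l * Y \<omega>)) \<partial>M) \<le> ennreal (exp (l\<^sup>2 * v / 2)))"
  then have "(\<integral>\<^sup>+\<omega>. ennreal (exp (l * c * Y \<omega>)) \<partial>M) \<le> ennreal (exp ((l * c)\<^sup>2 * v / 2))" by blast
  then show "(\<integral>\<^sup>+\<omega>. ennreal (exp (l * (c * Y \<omega>))) \<partial>M) \<le> ennreal (exp (l\<^sup>2 * (c\<^sup>2 * v) / 2))"
    by (simp add: power_mult_distrib mult.assoc)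
qed auto

lemma subgaussian_mono:
  assumes "subgaussian M v Y" "v \<le> v'"
  shows "subgaussian M v' Y"
  unfolding subgaussian_def
proof (intro conjI allI)
  fix l
  have "(\<integral>\<^sup>+\<omega>. ennreal (exp (l * Y \<omega>)) \<partial>M) \<le> ennreal (exp (l\<^sup>2 * v / 2))"
    using assms(1) by (simp add: subgaussian_def)
  also have "\<dots> \<le> ennreal (exp (l\<^sup>2 * v' / 2))"
    using assms(2) by (intro ennreal_leI) (simp add: mult_left_mono)
  finally show "(\<integral>\<^sup>+\<omega>. ennreal (exp (l * Y \<omega>)) \<partial>M) \<le> ennreal (exp (l\<^sup>2 * v' / 2))" .
qed (use assms in \<open>simp add: subgaussian_def\<close>)

lemma (in prob_space) subgaussian_tail:
  assumes sg: "subgaussian M v Y" and v: "v > 0" and x: "x \<ge> 0"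
  shows "prob {\<omega>\<in>space M. Y \<omega> \<ge> x} \<le> exp (- (x\<^sup>2 / (2 * v)))"
proof (cases "x = 0")
  case False
  have [measurable]: "Y \<in> borel_measurable M" using sg by (rule subgaussian_measurable)
  let ?l = "x / v"
  have l: "?l > 0" using v x False by simp
  have "emeasure M {\<omega>\<in>space M. Y \<omega> \<ge> x}
        \<le> ennreal (exp (- ?l * x)) * (\<integral>\<^sup>+\<omega>. ennreal (exp (?l * Y \<omega>)) * indicator (space M) \<omega> \<partial>M)"
    using Chernoff_ineq_nn_integral_ge[of ?l "space M" M Y x] l
    by simp
  also have "\<dots> \<le> ennreal (exp (- ?l * x)) * ennreal (exp (?l\<^sup>2 * v / 2))"
  proof -
    have "(\<integral>\<^sup>+\<omega>. ennreal (exp (?l * Y \<omega>)) * indicator (space M) \<omega> \<partial>M) = (\<integral>\<^sup>+\<omega>. ennreal (exp (?l * Y \<omega>)) \<partial>M)"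
      by (rule nn_integral_cong) simp
    also have "\<dots> \<le> ennreal (exp (?l\<^sup>2 * v / 2))" using sg unfolding subgaussian_def by blast
    finally show ?thesis by (intro mult_left_mono) auto
  qed
  also have "\<dots> = ennreal (exp (- (x\<^sup>2 / (2 * v))))"
    using v by (simp add: ennreal_mult[symmetric] exp_add[symmetric] power2_eq_square field_simps)
  finally show ?thesis
    by (simp add: emeasure_eq_measure)
qed (use prob_le_1 in simp)

lemma (in prob_space) subgaussian_tail_abs:
  assumes sg: "subgaussian M v Y" and v: "v > 0" and x: "x \<ge> 0"
  shows "prob {\<omega>\<in>space M. \<bar>Y \<omega>\<bar> \<ge> x} \<le> 2 * exp (- (x\<^sup>2 / (2 * v)))"
proof -
  have [measurable]: "Y \<in> borel_measurable M" using sg by (rule subgaussian_measurable)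
  have sg': "subgaussian M v (\<lambda>\<omega>. - Y \<omega>)" using subgaussian_scale[OF sg, of "-1"] by simp
  have "prob {\<omega>\<in>space M. \<bar>Y \<omega>\<bar> \<ge> x} \<le> prob ({\<omega>\<in>space M. Y \<omega> \<ge> x} \<union> {\<omega>\<in>space M. - Y \<omega> \<ge> x})"
    by (intro finite_measure_mono) auto
  also have "\<dots> \<le> prob {\<omega>\<in>space M. Y \<omega> \<ge> x} + prob {\<omega>\<in>space M. - Y \<omega> \<ge> x}"
    by (intro measure_Un_le) auto
  finally show ?thesis using subgaussian_tail[OF sg v x] subgaussian_tail[OF sg' v x] by simp
qed

lemma exp_neg_le_fact_div:
  fixes y :: real
  assumes "y > 0"
  shows "exp (- y) \<le> fact m / y ^ m"
proof -
  have "y ^ m / fact m \<le> exp y"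
  proof -
    have "(\<lambda>n. y ^ n /\<^sub>R fact n) sums exp y" by (rule exp_converges)
    then show ?thesis
      using sum_le_suminf[of "\<lambda>n. y ^ n /\<^sub>R fact n" "{m}"] assms
      by (auto simp: sums_iff field_simps)
  qed
  then show ?thesis using assms by (simp add: exp_minus field_simps)
qed

text \<open>A polynomial tail bound suits chaining, where powers of the ratio of variance to squared level have to be summed
  over the levels. It includes \<open>v = 0\<close>, by letting the variance parameter decrease to \<open>v\<close>.\<close>

lemma (in prob_space) subgaussian_tail_power:
  assumes sg: "subgaussian M v Y" and v: "v \<ge> 0" and x: "x > 0"
  shows "prob {\<omega>\<in>space M. \<bar>Y \<omega>\<bar> \<ge> x} \<le> 2 * fact m * 2 ^ m * (v / x\<^sup>2) ^ m"
proof -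
  have pos: "prob {\<omega>\<in>space M. \<bar>Y \<omega>\<bar> \<ge> x} \<le> 2 * fact m * 2 ^ m * (w / x\<^sup>2) ^ m" if w: "w > v" for w
  proof -
    have w0: "w > 0" using w v by simp
    have "prob {\<omega>\<in>space M. \<bar>Y \<omega>\<bar> \<ge> x} \<le> 2 * exp (- (x\<^sup>2 / (2 * w)))"
      using subgaussian_mono[OF sg, of w] w w0 x by (intro subgaussian_tail_abs) auto
    also have "\<dots> \<le> 2 * (fact m / (x\<^sup>2 / (2 * w)) ^ m)"
      using x w0 by (intro mult_left_mono exp_neg_le_fact_div) auto
    also have "\<dots> = 2 * fact m * 2 ^ m * (w / x\<^sup>2) ^ m"
      by (simp add: power_divide power_mult_distrib)
    finally show ?thesis .
  qed
  have lim: "((\<lambda>w. 2 * fact m * 2 ^ m * (w / x\<^sup>2) ^ m) \<longlongrightarrow> 2 * fact m * 2 ^ m * (v / x\<^sup>2) ^ m) (at_right v)"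
    using x by (intro tendsto_intros) auto
  show ?thesis
    by (rule tendsto_lowerbound[OF lim]) (auto simp: eventually_at_right_field intro!: exI[of _ "v + 1"] pos)
qed

text \<open>The inequality \<open>x\<^sup>2 / 2 \<le> cosh x\<close> is integrated at \<open>x = Y / sqrt v\<close>.\<close>

lemma (in prob_space) subgaussian_second_moment:
  assumes sg: "subgaussian M v Y" and v: "v > 0"
  shows "(\<integral>\<^sup>+\<omega>. ennreal ((Y \<omega>)\<^sup>2) \<partial>M) \<le> ennreal (4 * v)"
proof -
  have [measurable]: "Y \<in> borel_measurable M" using sg by (rule subgaussian_measurable)
  (* With this l the exponent l^2 v / 2 is 1/2. *)
  define l where "l = 1 / sqrt v"
  have l2: "l\<^sup>2 = 1 / v" using v by (simp add: l_def power_divide)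
  have "(Y \<omega>)\<^sup>2 \<le> v * exp (l * Y \<omega>) + v * exp (- l * Y \<omega>)" for \<omega>
  proof -
    have "(l * Y \<omega>)\<^sup>2 / 2 \<le> cosh (l * Y \<omega>)" using cosh_ge_quadratic[of "l * Y \<omega>"] by simp
    then have "v * (l * Y \<omega>)\<^sup>2 \<le> v * (2 * cosh (l * Y \<omega>))" using v by (intro mult_left_mono) auto
    then show ?thesis using v by (simp add: power_mult_distrib l2 cosh_def algebra_simps)
  qed
  then have "(\<integral>\<^sup>+\<omega>. ennreal ((Y \<omega>)\<^sup>2) \<partial>M) \<le> (\<integral>\<^sup>+\<omega>. ennreal (v * exp (l * Y \<omega>) + v * exp (- l * Y \<omega>)) \<partial>M)"
    by (intro nn_integral_mono ennreal_leI)
  also have "\<dots> = ennreal v * (\<integral>\<^sup>+\<omega>. ennreal (exp (l * Y \<omega>)) \<partial>M) + ennreal v * (\<integral>\<^sup>+\<omega>. ennreal (exp (- l * Y \<omega>)) \<partial>M)"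
    using v by (simp add: ennreal_plus ennreal_mult nn_integral_add nn_integral_cmult)
  also have "\<dots> \<le> ennreal v * ennreal (exp (l\<^sup>2 * v / 2)) + ennreal v * ennreal (exp ((-l)\<^sup>2 * v / 2))"
  proof -
    have "(\<integral>\<^sup>+\<omega>. ennreal (exp (t * Y \<omega>)) \<partial>M) \<le> ennreal (exp (t\<^sup>2 * v / 2))" for t
      using sg by (simp add: subgaussian_def)
    from this[of l] this[of "-l"] show ?thesis by (intro add_mono mult_left_mono) simp_all
  qed
  also have "\<dots> = ennreal (v * (2 * exp (1/2)))"
    using v by (simp add: l2 flip: ennreal_mult ennreal_plus)
  also have "\<dots> \<le> ennreal (4 * v)"
  proof -
    have "exp (1/2::real) \<le> 2" using exp_bound[of "1/2::real"] by (simp add: power2_eq_square)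
    then show ?thesis using v by (intro ennreal_leI) simp
  qed
  finally show ?thesis .
qed

lemma subgaussian_limit:
  assumes sg: "\<And>n. subgaussian M v (X n)" and Y: "Y \<in> borel_measurable M"
    and lim: "AE \<omega> in M. (\<lambda>n. X n \<omega>) \<longlonglongrightarrow> Y \<omega>"
  shows "subgaussian M v Y"
  unfolding subgaussian_def
proof (intro conjI allI Y)
  fix l
  have [measurable]: "X n \<in> borel_measurable M" for n using sg by (rule subgaussian_measurable)
  have "(\<integral>\<^sup>+\<omega>. ennreal (exp (l * Y \<omega>)) \<partial>M) = (\<integral>\<^sup>+\<omega>. liminf (\<lambda>n. ennreal (exp (l * X n \<omega>))) \<partial>M)"
  proof (rule nn_integral_cong_AE, use lim in eventually_elim)
    fix \<omega> assume "(\<lambda>n. X n \<omega>) \<longlonglongrightarrow> Y \<omega>"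
    then have "(\<lambda>n. ennreal (exp (l * X n \<omega>))) \<longlonglongrightarrow> ennreal (exp (l * Y \<omega>))"
      by (intro tendsto_intros)
    then show "ennreal (exp (l * Y \<omega>)) = liminf (\<lambda>n. ennreal (exp (l * X n \<omega>)))"
      by (simp only: lim_imp_Liminf sequentially_bot not_False_eq_True trivial_limit_sequentially)
  qed
  also have "\<dots> \<le> liminf (\<lambda>n. \<integral>\<^sup>+\<omega>. ennreal (exp (l * X n \<omega>)) \<partial>M)"
    by (rule nn_integral_liminf) measurable
  also have "\<dots> \<le> ennreal (exp (l\<^sup>2 * v / 2))"
    using sg unfolding subgaussian_def by (intro Liminf_le) (auto simp: eventually_sequentially)
  finally show "(\<integral>\<^sup>+\<omega>. ennreal (exp (l * Y \<omega>)) \<partial>M) \<le> ennreal (exp (l\<^sup>2 * v / 2))" .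
qed

text \<open>Summable second moments make \<open>\<Sum>n. (Y n)\<^sup>2\<close> integrable, hence finite almost surely.\<close>

lemma AE_tendsto_zero_second_moment:
  fixes Y :: "nat \<Rightarrow> 'a \<Rightarrow> real"
  assumes [measurable]: "\<And>n. Y n \<in> borel_measurable M"
    and Y: "\<And>n. (\<integral>\<^sup>+\<omega>. ennreal ((Y n \<omega>)\<^sup>2) \<partial>M) \<le> ennreal (v n)"
    and v: "summable v" "\<And>n. v n \<ge> 0"
  shows "AE \<omega> in M. (\<lambda>n. Y n \<omega>) \<longlonglongrightarrow> 0"
proof -
  have "(\<integral>\<^sup>+\<omega>. (\<Sum>n. ennreal ((Y n \<omega>)\<^sup>2)) \<partial>M) = (\<Sum>n. \<integral>\<^sup>+\<omega>. ennreal ((Y n \<omega>)\<^sup>2) \<partial>M)"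
    by (rule nn_integral_suminf) measurable
  also have "\<dots> \<le> (\<Sum>n. ennreal (v n))" using Y by (intro suminf_le) auto
  also have "\<dots> = ennreal (\<Sum>n. v n)" using v by (intro suminf_ennreal2) auto
  finally have "(\<integral>\<^sup>+\<omega>. (\<Sum>n. ennreal ((Y n \<omega>)\<^sup>2)) \<partial>M) \<noteq> \<infinity>" by (auto simp: top_unique)
  then have "AE \<omega> in M. (\<Sum>n. ennreal ((Y n \<omega>)\<^sup>2)) \<noteq> \<infinity>"
    by (intro nn_integral_PInf_AE) measurable
  then show ?thesis
  proof eventually_elim
    fix \<omega> assume "(\<Sum>n. ennreal ((Y n \<omega>)\<^sup>2)) \<noteq> \<infinity>"
    then have "summable (\<lambda>n. (Y n \<omega>)\<^sup>2)" by (intro summable_suminf_not_top) auto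
    then have "(\<lambda>n. (Y n \<omega>)\<^sup>2) \<longlonglongrightarrow> 0" by (rule summable_LIMSEQ_zero)
    then show "(\<lambda>n. Y n \<omega>) \<longlonglongrightarrow> 0" using tendsto_real_sqrt[of "\<lambda>n. (Y n \<omega>)\<^sup>2" 0] by (simp add: tendsto_rabs_zero_iff)
  qed
qed

section \<open>Independent random signs on the primes\<close>

locale rademacher = prob_space M for M :: "'a measure" +
  fixes \<epsilon> :: "nat \<Rightarrow> 'a \<Rightarrow> real"
  assumes indep: "indep_vars (\<lambda>_. borel) \<epsilon> {p. prime p}"
    and half_pos: "\<And>p. prime p \<Longrightarrow> prob {\<omega> \<in> space M. \<epsilon> p \<omega> = 1} = 1/2"
    and half_neg: "\<And>p. prime p \<Longrightarrow> prob {\<omega> \<in> space M. \<epsilon> p \<omega> = -1} = 1/2"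
begin

lemma measurable_sign [measurable (raw)]: "prime p \<Longrightarrow> \<epsilon> p \<in> borel_measurable M"
  using indep unfolding indep_vars_def by auto

lemma AE_sign1:
  assumes p: "prime p"
  shows "AE \<omega> in M. \<epsilon> p \<omega> = 1 \<or> \<epsilon> p \<omega> = -1"
proof -
  note [measurable] = measurable_sign[OF p]
  have "prob ({\<omega> \<in> space M. \<epsilon> p \<omega> = 1} \<union> {\<omega> \<in> space M. \<epsilon> p \<omega> = -1}) = 1"
    using half_pos[OF p] half_neg[OF p] by (subst finite_measure_Union) auto
  then have "AE \<omega> in M. \<omega> \<in> {\<omega> \<in> space M. \<epsilon> p \<omega> = 1} \<union> {\<omega> \<in> space M. \<epsilon> p \<omega> = -1}"
    by (intro AE_prob_1)
  then show ?thesis by eventually_elim auto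
qed

lemma AE_sign: "AE \<omega> in M. \<forall>p. prime p \<longrightarrow> \<epsilon> p \<omega> = 1 \<or> \<epsilon> p \<omega> = -1"
  using AE_sign1 by (subst AE_all_countable) (auto simp: AE_impI)

lemma has_expectation_sign:
  fixes \<phi> :: "real \<Rightarrow> 'b :: {banach, second_countable_topology, real_normed_field}"
  assumes p: "prime p" and [measurable]: "\<phi> \<in> borel_measurable borel"
  shows "integrable M (\<lambda>\<omega>. \<phi> (\<epsilon> p \<omega>))" "expectation (\<lambda>\<omega>. \<phi> (\<epsilon> p \<omega>)) = (\<phi> 1 + \<phi> (-1)) / 2"
proof -
  note [measurable] = measurable_sign[OF p]
  let ?A = "{\<omega> \<in> space M. \<epsilon> p \<omega> = 1}" and ?B = "{\<omega> \<in> space M. \<epsilon> p \<omega> = -1}"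
  let ?f = "\<lambda>\<omega>. indicat_real ?A \<omega> *\<^sub>R \<phi> 1 + indicat_real ?B \<omega> *\<^sub>R \<phi> (-1)"
  have ae: "AE \<omega> in M. \<phi> (\<epsilon> p \<omega>) = ?f \<omega>"
    using AE_sign1[OF p] AE_space by eventually_elim (auto simp: indicator_def)
  have int: "has_bochner_integral M ?f (prob ?A *\<^sub>R \<phi> 1 + prob ?B *\<^sub>R \<phi> (-1))"
    by (intro has_bochner_integral_add has_bochner_integral_scaleR_left has_bochner_integral_real_indicator)
       (auto simp: emeasure_eq_measure)
  have "has_bochner_integral M (\<lambda>\<omega>. \<phi> (\<epsilon> p \<omega>)) (prob ?A *\<^sub>R \<phi> 1 + prob ?B *\<^sub>R \<phi> (-1))"
    using int by (subst has_bochner_integral_cong_AE[OF _ _ ae]) auto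
  then show "integrable M (\<lambda>\<omega>. \<phi> (\<epsilon> p \<omega>))" "expectation (\<lambda>\<omega>. \<phi> (\<epsilon> p \<omega>)) = (\<phi> 1 + \<phi> (-1)) / 2"
    by (auto simp: has_bochner_integral_iff half_pos[OF p] half_neg[OF p] scaleR_conv_of_real add_divide_distrib)
qed

lemma expectation_prod_sign:
  fixes \<phi> :: "nat \<Rightarrow> real \<Rightarrow> 'b :: {banach, second_countable_topology, real_normed_field}"
  assumes I: "finite I" "\<And>p. p \<in> I \<Longrightarrow> prime p" and [measurable]: "\<And>p. \<phi> p \<in> borel_measurable borel"
  shows "integrable M (\<lambda>\<omega>. \<Prod>p\<in>I. \<phi> p (\<epsilon> p \<omega>))"
    "expectation (\<lambda>\<omega>. \<Prod>p\<in>I. \<phi> p (\<epsilon> p \<omega>)) = (\<Prod>p\<in>I. (\<phi> p 1 + \<phi> p (-1)) / 2)"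
proof -
  have ind: "indep_vars (\<lambda>_. borel) (\<lambda>p \<omega>. \<phi> p (\<epsilon> p \<omega>)) I"
    by (rule indep_vars_compose2[OF indep_vars_subset[OF indep]]) (use I in auto)
  show "integrable M (\<lambda>\<omega>. \<Prod>p\<in>I. \<phi> p (\<epsilon> p \<omega>))"
    by (rule indep_vars_integrable[OF I(1) ind]) (use I in \<open>auto intro!: has_expectation_sign(1)\<close>)
  have "expectation (\<lambda>\<omega>. \<Prod>p\<in>I. \<phi> p (\<epsilon> p \<omega>)) = (\<Prod>p\<in>I. expectation (\<lambda>\<omega>. \<phi> p (\<epsilon> p \<omega>)))"
    by (rule indep_vars_lebesgue_integral[OF I(1) ind]) (use I in \<open>auto intro!: has_expectation_sign(1)\<close>)
  also have "\<dots> = (\<Prod>p\<in>I. (\<phi> p 1 + \<phi> p (-1)) / 2)"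
    by (intro prod.cong refl has_expectation_sign(2)) (use I in auto)
  finally show "expectation (\<lambda>\<omega>. \<Prod>p\<in>I. \<phi> p (\<epsilon> p \<omega>)) = (\<Prod>p\<in>I. (\<phi> p 1 + \<phi> p (-1)) / 2)" .
qed

definition rsum :: "nat set \<Rightarrow> (nat \<Rightarrow> real) \<Rightarrow> 'a \<Rightarrow> real" where
  "rsum I a \<omega> = (\<Sum>p\<in>I. a p * \<epsilon> p \<omega>)"

lemma measurable_rsum [measurable (raw)]:
  "(\<And>p. p \<in> I \<Longrightarrow> prime p) \<Longrightarrow> rsum I a \<in> borel_measurable M"
  unfolding rsum_def by (intro borel_measurable_sum) auto

lemma mgf_rsum:
  assumes I: "finite I" "\<And>p. p \<in> I \<Longrightarrow> prime p"
  shows "integrable M (\<lambda>\<omega>. exp (l * rsum I a \<omega>))"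
    "expectation (\<lambda>\<omega>. exp (l * rsum I a \<omega>)) = (\<Prod>p\<in>I. cosh (l * a p))"
proof -
  have eq: "exp (l * rsum I a \<omega>) = (\<Prod>p\<in>I. exp (l * a p * \<epsilon> p \<omega>))" for \<omega>
    using I(1) by (simp add: rsum_def sum_distrib_left exp_sum mult.assoc)
  show "integrable M (\<lambda>\<omega>. exp (l * rsum I a \<omega>))"
    unfolding eq by (rule expectation_prod_sign(1)[of I "\<lambda>p x. exp (l * a p * x)"]) (use I in auto)
  show "expectation (\<lambda>\<omega>. exp (l * rsum I a \<omega>)) = (\<Prod>p\<in>I. cosh (l * a p))"
    unfolding eq by (subst expectation_prod_sign(2)[of I "\<lambda>p x. exp (l * a p * x)"])
      (use I in \<open>auto simp: cosh_def\<close>)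
qed

lemma subgaussian_rsum:
  assumes I: "finite I" "\<And>p. p \<in> I \<Longrightarrow> prime p" and v: "(\<Sum>p\<in>I. (a p)\<^sup>2) \<le> v"
  shows "subgaussian M v (rsum I a)"
  unfolding subgaussian_def
proof (intro conjI allI)
  fix l
  have "(\<Prod>p\<in>I. cosh (l * a p)) \<le> (\<Prod>p\<in>I. exp ((l * a p)\<^sup>2 / 2))"
    by (intro prod_mono conjI cosh_le_exp_half_sq) (auto intro: cosh_real_nonneg)
  also have "\<dots> = exp (l\<^sup>2 * (\<Sum>p\<in>I. (a p)\<^sup>2) / 2)"
    using I(1) by (simp add: power_mult_distrib sum_distrib_left sum_divide_distrib flip: exp_sum)
  also have "\<dots> \<le> exp (l\<^sup>2 * v / 2)" using v by (simp add: mult_left_mono)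
  finally have "expectation (\<lambda>\<omega>. exp (l * rsum I a \<omega>)) \<le> exp (l\<^sup>2 * v / 2)"
    using mgf_rsum(2)[OF I] by simp
  then show "(\<integral>\<^sup>+\<omega>. ennreal (exp (l * rsum I a \<omega>)) \<partial>M) \<le> ennreal (exp (l\<^sup>2 * v / 2))"
    by (subst nn_integral_eq_integral[OF mgf_rsum(1)[OF I]]) (auto intro: ennreal_leI)
qed (use I in measurable)

end

section \<open>Almost sure convergence of random Dirichlet series\<close>

lemma nn_integral_sum_ennreal:
  fixes f :: "'i \<Rightarrow> 'a \<Rightarrow> real"
  assumes "\<And>i. i \<in> A \<Longrightarrow> f i \<in> borel_measurable M" "\<And>i x. i \<in> A \<Longrightarrow> f i x \<ge> 0"
  shows "(\<integral>\<^sup>+x. ennreal (\<Sum>i\<in>A. f i x) \<partial>M) = (\<Sum>i\<in>A. \<integral>\<^sup>+x. ennreal (f i x) \<partial>M)"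
proof -
  have "(\<integral>\<^sup>+x. ennreal (\<Sum>i\<in>A. f i x) \<partial>M) = (\<integral>\<^sup>+x. (\<Sum>i\<in>A. ennreal (f i x)) \<partial>M)"
    using assms by (intro nn_integral_cong sum_ennreal[symmetric]) auto
  also have "\<dots> = (\<Sum>i\<in>A. \<integral>\<^sup>+x. ennreal (f i x) \<partial>M)"
    using assms by (intro nn_integral_sum) auto
  finally show ?thesis .
qed

lemma summable_Suc_times_exp:
  fixes \<delta> :: real
  assumes d: "\<delta> > 0"
  shows "summable (\<lambda>J. real (Suc J) * 2 powr (- (\<delta> * real J)))"
proof (rule summable_comparison_test_bigo)
  have "summable (\<lambda>J. real J powr (-2))" by (simp only: summable_real_powr_iff)
  moreover have "norm (real J powr (-2)) = real J powr (-2)" for J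
    by (simp only: real_norm_def abs_of_nonneg powr_ge_zero)
  ultimately show "summable (\<lambda>J. norm (real J powr (-2)))" by (simp only:)
  show "(\<lambda>J. real (Suc J) * 2 powr (- (\<delta> * real J))) \<in> O(\<lambda>J. real J powr (-2))" using d by real_asymp
qed

context rademacher
begin

text \<open>The set \<open>S\<close> selects a subseries: all integers give the random Dirichlet series itself, the primes give
  \<open>\<Sum>p. \<epsilon> p / p powr r\<close>.\<close>

definition sign_coeff :: "nat \<Rightarrow> nat set \<Rightarrow> nat \<Rightarrow> 'a \<Rightarrow> real" where
  "sign_coeff k S n \<omega> = of_bool (n \<in> S) * kfree_mult k (\<lambda>p. \<epsilon> p \<omega>) n"

lemma measurable_kfree_mult [measurable]: "(\<lambda>\<omega>. kfree_mult k (\<lambda>p. \<epsilon> p \<omega>) n) \<in> borel_measurable M"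
  unfolding kfree_mult_def
  by (cases "kfree k n") (auto intro!: borel_measurable_prod borel_measurable_power measurable_sign)

lemma measurable_sign_coeff [measurable]: "sign_coeff k S n \<in> borel_measurable M"
  unfolding sign_coeff_def by measurable

lemma sign_coeff_mult:
  assumes nm: "n > 0" "m > 0"
  shows "sign_coeff k S n \<omega> * sign_coeff k S m \<omega> =
    of_bool (n \<in> S \<and> m \<in> S \<and> kfree k n \<and> kfree k m) * (\<Prod>p\<in>prime_factors (n * m). \<epsilon> p \<omega> ^ multiplicity p (n * m))"
proof -
  let ?A = "prime_factors (n * m)"
  have A: "?A = prime_factors n \<union> prime_factors m" using nm by (simp add: prime_factors_product)
  have ext: "(\<Prod>p\<in>prime_factors l. \<epsilon> p \<omega> ^ multiplicity p l) = (\<Prod>p\<in>?A. \<epsilon> p \<omega> ^ multiplicity p l)"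
    if "l \<in> {n, m}" for l
  proof (rule prod.mono_neutral_left)
    show "prime_factors l \<subseteq> ?A" using that A by auto
    have "multiplicity p l = 0" if "p \<in> ?A - prime_factors l" for p
      using that by (simp add: prime_factors_multiplicity)
    then show "\<forall>p\<in>?A - prime_factors l. \<epsilon> p \<omega> ^ multiplicity p l = 1" by simp
  qed simp
  have "(\<Prod>p\<in>?A. \<epsilon> p \<omega> ^ multiplicity p n) * (\<Prod>p\<in>?A. \<epsilon> p \<omega> ^ multiplicity p m)
       = (\<Prod>p\<in>?A. \<epsilon> p \<omega> ^ multiplicity p (n * m))"
    unfolding prod.distrib[symmetric]
    by (intro prod.cong refl) (use nm in \<open>auto simp: prime_elem_multiplicity_mult_distrib power_add in_prime_factors_iff\<close>)
  then show ?thesis by (auto simp: sign_coeff_def kfree_mult_def ext)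
qed

text \<open>The mean factors over the primes, and an odd exponent in \<open>n * m\<close> produces a factor \<open>0\<close>.\<close>

lemma expectation_sign_coeff_mult:
  assumes nm: "n > 0" "m > 0"
  shows "integrable M (\<lambda>\<omega>. sign_coeff k S n \<omega> * sign_coeff k S m \<omega>)"
    "expectation (\<lambda>\<omega>. sign_coeff k S n \<omega> * sign_coeff k S m \<omega>) \<le> of_bool (is_nth_power 2 (n * m))"
proof -
  let ?A = "prime_factors (n * m)" and ?e = "\<lambda>p. multiplicity p (n * m)"
  have A: "finite ?A" "\<And>p. p \<in> ?A \<Longrightarrow> prime p" by auto
  have int: "integrable M (\<lambda>\<omega>. \<Prod>p\<in>?A. \<epsilon> p \<omega> ^ ?e p)"
    by (rule expectation_prod_sign(1)[OF A, of "\<lambda>p x. x ^ ?e p"]) auto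
  have E: "expectation (\<lambda>\<omega>. \<Prod>p\<in>?A. \<epsilon> p \<omega> ^ ?e p) = (\<Prod>p\<in>?A. (1 + (-1) ^ ?e p) / 2 :: real)"
    by (subst expectation_prod_sign(2)[OF A, of "\<lambda>p x. x ^ ?e p"]) auto
  have le: "(\<Prod>p\<in>?A. (1 + (-1) ^ ?e p) / 2 :: real) \<le> of_bool (is_nth_power 2 (n * m))"
  proof (cases "is_nth_power 2 (n * m)")
    case True
    have "(\<Prod>p\<in>?A. (1 + (-1) ^ ?e p) / 2 :: real) \<le> (\<Prod>p\<in>?A. 1)"
      by (intro prod_mono) (auto simp: minus_one_power_iff)
    then show ?thesis using True by simp
  next
    case False
    then obtain p where p: "prime p" "odd (?e p)"
      using is_nth_power_conv_multiplicity_nat[of 2 "n * m"] by auto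
    then have "p \<in> ?A" by (auto simp: prime_factors_multiplicity intro: odd_pos)
    then have z: "(\<Prod>p\<in>?A. (1 + (-1) ^ ?e p) / 2 :: real) = 0"
      using p by (intro prod_zero) (auto intro!: bexI[of _ p])
    show ?thesis unfolding z by simp
  qed
  have nn: "(\<Prod>p\<in>?A. (1 + (-1) ^ ?e p) / 2 :: real) \<ge> 0"
    by (intro prod_nonneg) (auto simp: minus_one_power_iff)
  show "integrable M (\<lambda>\<omega>. sign_coeff k S n \<omega> * sign_coeff k S m \<omega>)"
    unfolding sign_coeff_mult[OF nm] using int by simp
  show "expectation (\<lambda>\<omega>. sign_coeff k S n \<omega> * sign_coeff k S m \<omega>) \<le> of_bool (is_nth_power 2 (n * m))"
  proof -
    have "expectation (\<lambda>\<omega>. sign_coeff k S n \<omega> * sign_coeff k S m \<omega>)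
        = of_bool (n \<in> S \<and> m \<in> S \<and> kfree k n \<and> kfree k m) * (\<Prod>p\<in>?A. (1 + (-1) ^ ?e p) / 2)"
      unfolding sign_coeff_mult[OF nm] integral_mult_right_zero E ..
    also have "\<dots> \<le> 1 * (\<Prod>p\<in>?A. (1 + (-1) ^ ?e p) / 2)"
      using nn by (intro mult_right_mono) auto
    also have "\<dots> \<le> of_bool (is_nth_power 2 (n * m))" unfolding mult_1 by (rule le)
    finally show ?thesis .
  qed
qed

lemma sign_coeff_second_moment:
  assumes I: "finite I" "0 \<notin> I" and w: "\<And>n. w n \<ge> 0"
  shows "(\<integral>\<^sup>+\<omega>. ennreal ((\<Sum>n\<in>I. sign_coeff k S n \<omega> * w n)\<^sup>2) \<partial>M)
           \<le> ennreal (\<Sum>n\<in>I. \<Sum>m\<in>I. of_bool (is_nth_power 2 (n * m)) * (w n * w m))"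
proof -
  let ?a = "sign_coeff k S"
  have I0: "n > 0" if "n \<in> I" for n using I that by (auto intro: Nat.gr0I)
  have eq: "(\<Sum>n\<in>I. ?a n \<omega> * w n)\<^sup>2 = (\<Sum>n\<in>I. \<Sum>m\<in>I. ?a n \<omega> * ?a m \<omega> * (w n * w m))" for \<omega>
    by (simp add: power2_eq_square sum_product mult_ac)
  have int: "integrable M (\<lambda>\<omega>. \<Sum>n\<in>I. \<Sum>m\<in>I. ?a n \<omega> * ?a m \<omega> * (w n * w m))"
    using I0 by (intro Bochner_Integration.integrable_sum integrable_mult_left expectation_sign_coeff_mult) auto
  have "expectation (\<lambda>\<omega>. \<Sum>n\<in>I. \<Sum>m\<in>I. ?a n \<omega> * ?a m \<omega> * (w n * w m))
     = (\<Sum>n\<in>I. \<Sum>m\<in>I. expectation (\<lambda>\<omega>. ?a n \<omega> * ?a m \<omega>) * (w n * w m))"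
    using I0 by (simp add: Bochner_Integration.integral_sum expectation_sign_coeff_mult Bochner_Integration.integrable_sum)
  also have "\<dots> \<le> (\<Sum>n\<in>I. \<Sum>m\<in>I. of_bool (is_nth_power 2 (n * m)) * (w n * w m))"
    using I0 w by (intro sum_mono mult_right_mono expectation_sign_coeff_mult) auto
  finally show ?thesis
    unfolding eq by (subst nn_integral_eq_integral[OF int])
      (auto simp: eq[symmetric] intro!: ennreal_leI)
qed

text \<open>A maximal inequality of Rademacher-Menshov type on each dyadic block \<open>{2 ^ J..<2 ^ Suc J}\<close>. At each of the \<open>J + 1\<close> scales
  the block is cut into equal pieces; since the coefficients of the second moment are nonnegative,
  the second moments of the pieces add up to at most that of the block, which decays geometrically in \<open>J\<close>. Any partial sum within
  the block is reached by one piece per scale.\<close>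

lemma AE_dirichlet_summable_at:
  assumes r: "r > 1/2"
  shows "AE \<omega> in M. summable (\<lambda>n. sign_coeff k S (Suc n) \<omega> / real (Suc n) powr r)"
proof -
  let ?a = "sign_coeff k S"
  (* Half of the room above 1/2 is kept for convergence, the other half becomes decay in J. *)
  define \<delta> where "\<delta> = (r - 1/2) / 2"
  have \<delta>: "\<delta> > 0" "r - \<delta> > 1/2" using r by (auto simp: \<delta>_def field_simps)
  define C where "C = (zeta (2 * (r - \<delta>))) ^ 3"
  define w where "w n = real n powr (- r)" for n
  define c where "c n m = of_bool (is_nth_power 2 (n * m)) * (w n * w m)" for n m :: nat
  have c0: "c n m \<ge> 0" for n m by (simp add: c_def w_def)
  have "zeta (2 * (r - \<delta>)) > 0"
    using \<delta> by (intro zeta_pos) auto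
  then have C0: "C > 0" by (simp add: C_def)
  define P where "P y \<omega> = (\<Sum>n\<in>{1..<y}. ?a n \<omega> * w n)" for y \<omega>
  have [measurable]: "P y \<in> borel_measurable M" for y unfolding P_def by measurable
  (* The sum over piece q of block J at scale i, which has 2 ^ (J - i) terms. *)
  define inc where "inc J i q \<omega> = P (2 ^ J + Suc q * 2 ^ (J - i)) \<omega> - P (2 ^ J + q * 2 ^ (J - i)) \<omega>" for J i q \<omega>
  have [measurable]: "inc J i q \<in> borel_measurable M" for J i q unfolding inc_def by measurable
  define D where "D J \<omega> = (\<Sum>i\<le>J. \<Sum>q<2^i. (inc J i q \<omega>)\<^sup>2)" for J \<omega>
  have [measurable]: "D J \<in> borel_measurable M" for J unfolding D_def by measurable
  have D0: "D J \<omega> \<ge> 0" for J \<omega> by (auto simp: D_def intro!: sum_nonneg)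
  have level: "(\<integral>\<^sup>+\<omega>. ennreal (\<Sum>q<2^i. (inc J i q \<omega>)\<^sup>2) \<partial>M) \<le> ennreal (C * 2 powr (- (2 * \<delta> * real J)))"
    if iJ: "i \<le> J" for i J
  proof -
    define L where "L = (2::nat) ^ (J - i)"
    have L: "2 ^ i * L = 2 ^ J" using iJ by (simp add: L_def flip: power_add)
    let ?b = "\<lambda>q. {2 ^ J + q * L..<2 ^ J + q * L + L}"
    let ?I = "{2 ^ J..<2 ^ J + 2 ^ J}"
    have bI: "?b q \<subseteq> ?I" if "q < 2 ^ i" for q
    proof -
      have "Suc q * L \<le> 2 ^ i * L" using that by (intro mult_right_mono) auto
      then show ?thesis using L by auto
    qed
    have inc: "inc J i q \<omega> = (\<Sum>n\<in>?b q. ?a n \<omega> * w n)" for q \<omega>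
    proof -
      have "{1..<2 ^ J + Suc q * L} = {1..<2 ^ J + q * L} \<union> ?b q"
      proof -
        have "x > 0" if "2 ^ J + q * L \<le> x" for x :: nat
          using that zero_less_power[of "2::nat" J] by linarith
        then show ?thesis by (auto simp: Suc_le_eq)
      qed
      moreover have "sum f ({1..<2 ^ J + q * L} \<union> ?b q) = sum f {1..<2 ^ J + q * L} + sum f (?b q)" for f :: "nat \<Rightarrow> real"
        by (rule sum.union_disjoint) auto
      ultimately show ?thesis by (simp add: inc_def P_def flip: L_def)
    qed
    have "(\<integral>\<^sup>+\<omega>. ennreal (\<Sum>q<2^i. (inc J i q \<omega>)\<^sup>2) \<partial>M) = (\<Sum>q<2^i. \<integral>\<^sup>+\<omega>. ennreal ((inc J i q \<omega>)\<^sup>2) \<partial>M)"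
      by (rule nn_integral_sum_ennreal) auto
    also have "\<dots> \<le> (\<Sum>q<2^i. ennreal (\<Sum>n\<in>?b q. \<Sum>m\<in>?b q. c n m))"
      unfolding inc c_def by (intro sum_mono sign_coeff_second_moment) (auto simp: w_def)
    also have "\<dots> = ennreal (\<Sum>q<2^i. \<Sum>n\<in>?b q. \<Sum>m\<in>?b q. c n m)"
      using c0 by (intro sum_ennreal) (auto intro!: sum_nonneg)
    also have "\<dots> \<le> ennreal (\<Sum>n\<in>?I. \<Sum>m\<in>?I. c n m)"
    proof (rule ennreal_leI)
      have "(\<Sum>q<2^i. \<Sum>n\<in>?b q. \<Sum>m\<in>?b q. c n m) \<le> (\<Sum>q<2^i. \<Sum>n\<in>?b q. \<Sum>m\<in>?I. c n m)"
        using bI c0 by (intro sum_mono sum_mono2) auto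
      also have "\<dots> = (\<Sum>q<2^i. \<Sum>n\<in>{q * L..<q * L + L}. \<Sum>m\<in>?I. c (2 ^ J + n) m)"
        by (intro sum.cong refl sum.reindex_bij_witness[of _ "\<lambda>n. 2 ^ J + n" "\<lambda>n. n - 2 ^ J"]) auto
      also have "\<dots> = (\<Sum>n<2^i * L. \<Sum>m\<in>?I. c (2 ^ J + n) m)" by (rule sum.nat_group)
      also have "\<dots> = (\<Sum>n\<in>?I. \<Sum>m\<in>?I. c n m)"
        unfolding L by (rule sum.reindex_bij_witness[of _ "\<lambda>n. n - 2 ^ J" "\<lambda>n. 2 ^ J + n"]) auto
      finally show "(\<Sum>q<2^i. \<Sum>n\<in>?b q. \<Sum>m\<in>?b q. c n m) \<le> (\<Sum>n\<in>?I. \<Sum>m\<in>?I. c n m)" .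
    qed
    also have "\<dots> \<le> ennreal (C * 2 powr (- (2 * \<delta> * real J)))"
    proof (rule ennreal_leI)
      have "(\<Sum>n\<in>?I. \<Sum>m\<in>?I. c n m) =
         (\<Sum>n\<in>?I. \<Sum>m\<in>?I. of_bool (is_nth_power 2 (n * m)) * (real n * real m) powr (- r))"
        by (simp add: c_def w_def powr_mult)
      also have "\<dots> \<le> real (2 ^ J) powr (- (2 * \<delta>)) * C"
        unfolding C_def using \<delta> by (intro sum_square_pairs_tail) auto
      also have "real (2 ^ J) powr (- (2 * \<delta>)) = 2 powr (- (2 * \<delta> * real J))"
        by (simp add: powr_realpow[symmetric] powr_powr mult_ac)
      finally show "(\<Sum>n\<in>?I. \<Sum>m\<in>?I. c n m) \<le> C * 2 powr (- (2 * \<delta> * real J))" by (simp add: mult.commute)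
    qed
    finally show ?thesis .
  qed
  have ED: "(\<integral>\<^sup>+\<omega>. ennreal (D J \<omega>) \<partial>M) \<le> ennreal (real (Suc J) * (C * 2 powr (- (2 * \<delta> * real J))))" for J
  proof -
    have "(\<integral>\<^sup>+\<omega>. ennreal (D J \<omega>) \<partial>M) = (\<Sum>i\<le>J. \<integral>\<^sup>+\<omega>. ennreal (\<Sum>q<2^i. (inc J i q \<omega>)\<^sup>2) \<partial>M)"
      unfolding D_def by (rule nn_integral_sum_ennreal) (auto intro!: sum_nonneg)
    also have "\<dots> \<le> (\<Sum>i\<le>J. ennreal (C * 2 powr (- (2 * \<delta> * real J))))"
      by (intro sum_mono level) auto
    also have "\<dots> = ennreal (real (Suc J) * (C * 2 powr (- (2 * \<delta> * real J))))"
      by (subst sum_ennreal) (use C0 in \<open>auto simp del: of_nat_Suc\<close>)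
    finally show ?thesis .
  qed
  (* D J has mean of order J 2^(-2 delta J); half of the decay rate is spent on showing
     that Y J tends to 0, and the rest bounds every increment by d J below. *)
  define Y where "Y J \<omega> = 2 powr (\<delta> * real J / 2) * sqrt (D J \<omega>)" for J \<omega>
  have Y2: "(Y J \<omega>)\<^sup>2 = 2 powr (\<delta> * real J) * D J \<omega>" for J \<omega>
    using D0 by (simp add: Y_def power_mult_distrib powr_power)
  have "AE \<omega> in M. (\<lambda>J. Y J \<omega>) \<longlonglongrightarrow> 0"
  proof (rule AE_tendsto_zero_second_moment)
    show "Y J \<in> borel_measurable M" for J unfolding Y_def by measurable
    show "(\<integral>\<^sup>+\<omega>. ennreal ((Y J \<omega>)\<^sup>2) \<partial>M) \<le> ennreal (C * (real (Suc J) * 2 powr (- \<delta> * real J)))" for J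
    proof -
      have "(\<integral>\<^sup>+\<omega>. ennreal ((Y J \<omega>)\<^sup>2) \<partial>M) = ennreal (2 powr (\<delta> * real J)) * (\<integral>\<^sup>+\<omega>. ennreal (D J \<omega>) \<partial>M)"
        unfolding Y2 by (subst nn_integral_cmult[symmetric]) (auto simp: ennreal_mult D0)
      also have "\<dots> \<le> ennreal (2 powr (\<delta> * real J)) * ennreal (real (Suc J) * (C * 2 powr (- (2 * \<delta> * real J))))"
        by (intro mult_left_mono ED) auto
      also have "\<dots> = ennreal (C * (real (Suc J) * 2 powr (- \<delta> * real J)))"
      proof -
        have e: "\<delta> * real J + - (2 * \<delta> * real J) = - \<delta> * real J" by simp
        have p: "2 powr (\<delta> * real J) * 2 powr (- (2 * \<delta> * real J)) = 2 powr (- \<delta> * real J)"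
          by (subst powr_add[symmetric], subst e, rule refl)
        have gen: "a * (u * (v * b)) = v * (u * (a * b))" for a b u v :: real by simp
        have "2 powr (\<delta> * real J) * (real (Suc J) * (C * 2 powr (- (2 * \<delta> * real J)))) = C * (real (Suc J) * 2 powr (- \<delta> * real J))"
          by (subst gen, subst p, rule refl)
        then show ?thesis by (subst ennreal_mult'[symmetric]) (rule powr_ge_zero, rule arg_cong)
      qed
      finally show ?thesis .
    qed
    show "summable (\<lambda>J. C * (real (Suc J) * 2 powr (- \<delta> * real J)))"
      using summable_mult[OF summable_Suc_times_exp[OF \<delta>(1)]] by simp
  qed (use C0 in auto)
  then show ?thesis
  proof eventually_elim
    fix \<omega> assume Y: "(\<lambda>J. Y J \<omega>) \<longlonglongrightarrow> 0"
    define d where "d J = 2 powr (- (\<delta> * real J / 2))" for J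
    have "\<forall>\<^sub>F J in sequentially. Y J \<omega> < 1" using order_tendstoD(2)[OF Y] by simp
    then obtain J0 where J0: "\<And>J. J \<ge> J0 \<Longrightarrow> Y J \<omega> < 1" by (auto simp: eventually_sequentially)
    have incd: "\<bar>inc J i q \<omega>\<bar> \<le> d J" if J: "J \<ge> J0" and iq: "i \<le> J" "q < 2 ^ i" for J i q
    proof -
      have "(inc J i q \<omega>)\<^sup>2 \<le> (\<Sum>q<2^i. (inc J i q \<omega>)\<^sup>2)"
        using iq by (intro member_le_sum) auto
      also have "\<dots> \<le> D J \<omega>" unfolding D_def
        using iq by (intro member_le_sum[of i "{..J}" "\<lambda>i. \<Sum>q<2^i. (inc J i q \<omega>)\<^sup>2"]) (auto intro!: sum_nonneg)
      finally have "\<bar>inc J i q \<omega>\<bar> \<le> sqrt (D J \<omega>)" by (simp add: real_le_rsqrt)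
      also have "\<dots> = d J * Y J \<omega>" by (simp add: d_def Y_def mult.assoc[symmetric] flip: powr_add)
      also have "\<dots> \<le> d J * 1" using J0[OF J] by (intro mult_left_mono) (auto simp: d_def)
      finally show ?thesis by simp
    qed
    have "convergent (\<lambda>y. P y \<omega>)"
    proof (rule convergent_of_dyadic_blocks)
      show "summable (\<lambda>J. real (Suc J) * d J)"
        using summable_Suc_times_exp[of "\<delta> / 2"] \<delta>(1) by (simp add: d_def)
      fix J y :: nat assume J: "J0 \<le> J" and y: "2 ^ J \<le> y" "y \<le> 2 ^ Suc J"
      show "\<bar>P y \<omega> - P (2 ^ J) \<omega>\<bar> \<le> real (Suc J) * d J"
      proof (cases "y = 2 ^ Suc J")
        case True
        then have "P y \<omega> - P (2 ^ J) \<omega> = inc J 0 0 \<omega>" by (simp add: inc_def mult_2)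
        moreover have "d J \<ge> 0" "real J * d J \<ge> 0" by (auto simp: d_def)
        moreover have "real (Suc J) * d J = d J + real J * d J" by (simp add: algebra_simps)
        moreover have "\<bar>inc J 0 0 \<omega>\<bar> \<le> d J" using incd[OF J, of 0 0] by simp
        ultimately show ?thesis by linarith
      next
        case False
        (* Partial sums along block J, with the block rescaled to the unit interval. *)
        define x where "x t = P (nat \<lfloor>2 ^ J * (1 + t)\<rfloor>) \<omega>" for t :: real
        have x: "x (real j / 2 ^ i) = P (2 ^ J + j * 2 ^ (J - i)) \<omega>" if "i \<le> J" for i j
        proof -
          have "2 ^ J * (1 + real j / 2 ^ i) = real (2 ^ J + j * 2 ^ (J - i))"
          proof -
            have e: "(2::real) ^ J = 2 ^ (J - i) * 2 ^ i" using that by (simp flip: power_add)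
            show ?thesis by (simp add: distrib_left) (simp add: e)
          qed
          then show ?thesis unfolding x_def by (simp only: floor_of_nat nat_int)
        qed
        define t where "t = real (y - 2 ^ J) / 2 ^ J"
        have "y < 2 * 2 ^ J" using y False by auto
        then have "real y < real (2 * 2 ^ J)" by (simp only: of_nat_less_iff)
        then have t: "0 \<le> t" "t < real 1" using y by (auto simp: t_def of_nat_diff)
        have "\<bar>x (dyadic_floor J t) - x (dyadic_floor 0 t)\<bar> \<le> (\<Sum>i\<in>{0<..J}. d J)"
        proof (rule dyadic_chain[where T = 1])
          fix i j :: nat assume ij: "0 < i" "i \<le> J" "j < 1 * 2 ^ i"
          then have "x (real (Suc j) / 2 ^ i) - x (real j / 2 ^ i) = inc J i j \<omega>"
            by (subst (1 2) x) (auto simp: inc_def)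
          then show "\<bar>x (real (Suc j) / 2 ^ i) - x (real j / 2 ^ i)\<bar> \<le> d J"
            using incd[OF J, of i j] ij by simp
        qed (use t in auto)
        moreover have "dyadic_floor J t = real (y - 2 ^ J) / 2 ^ J" by (simp add: t_def)
        moreover have "\<lfloor>t\<rfloor> = 0" using t by (simp add: floor_eq_iff)
        ultimately have "\<bar>P y \<omega> - P (2 ^ J) \<omega>\<bar> \<le> real J * d J"
          using x[of J "y - 2 ^ J"] x[of 0 0] y by simp
        moreover have "d J \<ge> 0" by (auto simp: d_def)
        moreover have "real (Suc J) * d J = d J + real J * d J" by (simp add: algebra_simps)
        ultimately show ?thesis by linarith
      qed
    qed
    then have "convergent (\<lambda>n. P (Suc n) \<omega>)" by (subst convergent_Suc_iff)
    moreover have "P (Suc n) \<omega> = (\<Sum>i<n. ?a (Suc i) \<omega> / real (Suc i) powr r)" for n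
    proof -
      have "P (Suc n) \<omega> = (\<Sum>i<n. ?a (Suc i) \<omega> * w (Suc i))"
        unfolding P_def by (rule sum.reindex_bij_witness[of _ Suc "\<lambda>n. n - 1"]) auto
      then show ?thesis by (simp add: w_def powr_minus field_simps)
    qed
    ultimately show "summable (\<lambda>n. ?a (Suc n) \<omega> / real (Suc n) powr r)"
      by (simp add: summable_iff_convergent)
  qed
qed

lemma AE_dirichlet_summable:
  "AE \<omega> in M. \<forall>r>1/2. summable (\<lambda>n. sign_coeff k S (Suc n) \<omega> / real (Suc n) powr r)"
proof -
  have "AE \<omega> in M. \<forall>j. summable (\<lambda>n. sign_coeff k S (Suc n) \<omega> / real (Suc n) powr (1/2 + inverse (real (Suc j))))"
    by (subst AE_all_countable, intro allI AE_dirichlet_summable_at) simp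
  then show ?thesis
  proof eventually_elim
    fix \<omega> assume sm: "\<forall>j. summable (\<lambda>n. sign_coeff k S (Suc n) \<omega> / real (Suc n) powr (1/2 + inverse (real (Suc j))))"
    show "\<forall>r>1/2. summable (\<lambda>n. sign_coeff k S (Suc n) \<omega> / real (Suc n) powr r)"
    proof (intro allI impI)
      fix r :: real assume "r > 1/2"
      then obtain j where "inverse (real (Suc j)) < r - 1/2" using reals_Archimedean[of "r - 1/2"] by auto
      then show "summable (\<lambda>n. sign_coeff k S (Suc n) \<omega> / real (Suc n) powr r)"
        by (intro dirichlet_summable_mono[OF sm[rule_format, of j]]) auto
    qed
  qed
qed

section \<open>The Euler product of the random multiplicative function\<close>

definition prime_series :: "'a \<Rightarrow> real \<Rightarrow> real" where
  "prime_series \<omega> h = dirichlet_sum (prime_part (\<lambda>p. \<epsilon> p \<omega>)) (1/2 + h)"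

definition ln_remainder :: "nat \<Rightarrow> 'a \<Rightarrow> nat \<Rightarrow> real \<Rightarrow> real" where
  "ln_remainder k \<omega> p h = (let x = \<epsilon> p \<omega> / real p powr (1/2 + h) in ln (euler_factor k x) - x - x\<^sup>2 / 2)"

definition remainder_series :: "nat \<Rightarrow> 'a \<Rightarrow> real \<Rightarrow> real" where
  "remainder_series k \<omega> h = (\<Sum>n. if prime (Suc n) then ln_remainder k \<omega> (Suc n) h else 0)"

text \<open>The pathwise properties from which everything about the series over the primes and about the Euler factors follows
  deterministically.\<close>

definition good_signs :: "'a \<Rightarrow> bool" where
  "good_signs \<omega> \<longleftrightarrow> (\<forall>p. prime p \<longrightarrow> \<epsilon> p \<omega> = 1 \<or> \<epsilon> p \<omega> = -1) \<and>
     (\<forall>r>1/2. summable (\<lambda>n. prime_part (\<lambda>p. \<epsilon> p \<omega>) (Suc n) / real (Suc n) powr r))"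

lemma sign_coeff_prime:
  assumes "k \<ge> 2"
  shows "sign_coeff k {p. prime p} n \<omega> = prime_part (\<lambda>p. \<epsilon> p \<omega>) n"
proof (cases "prime n")
  case True
  have "multiplicity p n \<le> 1" if p: "prime p" for p
  proof (cases "p = n")
    case True
    then have "multiplicity p n = 1" using p by (simp add: multiplicity_self not_prime_unit prime_gt_0_nat)
    then show ?thesis by simp
  next
    case False
    then have "multiplicity p n = 0" using p \<open>prime n\<close> by (simp add: prime_multiplicity_other)
    then show ?thesis by simp
  qed
  then have "multiplicity p n < k" if "prime p" for p
    by (rule le_less_trans) (use that assms in auto)
  then have "kfree k n"
    using assms prime_gt_0_nat[OF True] by (subst kfree_iff_multiplicity) auto
  then show ?thesis using True
    by (simp add: sign_coeff_def prime_part_def kfree_mult_def prime_factorization_prime)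
qed (simp add: sign_coeff_def prime_part_def)

lemma AE_good_signs: "AE \<omega> in M. good_signs \<omega>"
  using AE_sign AE_dirichlet_summable[of 2 "{p. prime p}"]
  by eventually_elim (simp add: good_signs_def sign_coeff_prime)

lemma measurable_prime_part [measurable]: "(\<lambda>\<omega>. prime_part (\<lambda>p. \<epsilon> p \<omega>) n) \<in> borel_measurable M"
  unfolding prime_part_def by (cases "prime n") auto

lemma measurable_prime_series [measurable]: "(\<lambda>\<omega>. prime_series \<omega> h) \<in> borel_measurable M"
  unfolding prime_series_def dirichlet_sum_def by measurable

lemma measurable_centred_log_sum [measurable]:
  "(\<lambda>\<omega>. centred_log_sum k (\<lambda>p. \<epsilon> p \<omega>) h) \<in> borel_measurable M"
  unfolding centred_log_sum_def dirichlet_sum_def by measurable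

lemma prime_series_tendsto:
  assumes "good_signs \<omega>" "h > 0"
  shows "(\<lambda>N. rsum (primes_le N) (prime_weight h) \<omega>) \<longlonglongrightarrow> prime_series \<omega> h"
proof -
  have "(\<lambda>N. \<Sum>n<N. prime_part (\<lambda>p. \<epsilon> p \<omega>) (Suc n) / real (Suc n) powr (1/2 + h)) \<longlonglongrightarrow> prime_series \<omega> h"
    unfolding prime_series_def dirichlet_sum_def
    using assms by (intro summable_LIMSEQ) (auto simp: good_signs_def)
  then show ?thesis
    by (subst (asm) sum_prime_part_divide) (simp add: rsum_def prime_weight_def)
qed

lemma continuous_on_prime_series:
  assumes "good_signs \<omega>"
  shows "continuous_on {0<..} (prime_series \<omega>)"
proof -
  have "continuous_on {1/2<..} (dirichlet_sum (prime_part (\<lambda>p. \<epsilon> p \<omega>)))"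
    by (rule continuous_on_dirichlet_sum_open) (use assms in \<open>auto simp: good_signs_def\<close>)
  then have "continuous_on {0<..} (\<lambda>h. dirichlet_sum (prime_part (\<lambda>p. \<epsilon> p \<omega>)) (1/2 + h))"
    by (rule continuous_on_compose2) (auto intro!: continuous_intros)
  then show ?thesis by (simp add: prime_series_def[abs_def])
qed

text \<open>The constant \<open>3/4\<close> exceeds \<open>1 / sqrt 2\<close>, the largest value, attained at \<open>p = 2\<close> and \<open>h = 0\<close>.\<close>

lemma sign_weight_bounds:
  assumes "good_signs \<omega>" "prime p" "h \<ge> 0"
  defines "x \<equiv> \<epsilon> p \<omega> / real p powr (1/2 + h)"
  shows "\<bar>x\<bar> \<le> 3/4" "\<bar>x\<bar> ^ 3 \<le> real p powr (- 3/2)" "x\<^sup>2 = 1 / real p powr (1 + 2 * h)"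
proof -
  have p: "real p \<ge> 2" using prime_ge_2_nat[OF assms(2)] by simp
  have e: "\<bar>\<epsilon> p \<omega>\<bar> = 1" using assms by (auto simp: good_signs_def)
  then have e2: "(\<epsilon> p \<omega>)\<^sup>2 = 1" by (metis one_power2 power2_abs)
  have x: "\<bar>x\<bar> = real p powr - (1/2 + h)" using e p by (simp add: x_def powr_minus abs_divide field_simps)
  also have le: "\<dots> \<le> real p powr - (1/2)" using p assms by (intro powr_mono) auto
  also have "\<dots> \<le> 2 powr - (1/2)" using p by (intro powr_mono2') auto
  also have "\<dots> \<le> 3/4"
  proof -
    have "1 / sqrt 2 \<le> 3/4" by (rule power2_le_imp_le) (auto simp: power2_eq_square field_simps)
    then show ?thesis by (simp add: powr_minus powr_half_sqrt inverse_eq_divide)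
  qed
  finally show "\<bar>x\<bar> \<le> 3/4" .
  have "\<bar>x\<bar> ^ 3 \<le> (real p powr - (1/2)) ^ 3" using le x by (intro power_mono) auto
  also have "\<dots> = real p powr (- 3/2)" using p by (simp add: powr_power)
  finally show "\<bar>x\<bar> ^ 3 \<le> real p powr (- 3/2)" .
  have "1/2 + h + (1/2 + h) = 1 + 2 * h" by simp
  then show "x\<^sup>2 = 1 / real p powr (1 + 2 * h)"
    using e2 by (simp only: x_def power_divide power2_eq_square[of "real p powr (1/2 + h)"] powr_add[symmetric])
qed

text \<open>The bound is summable and independent of \<open>h \<ge> 0\<close>, which makes the remainder series bounded and continuous.\<close>

lemma ln_remainder_bound:
  assumes "good_signs \<omega>" "prime p" "h \<ge> 0" "k \<ge> 3"
  shows "\<bar>ln_remainder k \<omega> p h\<bar> \<le> 8 * real p powr (- 3/2)"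
proof -
  let ?x = "\<epsilon> p \<omega> / real p powr (1/2 + h)"
  have "\<bar>ln_remainder k \<omega> p h\<bar> \<le> 8 * \<bar>?x\<bar> ^ 3"
    unfolding ln_remainder_def Let_def using assms by (intro ln_euler_factor sign_weight_bounds) auto
  also have "\<dots> \<le> 8 * real p powr (- 3/2)"
    using sign_weight_bounds(2)[OF assms(1-3)] by simp
  finally show ?thesis .
qed

lemma summable_three_halves: "summable (\<lambda>n. 8 * real (Suc n) powr (- 3/2))"
  using summable_mult[OF summable_powr_Suc[of "3/2"], of 8] by simp

lemma remainder_term_bound:
  assumes "good_signs \<omega>" "h \<ge> 0" "k \<ge> 3"
  shows "norm (if prime (Suc n) then ln_remainder k \<omega> (Suc n) h else 0) \<le> 8 * real (Suc n) powr (- 3/2)"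
  using ln_remainder_bound[OF assms(1) _ assms(2,3), of "Suc n"] by (simp del: of_nat_Suc)

lemma summable_remainder:
  assumes "good_signs \<omega>" "h \<ge> 0" "k \<ge> 3"
  shows "summable (\<lambda>n. if prime (Suc n) then ln_remainder k \<omega> (Suc n) h else 0)"
  by (rule summable_comparison_test'[OF summable_three_halves, of 0]) (rule remainder_term_bound[OF assms])

lemma remainder_series_bound:
  assumes "good_signs \<omega>" "h \<ge> 0" "k \<ge> 3"
  shows "\<bar>remainder_series k \<omega> h\<bar> \<le> 8 * zeta (3/2)"
proof -
  let ?f = "\<lambda>n. if prime (Suc n) then ln_remainder k \<omega> (Suc n) h else 0"
  have sn: "summable (\<lambda>n. norm (?f n))"
    by (rule summable_comparison_test'[OF summable_three_halves, of 0])
       (use remainder_term_bound[OF assms] in \<open>simp del: of_nat_Suc\<close>)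
  have "\<bar>remainder_series k \<omega> h\<bar> \<le> (\<Sum>n. norm (?f n))"
    using summable_norm[OF sn] by (simp add: remainder_series_def)
  also have "\<dots> \<le> (\<Sum>n. 8 * real (Suc n) powr (- 3/2))"
    by (rule suminf_le[OF remainder_term_bound[OF assms] sn summable_three_halves])
  also have "\<dots> = 8 * zeta (3/2)"
    unfolding zeta_def using summable_powr_Suc[of "3/2"] by (subst suminf_mult[symmetric]) auto
  finally show ?thesis .
qed

lemma continuous_on_remainder_series:
  assumes \<omega>: "good_signs \<omega>" and k: "k \<ge> 3"
  shows "continuous_on {0<..} (remainder_series k \<omega>)"
proof (rule uniform_limit_theorem)
  let ?f = "\<lambda>n h. if prime (Suc n) then ln_remainder k \<omega> (Suc n) h else 0"
  show "uniform_limit {0<..} (\<lambda>N h. \<Sum>n<N. ?f n h) (remainder_series k \<omega>) sequentially"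
    unfolding remainder_series_def[abs_def]
    by (rule Weierstrass_m_test[OF _ summable_three_halves]) (use remainder_term_bound[OF \<omega> _ k] in auto)
  have "continuous_on {0<..} (ln_remainder k \<omega> p)" if p: "prime p" for p
  proof -
    have "euler_factor k (\<epsilon> p \<omega> / real p powr (1/2 + h)) > 0" if "h > 0" for h
      using that sign_weight_bounds(1)[OF \<omega> p, of h] k by (intro euler_factor_pos) auto
    then show ?thesis
      unfolding ln_remainder_def[abs_def] Let_def euler_factor_def
      using prime_gt_0_nat[OF p] by (intro continuous_intros) force+
  qed
  then have "continuous_on {0<..} (?f n)" for n by (cases "prime (Suc n)") auto
  then show "\<forall>\<^sub>F N in sequentially. continuous_on {0<..} (\<lambda>h. \<Sum>n<N. ?f n h)"
    by (intro always_eventually allI continuous_on_sum)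
qed simp

definition ln_euler_product :: "nat \<Rightarrow> 'a \<Rightarrow> real \<Rightarrow> real" where
  "ln_euler_product k \<omega> h = prime_series \<omega> h + prime_zeta (1 + 2 * h) / 2 + remainder_series k \<omega> h"

lemma ln_euler_product_tendsto:
  assumes \<omega>: "good_signs \<omega>" and h: "h > 0" and k: "k \<ge> 3"
  shows "(\<lambda>N. \<Prod>p\<in>primes_le N. euler_factor k (\<epsilon> p \<omega> / real p powr (1/2 + h))) \<longlonglongrightarrow> exp (ln_euler_product k \<omega> h)"
proof -
  let ?x = "\<lambda>p. \<epsilon> p \<omega> / real p powr (1/2 + h)"
  have R: "(\<lambda>N. \<Sum>p\<in>primes_le N. ln_remainder k \<omega> p h) \<longlonglongrightarrow> remainder_series k \<omega> h"
  proof -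
    have "(\<lambda>N. \<Sum>n<N. if prime (Suc n) then ln_remainder k \<omega> (Suc n) h else 0) \<longlonglongrightarrow> remainder_series k \<omega> h"
      unfolding remainder_series_def using h by (intro summable_LIMSEQ summable_remainder \<omega> k) auto
    moreover have "(\<Sum>n<N. if prime (Suc n) then ln_remainder k \<omega> (Suc n) h else 0) = (\<Sum>p\<in>primes_le N. ln_remainder k \<omega> p h)" for N
      using sum_prime_part[where N=N and f="\<lambda>_. 1" and x="\<lambda>p. ln_remainder k \<omega> p h"] by (simp add: prime_part_def)
    ultimately show ?thesis by simp
  qed
  have "(\<Prod>p\<in>primes_le N. euler_factor k (?x p)) =
     exp (rsum (primes_le N) (prime_weight h) \<omega> + (\<Sum>p\<in>primes_le N. 1 / real p powr (1 + 2 * h)) / 2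
          + (\<Sum>p\<in>primes_le N. ln_remainder k \<omega> p h))" for N
  proof -
    have pos: "euler_factor k (?x p) > 0" if "p \<in> primes_le N" for p
      using that h sign_weight_bounds(1)[OF \<omega>, of p h] k by (intro euler_factor_pos) auto
    have "(\<Prod>p\<in>primes_le N. euler_factor k (?x p)) = (\<Prod>p\<in>primes_le N. exp (ln (euler_factor k (?x p))))"
      using pos by (intro prod.cong) auto
    also have "\<dots> = exp (\<Sum>p\<in>primes_le N. ln (euler_factor k (?x p)))" by (rule exp_sum[symmetric]) simp
    also have "(\<Sum>p\<in>primes_le N. ln (euler_factor k (?x p))) =
       (\<Sum>p\<in>primes_le N. prime_weight h p * \<epsilon> p \<omega> + 1 / real p powr (1 + 2 * h) / 2 + ln_remainder k \<omega> p h)"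
    proof (rule sum.cong[OF refl])
      fix p assume "p \<in> primes_le N"
      then have "(?x p)\<^sup>2 = 1 / real p powr (1 + 2 * h)" using sign_weight_bounds(3)[OF \<omega>, of p h] h by auto
      then show "ln (euler_factor k (?x p)) = prime_weight h p * \<epsilon> p \<omega> + 1 / real p powr (1 + 2 * h) / 2 + ln_remainder k \<omega> p h"
        by (simp add: ln_remainder_def Let_def prime_weight_def)
    qed
    also have "\<dots> = rsum (primes_le N) (prime_weight h) \<omega> + (\<Sum>p\<in>primes_le N. 1 / real p powr (1 + 2 * h)) / 2
          + (\<Sum>p\<in>primes_le N. ln_remainder k \<omega> p h)"
      by (simp only: sum.distrib rsum_def sum_divide_distrib)
    finally show ?thesis .
  qed
  moreover have "(\<lambda>N. exp (rsum (primes_le N) (prime_weight h) \<omega> + (\<Sum>p\<in>primes_le N. 1 / real p powr (1 + 2 * h)) / 2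
          + (\<Sum>p\<in>primes_le N. ln_remainder k \<omega> p h))) \<longlonglongrightarrow> exp (ln_euler_product k \<omega> h)"
    unfolding ln_euler_product_def
    using h by (intro tendsto_intros R prime_series_tendsto \<omega> prime_zeta_tendsto) auto
  ultimately show ?thesis by simp
qed

text \<open>The product over the primes up to \<open>2 ^ J\<close> and the partial sum up to \<open>2 ^ J\<close> agree on
  \<open>n \<le> 2 ^ J\<close>. They differ by terms with \<open>n > 2 ^ J\<close>, whose second moment decays geometrically in \<open>J\<close>.\<close>

lemma AE_euler_identity_at:
  assumes h: "h > 0" and k: "k \<ge> 3"
  shows "AE \<omega> in M. dirichlet_sum (kfree_mult k (\<lambda>p. \<epsilon> p \<omega>)) (1/2 + h) = exp (ln_euler_product k \<omega> h)"
proof -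
  define r where "r = 1/2 + h"
  define \<delta> where "\<delta> = h / 2"
  have \<delta>: "\<delta> > 0" "r - \<delta> > 1/2" using h by (auto simp: \<delta>_def r_def)
  define C where "C = (zeta (2 * (r - \<delta>))) ^ 3"
  have C0: "C > 0" using \<delta> zeta_pos[of "2 * (r - \<delta>)"] by (simp add: C_def)
  let ?a = "\<lambda>n \<omega>. sign_coeff k UNIV n \<omega>"
  define A where "A J \<omega> = (\<Sum>n\<in>{1..2^J}. ?a n \<omega> * real n powr (- r))" for J :: nat and \<omega>
  define E where "E J \<omega> = (\<Sum>n\<in>smooth_kfree k (2^J). ?a n \<omega> * real n powr (- r))" for J :: nat and \<omega>
  have fin: "finite (smooth_kfree k N)" for N using k by (intro euler_product_finite_aux(1)) auto
  (* The surplus of the multiplied-out product over the partial sum. *)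
  define T where "T J = {n \<in> smooth_kfree k (2^J). n > 2^J}" for J :: nat
  have diff: "E J \<omega> - A J \<omega> = (\<Sum>n\<in>T J. ?a n \<omega> * real n powr (- r))" for J \<omega>
  proof -
    have A: "A J \<omega> = (\<Sum>n\<in>smooth_kfree k (2^J) - T J. ?a n \<omega> * real n powr (- r))"
      unfolding A_def
    proof (rule sum.mono_neutral_right)
      show "smooth_kfree k (2^J) - T J \<subseteq> {1..2^J}" by (auto simp: T_def Suc_le_eq dest: smooth_kfree_pos)
      show "\<forall>n\<in>{1..2^J} - (smooth_kfree k (2^J) - T J). ?a n \<omega> * real n powr (- r) = 0"
        using subset_smooth_kfree[of k "2^J"] by (auto simp: T_def sign_coeff_def kfree_mult_def)
    qed simp
    have "E J \<omega> = (\<Sum>n\<in>smooth_kfree k (2^J) - T J. ?a n \<omega> * real n powr (- r)) + (\<Sum>n\<in>T J. ?a n \<omega> * real n powr (- r))"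
      unfolding E_def by (rule sum.subset_diff) (auto simp: T_def fin)
    then show ?thesis using A by simp
  qed
  have "AE \<omega> in M. (\<lambda>J. E J \<omega> - A J \<omega>) \<longlonglongrightarrow> 0"
  proof (rule AE_tendsto_zero_second_moment)
    show "(\<lambda>\<omega>. E J \<omega> - A J \<omega>) \<in> borel_measurable M" for J unfolding E_def A_def by measurable
    show "(\<integral>\<^sup>+\<omega>. ennreal ((E J \<omega> - A J \<omega>)\<^sup>2) \<partial>M) \<le> ennreal (C * (2 powr (- (2 * \<delta>))) ^ J)" for J
    proof -
      have T: "finite (T J)" "0 \<notin> T J" "\<And>n. n \<in> T J \<Longrightarrow> 2 ^ J \<le> n" by (auto simp: T_def fin)
      have "(\<integral>\<^sup>+\<omega>. ennreal ((E J \<omega> - A J \<omega>)\<^sup>2) \<partial>M) \<le>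
         ennreal (\<Sum>n\<in>T J. \<Sum>m\<in>T J. of_bool (is_nth_power 2 (n * m)) * (real n powr (- r) * real m powr (- r)))"
        unfolding diff by (rule sign_coeff_second_moment) (use T in auto)
      also have "\<dots> \<le> ennreal (C * (2 powr (- (2 * \<delta>))) ^ J)"
      proof (rule ennreal_leI)
        have "(\<Sum>n\<in>T J. \<Sum>m\<in>T J. of_bool (is_nth_power 2 (n * m)) * (real n powr (- r) * real m powr (- r)))
          = (\<Sum>n\<in>T J. \<Sum>m\<in>T J. of_bool (is_nth_power 2 (n * m)) * (real n * real m) powr (- r))"
          by (simp add: powr_mult)
        also have "\<dots> \<le> real (2 ^ J) powr (- (2 * \<delta>)) * C"
          unfolding C_def using \<delta> T by (intro sum_square_pairs_tail) auto
        also have "real (2 ^ J) powr (- (2 * \<delta>)) = (2 powr (- (2 * \<delta>))) ^ J"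
          by (simp add: powr_realpow[symmetric] powr_powr mult_ac powr_power)
        finally show "(\<Sum>n\<in>T J. \<Sum>m\<in>T J. of_bool (is_nth_power 2 (n * m)) * (real n powr (- r) * real m powr (- r)))
           \<le> C * (2 powr (- (2 * \<delta>))) ^ J" by (simp add: mult.commute)
      qed
      finally show ?thesis .
    qed
    have "2 powr (- (2 * \<delta>)) < 2 powr 0" using \<delta> by (intro powr_less_mono) auto
    then show "summable (\<lambda>J. C * (2 powr (- (2 * \<delta>))) ^ J)" by (intro summable_mult summable_geometric) auto
  qed (use C0 in auto)
  then show ?thesis
    using AE_good_signs AE_dirichlet_summable[of k UNIV]
  proof eventually_elim
    fix \<omega> assume lim: "(\<lambda>J. E J \<omega> - A J \<omega>) \<longlonglongrightarrow> 0" and \<omega>: "good_signs \<omega>"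
      and sm: "\<forall>r>1/2. summable (\<lambda>n. ?a (Suc n) \<omega> / real (Suc n) powr r)"
    have pow: "filterlim (\<lambda>J. (2::nat) ^ J) at_top sequentially" by real_asymp
    have a: "?a n \<omega> = kfree_mult k (\<lambda>p. \<epsilon> p \<omega>) n" for n by (simp add: sign_coeff_def)
    have "(\<lambda>N. \<Sum>n<N. ?a (Suc n) \<omega> / real (Suc n) powr r) \<longlonglongrightarrow> dirichlet_sum (kfree_mult k (\<lambda>p. \<epsilon> p \<omega>)) r"
      unfolding dirichlet_sum_def a[symmetric] using sm h by (intro summable_LIMSEQ) (auto simp: r_def)
    note A' = filterlim_compose[OF this pow]
    have "(\<Sum>n<2^J. ?a (Suc n) \<omega> / real (Suc n) powr r) = A J \<omega>" for J
      unfolding A_def by (rule sum.reindex_bij_witness[of _ "\<lambda>n. n - 1" Suc]) (auto simp: powr_minus field_simps)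
    then have A: "(\<lambda>J. A J \<omega>) \<longlonglongrightarrow> dirichlet_sum (kfree_mult k (\<lambda>p. \<epsilon> p \<omega>)) r"
      using A' by (simp only:)
    note E' = filterlim_compose[OF ln_euler_product_tendsto[OF \<omega> h k] pow]
    have "(\<Prod>p\<in>primes_le (2^J). euler_factor k (\<epsilon> p \<omega> / real p powr (1/2 + h))) = E J \<omega>" for J
    proof -
      have "E J \<omega> = (\<Sum>n\<in>smooth_kfree k (2^J). kfree_mult k (\<lambda>p. \<epsilon> p \<omega>) n / real n powr r)"
        unfolding E_def a by (simp add: powr_minus divide_inverse)
      also have "\<dots> = (\<Prod>p\<in>primes_le (2^J). \<Sum>j<k. (\<epsilon> p \<omega> / real p powr r) ^ j)"
        using k by (intro euler_product_finite) auto
      finally show ?thesis unfolding euler_factor_def r_def by (rule sym)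
    qed
    then have E: "(\<lambda>J. E J \<omega>) \<longlonglongrightarrow> exp (ln_euler_product k \<omega> h)"
      using E' by (simp only:)
    have "(\<lambda>J. E J \<omega> - A J \<omega>) \<longlonglongrightarrow> exp (ln_euler_product k \<omega> h) - dirichlet_sum (kfree_mult k (\<lambda>p. \<epsilon> p \<omega>)) r"
      by (intro tendsto_diff E A)
    from LIMSEQ_unique[OF lim this]
    show "dirichlet_sum (kfree_mult k (\<lambda>p. \<epsilon> p \<omega>)) (1/2 + h) = exp (ln_euler_product k \<omega> h)"
      by (simp add: r_def)
  qed
qed

lemma continuous_on_prime_zeta: "continuous_on {1<..} prime_zeta"
  by (rule continuous_on_dirichlet_sum_open) (rule summable_prime_zeta)

lemma continuous_on_ln_euler_product:
  assumes \<omega>: "good_signs \<omega>" and k: "k \<ge> 3"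
  shows "continuous_on {0<..} (ln_euler_product k \<omega>)"
  unfolding ln_euler_product_def[abs_def]
  by (intro continuous_intros continuous_on_prime_series continuous_on_remainder_series assms
        continuous_on_compose2[OF continuous_on_prime_zeta]) auto

text \<open>Both sides are continuous in \<open>h\<close>, so one null set serves all \<open>h\<close> once rational \<open>h\<close> are covered.\<close>

lemma AE_euler_identity:
  assumes k: "k \<ge> 3"
  shows "AE \<omega> in M. \<forall>h>0. dirichlet_sum (kfree_mult k (\<lambda>p. \<epsilon> p \<omega>)) (1/2 + h) = exp (ln_euler_product k \<omega> h)"
proof -
  have "AE \<omega> in M. \<forall>h\<in>\<rat> \<inter> {0<..}. dirichlet_sum (kfree_mult k (\<lambda>p. \<epsilon> p \<omega>)) (1/2 + h) = exp (ln_euler_product k \<omega> h)"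
    by (subst AE_ball_countable) (auto intro!: AE_euler_identity_at k countable_rat countable_Int1)
  then show ?thesis using AE_good_signs AE_dirichlet_summable[of k UNIV]
  proof eventually_elim
    fix \<omega> assume eq: "\<forall>h\<in>\<rat> \<inter> {0<..}. dirichlet_sum (kfree_mult k (\<lambda>p. \<epsilon> p \<omega>)) (1/2 + h) = exp (ln_euler_product k \<omega> h)"
      and \<omega>: "good_signs \<omega>"
      and sm: "\<forall>r>1/2. summable (\<lambda>n. sign_coeff k UNIV (Suc n) \<omega> / real (Suc n) powr r)"
    have a: "sign_coeff k UNIV n \<omega> = kfree_mult k (\<lambda>p. \<epsilon> p \<omega>) n" for n by (simp add: sign_coeff_def)
    have "continuous_on {1/2<..} (dirichlet_sum (kfree_mult k (\<lambda>p. \<epsilon> p \<omega>)))"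
      by (rule continuous_on_dirichlet_sum_open) (use sm in \<open>simp add: a\<close>)
    then have c1: "continuous_on {0<..} (\<lambda>h. dirichlet_sum (kfree_mult k (\<lambda>p. \<epsilon> p \<omega>)) (1/2 + h))"
      by (rule continuous_on_compose2) (auto intro!: continuous_intros)
    have c2: "continuous_on {0<..} (\<lambda>h. exp (ln_euler_product k \<omega> h))"
      by (intro continuous_intros continuous_on_ln_euler_product \<omega> k)
    show "\<forall>h>0. dirichlet_sum (kfree_mult k (\<lambda>p. \<epsilon> p \<omega>)) (1/2 + h) = exp (ln_euler_product k \<omega> h)"
    proof (intro allI impI)
      fix h :: real assume h: "h > 0"
      (* Rational points decreasing to h. *)
      define q where "q n = (SOME q. q \<in> \<rat> \<and> h < q \<and> q < h + 1 / real (Suc n))" for n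
      have q: "q n \<in> \<rat>" "h < q n" "q n < h + 1 / real (Suc n)" for n
        using someI_ex[of "\<lambda>q. q \<in> \<rat> \<and> h < q \<and> q < h + 1 / real (Suc n)"]
          Rats_dense_in_real[of h "h + 1 / real (Suc n)"] unfolding q_def by auto
      have qlim: "q \<longlonglongrightarrow> h"
      proof (rule tendsto_sandwich[of "\<lambda>_. h" _ _ "\<lambda>n. h + 1 / real (Suc n)"])
        show "(\<lambda>n. h + 1 / real (Suc n)) \<longlonglongrightarrow> h" by real_asymp
      qed (use q in \<open>auto intro!: always_eventually less_imp_le\<close>)
      have l: "(\<lambda>n. f (q n)) \<longlonglongrightarrow> f h" if "continuous_on {0<..} f" for f :: "real \<Rightarrow> real"
        by (rule continuous_on_tendsto_compose[OF that qlim]) (use h q in \<open>auto intro!: always_eventually intro: less_trans\<close>)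
      have e: "dirichlet_sum (kfree_mult k (\<lambda>p. \<epsilon> p \<omega>)) (1/2 + q n) = exp (ln_euler_product k \<omega> (q n))" for n
        using eq q[of n] h by auto
      have "(\<lambda>n. exp (ln_euler_product k \<omega> (q n))) \<longlonglongrightarrow> dirichlet_sum (kfree_mult k (\<lambda>p. \<epsilon> p \<omega>)) (1/2 + h)"
        using l[OF c1] by (simp only: e)
      then show "dirichlet_sum (kfree_mult k (\<lambda>p. \<epsilon> p \<omega>)) (1/2 + h) = exp (ln_euler_product k \<omega> h)"
        by (rule LIMSEQ_unique) (rule l[OF c2])
    qed
  qed
qed

text \<open>Half of the error \<open>2 * prime_zeta 2\<close> between \<open>ln zeta\<close> and \<open>prime_zeta\<close>, plus the bound of the third order remainder.\<close>

definition centring_const :: real where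
  "centring_const = prime_zeta 2 + 8 * zeta (3/2)"

theorem AE_centred_log_sum:
  assumes k: "k \<ge> 3"
  shows "AE \<omega> in M. good_signs \<omega> \<and> continuous_on {0<..} (centred_log_sum k (\<lambda>p. \<epsilon> p \<omega>)) \<and>
     (\<forall>h>0. \<bar>centred_log_sum k (\<lambda>p. \<epsilon> p \<omega>) h - prime_series \<omega> h\<bar> \<le> centring_const)"
  using AE_good_signs AE_euler_identity[OF k]
proof eventually_elim
  fix \<omega> assume \<omega>: "good_signs \<omega>"
    and eu: "\<forall>h>0. dirichlet_sum (kfree_mult k (\<lambda>p. \<epsilon> p \<omega>)) (1/2 + h) = exp (ln_euler_product k \<omega> h)"
  have eq: "centred_log_sum k (\<lambda>p. \<epsilon> p \<omega>) h = ln_euler_product k \<omega> h - ln (zeta (1 + 2 * h)) / 2" if "h > 0" for h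
    using eu that by (simp add: centred_log_sum_def)
  have zc: "continuous_on {1<..} zeta"
  proof -
    have "continuous_on {1<..} (dirichlet_sum (\<lambda>_. 1))"
    proof (rule continuous_on_dirichlet_sum_open)
      fix r :: real assume "r > 1"
      then show "summable (\<lambda>n. 1 / real (Suc n) powr r)"
        using summable_powr_Suc[of r] by (simp add: powr_minus inverse_eq_divide del: of_nat_Suc)
    qed
    then show ?thesis by (simp add: zeta_eq_dirichlet_sum[abs_def])
  qed
  have "continuous_on {0<..} (\<lambda>h. ln_euler_product k \<omega> h - ln (zeta (1 + 2 * h)) / 2)"
  proof (intro continuous_intros continuous_on_ln_euler_product \<omega> k continuous_on_compose2[OF zc])
    show "\<forall>h\<in>{0<..}. zeta (1 + 2 * h) \<noteq> 0"
    proof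
      fix h :: real assume "h \<in> {0<..}"
      then show "zeta (1 + 2 * h) \<noteq> 0" using zeta_pos[of "1 + 2 * h"] by simp
    qed
  qed auto
  then have cont: "continuous_on {0<..} (centred_log_sum k (\<lambda>p. \<epsilon> p \<omega>))"
    by (rule continuous_on_eq) (use eq in auto)
  have bd: "\<bar>centred_log_sum k (\<lambda>p. \<epsilon> p \<omega>) h - prime_series \<omega> h\<bar> \<le> centring_const" if h: "h > 0" for h
  proof -
    have a: "\<bar>prime_zeta (1 + 2 * h) - ln (zeta (1 + 2 * h))\<bar> \<le> 2 * prime_zeta 2"
      using ln_zeta_le_prime_zeta[of "1 + 2 * h"] prime_zeta_le_ln_zeta[of "1 + 2 * h"] h by auto
    have b: "\<bar>remainder_series k \<omega> h\<bar> \<le> 8 * zeta (3/2)"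
      using h by (intro remainder_series_bound \<omega> k) auto
    have gen: "\<bar>(g + P / 2 + R - L / 2) - g\<bar> \<le> Q + Z" if "\<bar>P - L\<bar> \<le> 2 * Q" "\<bar>R\<bar> \<le> Z" for g P L R Q Z :: real
      using that unfolding abs_le_iff by argo
    show ?thesis
      unfolding eq[OF h] ln_euler_product_def centring_const_def by (rule gen[OF a b])
  qed
  then show "good_signs \<omega> \<and> continuous_on {0<..} (centred_log_sum k (\<lambda>p. \<epsilon> p \<omega>)) \<and>
     (\<forall>h>0. \<bar>centred_log_sum k (\<lambda>p. \<epsilon> p \<omega>) h - prime_series \<omega> h\<bar> \<le> centring_const)"
    by (intro conjI allI impI \<omega> cont bd)
qed

end

section \<open>Chaining for processes with rapidly decaying increments\<close>

text \<open>Level \<open>n0 + r\<close> of the dyadic grid is allowed increments of size \<open>w r\<close>, with \<open>\<Sum>r. w r = lam\<close>. By the union bound the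
  exceptional event has a probability dominated by its coarsest level as soon as the
  tail exponent \<open>m\<close> is at least \<open>2\<close>. Continuity of the path extends the bound from dyadic points to all times.\<close>

lemma (in prob_space) chaining:
  fixes X :: "real \<Rightarrow> 'a \<Rightarrow> real" and T n0 m :: nat
  assumes meas: "\<And>t. t \<ge> 0 \<Longrightarrow> X t \<in> borel_measurable M"
    and tail: "\<And>s t x. 0 \<le> s \<Longrightarrow> s \<le> t \<Longrightarrow> t \<le> real T \<Longrightarrow> x > 0 \<Longrightarrow>
      prob {\<omega>\<in>space M. \<bar>X t \<omega> - X s \<omega>\<bar> \<ge> x} \<le> K * (l * (t - s) / x\<^sup>2) ^ m"
    and K: "K \<ge> 0" and l: "l \<ge> 0" and m: "m \<ge> 2" and lam: "lam > 0"
  shows "\<exists>E\<in>events. prob E \<le> 5 * real T * K * 100 ^ m * 2 ^ n0 * (l / 2 ^ n0 / lam\<^sup>2) ^ m \<and>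
    (\<forall>\<omega>\<in>space M - E.
       (\<forall>j<T * 2 ^ n0. \<bar>X (real (Suc j) / 2 ^ n0) \<omega> - X (real j / 2 ^ n0) \<omega>\<bar> \<le> lam) \<and>
       (continuous_on {0..} (\<lambda>t. X t \<omega>) \<longrightarrow>
          (\<forall>t. 0 \<le> t \<longrightarrow> t < real T \<longrightarrow> \<bar>X t \<omega> - X (dyadic_floor n0 t) \<omega>\<bar> \<le> lam)))"
proof -
  (* The ratio 9/10 is below 1, so that the sum is lam, and its square 81/100 is above 1/2, so that
     the variance 2^(-r) still decays relative to w r ^ 2. *)
  define w where "w r = lam / 10 * (9/10) ^ r" for r :: nat
  have w0: "w r > 0" for r using lam by (simp add: w_def)
  define A where "A r j = {\<omega>\<in>space M. \<bar>X (real (Suc j) / 2 ^ (n0 + r)) \<omega> - X (real j / 2 ^ (n0 + r)) \<omega>\<bar> \<ge> w r}" for r j :: nat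
  have A[measurable]: "A r j \<in> events" for r j
    unfolding A_def using meas[of "real (Suc j) / 2 ^ (n0 + r)"] meas[of "real j / 2 ^ (n0 + r)"] by measurable
  define Er where "Er r = (\<Union>j<T * 2 ^ (n0 + r). A r j)" for r
  have Er[measurable]: "Er r \<in> events" for r unfolding Er_def by measurable
  define b where "b = real T * K * 100 ^ m * 2 ^ n0 * (l / 2 ^ n0 / lam\<^sup>2) ^ m"
  have b0: "b \<ge> 0" using K l by (simp add: b_def)
  have pA: "prob (A r j) \<le> K * (l / 2 ^ (n0 + r) / (w r)\<^sup>2) ^ m" if j: "j < T * 2 ^ (n0 + r)" for r j
  proof -
    have "real (Suc j) \<le> real (T * 2 ^ (n0 + r))" using j by (simp only: of_nat_le_iff)
    then have "real (Suc j) / 2 ^ (n0 + r) \<le> real T" by (simp add: divide_le_eq)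
    then have "prob (A r j) \<le> K * (l * (real (Suc j) / 2 ^ (n0 + r) - real j / 2 ^ (n0 + r)) / (w r)\<^sup>2) ^ m"
      unfolding A_def using w0 by (intro tail) (auto intro!: divide_right_mono)
    also have "real (Suc j) / 2 ^ (n0 + r) - real j / 2 ^ (n0 + r) = 1 / 2 ^ (n0 + r)"
      by (simp add: diff_divide_distrib[symmetric])
    finally show ?thesis by simp
  qed
  have pEr: "prob (Er r) \<le> b * (2 / (81/50) ^ m) ^ r" for r
  proof -
    have "prob (Er r) \<le> (\<Sum>j<T * 2 ^ (n0 + r). prob (A r j))"
      unfolding Er_def by (intro finite_measure_subadditive_finite) auto
    also have "\<dots> \<le> (\<Sum>j<T * 2 ^ (n0 + r). K * (l / 2 ^ (n0 + r) / (w r)\<^sup>2) ^ m)"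
      by (intro sum_mono pA) auto
    also have "\<dots> = real T * 2 ^ n0 * 2 ^ r * (K * (l / 2 ^ (n0 + r) / (w r)\<^sup>2) ^ m)"
      by (simp add: power_add)
    also have "l / 2 ^ (n0 + r) / (w r)\<^sup>2 = (l / 2 ^ n0 / lam\<^sup>2) * 100 / (81/50) ^ r"
    proof -
      have w2: "(w r)\<^sup>2 = lam\<^sup>2 / 100 * (81/100) ^ r"
        by (simp add: w_def power_mult_distrib power_divide power_mult[symmetric] mult.commute[of r 2])
           (simp add: power_mult power2_eq_square)
      have q2: "(81/50 :: real) ^ r = 2 ^ r * (81/100) ^ r" by (simp add: power_mult_distrib[symmetric])
      show ?thesis unfolding w2 q2 power_add by simp
    qed
    also have "((l / 2 ^ n0 / lam\<^sup>2) * 100 / (81/50) ^ r) ^ m = (l / 2 ^ n0 / lam\<^sup>2) ^ m * 100 ^ m / ((81/50) ^ m) ^ r"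
      by (simp only: power_mult_distrib power_divide power_mult[symmetric] mult.commute)
    finally show ?thesis by (simp add: b_def power_divide mult_ac)
  qed
  (* The number of intervals doubles per level, while each tail probability shrinks by (81/50) ^ m. *)
  have q: "2 / (81/50) ^ m \<le> (4/5 :: real)"
  proof -
    have "(81/50 :: real) ^ 2 \<le> (81/50) ^ m" using m by (intro power_increasing) auto
    moreover have "(81/50 :: real) ^ 2 = 6561/2500" by (simp add: power2_eq_square)
    ultimately have "(5/2 :: real) \<le> (81/50) ^ m" by linarith
    then have "2 / (81/50) ^ m \<le> 2 / (5/2 :: real)" by (intro divide_left_mono) auto
    then show ?thesis by simp
  qed
  have pEr': "prob (Er r) \<le> b * (4/5) ^ r" for r
    by (rule order_trans[OF pEr]) (use q b0 in \<open>intro mult_left_mono power_mono, auto\<close>)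
  have sm: "summable (\<lambda>r. b * (4/5 :: real) ^ r)" by (intro summable_mult summable_geometric) auto
  have smE: "summable (\<lambda>r. prob (Er r))"
    by (rule summable_comparison_test'[OF sm, of 0]) (use pEr' in auto)
  define E where "E = (\<Union>r. Er r)"
  have Ev: "E \<in> events" unfolding E_def by measurable
  have "prob E \<le> (\<Sum>r. prob (Er r))"
    unfolding E_def by (rule finite_measure_subadditive_countably[OF _ smE]) auto
  also have "\<dots> \<le> (\<Sum>r. b * (4/5) ^ r)" by (rule suminf_le[OF pEr' smE sm])
  also have "\<dots> = b * 5" by (subst suminf_mult) (auto simp: suminf_geometric intro!: summable_geometric)
  finally have pE: "prob E \<le> 5 * real T * K * 100 ^ m * 2 ^ n0 * (l / 2 ^ n0 / lam\<^sup>2) ^ m"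
    by (simp add: b_def mult_ac)
  have off: "\<bar>X (real (Suc j) / 2 ^ (n0 + r)) \<omega> - X (real j / 2 ^ (n0 + r)) \<omega>\<bar> \<le> w r"
    if "\<omega> \<in> space M - E" "j < T * 2 ^ (n0 + r)" for \<omega> r j
    using that unfolding E_def Er_def A_def by (auto simp: not_le intro: less_imp_le)
  have wl: "w r \<le> lam" for r
  proof -
    have "(9/10 :: real) ^ r \<le> 1" by (intro power_le_one) auto
    then have "lam / 10 * (9/10) ^ r \<le> lam / 10 * 1" using lam by (intro mult_left_mono) auto
    then show ?thesis using lam by (simp add: w_def)
  qed
  have "\<bar>X t \<omega> - X (dyadic_floor n0 t) \<omega>\<bar> \<le> lam"
    if \<omega>: "\<omega> \<in> space M - E" and cont: "continuous_on {0..} (\<lambda>t. X t \<omega>)" and t: "0 \<le> t" "t < real T" for \<omega> t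
  proof -
    have bound: "\<bar>X (dyadic_floor N t) \<omega> - X (dyadic_floor n0 t) \<omega>\<bar> \<le> lam" if N: "N \<ge> n0" for N
    proof -
      have "\<bar>X (dyadic_floor N t) \<omega> - X (dyadic_floor n0 t) \<omega>\<bar> \<le> (\<Sum>i\<in>{n0<..N}. w (i - n0))"
      proof (rule dyadic_chain[where x = "\<lambda>t. X t \<omega>" and T = T])
        fix i j :: nat assume ij: "n0 < i" "i \<le> N" "j < T * 2 ^ i"
        show "\<bar>X (real (Suc j) / 2 ^ i) \<omega> - X (real j / 2 ^ i) \<omega>\<bar> \<le> w (i - n0)"
          using off[OF \<omega>, of j "i - n0"] ij by simp
      qed (use t N in auto)
      also have "\<dots> \<le> (\<Sum>r<Suc (N - n0). w r)"
      proof -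
        have "(\<Sum>i\<in>{n0<..N}. w (i - n0)) = (\<Sum>r\<in>{0<..N-n0}. w r)"
          using N by (intro sum.reindex_bij_witness[of _ "\<lambda>r. n0 + r" "\<lambda>i. i - n0"]) auto
        also have "\<dots> \<le> (\<Sum>r<Suc (N - n0). w r)" using w0 by (intro sum_mono2) (auto intro: less_imp_le)
        finally show ?thesis .
      qed
      also have "\<dots> \<le> (\<Sum>r. w r)"
        unfolding w_def using lam by (intro sum_le_suminf summable_mult summable_geometric) auto
      also have "\<dots> = lam"
        unfolding w_def by (subst suminf_mult) (auto simp: suminf_geometric intro!: summable_geometric)
      finally show ?thesis .
    qed
    have dl: "(\<lambda>N. dyadic_floor N t) \<longlonglongrightarrow> t"
    proof (rule tendsto_sandwich[of "\<lambda>N. t - 1 / 2 ^ N" _ _ "\<lambda>_. t"])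
      show "\<forall>\<^sub>F N in sequentially. t - 1 / 2 ^ N \<le> dyadic_floor N t"
      proof (intro always_eventually allI)
        fix N :: nat
        have "2 ^ N * t - 1 \<le> of_int \<lfloor>2 ^ N * t\<rfloor>" by linarith
        then have "(2 ^ N * t - 1) / 2 ^ N \<le> dyadic_floor N t" by (rule divide_right_mono) simp
        then show "t - 1 / 2 ^ N \<le> dyadic_floor N t" by (simp add: diff_divide_distrib)
      qed
      show "\<forall>\<^sub>F N in sequentially. dyadic_floor N t \<le> t"
      proof (intro always_eventually allI)
        fix N :: nat
        have "of_int \<lfloor>2 ^ N * t\<rfloor> \<le> 2 ^ N * t" by linarith
        then show "dyadic_floor N t \<le> t" by (simp add: divide_le_eq mult.commute)
      qed
      show "(\<lambda>N. t - 1 / 2 ^ N) \<longlonglongrightarrow> t" by real_asymp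
    qed simp
    have "(\<lambda>N. X (dyadic_floor N t) \<omega>) \<longlonglongrightarrow> X t \<omega>"
      by (rule continuous_on_tendsto_compose[OF cont dl]) (use t in auto)
    then have lim: "(\<lambda>N. \<bar>X (dyadic_floor N t) \<omega> - X (dyadic_floor n0 t) \<omega>\<bar>) \<longlonglongrightarrow> \<bar>X t \<omega> - X (dyadic_floor n0 t) \<omega>\<bar>"
      by (intro tendsto_intros)
    have "\<forall>\<^sub>F N in sequentially. \<bar>X (dyadic_floor N t) \<omega> - X (dyadic_floor n0 t) \<omega>\<bar> \<le> lam"
      using eventually_ge_at_top[of n0] by eventually_elim (rule bound)
    then show ?thesis by (intro tendsto_upperbound[OF lim]) auto
  qed
  moreover have "\<bar>X (real (Suc j) / 2 ^ n0) \<omega> - X (real j / 2 ^ n0) \<omega>\<bar> \<le> lam"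
    if "\<omega> \<in> space M - E" "j < T * 2 ^ n0" for \<omega> j
    using off[OF that(1), of j 0] that(2) wl[of 0] by simp
  ultimately show ?thesis using Ev pE by blast
qed

section \<open>The prime series in logarithmic time\<close>

context rademacher
begin

text \<open>In the time \<open>\<tau> = ln (1/h)\<close> the variance grows linearly.\<close>

definition gproc :: "real \<Rightarrow> 'a \<Rightarrow> real" where
  "gproc \<tau> \<omega> = prime_series \<omega> (exp (- \<tau>))"

definition walk :: "real \<Rightarrow> 'a \<Rightarrow> real" where
  "walk \<tau> = rsum (early_primes \<tau>) (prime_weight 0)"

lemma measurable_gproc [measurable]: "gproc \<tau> \<in> borel_measurable M"
  unfolding gproc_def[abs_def] by measurable

lemma measurable_walk [measurable]: "walk \<tau> \<in> borel_measurable M"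
  unfolding walk_def by (rule measurable_rsum) (rule early_primes_prime)

lemma continuous_on_gproc:
  assumes "good_signs \<omega>"
  shows "continuous_on A (\<lambda>\<tau>. gproc \<tau> \<omega>)"
  unfolding gproc_def
  by (rule continuous_on_compose2[OF continuous_on_prime_series[OF assms]]) (auto intro!: continuous_intros)

lemma subgaussian_series:
  assumes Y: "Y \<in> borel_measurable M"
    and lim: "\<And>\<omega>. good_signs \<omega> \<Longrightarrow> (\<lambda>N. rsum (primes_le N) a \<omega>) \<longlonglongrightarrow> Y \<omega>"
    and v: "\<And>N. (\<Sum>p\<in>primes_le N. (a p)\<^sup>2) \<le> v"
  shows "subgaussian M v Y"
proof (rule subgaussian_limit[OF _ Y])
  show "subgaussian M v (rsum (primes_le N) a)" for N
    by (rule subgaussian_rsum) (use v in auto)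
  show "AE \<omega> in M. (\<lambda>N. rsum (primes_le N) a \<omega>) \<longlonglongrightarrow> Y \<omega>"
    using AE_good_signs by eventually_elim (rule lim)
qed

lemma rsum_diff: "rsum I (\<lambda>p. a p - b p) \<omega> = rsum I a \<omega> - rsum I b \<omega>"
  by (simp add: rsum_def left_diff_distrib sum_subtractf)

text \<open>Variance parameters of limits of sign sums are computed on finite sets of primes and pass to the limit.\<close>

lemma subgaussian_gproc:
  assumes "\<tau> \<ge> 0"
  shows "subgaussian M (\<tau> + var_const) (gproc \<tau>)"
proof (rule subgaussian_series)
  show "(\<lambda>N. rsum (primes_le N) (prime_weight (exp (- \<tau>))) \<omega>) \<longlonglongrightarrow> gproc \<tau> \<omega>" if "good_signs \<omega>" for \<omega>
    unfolding gproc_def by (rule prime_series_tendsto[OF that]) simp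
  show "(\<Sum>p\<in>primes_le N. (prime_weight (exp (- \<tau>)) p)\<^sup>2) \<le> \<tau> + var_const" for N
  proof -
    have "(\<Sum>p\<in>primes_le N. (prime_weight (exp (- \<tau>)) p)\<^sup>2) \<le> ln (1 / exp (- \<tau>)) + var_const"
      by (rule var_weight) (use assms in auto)
    then show ?thesis by (simp add: ln_div)
  qed
qed simp

lemma subgaussian_gproc_diff:
  assumes "0 \<le> \<tau>" "\<tau> \<le> \<tau>'"
  shows "subgaussian M (var_const * (\<tau>' - \<tau>)) (\<lambda>\<omega>. gproc \<tau>' \<omega> - gproc \<tau> \<omega>)"
proof (rule subgaussian_series)
  let ?a = "\<lambda>p. prime_weight (exp (- \<tau>')) p - prime_weight (exp (- \<tau>)) p"
  show "(\<lambda>N. rsum (primes_le N) ?a \<omega>) \<longlonglongrightarrow> gproc \<tau>' \<omega> - gproc \<tau> \<omega>" if "good_signs \<omega>" for \<omega>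
    unfolding gproc_def rsum_diff by (intro tendsto_diff prime_series_tendsto[OF that]) auto
  show "(\<Sum>p\<in>primes_le N. (?a p)\<^sup>2) \<le> var_const * (\<tau>' - \<tau>)" for N
  proof -
    have "(\<Sum>p\<in>primes_le N. (?a p)\<^sup>2) \<le> var_const * ln (exp (- \<tau>) / exp (- \<tau>'))"
      by (rule var_diff) (use assms in auto)
    also have "ln (exp (- \<tau>) / exp (- \<tau>')) = \<tau>' - \<tau>" by (simp add: ln_div)
    finally show ?thesis .
  qed
qed simp

lemma subgaussian_gproc_walk:
  assumes "0 \<le> \<tau>"
  shows "subgaussian M var_const (\<lambda>\<omega>. gproc \<tau> \<omega> - walk \<tau> \<omega>)"
proof (rule subgaussian_series)
  let ?b = "\<lambda>p. of_bool (exp (- \<tau>) * ln (real p) \<le> 1) * prime_weight 0 p"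
  show "(\<lambda>N. rsum (primes_le N) (\<lambda>p. prime_weight (exp (- \<tau>)) p - ?b p) \<omega>) \<longlonglongrightarrow> gproc \<tau> \<omega> - walk \<tau> \<omega>"
    if "good_signs \<omega>" for \<omega>
  proof -
    obtain N0 where N0: "\<And>N. N \<ge> N0 \<Longrightarrow> early_primes \<tau> \<subseteq> primes_le N"
      using finite_subset_primes_le[OF finite_early_primes] early_primes_prime by metis
    have "rsum (primes_le N) ?b \<omega> = walk \<tau> \<omega>" if "N \<ge> N0" for N
      unfolding rsum_def walk_def using N0[OF that]
      by (intro sum.mono_neutral_cong_right) (auto simp: early_primes_def)
    then have "(\<lambda>N. rsum (primes_le N) ?b \<omega>) \<longlonglongrightarrow> walk \<tau> \<omega>"
      by (intro tendsto_eventually) (auto simp: eventually_sequentially)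
    then show ?thesis
      unfolding gproc_def rsum_diff by (intro tendsto_diff prime_series_tendsto[OF that]) auto
  qed
  show "(\<Sum>p\<in>primes_le N. (prime_weight (exp (- \<tau>)) p - ?b p)\<^sup>2) \<le> var_const" for N
    using assms by (intro var_trunc) auto
qed measurable

lemma subgaussian_walk:
  assumes "0 \<le> \<tau>"
  shows "subgaussian M (\<tau> + var_const) (walk \<tau>)"
  unfolding walk_def
  by (rule subgaussian_rsum) (use early_primes_sum[OF assms] early_primes_prime in auto)

definition chain_const :: "nat \<Rightarrow> real" where
  "chain_const m = 2 * fact m * 2 ^ m * var_const ^ m"

lemma chain_const_nonneg: "chain_const m \<ge> 0"
  using var_const_pos by (simp add: chain_const_def)

lemma gproc_increment_tail:
  assumes "0 \<le> \<tau>" "\<tau> \<le> \<tau>'" "x > 0"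
  shows "prob {\<omega>\<in>space M. \<bar>gproc \<tau>' \<omega> - gproc \<tau> \<omega>\<bar> \<ge> x} \<le> chain_const m * ((\<tau>' - \<tau>) / x\<^sup>2) ^ m"
proof -
  have "prob {\<omega>\<in>space M. \<bar>gproc \<tau>' \<omega> - gproc \<tau> \<omega>\<bar> \<ge> x} \<le> 2 * fact m * 2 ^ m * (var_const * (\<tau>' - \<tau>) / x\<^sup>2) ^ m"
    using assms var_const_pos by (intro subgaussian_tail_power subgaussian_gproc_diff) auto
  also have "\<dots> = chain_const m * ((\<tau>' - \<tau>) / x\<^sup>2) ^ m"
    by (simp add: chain_const_def power_mult_distrib power_divide)
  finally show ?thesis .
qed

section \<open>Lower tails of sign sums\<close>

lemma indep_rsum_blocks:
  assumes "disjoint_family_on K L" "\<And>j. j \<in> L \<Longrightarrow> finite (K j)" "\<And>j p. j \<in> L \<Longrightarrow> p \<in> K j \<Longrightarrow> prime p"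
  shows "indep_vars (\<lambda>_. borel) (\<lambda>j. rsum (K j) (a j)) L"
proof -
  have "indep_vars (\<lambda>j. PiM (K j) (\<lambda>_. borel)) (\<lambda>j \<omega>. restrict (\<lambda>p. \<epsilon> p \<omega>) (K j)) L"
    by (rule indep_vars_restrict[OF indep]) (use assms in auto)
  then have "indep_vars (\<lambda>_. borel) (\<lambda>j \<omega>. (\<lambda>x. \<Sum>p\<in>K j. a j p * x p) (restrict (\<lambda>p. \<epsilon> p \<omega>) (K j))) L"
    by (rule indep_vars_compose2) (auto intro!: borel_measurable_sum borel_measurable_times)
  then show ?thesis
    by (simp add: rsum_def[abs_def] cong: sum.cong)
qed

text \<open>Exponential change of measure without changing the measure: under the tilt \<open>exp (l * Y)\<close> with
  \<open>l = z / sqrt V\<close> the sum \<open>Y\<close> is centred near \<open>z * sqrt V\<close>. The tilted mass outside the window of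
  three standard deviations around this point is small by the upper bound for exponential moments, so
  the window contributes at least \<open>exp (z\<^sup>2 / 2) / 3\<close> to the exponential moment, and on it the tilt is at most
  \<open>exp (z\<^sup>2 + 3 * z)\<close>. Centring the window at \<open>z\<close> loses the three standard deviations in the
  conclusion, which is of lower order as \<open>z\<close> grows.\<close>

lemma rsum_lower_tail:
  assumes I: "finite I" "\<And>p. p \<in> I \<Longrightarrow> prime p" and a: "\<And>p. p \<in> I \<Longrightarrow> \<bar>a p\<bar> \<le> 1"
    and V: "V = (\<Sum>p\<in>I. (a p)\<^sup>2)" "V > 0" and z: "z \<ge> 0" "z\<^sup>2 \<le> V" "z ^ 4 \<le> 2 * V"
  shows "prob {\<omega>\<in>space M. rsum I a \<omega> \<ge> (z - 3) * sqrt V} \<ge> 1/3 * exp (- z\<^sup>2 / 2 - 3 * z)"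
proof -
  have [measurable]: "rsum I a \<in> borel_measurable M" by (rule measurable_rsum) (use I in auto)
  let ?Y = "rsum I a"
  define s where "s = sqrt V"
  have s: "s > 0" "s\<^sup>2 = V" using V(2) by (auto simp: s_def)
  define l where "l = z / s"
  (* The shift of the tilt that detects a deviation of three standard deviations. *)
  define \<mu> where "\<mu> = 3 / s"
  have l2: "l\<^sup>2 * V = z\<^sup>2" using s V(2) by (simp add: l_def power_divide field_simps)
  define A where "A = {\<omega>\<in>space M. ?Y \<omega> \<ge> (z - 3) * s}"
  have [measurable]: "A \<in> events" unfolding A_def by measurable
  have upper: "expectation (\<lambda>\<omega>. exp (t * ?Y \<omega>)) \<le> exp (t\<^sup>2 * V / 2)" for t
  proof -
    have "(\<integral>\<^sup>+\<omega>. ennreal (exp (t * ?Y \<omega>)) \<partial>M) \<le> ennreal (exp (t\<^sup>2 * V / 2))"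
      using subgaussian_rsum[OF I, of a V] V(1) by (simp add: subgaussian_def)
    then show ?thesis by (subst (asm) nn_integral_eq_integral[OF mgf_rsum(1)[OF I]]) auto
  qed
  have lower: "exp (z\<^sup>2 / 2 - 1/2) \<le> expectation (\<lambda>\<omega>. exp (l * ?Y \<omega>))"
  proof -
    let ?u = "\<lambda>p. (l * a p)\<^sup>2 / 2"
    have l1: "l\<^sup>2 \<le> 1" using z(2) s V(2) by (simp add: l_def power_divide divide_le_eq)
    have au: "(a p)\<^sup>2 \<le> 1" if "p \<in> I" for p using a[OF that] by (simp add: abs_square_le_1)
    have u1: "?u p \<le> 1" if "p \<in> I" for p
      using mult_mono[OF l1 au[OF that]] by (simp add: power_mult_distrib)
    have "(\<Sum>p\<in>I. (?u p)\<^sup>2) \<le> 1/2"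
    proof -
      have "(\<Sum>p\<in>I. (?u p)\<^sup>2) \<le> (\<Sum>p\<in>I. l ^ 4 / 4 * (a p)\<^sup>2)"
      proof (rule sum_mono)
        fix p assume p: "p \<in> I"
        have "(?u p)\<^sup>2 = l ^ 4 / 4 * ((a p)\<^sup>2 * (a p)\<^sup>2)"
          by (simp add: power_mult_distrib power_divide power2_eq_square power4_eq_xxxx)
        also have "\<dots> \<le> l ^ 4 / 4 * ((a p)\<^sup>2 * 1)" using au[OF p] by (intro mult_left_mono) auto
        finally show "(?u p)\<^sup>2 \<le> l ^ 4 / 4 * (a p)\<^sup>2" by simp
      qed
      also have "\<dots> = l ^ 4 / 4 * V" by (simp only: V(1) sum_distrib_left)
      also have "\<dots> = z ^ 4 / V / 4"
      proof -
        have "s ^ 4 = V * V" by (metis power_add numeral_Bit0 s(2))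
        then show ?thesis using V(2) by (simp add: l_def power_divide)
      qed
      also have "\<dots> \<le> 1/2" using z(3) V(2) by (simp add: field_simps)
      finally show ?thesis .
    qed
    moreover have "(\<Sum>p\<in>I. ?u p) = z\<^sup>2 / 2"
      using l2 by (simp add: V(1) power_mult_distrib sum_divide_distrib[symmetric] sum_distrib_left)
    ultimately have "z\<^sup>2 / 2 - 1/2 \<le> (\<Sum>p\<in>I. ?u p - (?u p)\<^sup>2)"
      unfolding sum_subtractf by linarith
    then have "exp (z\<^sup>2 / 2 - 1/2) \<le> exp (\<Sum>p\<in>I. ?u p - (?u p)\<^sup>2)" by (simp only: exp_le_cancel_iff)
    also have "\<dots> = (\<Prod>p\<in>I. exp (?u p - (?u p)\<^sup>2))" by (rule exp_sum[OF I(1)])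
    also have "\<dots> \<le> (\<Prod>p\<in>I. cosh (l * a p))"
    proof (rule prod_mono, intro conjI)
      fix p assume p: "p \<in> I"
      have "?u p - (?u p)\<^sup>2 \<le> ln (1 + ?u p)" by (rule ln_one_plus_pos_lower_bound) (use u1[OF p] in auto)
      then have "exp (?u p - (?u p)\<^sup>2) \<le> exp (ln (1 + ?u p))" by (simp only: exp_le_cancel_iff)
      also have "\<dots> = 1 + ?u p" by (rule exp_ln) (simp add: add_pos_nonneg)
      also have "\<dots> \<le> cosh (l * a p)" by (rule cosh_ge_quadratic)
      finally show "exp (?u p - (?u p)\<^sup>2) \<le> cosh (l * a p)" .
    qed simp
    also have "\<dots> = expectation (\<lambda>\<omega>. exp (l * ?Y \<omega>))" by (rule mgf_rsum(2)[OF I, symmetric])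
    finally show ?thesis .
  qed
  (* Window, below the window, above the window: in the last two cases changing the tilt by mu
     only increases the exponential. *)
  have le: "exp (l * ?Y \<omega>) \<le> exp (z\<^sup>2 + 3 * z) * indicator A \<omega>
      + exp (\<mu> * ((z - 3) * s)) * exp ((l - \<mu>) * ?Y \<omega>) + exp (- (\<mu> * ((z + 3) * s))) * exp ((l + \<mu>) * ?Y \<omega>)"
    (is "_ \<le> ?r1 + ?r2 + ?r3") if "\<omega> \<in> space M" for \<omega>
  proof -
    have m: "\<mu> > 0" using s by (simp add: \<mu>_def)
    have l0: "l \<ge> 0" using s z by (simp add: l_def)
    have pos: "?r1 \<ge> 0" "?r2 \<ge> 0" "?r3 \<ge> 0" by auto
    note \<omega> = that
    consider "?Y \<omega> < (z - 3) * s" | "?Y \<omega> > (z + 3) * s" | "\<omega> \<in> A" "?Y \<omega> \<le> (z + 3) * s"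
    proof -
      have "?Y \<omega> < (z - 3) * s \<or> ?Y \<omega> > (z + 3) * s \<or> (\<omega> \<in> A \<and> ?Y \<omega> \<le> (z + 3) * s)"
        using \<omega> unfolding A_def by simp linarith
      then show ?thesis using that(1) that(2) that(3) by blast
    qed
    then show ?thesis
    proof cases
      case 1
      then have "\<mu> * ?Y \<omega> \<le> \<mu> * ((z - 3) * s)" using m by (intro mult_left_mono) auto
      then have "exp (l * ?Y \<omega>) \<le> exp (\<mu> * ((z - 3) * s) + (l - \<mu>) * ?Y \<omega>)" by (simp add: left_diff_distrib)
      also have "\<dots> = ?r2" by (rule exp_add)
      finally show ?thesis using pos by linarith
    next
      case 2
      then have "\<mu> * ((z + 3) * s) \<le> \<mu> * ?Y \<omega>" using m by (intro mult_left_mono) auto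
      then have "exp (l * ?Y \<omega>) \<le> exp (- (\<mu> * ((z + 3) * s)) + (l + \<mu>) * ?Y \<omega>)" by (simp add: distrib_right)
      also have "\<dots> = ?r3" by (rule exp_add)
      finally show ?thesis using pos by linarith
    next
      case 3
      have "l * ?Y \<omega> \<le> l * ((z + 3) * s)" using 3 l0 by (intro mult_left_mono) auto
      also have "\<dots> = z\<^sup>2 + 3 * z" using s by (simp add: l_def power2_eq_square algebra_simps)
      finally have "exp (l * ?Y \<omega>) \<le> ?r1" using 3 by simp
      then show ?thesis using pos by linarith
    qed
  qed
  have "expectation (\<lambda>\<omega>. exp (l * ?Y \<omega>)) \<le> expectation (\<lambda>\<omega>. exp (z\<^sup>2 + 3 * z) * indicator A \<omega>
      + exp (\<mu> * ((z - 3) * s)) * exp ((l - \<mu>) * ?Y \<omega>) + exp (- (\<mu> * ((z + 3) * s))) * exp ((l + \<mu>) * ?Y \<omega>))"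
    by (intro integral_mono le mgf_rsum(1) I Bochner_Integration.integrable_add integrable_mult_right)
       (auto simp: emeasure_eq_measure)
  also have "\<dots> = exp (z\<^sup>2 + 3 * z) * prob A + exp (\<mu> * ((z - 3) * s)) * expectation (\<lambda>\<omega>. exp ((l - \<mu>) * ?Y \<omega>))
      + exp (- (\<mu> * ((z + 3) * s))) * expectation (\<lambda>\<omega>. exp ((l + \<mu>) * ?Y \<omega>))"
    by (simp add: Bochner_Integration.integral_add mgf_rsum(1)[OF I] emeasure_eq_measure)
  also have "\<dots> \<le> exp (z\<^sup>2 + 3 * z) * prob A + exp (\<mu> * ((z - 3) * s)) * exp ((l - \<mu>)\<^sup>2 * V / 2)
      + exp (- (\<mu> * ((z + 3) * s))) * exp ((l + \<mu>)\<^sup>2 * V / 2)"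
    by (intro add_mono mult_left_mono upper) auto
  also have "exp (\<mu> * ((z - 3) * s)) * exp ((l - \<mu>)\<^sup>2 * V / 2) = exp (z\<^sup>2 / 2 - 9/2)"
  proof -
    have "(l - \<mu>)\<^sup>2 * V = (z - 3)\<^sup>2" using s V(2) by (simp add: l_def \<mu>_def diff_divide_distrib[symmetric] power_divide)
    moreover have "\<mu> * ((z - 3) * s) = 3 * (z - 3)" using s by (simp add: \<mu>_def)
    moreover have "3 * (z - 3) + (z - 3)\<^sup>2 / 2 = z\<^sup>2 / 2 - 9/2" by (simp add: power2_eq_square algebra_simps add_divide_distrib diff_divide_distrib)
    ultimately show ?thesis by (simp flip: exp_add)
  qed
  also have "exp (- (\<mu> * ((z + 3) * s))) * exp ((l + \<mu>)\<^sup>2 * V / 2) = exp (z\<^sup>2 / 2 - 9/2)"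
  proof -
    have "(l + \<mu>)\<^sup>2 * V = (z + 3)\<^sup>2" using s V(2) by (simp add: l_def \<mu>_def add_divide_distrib[symmetric] power_divide)
    moreover have "\<mu> * ((z + 3) * s) = 3 * (z + 3)" using s by (simp add: \<mu>_def)
    moreover have "- (3 * (z + 3)) + (z + 3)\<^sup>2 / 2 = z\<^sup>2 / 2 - 9/2" by (simp add: power2_eq_square algebra_simps add_divide_distrib diff_divide_distrib)
    ultimately show ?thesis by (simp flip: exp_add)
  qed
  finally have "exp (z\<^sup>2 / 2 - 1/2) \<le> exp (z\<^sup>2 + 3 * z) * prob A + exp (z\<^sup>2 / 2 - 9/2) + exp (z\<^sup>2 / 2 - 9/2)"
    using lower by linarith
  moreover have "exp (z\<^sup>2 / 2 - 1/2) \<ge> exp (z\<^sup>2 / 2) * (1/2)"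
    using exp_ge_add_one_self[of "-1/2"] unfolding diff_conv_add_uminus exp_add by (intro mult_left_mono) auto
  moreover have "exp (z\<^sup>2 / 2 - 9/2) \<le> exp (z\<^sup>2 / 2) * (1/15)"
  proof -
    have "exp (9/2 :: real) \<ge> 15" using exp_lower_Taylor_quadratic[of "9/2"] by (simp add: power2_eq_square)
    then have "exp (- (9/2) :: real) \<le> 1/15" by (simp add: exp_minus field_simps)
    then show ?thesis unfolding diff_conv_add_uminus exp_add by (intro mult_left_mono) auto
  qed
  ultimately have "exp (z\<^sup>2 / 2) * (1/3) \<le> exp (z\<^sup>2 + 3 * z) * prob A" using exp_gt_zero[of "z\<^sup>2 / 2"] by linarith
  then have "exp (- (z\<^sup>2 + 3 * z)) * (exp (z\<^sup>2 / 2) * (1/3)) \<le> exp (- (z\<^sup>2 + 3 * z)) * (exp (z\<^sup>2 + 3 * z) * prob A)"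
    by (intro mult_left_mono) auto
  also have "\<dots> = prob A" by (simp add: mult.assoc[symmetric] flip: exp_add)
  finally have "exp (- (z\<^sup>2 + 3 * z) + z\<^sup>2 / 2) * (1/3) \<le> prob A" by (simp only: exp_add mult.assoc)
  moreover have "- (z\<^sup>2 + 3 * z) + z\<^sup>2 / 2 = - z\<^sup>2 / 2 - 3 * z" by simp
  ultimately show ?thesis by (simp add: A_def s_def mult.commute)
qed

end

text \<open>Divergence of the harmonic series makes the probability that none of the events occurs from some index on vanish.\<close>

lemma (in prob_space) borel_cantelli_indep:
  fixes Y :: "nat \<Rightarrow> 'a \<Rightarrow> real"
  assumes ind: "indep_vars (\<lambda>_. borel) Y UNIV"
    and p: "\<forall>\<^sub>F n in sequentially. prob {\<omega>\<in>space M. Y n \<omega> \<ge> c n} \<ge> 1 / real (Suc n)"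
  shows "AE \<omega> in M. \<exists>\<^sub>F n in sequentially. Y n \<omega> \<ge> c n"
proof -
  have [measurable]: "Y n \<in> borel_measurable M" for n using ind unfolding indep_vars_def by auto
  define B where "B n = Y n -` {..<c n} \<inter> space M" for n
  have [measurable]: "B n \<in> events" for n unfolding B_def by measurable
  have pB: "prob (B n) = 1 - prob {\<omega>\<in>space M. Y n \<omega> \<ge> c n}" for n
  proof -
    have "B n = space M - {\<omega>\<in>space M. Y n \<omega> \<ge> c n}" by (auto simp: B_def)
    then show ?thesis by (simp add: prob_compl)
  qed
  obtain n0 where n0: "\<And>n. n \<ge> n0 \<Longrightarrow> prob {\<omega>\<in>space M. Y n \<omega> \<ge> c n} \<ge> 1 / real (Suc n)"
    using p by (auto simp: eventually_sequentially)
  have null: "(\<Inter>n\<in>{N..}. B n) \<in> null_sets M" for N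
  proof -
    define N' where "N' = max N n0"
    have le: "prob (\<Inter>n\<in>{N..}. B n) \<le> exp (- (\<Sum>n\<in>{N'..<N' + Suc k}. 1 / real (Suc n)))" for k
    proof -
      have "prob (\<Inter>n\<in>{N..}. B n) \<le> prob (\<Inter>n\<in>{N'..<N' + Suc k}. B n)"
        by (rule finite_measure_mono) (auto simp: N'_def intro!: sets.finite_INT)
      also have "\<dots> = (\<Prod>n\<in>{N'..<N' + Suc k}. prob (B n))"
        unfolding B_def by (rule indep_varsD[OF ind]) auto
      also have "\<dots> \<le> (\<Prod>n\<in>{N'..<N' + Suc k}. exp (- (1 / real (Suc n))))"
      proof (rule prod_mono, intro conjI)
        fix n assume "n \<in> {N'..<N' + Suc k}"
        then have "prob (B n) \<le> 1 - 1 / real (Suc n)" using n0[of n] pB[of n] by (simp add: N'_def)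
        also have "\<dots> \<le> exp (- (1 / real (Suc n)))" using exp_ge_add_one_self[of "- (1 / real (Suc n))"] by simp
        finally show "prob (B n) \<le> exp (- (1 / real (Suc n)))" .
      qed simp
      also have "\<dots> = exp (- (\<Sum>n\<in>{N'..<N' + Suc k}. 1 / real (Suc n)))"
        by (simp only: exp_sum[symmetric] finite_atLeastLessThan sum_negf)
      finally show ?thesis .
    qed
    have "prob (\<Inter>n\<in>{N..}. B n) \<le> e" if e: "e > 0" for e
    proof -
      have "\<not> summable (\<lambda>n. 1 / real (Suc (n + N')))"
        using not_summable_harmonic[where 'a=real] summable_iff_shift[of "\<lambda>n. inverse (real n)" "Suc N'"]
        by (simp add: inverse_eq_divide)
      have "\<not> (\<forall>k. (\<Sum>n<k. 1 / real (Suc (n + N'))) \<le> - ln e)"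
      proof
        assume "\<forall>k. (\<Sum>n<k. 1 / real (Suc (n + N'))) \<le> - ln e"
        then have "summable (\<lambda>n. 1 / real (Suc (n + N')))" by (intro summableI_nonneg_bounded) auto
        with \<open>\<not> summable (\<lambda>n. 1 / real (Suc (n + N')))\<close> show False by blast
      qed
      then obtain k where k: "(\<Sum>n<k. 1 / real (Suc (n + N'))) > - ln e" by (meson not_le)
      have "(\<Sum>n\<in>{N'..<N' + Suc k}. 1 / real (Suc n)) = (\<Sum>n<Suc k. 1 / real (Suc (n + N')))"
        by (rule sum.reindex_bij_witness[of _ "\<lambda>n. n + N'" "\<lambda>n. n - N'"]) auto
      also have "\<dots> \<ge> (\<Sum>n<k. 1 / real (Suc (n + N')))" by simp
      finally have "exp (- (\<Sum>n\<in>{N'..<N' + Suc k}. 1 / real (Suc n))) \<le> exp (ln e)"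
        using k by (simp only: exp_le_cancel_iff)
      then show ?thesis using le[of k] e by simp
    qed
    then have "prob (\<Inter>n\<in>{N..}. B n) \<le> 0" by (rule field_le_epsilon[of _ 0, simplified])
    then show ?thesis by (intro null_setsI) (auto simp: emeasure_eq_measure measure_le_0_iff)
  qed
  have "AE \<omega> in M. \<forall>N. \<omega> \<notin> (\<Inter>n\<in>{N..}. B n)"
    unfolding AE_all_countable by (intro allI AE_not_in[OF null])
  then show ?thesis using AE_space
    by eventually_elim (auto simp: B_def frequently_sequentially not_less)
qed

section \<open>The lower bound in the law of the iterated logarithm\<close>

text \<open>\<open>\<tau>\<close> stands for \<open>ln (1/s)\<close>, so this is the reciprocal of the normalising factor of the second assertion.\<close>

definition lil_scale :: "real \<Rightarrow> real" where
  "lil_scale \<tau> = sqrt (2 * \<tau> * ln (ln \<tau>))"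

lemma sqrt_le_lil_scale:
  fixes d :: real
  assumes "d > 0" shows "\<forall>\<^sub>F \<tau> in at_top. sqrt \<tau> \<le> d * lil_scale \<tau>"
  unfolding lil_scale_def using assms by real_asymp

lemma const_le_lil_scale:
  fixes d C :: real
  assumes "d > 0" shows "\<forall>\<^sub>F \<tau> in at_top. C \<le> d * lil_scale \<tau>"
  unfolding lil_scale_def using assms by real_asymp

lemma lil_scale_mono:
  assumes "exp 1 \<le> \<tau>" "\<tau> \<le> \<tau>'"
  shows "lil_scale \<tau> \<le> lil_scale \<tau>'"
proof -
  have p: "0 < exp (1::real)" by simp
  have t: "0 < \<tau>" "0 < \<tau>'" using assms p by linarith+
  have "ln (exp 1) \<le> ln \<tau>" using t assms by (subst ln_le_cancel_iff) auto
  then have l1: "1 \<le> ln \<tau>" by simp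
  moreover have l2: "ln \<tau> \<le> ln \<tau>'" using t assms by (subst ln_le_cancel_iff) auto
  ultimately have "0 \<le> ln (ln \<tau>)" "ln (ln \<tau>) \<le> ln (ln \<tau>')" by (auto intro: ln_ge_zero)
  then show ?thesis unfolding lil_scale_def using t assms by (intro real_sqrt_le_mono mult_mono) auto
qed

lemma lil_scale_pos:
  assumes "\<tau> > exp 1"
  shows "lil_scale \<tau> > 0"
proof -
  have p: "0 < exp (1::real)" by simp
  have t: "0 < \<tau>" using assms p by linarith
  have "ln (exp 1) < ln \<tau>" using t assms by (subst ln_less_cancel_iff) auto
  then have "0 < ln (ln \<tau>)" by (simp add: ln_gt_zero)
  then show ?thesis using t by (simp add: lil_scale_def)
qed

text \<open>Successive ratios tend to infinity fast enough for \<open>lil_time n / lil_time (Suc n)\<close> to be summable, which makes the walk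
  up to \<open>lil_time n\<close> negligible at \<open>lil_time (Suc n)\<close>; yet \<open>ln (ln (lil_time n))\<close> is still
  \<open>ln n\<close> up to lower order, so that the probabilities in the lower bound have a divergent sum.\<close>

definition lil_time :: "nat \<Rightarrow> real" where
  "lil_time n = exp (real n * (ln (real n))\<^sup>2)"

lemma lil_time_mono: "m \<le> n \<Longrightarrow> lil_time m \<le> lil_time n"
proof (cases "m = 0")
  case False
  assume "m \<le> n"
  then have "(ln (real m))\<^sup>2 \<le> (ln (real n))\<^sup>2" using False by (intro power_mono) auto
  then show ?thesis using \<open>m \<le> n\<close> by (simp add: lil_time_def mult_mono)
qed (simp add: lil_time_def)

lemma lil_time_ge_1: "lil_time n \<ge> 1"
  by (simp add: lil_time_def)

lemma ln_ln_lil_time: "ln (ln (lil_time n)) = ln (real n * (ln (real n))\<^sup>2)"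
  by (simp add: lil_time_def)

text \<open>The right side is \<open>n powr (- q + o(1))\<close> with \<open>q < 1\<close>.\<close>

lemma lil_time_probability:
  fixes g q :: real
  assumes "0 < g" "q > 0" "q < 1"
  shows "\<forall>\<^sub>F n in sequentially. 1 / real (Suc n) \<le>
    1/3 * exp (- (q * (2 * ln (ln (lil_time (Suc n))))) / 2 - 3 * (g * sqrt (2 * ln (ln (lil_time (Suc n))))))"
  unfolding ln_ln_lil_time using assms by real_asymp

text \<open>One factor \<open>g\<close> is the loss in the tail estimate; the second absorbs the shift by three standard deviations, the difference
  between \<open>lil_time (Suc n)\<close> and the block variance, and two negligible errors of the size of a standard deviation.\<close>

lemma lil_time_dominates:
  fixes g C :: real
  assumes "0 < g" "g < 1" "C > 0"
  shows "\<forall>\<^sub>F n in sequentially. g * g * lil_scale (lil_time (Suc n)) \<le>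
     (g * sqrt (2 * ln (ln (lil_time (Suc n)))) - 3) * sqrt (lil_time (Suc n) - lil_time n - C) - 2 * sqrt (lil_time (Suc n))"
  unfolding lil_scale_def ln_ln_lil_time unfolding lil_time_def using assms by real_asymp

lemma lil_time_variance:
  fixes g C :: real
  assumes "0 < g" "C > 0"
  shows "\<forall>\<^sub>F n in sequentially. (g * sqrt (2 * ln (ln (lil_time (Suc n))))) ^ 4 \<le> lil_time (Suc n) - lil_time n - C"
  unfolding ln_ln_lil_time unfolding lil_time_def using assms by real_asymp

lemma lil_time_large:
  fixes g :: real
  assumes "0 < g"
  shows "\<forall>\<^sub>F n in sequentially. 3 \<le> g * sqrt (2 * ln (ln (lil_time (Suc n))))"
  unfolding ln_ln_lil_time using assms by real_asymp

lemma summable_lil_time_ratio: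
  fixes C :: real
  shows "summable (\<lambda>n. 4 * (lil_time n + C) / lil_time (Suc n))"
proof (rule summable_comparison_test_bigo)
  have "summable (\<lambda>n. real n powr (-2))" by (simp only: summable_real_powr_iff)
  moreover have "norm (real n powr (-2)) = real n powr (-2)" for n
    by (simp only: real_norm_def abs_of_nonneg powr_ge_zero)
  ultimately show "summable (\<lambda>n. norm (real n powr (-2)))" by (simp only:)
  show "(\<lambda>n. 4 * (lil_time n + C) / lil_time (Suc n)) \<in> O(\<lambda>n. real n powr (-2))"
    unfolding lil_time_def by real_asymp
qed

lemma filterlim_lil_time: "filterlim (\<lambda>n. lil_time (Suc n)) at_top sequentially"
  unfolding lil_time_def by real_asymp

context rademacher
begin

lemma walk_increment:
  assumes "\<tau> \<le> \<tau>'"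
  shows "walk \<tau>' \<omega> - walk \<tau> \<omega> = rsum (early_primes \<tau>' - early_primes \<tau>) (prime_weight 0) \<omega>"
  unfolding walk_def rsum_def
  by (subst sum_diff) (use early_primes_mono[OF assms] in auto)

lemma early_primes_increment:
  assumes "0 \<le> \<tau>" "\<tau> \<le> \<tau>'"
  shows "\<bar>(\<Sum>p\<in>early_primes \<tau>' - early_primes \<tau>. (prime_weight 0 p)\<^sup>2) - (\<tau>' - \<tau>)\<bar> \<le> 2 * var_const"
proof -
  have "(\<Sum>p\<in>early_primes \<tau>' - early_primes \<tau>. (prime_weight 0 p)\<^sup>2) =
     (\<Sum>p\<in>early_primes \<tau>'. (prime_weight 0 p)\<^sup>2) - (\<Sum>p\<in>early_primes \<tau>. (prime_weight 0 p)\<^sup>2)"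
    by (subst sum_diff) (use early_primes_mono[OF assms(2)] in auto)
  then show ?thesis using early_primes_sum[of \<tau>] early_primes_sum[of \<tau>'] assms by auto
qed

lemma prime_weight_0_le_1: "prime p \<Longrightarrow> \<bar>prime_weight 0 p\<bar> \<le> 1"
  using prime_ge_1_nat[of p] ge_one_powr_ge_zero[of "real p" "1/2"] by (simp add: prime_weight_def)

lemma disjoint_early_primes:
  fixes t :: "nat \<Rightarrow> real"
  assumes "\<And>m n. m \<le> n \<Longrightarrow> t m \<le> t n"
  shows "disjoint_family_on (\<lambda>n. early_primes (t (Suc n)) - early_primes (t n)) A"
  unfolding disjoint_family_on_def
proof (intro ballI impI)
  fix m n :: nat assume "m \<noteq> n"
  then consider "Suc m \<le> n" | "Suc n \<le> m" by linarith
  then show "(early_primes (t (Suc m)) - early_primes (t m)) \<inter> (early_primes (t (Suc n)) - early_primes (t n)) = {}"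
    by cases (use early_primes_mono[OF assms] in blast)+
qed

text \<open>The increments of the walk between consecutive times \<open>lil_time n\<close> are independent, so the second
  Borel-Cantelli lemma makes them large infinitely often. The process at \<open>lil_time (Suc n)\<close> differs from that
  increment by the earlier part of the walk and by the error of the walk approximation, both \<open>o(sqrt (lil_time (Suc n)))\<close>.\<close>

lemma AE_lil_lower:
  assumes g: "0 < g" "g < 1"
  shows "AE \<omega> in M. \<exists>\<^sub>F n in sequentially. gproc (lil_time (Suc n)) \<omega> \<ge> g * g * lil_scale (lil_time (Suc n))"
proof -
  define C where "C = 2 * var_const"
  have C: "C > 0" using var_const_pos by (simp add: C_def)
  define K where "K n = early_primes (lil_time (Suc n)) - early_primes (lil_time n)" for n
  define V where "V n = (\<Sum>p\<in>K n. (prime_weight 0 p)\<^sup>2)" for n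
  define z where "z n = g * sqrt (2 * ln (ln (lil_time (Suc n))))" for n
  have lt0: "lil_time n \<ge> 0" for n using lil_time_ge_1[of n] by simp
  have V: "V n \<ge> lil_time (Suc n) - lil_time n - C" for n
    using early_primes_increment[OF lt0 lil_time_mono[of n "Suc n"]] by (simp add: V_def K_def C_def)
  have K: "finite (K n)" "p \<in> K n \<Longrightarrow> prime p" for n p
    by (auto simp: K_def early_primes_prime)
  define Y where "Y n = rsum (K n) (prime_weight 0)" for n
  have ind: "indep_vars (\<lambda>_. borel) Y UNIV"
    unfolding Y_def by (rule indep_rsum_blocks)
      (use K in \<open>auto simp: K_def intro!: disjoint_early_primes lil_time_mono\<close>)
  have ev1: "\<forall>\<^sub>F n in sequentially. 1 / real (Suc n) \<le> prob {\<omega>\<in>space M. Y n \<omega> \<ge> (z n - 3) * sqrt (V n)}"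
  proof -
    have "g * g < 1 * 1" using g by (intro mult_strict_mono) auto
    then have "\<forall>\<^sub>F n in sequentially. 1 / real (Suc n) \<le> 1/3 * exp (- (g\<^sup>2 * (2 * ln (ln (lil_time (Suc n))))) / 2 - 3 * z n)"
      unfolding z_def using g by (intro lil_time_probability) (auto simp: power2_eq_square)
    moreover have "\<forall>\<^sub>F n in sequentially. z n ^ 4 \<le> lil_time (Suc n) - lil_time n - C"
      unfolding z_def by (rule lil_time_variance[OF g(1) C])
    moreover have "\<forall>\<^sub>F n in sequentially. 3 \<le> z n" unfolding z_def by (rule lil_time_large[OF g(1)])
    ultimately show ?thesis
    proof eventually_elim
      case (elim n)
      have z1: "z n \<ge> 1" using elim(3) by simp
      have V4: "z n ^ 4 \<le> V n" using elim(2) V[of n] by linarith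
      have "z n ^ 2 \<le> z n ^ 4" using z1 by (intro power_increasing) auto
      moreover have "z n ^ 4 > 0" using z1 by simp
      ultimately have c: "V n > 0" "(z n)\<^sup>2 \<le> V n" "z n ^ 4 \<le> 2 * V n" "z n \<ge> 0"
        using V4 z1 by linarith+
      have "1/3 * exp (- (z n)\<^sup>2 / 2 - 3 * z n) \<le> prob {\<omega>\<in>space M. Y n \<omega> \<ge> (z n - 3) * sqrt (V n)}"
        unfolding Y_def by (rule rsum_lower_tail[OF K prime_weight_0_le_1[OF K(2)] V_def c(1,4,2,3)])
      moreover have "(z n)\<^sup>2 = g\<^sup>2 * (2 * ln (ln (lil_time (Suc n))))"
      proof -
        have "z n > 0" using z1 by simp
        then have "sqrt (2 * ln (ln (lil_time (Suc n)))) > 0" unfolding z_def using g(1) by (simp only: zero_less_mult_pos)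
        then show ?thesis by (simp add: z_def power_mult_distrib)
      qed
      ultimately show ?case using elim(1) by simp
    qed
  qed
  have "AE \<omega> in M. \<exists>\<^sub>F n in sequentially. Y n \<omega> \<ge> (z n - 3) * sqrt (V n)"
    by (rule borel_cantelli_indep[OF ind ev1])
  moreover have "AE \<omega> in M. (\<lambda>n. (gproc (lil_time (Suc n)) \<omega> - walk (lil_time (Suc n)) \<omega>) / sqrt (lil_time (Suc n))) \<longlonglongrightarrow> 0"
  proof (rule AE_tendsto_zero_second_moment[OF _ _ summable_lil_time_ratio[of var_const]])
    fix n
    let ?T = "lil_time (Suc n)"
    have T: "?T > 0" using lil_time_ge_1[of "Suc n"] by simp
    have "subgaussian M ((1 / sqrt ?T)\<^sup>2 * var_const) (\<lambda>\<omega>. 1 / sqrt ?T * (gproc ?T \<omega> - walk ?T \<omega>))"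
      by (rule subgaussian_scale[OF subgaussian_gproc_walk[OF lt0]])
    from subgaussian_second_moment[OF this] T var_const_pos
    have "(\<integral>\<^sup>+\<omega>. ennreal (((gproc ?T \<omega> - walk ?T \<omega>) / sqrt ?T)\<^sup>2) \<partial>M) \<le> ennreal (4 * ((1 / sqrt ?T)\<^sup>2 * var_const))"
      by simp
    also have "\<dots> \<le> ennreal (4 * (lil_time n + var_const) / ?T)"
      using T lt0[of n] by (intro ennreal_leI) (simp add: power_divide field_simps)
    finally show "(\<integral>\<^sup>+\<omega>. ennreal (((gproc ?T \<omega> - walk ?T \<omega>) / sqrt ?T)\<^sup>2) \<partial>M) \<le> ennreal (4 * (lil_time n + var_const) / ?T)" .
    show "4 * (lil_time n + var_const) / ?T \<ge> 0" using T lt0[of n] var_const_pos by simp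
  qed measurable
  moreover have "AE \<omega> in M. (\<lambda>n. walk (lil_time n) \<omega> / sqrt (lil_time (Suc n))) \<longlonglongrightarrow> 0"
  proof (rule AE_tendsto_zero_second_moment[OF _ _ summable_lil_time_ratio[of var_const]])
    fix n
    let ?T = "lil_time (Suc n)"
    have T: "?T > 0" using lil_time_ge_1[of "Suc n"] by simp
    have "subgaussian M ((1 / sqrt ?T)\<^sup>2 * (lil_time n + var_const)) (\<lambda>\<omega>. 1 / sqrt ?T * walk (lil_time n) \<omega>)"
      by (rule subgaussian_scale[OF subgaussian_walk[OF lt0]])
    from subgaussian_second_moment[OF this] T var_const_pos lt0[of n]
    have "(\<integral>\<^sup>+\<omega>. ennreal ((walk (lil_time n) \<omega> / sqrt ?T)\<^sup>2) \<partial>M) \<le> ennreal (4 * ((1 / sqrt ?T)\<^sup>2 * (lil_time n + var_const)))"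
      by (simp add: add_nonneg_pos)
    also have "4 * ((1 / sqrt ?T)\<^sup>2 * (lil_time n + var_const)) = 4 * (lil_time n + var_const) / ?T"
      using T by (simp add: power_divide)
    finally show "(\<integral>\<^sup>+\<omega>. ennreal ((walk (lil_time n) \<omega> / sqrt ?T)\<^sup>2) \<partial>M) \<le> ennreal (4 * (lil_time n + var_const) / ?T)" .
    show "4 * (lil_time n + var_const) / ?T \<ge> 0" using T lt0[of n] var_const_pos by simp
  qed measurable
  ultimately show ?thesis
  proof eventually_elim
    fix \<omega> assume io: "\<exists>\<^sub>F n in sequentially. Y n \<omega> \<ge> (z n - 3) * sqrt (V n)"
      and r1: "(\<lambda>n. (gproc (lil_time (Suc n)) \<omega> - walk (lil_time (Suc n)) \<omega>) / sqrt (lil_time (Suc n))) \<longlonglongrightarrow> 0"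
      and r2: "(\<lambda>n. walk (lil_time n) \<omega> / sqrt (lil_time (Suc n))) \<longlonglongrightarrow> 0"
    have "\<forall>\<^sub>F n in sequentially. (gproc (lil_time (Suc n)) \<omega> - walk (lil_time (Suc n)) \<omega>) / sqrt (lil_time (Suc n)) > -1"
      "\<forall>\<^sub>F n in sequentially. walk (lil_time n) \<omega> / sqrt (lil_time (Suc n)) > -1"
      using order_tendstoD(1)[OF r1, of "-1"] order_tendstoD(1)[OF r2, of "-1"] by auto
    moreover have "\<forall>\<^sub>F n in sequentially. g * g * lil_scale (lil_time (Suc n)) \<le>
       (z n - 3) * sqrt (lil_time (Suc n) - lil_time n - C) - 2 * sqrt (lil_time (Suc n))"
      unfolding z_def by (rule lil_time_dominates[OF g C])
    moreover have "\<forall>\<^sub>F n in sequentially. 3 \<le> z n" unfolding z_def by (rule lil_time_large[OF g(1)])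
    ultimately have "\<forall>\<^sub>F n in sequentially. Y n \<omega> \<ge> (z n - 3) * sqrt (V n) \<longrightarrow> gproc (lil_time (Suc n)) \<omega> \<ge> g * g * lil_scale (lil_time (Suc n))"
    proof eventually_elim
      case (elim n)
      let ?T = "lil_time (Suc n)"
      have T: "sqrt ?T > 0" using lil_time_ge_1[of "Suc n"] by simp
      have e1: "gproc ?T \<omega> - walk ?T \<omega> > - sqrt ?T" "walk (lil_time n) \<omega> > - sqrt ?T"
        using elim(1,2) T by (simp_all add: less_divide_eq)
      have e2: "Y n \<omega> = walk ?T \<omega> - walk (lil_time n) \<omega>"
        unfolding Y_def K_def by (rule walk_increment[symmetric]) (simp add: lil_time_mono)
      have e3: "(z n - 3) * sqrt (?T - lil_time n - C) \<le> (z n - 3) * sqrt (V n)"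
        using elim(4) V[of n] by (intro mult_left_mono) auto
      show ?case
      proof
        assume "(z n - 3) * sqrt (V n) \<le> Y n \<omega>"
        then show "g * g * lil_scale ?T \<le> gproc ?T \<omega>" using e1 e2 e3 elim(3) by linarith
      qed
    qed
    then show "\<exists>\<^sub>F n in sequentially. gproc (lil_time (Suc n)) \<omega> \<ge> g * g * lil_scale (lil_time (Suc n))"
      by (rule frequently_rev_mp[OF io])
  qed
qed

section \<open>The upper bound in the law of the iterated logarithm\<close>

text \<open>Chaining on a single block, rescaled to the unit interval.\<close>

lemma gproc_block_oscillation:
  assumes t: "0 \<le> \<tau>" "\<tau> < \<tau>'" and lam: "lam > 0" and m: "m \<ge> 2"
  shows "\<exists>E\<in>events. prob E \<le> 5 * chain_const m * 100 ^ m * ((\<tau>' - \<tau>) / lam\<^sup>2) ^ m \<and>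
    (\<forall>\<omega>\<in>space M - E. good_signs \<omega> \<longrightarrow> (\<forall>u. \<tau> \<le> u \<longrightarrow> u < \<tau>' \<longrightarrow> \<bar>gproc u \<omega> - gproc \<tau> \<omega>\<bar> \<le> lam))"
proof -
  let ?l = "\<tau>' - \<tau>"
  let ?X = "\<lambda>t \<omega>. gproc (\<tau> + ?l * t) \<omega>"
  have l: "?l > 0" using t by simp
  have "\<exists>E\<in>events. prob E \<le> 5 * real 1 * chain_const m * 100 ^ m * 2 ^ 0 * (?l / 2 ^ 0 / lam\<^sup>2) ^ m \<and>
    (\<forall>\<omega>\<in>space M - E.
       (\<forall>j<1 * 2 ^ 0. \<bar>?X (real (Suc j) / 2 ^ 0) \<omega> - ?X (real j / 2 ^ 0) \<omega>\<bar> \<le> lam) \<and>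
       (continuous_on {0..} (\<lambda>t. ?X t \<omega>) \<longrightarrow>
          (\<forall>t. 0 \<le> t \<longrightarrow> t < real 1 \<longrightarrow> \<bar>?X t \<omega> - ?X (dyadic_floor 0 t) \<omega>\<bar> \<le> lam)))"
  proof (rule chaining)
    fix s u x :: real assume su: "0 \<le> s" "s \<le> u" "u \<le> real 1" "x > 0"
    have "prob {\<omega>\<in>space M. \<bar>?X u \<omega> - ?X s \<omega>\<bar> \<ge> x} \<le> chain_const m * ((\<tau> + ?l * u - (\<tau> + ?l * s)) / x\<^sup>2) ^ m"
      using t l su by (intro gproc_increment_tail) (auto intro!: mult_left_mono)
    then show "prob {\<omega>\<in>space M. \<bar>?X u \<omega> - ?X s \<omega>\<bar> \<ge> x} \<le> chain_const m * (?l * (u - s) / x\<^sup>2) ^ m"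
      by (simp add: right_diff_distrib)
  qed (use l lam m chain_const_nonneg in auto)
  then obtain E where E: "E \<in> events" "prob E \<le> 5 * chain_const m * 100 ^ m * (?l / lam\<^sup>2) ^ m"
    "\<And>\<omega> t. \<omega> \<in> space M - E \<Longrightarrow> continuous_on {0..} (\<lambda>t. ?X t \<omega>) \<Longrightarrow> 0 \<le> t \<Longrightarrow> t < 1 \<Longrightarrow>
       \<bar>?X t \<omega> - ?X (dyadic_floor 0 t) \<omega>\<bar> \<le> lam" by auto
  have "\<bar>gproc u \<omega> - gproc \<tau> \<omega>\<bar> \<le> lam" if \<omega>: "\<omega> \<in> space M - E" "good_signs \<omega>" and u: "\<tau> \<le> u" "u < \<tau>'" for \<omega> u
  proof -
    define t where "t = (u - \<tau>) / ?l"
    have t: "0 \<le> t" "t < 1" using u l by (auto simp: t_def)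
    have "continuous_on {0..} (\<lambda>t. ?X t \<omega>)"
      by (rule continuous_on_compose2[OF continuous_on_gproc[OF \<omega>(2), of UNIV]]) (auto intro!: continuous_intros)
    from E(3)[OF \<omega>(1) this t] have "\<bar>?X t \<omega> - ?X (dyadic_floor 0 t) \<omega>\<bar> \<le> lam" .
    moreover have "\<lfloor>t\<rfloor> = 0" using t by (simp add: floor_eq_iff)
    moreover have "\<tau> + ?l * t = u" using l by (simp add: t_def)
    ultimately show ?thesis by simp
  qed
  then show ?thesis using E(1,2) by blast
qed

text \<open>The times \<open>exp (n powr \<alpha>)\<close> with \<open>\<alpha> < 1\<close> are sparse enough for the Gaussian tail bound at level
  \<open>1 + d\<close> to be summable, and dense enough for the relative block length to tend to \<open>0\<close> polynomially,
  so that a high moment in the chaining estimate makes the oscillation over a block negligible.\<close>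

lemma AE_lil_upper:
  assumes d: "0 < d"
  shows "AE \<omega> in M. \<forall>\<^sub>F \<tau> in at_top. \<bar>gproc \<tau> \<omega>\<bar> \<le> (1 + 2 * d) * lil_scale \<tau>"
proof -
  (* The tail bound at time n is n powr (- (1 + d)^2 * alpha) up to lower order, with exponent
     - (1 + d) for this alpha. *)
  define \<alpha> where "\<alpha> = 1 / (1 + d)"
  have \<alpha>: "0 < \<alpha>" "\<alpha> < 1" "(1 + d) * \<alpha> = 1" using d by (auto simp: \<alpha>_def)
  define \<tau> where "\<tau> n = exp (real n powr \<alpha>)" for n
  have \<tau>: "\<tau> n \<ge> 1" "\<tau> n < \<tau> (Suc n)" for n
    using \<alpha> by (auto simp: \<tau>_def intro!: powr_less_mono2)
  have \<tau>lim: "filterlim \<tau> at_top sequentially" unfolding \<tau>_def using \<alpha>(1) by real_asymp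
  have lnln: "ln (ln (\<tau> n)) = \<alpha> * ln (real n)" for n by (cases "n = 0") (auto simp: \<tau>_def ln_powr)
  have scale: "lil_scale (\<tau> n) \<ge> 0" "(lil_scale (\<tau> n))\<^sup>2 = 2 * \<tau> n * (\<alpha> * ln (real n))" for n
  proof -
    have "ln (real n) \<ge> 0" by (cases "n = 0") auto
    then have "2 * \<tau> n * (\<alpha> * ln (real n)) \<ge> 0" using \<tau>(1)[of n] \<alpha> by simp
    then show "lil_scale (\<tau> n) \<ge> 0" "(lil_scale (\<tau> n))\<^sup>2 = 2 * \<tau> n * (\<alpha> * ln (real n))"
      by (auto simp: lil_scale_def lnln)
  qed
  define A where "A n = {\<omega>\<in>space M. \<bar>gproc (\<tau> n) \<omega>\<bar> \<ge> (1 + d) * lil_scale (\<tau> n)}" for n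
  have A[measurable]: "A n \<in> events" for n unfolding A_def by measurable
  have pA: "\<forall>\<^sub>F n in sequentially. norm (prob (A n)) \<le> 2 * real n powr (- (1 + d / 2))"
  proof -
    have "\<forall>\<^sub>F t in at_top. (1 + d) * (t / (t + var_const)) \<ge> 1 + d / 2" using d var_const_pos(1) by real_asymp
    from eventually_compose_filterlim[OF this \<tau>lim] show ?thesis
      using eventually_gt_at_top[of 0]
    proof eventually_elim
      case (elim n)
      have t0: "\<tau> n > 0" "\<tau> n + var_const > 0" using \<tau>(1)[of n] var_const_pos by auto
      have "prob (A n) \<le> 2 * exp (- (((1 + d) * lil_scale (\<tau> n))\<^sup>2 / (2 * (\<tau> n + var_const))))"
        unfolding A_def using t0 d scale(1) by (intro subgaussian_tail_abs subgaussian_gproc) auto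
      also have "((1 + d) * lil_scale (\<tau> n))\<^sup>2 / (2 * (\<tau> n + var_const)) = ((1 + d) * \<alpha>) * ((1 + d) * (\<tau> n / (\<tau> n + var_const)) * ln (real n))"
      proof -
        have e1: "((1 + d) * lil_scale (\<tau> n))\<^sup>2 = (1 + d)\<^sup>2 * (2 * \<tau> n * (\<alpha> * ln (real n)))"
          by (simp only: power_mult_distrib scale(2))
        have e2: "(1 + d)\<^sup>2 * (2 * t * (\<alpha> * y)) / (2 * u) = ((1 + d) * \<alpha>) * ((1 + d) * (t / u) * y)" if "u > 0" for t u y
          using that by (simp add: power2_eq_square)
        show ?thesis unfolding e1 by (rule e2[OF t0(2)])
      qed
      also have "\<dots> = (1 + d) * (\<tau> n / (\<tau> n + var_const)) * ln (real n)" by (simp only: \<alpha>(3) mult_1)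
      also have "2 * exp (- ((1 + d) * (\<tau> n / (\<tau> n + var_const)) * ln (real n))) \<le> 2 * exp (- ((1 + d / 2) * ln (real n)))"
      proof -
        have "(1 + d / 2) * ln (real n) \<le> (1 + d) * (\<tau> n / (\<tau> n + var_const)) * ln (real n)"
          using elim by (intro mult_right_mono) auto
        then show ?thesis by simp
      qed
      also have "\<dots> = 2 * real n powr (- (1 + d / 2))" using elim by (simp add: powr_def algebra_simps)
      finally show ?case by simp
    qed
  qed
  have sA: "summable (\<lambda>n. prob (A n))"
  proof (rule summable_comparison_test_ev[OF pA])
    have "- (1 + d / 2) < -1" using d by simp
    then show "summable (\<lambda>n. 2 * real n powr (- (1 + d / 2)))"
      by (intro summable_mult) (simp only: summable_real_powr_iff)
  qed
  (* The relative block length is of order n powr (alpha - 1); its m-th power must be summable. *)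
  define m where "m = nat \<lceil>2 / (1 - \<alpha>)\<rceil> + 2"
  have m: "m \<ge> 2" "(\<alpha> - 1) * real m \<le> -2"
  proof -
    have "real m \<ge> 2 / (1 - \<alpha>)" unfolding m_def by linarith
    then have "2 \<le> real m * (1 - \<alpha>)" using \<alpha> by (simp add: divide_le_eq)
    then show "(\<alpha> - 1) * real m \<le> -2" by (simp add: algebra_simps)
  qed (simp add: m_def)
  let ?b = "\<lambda>n. 5 * chain_const m * 100 ^ m * ((\<tau> (Suc n) - \<tau> n) / (sqrt (\<tau> n))\<^sup>2) ^ m"
  have "\<exists>E\<in>events. prob E \<le> ?b n \<and>
    (\<forall>\<omega>\<in>space M - E. good_signs \<omega> \<longrightarrow> (\<forall>u. \<tau> n \<le> u \<longrightarrow> u < \<tau> (Suc n) \<longrightarrow> \<bar>gproc u \<omega> - gproc (\<tau> n) \<omega>\<bar> \<le> sqrt (\<tau> n)))" for n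
  proof (rule gproc_block_oscillation[OF _ \<tau>(2) _ m(1)])
    show "0 \<le> \<tau> n" "0 < sqrt (\<tau> n)" using \<tau>(1)[of n] by auto
  qed
  then obtain E where E: "\<And>n. E n \<in> events" "\<And>n. prob (E n) \<le> ?b n"
    "\<And>n \<omega> u. \<omega> \<in> space M - E n \<Longrightarrow> good_signs \<omega> \<Longrightarrow> \<tau> n \<le> u \<Longrightarrow> u < \<tau> (Suc n) \<Longrightarrow> \<bar>gproc u \<omega> - gproc (\<tau> n) \<omega>\<bar> \<le> sqrt (\<tau> n)"
    by metis
  have sE: "summable (\<lambda>n. prob (E n))"
  proof (rule summable_comparison_test_bigo)
    have "summable (\<lambda>n. real n powr (-2))" by (simp only: summable_real_powr_iff)
    moreover have "norm (real n powr (-2)) = real n powr (-2)" for n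
      by (simp only: real_norm_def abs_of_nonneg powr_ge_zero)
    ultimately show "summable (\<lambda>n. norm (real n powr (-2)))" by (simp only:)
    have "(\<lambda>n. prob (E n)) \<in> O(?b)"
      by (rule landau_o.big_mono) (use E(2) in \<open>auto intro!: always_eventually order_trans[OF _ abs_ge_self]\<close>)
    also have "(?b) \<in> O(\<lambda>n. ((\<tau> (Suc n) - \<tau> n) / (sqrt (\<tau> n))\<^sup>2) ^ m)" by simp
    also have "(\<lambda>n. ((\<tau> (Suc n) - \<tau> n) / (sqrt (\<tau> n))\<^sup>2) ^ m) \<in> O(\<lambda>n. (real n powr (\<alpha> - 1)) ^ m)"
    proof (rule landau_o.big_power)
      have "(\<tau> (Suc n) - \<tau> n) / (sqrt (\<tau> n))\<^sup>2 = exp (real (Suc n) powr \<alpha> - real n powr \<alpha>) - 1" for n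
        by (simp add: \<tau>_def exp_diff diff_divide_distrib)
      moreover have "(\<lambda>n. exp (real (Suc n) powr \<alpha> - real n powr \<alpha>) - 1) \<in> O(\<lambda>n. real n powr (\<alpha> - 1))"
        using \<alpha>(1,2) by real_asymp
      ultimately show "(\<lambda>n. (\<tau> (Suc n) - \<tau> n) / (sqrt (\<tau> n))\<^sup>2) \<in> O(\<lambda>n. real n powr (\<alpha> - 1))" by simp
    qed
    also have "(\<lambda>n. (real n powr (\<alpha> - 1)) ^ m) \<in> O(\<lambda>n. real n powr (-2))"
    proof (rule landau_o.big_mono)
      show "\<forall>\<^sub>F n in sequentially. norm ((real n powr (\<alpha> - 1)) ^ m) \<le> norm (real n powr (-2))"
        using eventually_ge_at_top[of 1]
      proof eventually_elim
        case (elim n)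
        have "(real n powr (\<alpha> - 1)) ^ m = real n powr ((\<alpha> - 1) * real m)"
          using elim by (simp add: powr_power mult.commute)
        also have "\<dots> \<le> real n powr (-2)" using elim m(2) by (intro powr_mono) auto
        finally show ?case by (simp only: real_norm_def abs_of_nonneg powr_ge_zero zero_le_power)
      qed
    qed
    finally show "(\<lambda>n. prob (E n)) \<in> O(\<lambda>n. real n powr (-2))" .
  qed
  have "AE \<omega> in M. \<forall>\<^sub>F n in sequentially. \<omega> \<in> space M - A n"
    by (rule borel_cantelli_AE1[OF A _ sA]) (simp add: emeasure_eq_measure)
  moreover have "AE \<omega> in M. \<forall>\<^sub>F n in sequentially. \<omega> \<in> space M - E n"
    by (rule borel_cantelli_AE1[OF E(1) _ sE]) (simp add: emeasure_eq_measure)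
  ultimately show ?thesis using AE_good_signs
  proof eventually_elim
    fix \<omega> assume evA: "\<forall>\<^sub>F n in sequentially. \<omega> \<in> space M - A n"
      and evE: "\<forall>\<^sub>F n in sequentially. \<omega> \<in> space M - E n" and gs: "good_signs \<omega>"
    have "\<forall>\<^sub>F n in sequentially. sqrt (\<tau> n) \<le> d * lil_scale (\<tau> n)"
      by (rule eventually_compose_filterlim[OF sqrt_le_lil_scale[OF d] \<tau>lim])
    moreover have "\<forall>\<^sub>F n in sequentially. exp 1 \<le> \<tau> n"
      using \<tau>lim by (auto simp: filterlim_at_top)
    ultimately have "\<forall>\<^sub>F n in sequentially. \<forall>u. \<tau> n \<le> u \<longrightarrow> u < \<tau> (Suc n) \<longrightarrow> \<bar>gproc u \<omega>\<bar> \<le> (1 + 2 * d) * lil_scale u"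
      using evA evE
    proof eventually_elim
      case (elim n)
      show ?case
      proof (intro allI impI)
        fix u assume u: "\<tau> n \<le> u" "u < \<tau> (Suc n)"
        have "\<bar>gproc (\<tau> n) \<omega>\<bar> \<le> (1 + d) * lil_scale (\<tau> n)" using elim(3) by (auto simp: A_def)
        moreover have "\<bar>gproc u \<omega> - gproc (\<tau> n) \<omega>\<bar> \<le> sqrt (\<tau> n)" by (rule E(3)[OF elim(4) gs u])
        moreover have "(1 + 2 * d) * lil_scale (\<tau> n) = (1 + d) * lil_scale (\<tau> n) + d * lil_scale (\<tau> n)" by (simp add: algebra_simps)
        ultimately have "\<bar>gproc u \<omega>\<bar> \<le> (1 + 2 * d) * lil_scale (\<tau> n)" using elim(1) by linarith
        also have "\<dots> \<le> (1 + 2 * d) * lil_scale u" using d u elim(2) by (intro mult_left_mono lil_scale_mono) auto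
        finally show "\<bar>gproc u \<omega>\<bar> \<le> (1 + 2 * d) * lil_scale u" .
      qed
    qed
    then obtain N where N: "\<And>n u. n \<ge> N \<Longrightarrow> \<tau> n \<le> u \<Longrightarrow> u < \<tau> (Suc n) \<Longrightarrow> \<bar>gproc u \<omega>\<bar> \<le> (1 + 2 * d) * lil_scale u"
      by (auto simp: eventually_sequentially)
    have "\<forall>\<^sub>F u in at_top. real N + 1 \<le> ln u powr (1 / \<alpha>)" using \<alpha>(1) by real_asymp
    then show "\<forall>\<^sub>F u in at_top. \<bar>gproc u \<omega>\<bar> \<le> (1 + 2 * d) * lil_scale u"
      using eventually_ge_at_top[of 1]
    proof eventually_elim
      case (elim u)
      let ?y = "ln u powr (1 / \<alpha>)"
      define n where "n = nat \<lfloor>?y\<rfloor>"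
      have n: "n \<ge> N" "real n \<le> ?y" "?y < real (Suc n)" using elim(1) unfolding n_def by linarith+
      have y: "?y powr \<alpha> = ln u" using \<alpha> elim(2) by (simp add: powr_powr)
      have "real n powr \<alpha> \<le> ?y powr \<alpha>" using n \<alpha> by (intro powr_mono2) auto
      then have 1: "exp (real n powr \<alpha>) \<le> exp (ln u)" by (simp only: y exp_le_cancel_iff)
      have "?y powr \<alpha> < real (Suc n) powr \<alpha>" using n \<alpha> by (intro powr_less_mono2) auto
      then have 2: "exp (ln u) < exp (real (Suc n) powr \<alpha>)" by (simp only: y exp_less_cancel_iff)
      show ?case using 1 2 elim(2) by (intro N[OF n(1)]) (auto simp: \<tau>_def)
    qed
  qed
qed

text \<open>The symmetry that turns the lower bound for the upper limit into one for the lower limit.\<close>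

lemma rademacher_uminus: "rademacher M (\<lambda>p \<omega>. - \<epsilon> p \<omega>)"
proof unfold_locales
  show "indep_vars (\<lambda>_. borel) (\<lambda>p \<omega>. - \<epsilon> p \<omega>) {p. prime p}"
    by (rule indep_vars_compose2[OF indep]) auto
  fix p :: nat assume p: "prime p"
  have "{\<omega> \<in> space M. - \<epsilon> p \<omega> = 1} = {\<omega> \<in> space M. \<epsilon> p \<omega> = -1}" by auto
  then show "prob {\<omega> \<in> space M. - \<epsilon> p \<omega> = 1} = 1/2" using half_neg[OF p] by simp
  show "prob {\<omega> \<in> space M. - \<epsilon> p \<omega> = -1} = 1/2" using half_pos[OF p] by simp
qed

lemma AE_lil_lower_both:
  assumes g: "0 < g" "g < 1"
  shows "AE \<omega> in M. (\<exists>\<^sub>F n in sequentially. gproc (lil_time (Suc n)) \<omega> \<ge> g * g * lil_scale (lil_time (Suc n))) \<and>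
    (\<exists>\<^sub>F n in sequentially. - gproc (lil_time (Suc n)) \<omega> \<ge> g * g * lil_scale (lil_time (Suc n)))"
proof -
  interpret neg: rademacher M "\<lambda>p \<omega>. - \<epsilon> p \<omega>" by (rule rademacher_uminus)
  have "neg.gproc \<tau> \<omega> = - gproc \<tau> \<omega>" if "good_signs \<omega>" for \<tau> \<omega>
  proof -
    have "summable (\<lambda>n. prime_part (\<lambda>p. \<epsilon> p \<omega>) (Suc n) / real (Suc n) powr (1/2 + exp (- \<tau>)))"
      using that by (simp add: good_signs_def)
    from suminf_minus[OF this]
    have "(\<Sum>n. - (prime_part (\<lambda>p. \<epsilon> p \<omega>) (Suc n) / real (Suc n) powr (1/2 + exp (- \<tau>))))
        = - (\<Sum>n. prime_part (\<lambda>p. \<epsilon> p \<omega>) (Suc n) / real (Suc n) powr (1/2 + exp (- \<tau>)))" .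
    moreover have "prime_part (\<lambda>p. - \<epsilon> p \<omega>) n / y = - (prime_part (\<lambda>p. \<epsilon> p \<omega>) n / y)" for n y
      by (simp add: prime_part_def)
    ultimately show ?thesis
      unfolding neg.gproc_def gproc_def neg.prime_series_def prime_series_def dirichlet_sum_def
      by (simp only:)
  qed
  then show ?thesis
    using AE_lil_lower[OF g] neg.AE_lil_lower[OF g] AE_good_signs
    by (elim eventually_rev_mp[OF eventually_conj[OF _ eventually_conj]]) (auto elim!: eventually_mono)
qed

end

section \<open>The set of limit points\<close>

text \<open>A deterministic fact about a continuous function: in the variable \<open>\<tau> = ln (1/s)\<close> the normalised function
  comes close to \<open>1\<close> and to \<open>-1\<close> at arbitrarily late times, so by the intermediate value theorem it takes every value in between at
  arbitrarily late times.\<close>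

lemma limit_points_lil:
  fixes c :: "real \<Rightarrow> real"
  assumes cont: "continuous_on {0<..} c"
    and upper: "\<And>d. d > 0 \<Longrightarrow> \<forall>\<^sub>F \<tau> in at_top. \<bar>c (exp (- \<tau>))\<bar> \<le> (1 + d) * lil_scale \<tau>"
    and lower1: "\<And>d B. d > 0 \<Longrightarrow> \<exists>\<tau>\<ge>B. c (exp (- \<tau>)) \<ge> (1 - d) * lil_scale \<tau>"
    and lower2: "\<And>d B. d > 0 \<Longrightarrow> \<exists>\<tau>\<ge>B. c (exp (- \<tau>)) \<le> - (1 - d) * lil_scale \<tau>"
  shows "limit_points {0<..<exp (- exp 1)} (\<lambda>s. sqrt (1 / (2 * ln (1/s) * ln (ln (ln (1/s))))) * c s) = {-1..1}"
proof -
  let ?f = "\<lambda>s. sqrt (1 / (2 * ln (1/s) * ln (ln (ln (1/s))))) * c s"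
  define r where "r \<tau> = c (exp (- \<tau>)) / lil_scale \<tau>" for \<tau>
  have fr: "?f (exp (- \<tau>)) = r \<tau>" for \<tau>
  proof -
    have l: "ln (1 / exp (- \<tau>)) = \<tau>" by (simp add: ln_div)
    show ?thesis unfolding l by (simp add: r_def lil_scale_def real_sqrt_divide)
  qed
  have rcont: "continuous_on {exp 1<..} r"
  proof -
    have "continuous_on {exp 1<..} (\<lambda>\<tau>. c (exp (- \<tau>)))"
      by (rule continuous_on_compose2[OF cont]) (auto intro!: continuous_intros)
    moreover have "continuous_on {exp 1<..} lil_scale"
    proof -
      have "\<tau> > 0 \<and> ln \<tau> > 0" if "\<tau> > exp 1" for \<tau> :: real
      proof -
        have p: "0 < exp (1::real)" by simp
        have t: "0 < \<tau>" using that p by linarith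
        have "ln (exp 1) < ln \<tau>" using t that by (subst ln_less_cancel_iff) auto
        then have "1 < ln \<tau>" by simp
        then have "0 < ln \<tau>" by linarith
        then show ?thesis using t by blast
      qed
      then show ?thesis unfolding lil_scale_def[abs_def] by (intro continuous_intros) force+
    qed
    ultimately show ?thesis unfolding r_def[abs_def]
      by (intro continuous_on_divide) (use lil_scale_pos in force)+
  qed
  show ?thesis
  proof (intro subset_antisym subsetI)
    fix x assume "x \<in> limit_points {0<..<exp (- exp 1)} ?f"
    then obtain s where s: "\<And>n. s n \<in> {0<..<exp (- exp 1)} \<and> 0 < s n" "s \<longlonglongrightarrow> 0" "(\<lambda>n. ?f (s n)) \<longlonglongrightarrow> x"
      unfolding limit_points_def by blast
    define \<sigma> where "\<sigma> n = ln (1 / s n)" for n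
    have s\<sigma>: "s n = exp (- \<sigma> n)" for n using s(1)[of n] by (simp add: \<sigma>_def ln_div)
    have \<sigma>: "\<sigma> n > exp 1" for n
    proof -
      have "exp (- \<sigma> n) < exp (- exp 1)" using s(1)[of n] by (simp add: s\<sigma>[symmetric])
      then show ?thesis by simp
    qed
    have "filterlim s (at_right 0) sequentially"
    proof -
      have "s n \<in> {0<..}" "s n \<noteq> 0" for n using s(1)[of n] by auto
      then show ?thesis unfolding filterlim_at using s(2) by simp
    qed
    moreover have "filterlim (\<lambda>u::real. ln (1 / u)) at_top (at_right 0)" by real_asymp
    ultimately have \<sigma>lim: "filterlim \<sigma> at_top sequentially"
      unfolding \<sigma>_def[abs_def] by (rule filterlim_compose[rotated])
    have lim: "(\<lambda>n. r (\<sigma> n)) \<longlonglongrightarrow> x" using s(3) by (simp only: s\<sigma> fr)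
    have "\<bar>x\<bar> \<le> 1 + d" if d: "d > 0" for d
    proof (rule tendsto_upperbound[OF tendsto_rabs[OF lim]])
      have "\<forall>\<^sub>F n in sequentially. \<bar>c (exp (- \<sigma> n))\<bar> \<le> (1 + d) * lil_scale (\<sigma> n)"
        by (rule eventually_compose_filterlim[OF upper[OF d] \<sigma>lim])
      then show "\<forall>\<^sub>F n in sequentially. \<bar>r (\<sigma> n)\<bar> \<le> 1 + d"
      proof eventually_elim
        case (elim n)
        have p: "lil_scale (\<sigma> n) > 0" by (rule lil_scale_pos[OF \<sigma>])
        then have "\<bar>r (\<sigma> n)\<bar> = \<bar>c (exp (- \<sigma> n))\<bar> / lil_scale (\<sigma> n)" by (simp add: r_def abs_divide)
        then show ?case using p elim by (simp add: divide_le_eq)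
      qed
    qed simp
    then have "\<bar>x\<bar> \<le> 1" by (rule field_le_epsilon)
    then show "x \<in> {-1..1}" by (auto simp: abs_le_iff)
  next
    fix x :: real assume x: "x \<in> {-1..1}"
    have "\<exists>\<tau>. \<tau> > exp 1 + real n \<and> \<bar>r \<tau> - x\<bar> \<le> 1 / real (Suc n)" for n
    proof -
      define d where "d = 1 / (2 * real (Suc n))"
      have d: "d > 0" "d < 1" "2 * d = 1 / real (Suc n)" by (auto simp: d_def field_simps)
      (* Shrinking the target into the range that the bounds with error d are known to cover. *)
      define x' where "x' = max (- (1 - d)) (min (1 - d) x)"
      have x': "- (1 - d) \<le> x'" "x' \<le> 1 - d" "\<bar>x' - x\<bar> \<le> d" using x d by (auto simp: x'_def max_def min_def)
      obtain \<tau>1 where t1: "\<tau>1 \<ge> exp 1 + real n + 1" "c (exp (- \<tau>1)) \<ge> (1 - d) * lil_scale \<tau>1" using lower1[OF d(1)] by blast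
      obtain \<tau>2 where t2: "\<tau>2 \<ge> exp 1 + real n + 1" "c (exp (- \<tau>2)) \<le> - (1 - d) * lil_scale \<tau>2" using lower2[OF d(1)] by blast
      have r1: "x' \<le> r \<tau>1"
      proof -
        have "1 - d \<le> r \<tau>1" using t1 lil_scale_pos[of \<tau>1] by (simp add: r_def le_divide_eq)
        then show ?thesis using x' by linarith
      qed
      have r2: "r \<tau>2 \<le> x'"
      proof -
        have "r \<tau>2 \<le> - (1 - d)" using t2 lil_scale_pos[of \<tau>2] by (simp add: r_def divide_le_eq)
        then show ?thesis using x' by linarith
      qed
      have cs: "continuous_on {a..b} r" if "a > exp 1" for a b
        by (rule continuous_on_subset[OF rcont]) (use that in auto)
      have "\<exists>\<tau>. min \<tau>1 \<tau>2 \<le> \<tau> \<and> r \<tau> = x'"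
      proof (cases "\<tau>1 \<le> \<tau>2")
        case True
        then show ?thesis using IVT2'[of r \<tau>2 x' \<tau>1, OF r2 r1 True cs] t1 by auto
      next
        case False
        then show ?thesis using IVT'[of r \<tau>2 x' \<tau>1, OF r2 r1 _ cs] t2 by auto
      qed
      then obtain \<tau> where "min \<tau>1 \<tau>2 \<le> \<tau>" "r \<tau> = x'" by blast
      moreover have "d \<le> 1 / real (Suc n)" using d by linarith
      ultimately show ?thesis using t1 t2 x'(3) by (intro exI[of _ \<tau>]) auto
    qed
    then obtain \<sigma> where \<sigma>: "\<And>n. \<sigma> n > exp 1 + real n" "\<And>n. \<bar>r (\<sigma> n) - x\<bar> \<le> 1 / real (Suc n)" by metis
    show "x \<in> limit_points {0<..<exp (- exp 1)} ?f"
      unfolding limit_points_def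
    proof (intro CollectI exI[of _ "\<lambda>n. exp (- \<sigma> n)"] conjI allI)
      fix n
      have "\<sigma> n > exp 1" using \<sigma>(1)[of n] by (smt (verit) of_nat_0_le_iff)
      then show "exp (- \<sigma> n) \<in> {0<..<exp (- exp 1)}" by simp
      show "0 < exp (- \<sigma> n)" by simp
    next
      have "filterlim \<sigma> at_top sequentially"
      proof (rule filterlim_at_top_mono)
        show "filterlim (\<lambda>n. real n) at_top sequentially" by real_asymp
        have "real n \<le> \<sigma> n" for n using \<sigma>(1)[of n] exp_gt_zero[of "1::real"] by linarith
        then show "\<forall>\<^sub>F n in sequentially. real n \<le> \<sigma> n" by simp
      qed
      moreover have "((\<lambda>u::real. exp (- u)) \<longlongrightarrow> 0) at_top" by real_asymp
      ultimately show "(\<lambda>n. exp (- \<sigma> n)) \<longlonglongrightarrow> 0" by (rule filterlim_compose[rotated])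
    next
      have "(\<lambda>n. r (\<sigma> n) - x) \<longlonglongrightarrow> 0"
      proof (rule Lim_null_comparison)
        show "\<forall>\<^sub>F n in sequentially. norm (r (\<sigma> n) - x) \<le> 1 / real (Suc n)" using \<sigma>(2) by simp
        show "(\<lambda>n. 1 / real (Suc n)) \<longlonglongrightarrow> 0" by real_asymp
      qed
      then have "(\<lambda>n. r (\<sigma> n)) \<longlonglongrightarrow> x" by (rule LIM_zero_cancel)
      then show "(\<lambda>n. ?f (exp (- \<sigma> n))) \<longlonglongrightarrow> x" by (simp only: fr)
    qed
  qed
qed

context rademacher
begin

theorem AE_lil:
  assumes k: "k \<ge> 3"
  shows "AE \<omega> in M. limit_points {0<..<exp (- exp 1)}
     (\<lambda>s. sqrt (1 / (2 * ln (1/s) * ln (ln (ln (1/s))))) * centred_log_sum k (\<lambda>p. \<epsilon> p \<omega>) s) = {-1..1}"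
proof -
  define e where "e j = 1 / (real j + 2)" for j :: nat
  have e: "0 < e j" "e j < 1" for j by (auto simp: e_def)
  have esmall: "\<exists>j. e j < x" if x: "x > 0" for x :: real
  proof -
    obtain j where "inverse (real (Suc j)) < x" using reals_Archimedean[OF x] by auto
    moreover have "e j \<le> inverse (real (Suc j))" by (simp add: e_def field_simps)
    ultimately show ?thesis by (intro exI[of _ j]) linarith
  qed
  have "AE \<omega> in M. \<forall>j. \<forall>\<^sub>F \<tau> in at_top. \<bar>gproc \<tau> \<omega>\<bar> \<le> (1 + 2 * e j) * lil_scale \<tau>"
    unfolding AE_all_countable using e by (intro allI AE_lil_upper) auto
  moreover have "AE \<omega> in M. \<forall>j. (\<exists>\<^sub>F n in sequentially. gproc (lil_time (Suc n)) \<omega> \<ge> (1 - e j) * (1 - e j) * lil_scale (lil_time (Suc n))) \<and>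
    (\<exists>\<^sub>F n in sequentially. - gproc (lil_time (Suc n)) \<omega> \<ge> (1 - e j) * (1 - e j) * lil_scale (lil_time (Suc n)))"
    unfolding AE_all_countable using e by (intro allI AE_lil_lower_both) auto
  ultimately show ?thesis using AE_centred_log_sum[OF k]
  proof eventually_elim
    fix \<omega>
    assume up: "\<forall>j. \<forall>\<^sub>F \<tau> in at_top. \<bar>gproc \<tau> \<omega>\<bar> \<le> (1 + 2 * e j) * lil_scale \<tau>"
      and low: "\<forall>j. (\<exists>\<^sub>F n in sequentially. gproc (lil_time (Suc n)) \<omega> \<ge> (1 - e j) * (1 - e j) * lil_scale (lil_time (Suc n))) \<and>
        (\<exists>\<^sub>F n in sequentially. - gproc (lil_time (Suc n)) \<omega> \<ge> (1 - e j) * (1 - e j) * lil_scale (lil_time (Suc n)))"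
      and c: "good_signs \<omega> \<and> continuous_on {0<..} (centred_log_sum k (\<lambda>p. \<epsilon> p \<omega>)) \<and>
        (\<forall>h>0. \<bar>centred_log_sum k (\<lambda>p. \<epsilon> p \<omega>) h - prime_series \<omega> h\<bar> \<le> centring_const)"
    let ?c = "centred_log_sum k (\<lambda>p. \<epsilon> p \<omega>)"
    have close: "\<bar>?c (exp (- \<tau>)) - gproc \<tau> \<omega>\<bar> \<le> centring_const" for \<tau> using c by (simp add: gproc_def)
    have low': "\<exists>\<tau>\<ge>B. x * gproc \<tau> \<omega> \<ge> (1 - d) * lil_scale \<tau> + centring_const"
      if d: "d > 0" and fr: "\<And>j. \<exists>\<^sub>F n in sequentially. x * gproc (lil_time (Suc n)) \<omega> \<ge> (1 - e j) * (1 - e j) * lil_scale (lil_time (Suc n))"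
      for d B x :: real
    proof -
      obtain j where j: "e j < d / 4" using esmall[of "d/4"] d by auto
      have "\<forall>\<^sub>F n in sequentially. B \<le> lil_time (Suc n)" using filterlim_lil_time by (auto simp: filterlim_at_top)
      moreover have "\<forall>\<^sub>F n in sequentially. exp 1 + 1 \<le> lil_time (Suc n)" using filterlim_lil_time by (auto simp: filterlim_at_top)
      moreover have "\<forall>\<^sub>F n in sequentially. centring_const \<le> d / 2 * lil_scale (lil_time (Suc n))"
        by (rule eventually_compose_filterlim[OF const_le_lil_scale filterlim_lil_time]) (use d in simp)
      ultimately have "\<forall>\<^sub>F n in sequentially. B \<le> lil_time (Suc n) \<and> exp 1 + 1 \<le> lil_time (Suc n) \<and> centring_const \<le> d / 2 * lil_scale (lil_time (Suc n))"
        by eventually_elim simp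
      from frequently_ex[OF frequently_eventually_frequently[OF fr[of j] this]]
      obtain n where n: "x * gproc (lil_time (Suc n)) \<omega> \<ge> (1 - e j) * (1 - e j) * lil_scale (lil_time (Suc n))"
        "B \<le> lil_time (Suc n)" "exp 1 + 1 \<le> lil_time (Suc n)" "centring_const \<le> d / 2 * lil_scale (lil_time (Suc n))" by auto
      have p: "lil_scale (lil_time (Suc n)) > 0" using n(3) by (intro lil_scale_pos) simp
      have "1 - d / 2 \<le> (1 - e j) * (1 - e j)"
      proof -
        have "(1 - e j) * (1 - e j) = 1 - 2 * e j + e j * e j" by (simp add: algebra_simps)
        moreover have "e j * e j \<ge> 0" by simp
        ultimately show ?thesis using j by linarith
      qed
      then have "(1 - d / 2) * lil_scale (lil_time (Suc n)) \<le> (1 - e j) * (1 - e j) * lil_scale (lil_time (Suc n))"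
        using p by (intro mult_right_mono) auto
      moreover have "(1 - d / 2) * lil_scale (lil_time (Suc n)) = (1 - d) * lil_scale (lil_time (Suc n)) + d / 2 * lil_scale (lil_time (Suc n))"
        by (simp add: algebra_simps)
      ultimately show ?thesis using n by (intro exI[of _ "lil_time (Suc n)"]) linarith
    qed
    show "limit_points {0<..<exp (- exp 1)} (\<lambda>s. sqrt (1 / (2 * ln (1/s) * ln (ln (ln (1/s))))) * ?c s) = {-1..1}"
    proof (rule limit_points_lil)
      show "continuous_on {0<..} ?c" using c by blast
    next
      fix d :: real assume d: "d > 0"
      obtain j where j: "e j < d / 4" using esmall[of "d/4"] d by auto
      have "\<forall>\<^sub>F \<tau> in at_top. centring_const \<le> d / 2 * lil_scale \<tau>" using d by (intro const_le_lil_scale) auto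
      moreover have "\<forall>\<^sub>F \<tau> in at_top. (\<tau> :: real) > exp 1" by (rule eventually_gt_at_top)
      ultimately show "\<forall>\<^sub>F \<tau> in at_top. \<bar>?c (exp (- \<tau>))\<bar> \<le> (1 + d) * lil_scale \<tau>"
        using up[rule_format, of j]
      proof eventually_elim
        case (elim \<tau>)
        have "(1 + 2 * e j) * lil_scale \<tau> \<le> (1 + d / 2) * lil_scale \<tau>"
          using j lil_scale_pos[OF elim(2)] by (intro mult_right_mono) auto
        moreover have "(1 + d) * lil_scale \<tau> = (1 + d / 2) * lil_scale \<tau> + d / 2 * lil_scale \<tau>" by (simp add: algebra_simps)
        ultimately show ?case using elim(1,3) close[of \<tau>] by linarith
      qed
    next
      fix d B :: real assume d: "d > 0"
      obtain \<tau> where "\<tau> \<ge> B" "1 * gproc \<tau> \<omega> \<ge> (1 - d) * lil_scale \<tau> + centring_const"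
        using low'[OF d, of 1 B] low by auto
      then show "\<exists>\<tau>\<ge>B. ?c (exp (- \<tau>)) \<ge> (1 - d) * lil_scale \<tau>"
        using close[of \<tau>] by (intro exI[of _ \<tau>]) linarith
      obtain \<tau> where "\<tau> \<ge> B" "-1 * gproc \<tau> \<omega> \<ge> (1 - d) * lil_scale \<tau> + centring_const"
        using low'[OF d, of "-1" B] low by auto
      moreover have "- (1 - d) * lil_scale \<tau> = - ((1 - d) * lil_scale \<tau>)" by (simp only: mult_minus_left)
      ultimately show "\<exists>\<tau>\<ge>B. ?c (exp (- \<tau>)) \<le> - (1 - d) * lil_scale \<tau>"
        using close[of \<tau>] by (intro exI[of _ \<tau>]) linarith
    qed
  qed
qed

end

section \<open>Functionals on path space\<close>

lemma continuous_on_path_at: "continuous_on {0..} (path_at x)"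
  using path_at[of x] by simp

text \<open>The class through which weak convergence is tested. The time interval is half-open because the grid
  approximations are controlled for \<open>t < T\<close>.\<close>

definition lip_functional :: "real \<Rightarrow> nat \<Rightarrow> (cpath \<Rightarrow> real) \<Rightarrow> bool" where
  "lip_functional L T F \<longleftrightarrow> L \<ge> 0 \<and>
     (\<forall>x y d. (\<forall>t. 0 \<le> t \<longrightarrow> t < real T \<longrightarrow> \<bar>path_at x t - path_at y t\<bar> \<le> d) \<longrightarrow> d \<ge> 0 \<longrightarrow> \<bar>F x - F y\<bar> \<le> L * d)"

lemma lip_functionalD:
  assumes "lip_functional L T F" "\<And>t. 0 \<le> t \<Longrightarrow> t < real T \<Longrightarrow> \<bar>path_at x t - path_at y t\<bar> \<le> d" "d \<ge> 0"
  shows "\<bar>F x - F y\<bar> \<le> L * d"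
  using assms unfolding lip_functional_def by blast

definition path_sup :: "nat \<Rightarrow> cpath \<Rightarrow> cpath \<Rightarrow> real" where
  "path_sup n x y = Sup ((\<lambda>t. \<bar>path_at x t - path_at y t\<bar>) ` {0..real n})"

lemma bdd_path_diff: "bdd_above ((\<lambda>t. \<bar>path_at x t - path_at y t\<bar>) ` {0..real n})"
proof -
  have "continuous_on {0..real n} (\<lambda>t. \<bar>path_at x t - path_at y t\<bar>)"
    by (intro continuous_intros continuous_on_subset[OF continuous_on_path_at]) auto
  then have "compact ((\<lambda>t. \<bar>path_at x t - path_at y t\<bar>) ` {0..real n})"
    by (intro compact_continuous_image) auto
  then show ?thesis by (intro bounded_imp_bdd_above compact_imp_bounded)
qed

lemma path_sup_upper: "0 \<le> t \<Longrightarrow> t \<le> real n \<Longrightarrow> \<bar>path_at x t - path_at y t\<bar> \<le> path_sup n x y"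
  unfolding path_sup_def by (intro cSup_upper bdd_path_diff) auto

lemma path_sup_least:
  "(\<And>t. 0 \<le> t \<Longrightarrow> t \<le> real n \<Longrightarrow> \<bar>path_at x t - path_at y t\<bar> \<le> d) \<Longrightarrow> path_sup n x y \<le> d"
  unfolding path_sup_def by (intro cSup_least) auto

lemma path_sup_nonneg: "path_sup n x y \<ge> 0"
  using path_sup_upper[of 0 n x y] by (simp add: order_trans[OF abs_ge_zero])

lemma path_sup_triangle: "path_sup n x z \<le> path_sup n x y + path_sup n y z"
proof (rule path_sup_least)
  fix t assume "0 \<le> t" "t \<le> real n"
  then show "\<bar>path_at x t - path_at z t\<bar> \<le> path_sup n x y + path_sup n y z"
    using path_sup_upper[of t n x y] path_sup_upper[of t n y z] by linarith
qed

lemma path_sup_self: "path_sup n x x = 0"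
  using path_sup_nonneg[of n x x] path_sup_least[of n x x 0] by simp

text \<open>The Lipschitz regularisation from below of \<open>F\<close>. Capping the distance at \<open>1\<close> loses nothing for bounded \<open>F\<close>, and
  the supremum over \<open>{0..n}\<close> makes the time horizon grow with the Lipschitz constant.\<close>

definition inf_conv :: "(cpath \<Rightarrow> real) \<Rightarrow> nat \<Rightarrow> cpath \<Rightarrow> real" where
  "inf_conv F n x = (INF y. F y + real n * min 1 (path_sup n x y))"

context
  fixes F :: "cpath \<Rightarrow> real" and C :: real
  assumes bounded: "\<And>x. \<bar>F x\<bar> \<le> C"
begin

lemma inf_conv_bdd: "bdd_below (range (\<lambda>y. F y + real n * min 1 (path_sup n x y)))"
proof (rule bdd_belowI2)
  fix y
  have "real n * min 1 (path_sup n x y) \<ge> 0" using path_sup_nonneg[of n x y] by simp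
  then show "- C \<le> F y + real n * min 1 (path_sup n x y)" using bounded[of y] by linarith
qed

lemma inf_conv_le: "inf_conv F n x \<le> F y + real n * min 1 (path_sup n x y)"
  unfolding inf_conv_def by (intro cINF_lower inf_conv_bdd) auto

lemma inf_conv_le_self: "inf_conv F n x \<le> F x"
  using inf_conv_le[of n x x] by (simp add: path_sup_self)

lemma inf_conv_greatest:
  "(\<And>y. c \<le> F y + real n * min 1 (path_sup n x y)) \<Longrightarrow> c \<le> inf_conv F n x"
  unfolding inf_conv_def by (rule cINF_greatest) auto

lemma inf_conv_bounded: "\<bar>inf_conv F n x\<bar> \<le> C"
proof -
  have "- C \<le> inf_conv F n x"
  proof (rule inf_conv_greatest)
    fix y
    have "real n * min 1 (path_sup n x y) \<ge> 0" using path_sup_nonneg[of n x y] by simp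
    then show "- C \<le> F y + real n * min 1 (path_sup n x y)" using bounded[of y] by linarith
  qed
  then show ?thesis using inf_conv_le_self[of n x] bounded[of x] by linarith
qed

lemma inf_conv_lip_le: "inf_conv F n x \<le> inf_conv F n z + real n * path_sup n x z"
proof -
  have "inf_conv F n x - real n * path_sup n x z \<le> inf_conv F n z"
  proof (rule inf_conv_greatest)
    fix y
    have "min 1 (path_sup n x y) \<le> path_sup n x z + min 1 (path_sup n z y)"
      using path_sup_triangle[of n x y z] path_sup_nonneg[of n x z] by (auto simp: min_def)
    then have "real n * min 1 (path_sup n x y) \<le> real n * (path_sup n x z + min 1 (path_sup n z y))"
      by (intro mult_left_mono) auto
    then show "inf_conv F n x - real n * path_sup n x z \<le> F y + real n * min 1 (path_sup n z y)"
      using inf_conv_le[of n x y] by (simp add: distrib_left)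
  qed
  then show ?thesis by simp
qed

lemma path_sup_commute: "path_sup n x y = path_sup n y x"
  by (simp add: path_sup_def abs_minus_commute)

lemma lip_inf_conv: "lip_functional (real n) (Suc n) (inf_conv F n)"
  unfolding lip_functional_def
proof (intro conjI allI impI)
  fix x y :: cpath and d :: real
  assume d: "\<forall>t. 0 \<le> t \<longrightarrow> t < real (Suc n) \<longrightarrow> \<bar>path_at x t - path_at y t\<bar> \<le> d" "d \<ge> 0"
  have "path_sup n x y \<le> d" by (rule path_sup_least) (use d in auto)
  then have "real n * path_sup n x y \<le> real n * d" by (intro mult_left_mono) auto
  then show "\<bar>inf_conv F n x - inf_conv F n y\<bar> \<le> real n * d"
    using inf_conv_lip_le[of n x y] inf_conv_lip_le[of n y x] path_sup_commute[of n y x] by simp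
qed simp

text \<open>If \<open>y\<close> is close to \<open>x\<close>, lower semicontinuity bounds \<open>F y\<close> from below; otherwise the penalty exceeds
  the total oscillation \<open>2 * C\<close> once \<open>n\<close> is large.\<close>

lemma inf_conv_tendsto:
  assumes lsc: "\<And>e. e > 0 \<Longrightarrow> \<exists>T\<ge>0. \<exists>r>0. \<forall>y. (\<forall>t\<in>{0..T}. \<bar>path_at y t - path_at x t\<bar> < r) \<longrightarrow> F y > F x - e"
  shows "(\<lambda>n. inf_conv F n x) \<longlonglongrightarrow> F x"
proof (rule LIMSEQ_I)
  fix e :: real assume e: "e > 0"
  then obtain T r where Tr: "T \<ge> 0" "r > 0"
      "\<And>y. (\<forall>t\<in>{0..T}. \<bar>path_at y t - path_at x t\<bar> < r) \<Longrightarrow> F y > F x - e/2"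
    using lsc[of "e/2"] by auto
  (* Large enough for the horizon T and for the penalty to exceed 2 C outside the neighbourhood. *)
  define N where "N = nat \<lceil>max T (2 * C / min 1 r)\<rceil>"
  have "norm (inf_conv F n x - F x) < e" if n: "n \<ge> N" for n
  proof -
    have nT: "real n \<ge> T" "real n \<ge> 2 * C / min 1 r" using n unfolding N_def by linarith+
    have "F x - e/2 \<le> inf_conv F n x"
    proof (rule inf_conv_greatest)
      fix y
      show "F x - e/2 \<le> F y + real n * min 1 (path_sup n x y)"
      proof (cases "path_sup n x y < r")
        case True
        have "\<forall>t\<in>{0..T}. \<bar>path_at y t - path_at x t\<bar> < r"
          using path_sup_upper[of _ n x y] True nT by (fastforce simp: abs_minus_commute)
        from Tr(3)[OF this] have "F y > F x - e/2" .
        moreover have "real n * min 1 (path_sup n x y) \<ge> 0" using path_sup_nonneg[of n x y] by simp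
        ultimately show ?thesis by linarith
      next
        case False
        have "2 * C \<le> real n * min 1 r" using nT(2) Tr(2) by (simp add: divide_le_eq mult.commute)
        also have "\<dots> \<le> real n * min 1 (path_sup n x y)" using False by (intro mult_left_mono) auto
        finally show ?thesis using bounded[of x] bounded[of y] e by linarith
      qed
    qed
    then show ?thesis using inf_conv_le_self[of n x] e by simp
  qed
  then show "\<exists>N. \<forall>n\<ge>N. norm (inf_conv F n x - F x) < e" by blast
qed

end

lemma lsc_of_continuous:
  fixes F :: "cpath \<Rightarrow> real"
  assumes "continuous_on UNIV F" "e > 0"
  shows "\<exists>T\<ge>0. \<exists>r>0. \<forall>y. (\<forall>t\<in>{0..T}. \<bar>path_at y t - path_at x t\<bar> < r) \<longrightarrow> F y > F x - e"
proof -
  have "open (F -` {F x - e<..})" using assms(1) by (rule open_vimage[OF open_greaterThan])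
  then show ?thesis using assms(2) unfolding open_cpath_def by fastforce
qed

lemma lsc_indicator_open:
  assumes "open (U :: cpath set)" "e > 0"
  shows "\<exists>T\<ge>0. \<exists>r>0. \<forall>y. (\<forall>t\<in>{0..T}. \<bar>path_at y t - path_at x t\<bar> < r) \<longrightarrow> indicat_real U y > indicat_real U x - e"
proof (cases "x \<in> U")
  case True
  then obtain T r where "T \<ge> 0" "r > 0" "\<And>y. (\<forall>t\<in>{0..T}. \<bar>path_at y t - path_at x t\<bar> < r) \<Longrightarrow> y \<in> U"
    using assms(1) unfolding open_cpath_def by blast
  then show ?thesis using assms(2) True by (intro exI[of _ T] conjI exI[of _ r]) (auto simp: indicator_def)
next
  case False
  then show ?thesis using assms(2) by (intro exI[of _ 0] conjI exI[of _ 1]) (auto simp: indicator_def)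
qed

section \<open>Polygonal paths\<close>

text \<open>Starting at \<open>a\<close>, the polygon rises by \<open>y j\<close> over \<open>{j / 2 ^ n..(j + 1) / 2 ^ n}\<close>. As a sum of clamped ramps it is defined
  and continuous for all times, and depends linearly on \<open>a\<close> and \<open>y\<close>.\<close>

definition polygon :: "nat \<Rightarrow> nat \<Rightarrow> real \<Rightarrow> (nat \<Rightarrow> real) \<Rightarrow> real \<Rightarrow> real" where
  "polygon n J a y t = a + (\<Sum>j<J. y j * max 0 (min 1 (2 ^ n * t - real j)))"

lemma continuous_on_polygon: "continuous_on A (polygon n J a y)"
  unfolding polygon_def[abs_def] by (intro continuous_intros)

lemma polygon_eval:
  assumes i: "i < J" "real i \<le> 2 ^ n * t" "2 ^ n * t \<le> real i + 1"
  shows "polygon n J a y t = a + (\<Sum>j<i. y j) + y i * (2 ^ n * t - real i)"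
proof -
  have "(\<Sum>j<J. y j * max 0 (min 1 (2 ^ n * t - real j))) =
     (\<Sum>j<Suc i. y j * max 0 (min 1 (2 ^ n * t - real j)))"
  proof (rule sum.mono_neutral_right)
    show "\<forall>j\<in>{..<J} - {..<Suc i}. y j * max 0 (min 1 (2 ^ n * t - real j)) = 0"
    proof
      fix j assume "j \<in> {..<J} - {..<Suc i}"
      then have "real j \<ge> real i + 1" by auto
      then have "2 ^ n * t - real j \<le> 0" using i by linarith
      then show "y j * max 0 (min 1 (2 ^ n * t - real j)) = 0" by simp
    qed
  qed (use i in auto)
  also have "\<dots> = (\<Sum>j<i. y j * max 0 (min 1 (2 ^ n * t - real j))) + y i * (2 ^ n * t - real i)"
    using i by simp
  also have "(\<Sum>j<i. y j * max 0 (min 1 (2 ^ n * t - real j))) = (\<Sum>j<i. y j)"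
  proof (rule sum.cong[OF refl])
    fix j assume "j \<in> {..<i}"
    then have "real j + 1 \<le> real i" by auto
    then have "2 ^ n * t - real j \<ge> 1" using i by linarith
    then show "y j * max 0 (min 1 (2 ^ n * t - real j)) = y j" by simp
  qed
  finally show ?thesis by (simp add: polygon_def)
qed

lemma polygon_diff_le:
  "\<bar>polygon n J a y t - polygon n J b z t\<bar> \<le> \<bar>a - b\<bar> + (\<Sum>j<J. \<bar>y j - z j\<bar>)"
proof -
  have "polygon n J a y t - polygon n J b z t = (a - b) + (\<Sum>j<J. (y j - z j) * max 0 (min 1 (2 ^ n * t - real j)))"
    by (simp add: polygon_def sum_subtractf left_diff_distrib)
  also have "\<bar>\<dots>\<bar> \<le> \<bar>a - b\<bar> + (\<Sum>j<J. \<bar>(y j - z j) * max 0 (min 1 (2 ^ n * t - real j))\<bar>)"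
    by (rule order_trans[OF abs_triangle_ineq add_left_mono[OF sum_abs]])
  also have "\<dots> \<le> \<bar>a - b\<bar> + (\<Sum>j<J. \<bar>y j - z j\<bar>)"
  proof (intro add_left_mono sum_mono)
    fix j
    have "\<bar>max 0 (min 1 (2 ^ n * t - real j))\<bar> \<le> 1" by auto
    then show "\<bar>(y j - z j) * max 0 (min 1 (2 ^ n * t - real j))\<bar> \<le> \<bar>y j - z j\<bar>"
      by (simp only: abs_mult mult_left_le abs_ge_zero)
  qed
  finally show ?thesis .
qed

text \<open>The polygon with these increments and initial value \<open>x 0\<close> interpolates \<open>x\<close> at the points \<open>j / 2 ^ n\<close>.\<close>

abbreviation grid_increment :: "nat \<Rightarrow> (real \<Rightarrow> real) \<Rightarrow> nat \<Rightarrow> real" where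
  "grid_increment n x j \<equiv> x (real (Suc j) / 2 ^ n) - x (real j / 2 ^ n)"

text \<open>On a grid cell both the path and its interpolation stay close to the value at the left end.\<close>

lemma interpolation_close:
  assumes t: "0 \<le> t" "t < real T"
    and inc: "\<And>j. j < T * 2 ^ n \<Longrightarrow> \<bar>grid_increment n x j\<bar> \<le> d"
    and osc: "\<bar>x t - x (of_int \<lfloor>2 ^ n * t\<rfloor> / 2 ^ n)\<bar> \<le> d"
  shows "\<bar>x t - polygon n (T * 2 ^ n) (x 0) (grid_increment n x) t\<bar> \<le> 2 * d"
proof -
  define i where "i = nat \<lfloor>2 ^ n * t\<rfloor>"
  have i: "real i \<le> 2 ^ n * t" "2 ^ n * t < real i + 1" "of_int \<lfloor>2 ^ n * t\<rfloor> / 2 ^ n = real i / 2 ^ n"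
    using t by (auto simp: i_def)
  have "2 ^ n * t < 2 ^ n * real T" using t by simp
  then have "real i < 2 ^ n * real T" using i by linarith
  then have "real i < real (T * 2 ^ n)" by (simp add: mult.commute)
  then have iJ: "i < T * 2 ^ n" by (simp only: of_nat_less_iff)
  have "polygon n (T * 2 ^ n) (x 0) (grid_increment n x) t =
     x 0 + (\<Sum>j<i. grid_increment n x j) + grid_increment n x i * (2 ^ n * t - real i)"
    using i iJ by (intro polygon_eval) auto
  also have "(\<Sum>j<i. grid_increment n x j) = x (real i / 2 ^ n) - x 0"
    using sum_lessThan_telescope[of "\<lambda>j. x (real j / 2 ^ n)" i] by simp
  finally have eq: "x t - polygon n (T * 2 ^ n) (x 0) (grid_increment n x) t =
     (x t - x (real i / 2 ^ n)) - grid_increment n x i * (2 ^ n * t - real i)" by simp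
  have "\<bar>grid_increment n x i * (2 ^ n * t - real i)\<bar> \<le> d * 1"
    unfolding abs_mult using inc[OF iJ] i by (intro mult_mono) auto
  then show ?thesis unfolding eq using osc i(3) by simp
qed

lemma interpolation_uniform:
  fixes x :: "real \<Rightarrow> real"
  assumes x: "continuous_on {0..} x" and e: "e > 0"
  shows "\<forall>\<^sub>F n in sequentially. \<forall>t. 0 \<le> t \<longrightarrow> t < real T \<longrightarrow>
           \<bar>x t - polygon n (T * 2 ^ n) (x 0) (grid_increment n x) t\<bar> \<le> e"
proof -
  have "uniformly_continuous_on {0..real T} x"
    by (intro compact_uniformly_continuous continuous_on_subset[OF x]) auto
  then obtain d where d: "d > 0" "\<And>s t. s \<in> {0..real T} \<Longrightarrow> t \<in> {0..real T} \<Longrightarrow> \<bar>s - t\<bar> < d \<Longrightarrow> \<bar>x s - x t\<bar> < e/2"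
    unfolding uniformly_continuous_on_def using half_gt_zero[OF e] by (metis dist_real_def)
  have "(\<lambda>n. 1 / 2 ^ n :: real) \<longlonglongrightarrow> 0" by real_asymp
  then have "\<forall>\<^sub>F n in sequentially. 1 / 2 ^ n < d" using d(1) by (rule order_tendstoD)
  then show ?thesis
  proof eventually_elim
    fix n assume n: "1 / 2 ^ n < d"
    show "\<forall>t. 0 \<le> t \<longrightarrow> t < real T \<longrightarrow> \<bar>x t - polygon n (T * 2 ^ n) (x 0) (grid_increment n x) t\<bar> \<le> e"
    proof (intro allI impI)
      fix t assume t: "0 \<le> t" "t < real T"
      have "\<bar>x t - polygon n (T * 2 ^ n) (x 0) (grid_increment n x) t\<bar> \<le> 2 * (e/2)"
      proof (rule interpolation_close[OF t])
        fix j assume "j < T * 2 ^ n"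
        then have "real (Suc j) \<le> real (T * 2 ^ n)" by (simp only: of_nat_le_iff)
        then have j: "real (Suc j) / 2 ^ n \<le> real T" by (simp add: divide_le_eq)
        have s: "real (Suc j) / 2 ^ n - real j / 2 ^ n = 1 / 2 ^ n" by (simp add: diff_divide_distrib[symmetric])
        have p: "(1 :: real) / 2 ^ n > 0" by simp
        have "real j / 2 ^ n \<le> real T" using j s p by linarith
        moreover have "real (Suc j) / 2 ^ n \<ge> 0" "real j / 2 ^ n \<ge> 0" by auto
        moreover have "\<bar>real (Suc j) / 2 ^ n - real j / 2 ^ n\<bar> < d" using s n p by linarith
        ultimately show "\<bar>grid_increment n x j\<bar> \<le> e/2" using j d(2)[of "real (Suc j) / 2 ^ n" "real j / 2 ^ n"] by auto
      next
        define u :: real where "u = of_int \<lfloor>2 ^ n * t\<rfloor> / 2 ^ n"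
        have "of_int \<lfloor>2 ^ n * t\<rfloor> \<ge> (0::real)" using t by simp
        then have u0: "u \<ge> 0" by (simp add: u_def)
        have "of_int \<lfloor>2 ^ n * t\<rfloor> \<le> 2 ^ n * t" "2 ^ n * t < of_int \<lfloor>2 ^ n * t\<rfloor> + 1" by linarith+
        then have u1: "u \<le> t" "t < u + 1 / 2 ^ n" by (auto simp: u_def field_simps)
        have "\<bar>x t - x u\<bar> < e/2" using u0 u1 t n by (intro d(2)) auto
        then show "\<bar>x t - x (of_int \<lfloor>2 ^ n * t\<rfloor> / 2 ^ n)\<bar> \<le> e/2" by (simp add: u_def)
      qed
      then show "\<bar>x t - polygon n (T * 2 ^ n) (x 0) (grid_increment n x) t\<bar> \<le> e" by simp
    qed
  qed
qed

section \<open>Measurability on path space\<close>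

definition polygon_path :: "nat \<Rightarrow> nat \<Rightarrow> real \<Rightarrow> (nat \<Rightarrow> real) \<Rightarrow> cpath" where
  "polygon_path n J a y = to_cpath (polygon n J a y)"

lemma path_at_polygon_path: "t \<ge> 0 \<Longrightarrow> path_at (polygon_path n J a y) t = polygon n J a y t"
  unfolding polygon_path_def by (rule path_at_to_cpath[OF continuous_on_polygon])

lemma lip_polygon_path:
  assumes "lip_functional L T F"
  shows "\<bar>F (polygon_path n J a y) - F (polygon_path n J b z)\<bar> \<le> L * (\<bar>a - b\<bar> + (\<Sum>j<J. \<bar>y j - z j\<bar>))"
  by (rule lip_functionalD[OF assms]) (auto simp: path_at_polygon_path polygon_diff_le intro!: add_nonneg_nonneg sum_nonneg)

text \<open>The functional is continuous in the starting point and the finitely many increments. This gives measurability before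
  the path map is known to be Borel.\<close>

lemma borel_measurable_polygon_functional:
  assumes F: "lip_functional L T F" and a: "a \<in> borel_measurable M" and y: "\<And>j. j < J \<Longrightarrow> y j \<in> borel_measurable M"
  shows "(\<lambda>\<omega>. F (polygon_path n J (a \<omega>) (\<lambda>j. y j \<omega>))) \<in> borel_measurable M"
proof -
  define g where "g v = F (polygon_path n J (v 0) (\<lambda>j. v (Suc j)))" for v :: "nat \<Rightarrow> real"
  have "continuous_on UNIV g"
    unfolding continuous_on_def
  proof
    fix v :: "nat \<Rightarrow> real"
    have "((\<lambda>w. L * (\<bar>w 0 - v 0\<bar> + (\<Sum>j<J. \<bar>w (Suc j) - v (Suc j)\<bar>))) \<longlongrightarrow> L * (\<bar>v 0 - v 0\<bar> + (\<Sum>j<J. \<bar>v (Suc j) - v (Suc j)\<bar>))) (at v)"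
    proof -
      have c: "((\<lambda>w. w i) \<longlongrightarrow> v i) (at v)" for i
        using continuous_on_product_coordinates[of i] unfolding continuous_on_def by blast
      show ?thesis by (intro tendsto_intros c)
    qed
    then have "((\<lambda>w. L * (\<bar>w 0 - v 0\<bar> + (\<Sum>j<J. \<bar>w (Suc j) - v (Suc j)\<bar>))) \<longlongrightarrow> 0) (at v)" by simp
    then have "((\<lambda>w. g w - g v) \<longlongrightarrow> 0) (at v)"
      by (rule Lim_null_comparison[rotated]) (auto simp: g_def intro!: always_eventually lip_polygon_path[OF F])
    then show "(g \<longlongrightarrow> g v) (at v)" by (rule LIM_zero_cancel)
  qed
  then have g: "g \<in> borel_measurable borel" by (rule borel_measurable_continuous_onI)
  define V where "V \<omega> i = (case i of 0 \<Rightarrow> a \<omega> | Suc j \<Rightarrow> if j < J then y j \<omega> else 0)" for \<omega> i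
  have "V \<in> measurable M borel"
  proof (rule measurable_coordinatewise_then_product)
    fix i show "(\<lambda>\<omega>. V \<omega> i) \<in> borel_measurable M"
    proof (cases i)
      case (Suc j)
      then show ?thesis using y by (cases "j < J") (auto simp: V_def)
    qed (use a in \<open>auto simp: V_def\<close>)
  qed
  then have "(\<lambda>\<omega>. g (V \<omega>)) \<in> borel_measurable M" using g by (rule measurable_compose)
  moreover have "g (V \<omega>) = F (polygon_path n J (a \<omega>) (\<lambda>j. y j \<omega>))" for \<omega>
  proof -
    have "polygon n J (V \<omega> 0) (\<lambda>j. V \<omega> (Suc j)) = polygon n J (a \<omega>) (\<lambda>j. y j \<omega>)"
      unfolding polygon_def[abs_def] by (intro ext) (simp add: V_def)
    then show ?thesis by (simp add: g_def polygon_path_def)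
  qed
  ultimately show ?thesis by simp
qed

lemma lip_functional_interpolation:
  assumes F: "lip_functional L T F" and x: "continuous_on {0..} x"
  shows "(\<lambda>n. F (polygon_path n (T * 2 ^ n) (x 0) (grid_increment n x))) \<longlonglongrightarrow> F (to_cpath x)"
proof (rule LIMSEQ_I)
  fix e :: real assume e: "e > 0"
  define d where "d = e / (2 * (L + 1))"
  have L: "L \<ge> 0" using F by (simp add: lip_functional_def)
  have d: "d > 0" "L * d < e"
  proof -
    show "d > 0" using e L by (simp add: d_def)
    have "L * d \<le> (L + 1) * d" using \<open>d > 0\<close> by (simp add: distrib_right)
    also have "\<dots> = e / 2" using L by (simp add: d_def field_simps)
    finally show "L * d < e" using e by simp
  qed
  show "\<exists>N. \<forall>n\<ge>N. norm (F (polygon_path n (T * 2 ^ n) (x 0) (grid_increment n x)) - F (to_cpath x)) < e"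
  proof -
    obtain N where N: "\<And>n t. n \<ge> N \<Longrightarrow> 0 \<le> t \<Longrightarrow> t < real T \<Longrightarrow>
        \<bar>x t - polygon n (T * 2 ^ n) (x 0) (grid_increment n x) t\<bar> \<le> d"
      using interpolation_uniform[OF x d(1), of T] unfolding eventually_sequentially by blast
    have "\<bar>F (polygon_path n (T * 2 ^ n) (x 0) (grid_increment n x)) - F (to_cpath x)\<bar> \<le> L * d" if "n \<ge> N" for n
    proof (rule lip_functionalD[OF F])
      fix t assume t: "0 \<le> t" "t < real T"
      show "\<bar>path_at (polygon_path n (T * 2 ^ n) (x 0) (grid_increment n x)) t - path_at (to_cpath x) t\<bar> \<le> d"
        using N[OF that t] t by (simp only: path_at_polygon_path path_at_to_cpath[OF x] abs_minus_commute)
    qed (use d in auto)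
    then show ?thesis using d(2) by (intro exI[of _ N]) fastforce
  qed
qed

lemma borel_measurable_lip_functional:
  assumes F: "lip_functional L T F" and X: "\<And>t. t \<ge> 0 \<Longrightarrow> X t \<in> borel_measurable M"
    and cont: "\<And>\<omega>. \<omega> \<in> space M \<Longrightarrow> continuous_on {0..} (\<lambda>t. X t \<omega>)"
  shows "(\<lambda>\<omega>. F (to_cpath (\<lambda>t. X t \<omega>))) \<in> borel_measurable M"
proof (rule borel_measurable_LIMSEQ_metric)
  fix n
  show "(\<lambda>\<omega>. F (polygon_path n (T * 2 ^ n) (X 0 \<omega>) (\<lambda>j. X (real (Suc j) / 2 ^ n) \<omega> - X (real j / 2 ^ n) \<omega>))) \<in> borel_measurable M"
    by (rule borel_measurable_polygon_functional[OF F]) (auto intro!: X borel_measurable_diff)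
next
  fix \<omega> assume "\<omega> \<in> space M"
  from lip_functional_interpolation[OF F cont[OF this]]
  show "(\<lambda>n. F (polygon_path n (T * 2 ^ n) (X 0 \<omega>) (\<lambda>j. X (real (Suc j) / 2 ^ n) \<omega> - X (real j / 2 ^ n) \<omega>)))
      \<longlonglongrightarrow> F (to_cpath (\<lambda>t. X t \<omega>))" .
qed

text \<open>The indicator of an open set is lower semicontinuous, hence a limit of Lipschitz functionals, and these
  are limits of functions of finitely many coordinates by interpolation on dyadic grids.\<close>

lemma measurable_to_cpath:
  assumes X: "\<And>t. t \<ge> 0 \<Longrightarrow> X t \<in> borel_measurable M"
    and cont: "\<And>\<omega>. \<omega> \<in> space M \<Longrightarrow> continuous_on {0..} (\<lambda>t. X t \<omega>)"
  shows "(\<lambda>\<omega>. to_cpath (\<lambda>t. X t \<omega>)) \<in> borel_measurable M"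
proof (rule borel_measurableI)
  fix U :: "cpath set" assume U: "open U"
  have b: "\<bar>indicat_real U x\<bar> \<le> 1" for x by (simp add: indicator_def)
  have "(\<lambda>\<omega>. indicat_real U (to_cpath (\<lambda>t. X t \<omega>))) \<in> borel_measurable M"
  proof (rule borel_measurable_LIMSEQ_metric)
    show "(\<lambda>\<omega>. inf_conv (indicat_real U) n (to_cpath (\<lambda>t. X t \<omega>))) \<in> borel_measurable M" for n
      by (rule borel_measurable_lip_functional[OF lip_inf_conv[OF b] X cont])
    show "(\<lambda>n. inf_conv (indicat_real U) n (to_cpath (\<lambda>t. X t \<omega>))) \<longlonglongrightarrow> indicat_real U (to_cpath (\<lambda>t. X t \<omega>))" for \<omega>
      by (rule inf_conv_tendsto[OF b lsc_indicator_open[OF U]])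
  qed
  then have "(\<lambda>\<omega>. indicat_real U (to_cpath (\<lambda>t. X t \<omega>))) -` {1} \<inter> space M \<in> sets M"
    by (rule measurable_sets) simp
  moreover have "(\<lambda>\<omega>. indicat_real U (to_cpath (\<lambda>t. X t \<omega>))) -` {1} \<inter> space M = (\<lambda>\<omega>. to_cpath (\<lambda>t. X t \<omega>)) -` U \<inter> space M"
    by (auto simp: indicator_def)
  ultimately show "(\<lambda>\<omega>. to_cpath (\<lambda>t. X t \<omega>)) -` U \<inter> space M \<in> sets M" by simp
qed

text \<open>A process with almost surely continuous paths is changed on a null set to one with continuous
  paths, for which the path map is measurable; the law, taken on the completion, is the same.\<close>

lemma continuous_process_modification:
  assumes "continuous_process M X"
  obtains X' where "\<And>t. t \<ge> 0 \<Longrightarrow> X' t \<in> borel_measurable M"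
    "\<And>\<omega>. \<omega> \<in> space M \<Longrightarrow> continuous_on {0..} (\<lambda>t. X' t \<omega>)"
    "AE \<omega> in M. \<forall>t. X' t \<omega> = X t \<omega>"
    "path_law M X = distr M borel (\<lambda>\<omega>. to_cpath (\<lambda>t. X' t \<omega>))"
proof -
  have X: "\<And>t. t \<ge> 0 \<Longrightarrow> X t \<in> borel_measurable M" and "AE \<omega> in M. continuous_on {0..} (\<lambda>t. X t \<omega>)"
    using assms by (auto simp: continuous_process_def)
  then obtain N0 where N0: "N0 \<in> null_sets M" "{\<omega> \<in> space M. \<not> continuous_on {0..} (\<lambda>t. X t \<omega>)} \<subseteq> N0"
    unfolding eventually_ae_filter by auto
  define X' where "X' t \<omega> = (if \<omega> \<in> N0 then 0 else X t \<omega>)" for t \<omega>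
  have N0s: "N0 \<in> sets M" using N0 by auto
  have m: "X' t \<in> borel_measurable M" if "t \<ge> 0" for t
    unfolding X'_def using X[OF that] N0s by (intro measurable_If_set) auto
  have c: "continuous_on {0..} (\<lambda>t. X' t \<omega>)" if "\<omega> \<in> space M" for \<omega>
    using N0(2) that by (cases "\<omega> \<in> N0") (auto simp: X'_def)
  have ae: "AE \<omega> in M. \<forall>t. X' t \<omega> = X t \<omega>"
    using AE_not_in[OF N0(1)] by eventually_elim (simp add: X'_def)
  let ?f = "\<lambda>\<omega>. to_cpath (\<lambda>t. X t \<omega>)" and ?g = "\<lambda>\<omega>. to_cpath (\<lambda>t. X' t \<omega>)"
  have g: "?g \<in> borel_measurable M" by (rule measurable_to_cpath[OF m c])
  have aec: "AE \<omega> in completion M. ?f \<omega> = ?g \<omega>"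
    using AE_completion[OF ae] by eventually_elim simp
  have f: "?f \<in> measurable (completion M) borel"
  proof (rule measurableI)
    fix A :: "cpath set" assume A: "A \<in> sets borel"
    have gA: "?g -` A \<inter> space (completion M) \<in> sets (completion M)"
      using measurable_sets[OF measurable_completion[OF g] A] .
    have "AE \<omega> in completion M. \<omega> \<in> ?g -` A \<inter> space (completion M) \<longleftrightarrow> \<omega> \<in> ?f -` A \<inter> space (completion M)"
      using aec by eventually_elim simp
    then show "?f -` A \<inter> space (completion M) \<in> sets (completion M)"
      by (rule completion.in_sets_AE[OF _ gA]) auto
  qed simp
  have "path_law M X = distr (completion M) borel ?g"
    unfolding path_law_def by (rule distr_cong_AE[OF refl refl aec f measurable_completion[OF g]])
  also have "\<dots> = distr M borel ?g" by (rule distr_completion[OF g])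
  finally show thesis using that m c ae by blast
qed

section \<open>The central limit theorem for weighted sign sums\<close>

lemma cos_minus_gauss_le:
  fixes x :: real
  shows "\<bar>cos x - exp (- (x\<^sup>2 / 2))\<bar> \<le> x ^ 4"
proof -
  have "\<bar>cos x - (1 - x\<^sup>2 / 2)\<bar> \<le> x ^ 4 / 24"
  proof -
    have f: "fact (Suc 3) = (24 :: real)" by (simp add: eval_nat_numeral)
    have p: "\<bar>x\<bar> ^ Suc 3 = x ^ 4" by simp
    have a: "cmod (iexp x - (\<Sum>k\<le>3. (\<i> * x) ^ k / fact k)) \<le> x ^ 4 / 24"
      using iexp_approx1[of x 3] unfolding p f .
    have b: "\<bar>Re (iexp x - (\<Sum>k\<le>3. (\<i> * x) ^ k / fact k))\<bar> \<le> cmod (iexp x - (\<Sum>k\<le>3. (\<i> * x) ^ k / fact k))"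
      by (rule abs_Re_le_cmod)
    have c: "Re (iexp x - (\<Sum>k\<le>3. (\<i> * x) ^ k / fact k)) = cos x - (1 - x\<^sup>2 / 2)"
      by (simp add: eval_nat_numeral Re_exp power_mult_distrib)
    show ?thesis using order_trans[OF b a] unfolding c .
  qed
  moreover have "\<bar>exp (- (x\<^sup>2 / 2)) - (1 - x\<^sup>2 / 2)\<bar> \<le> x ^ 4 / 8"
  proof -
    define y where "y = x\<^sup>2 / 2"
    have y: "y \<ge> 0" by (simp add: y_def)
    have "1 - y \<le> exp (- y)" using exp_ge_add_one_self[of "- y"] by simp
    moreover have "exp (- y) \<le> 1 - y + y\<^sup>2 / 2"
    proof -
      have e: "1 + y + y\<^sup>2 / 2 \<le> exp y" by (rule exp_lower_Taylor_quadratic[OF y])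
      have eq: "(1 - y + y\<^sup>2 / 2) * (1 + y + y\<^sup>2 / 2) = 1 + y ^ 4 / 4"
        by (simp add: power2_eq_square power4_eq_xxxx field_simps)
      have q: "1 - y + y\<^sup>2 / 2 \<ge> 0"
      proof -
        have "0 \<le> (y - 1)\<^sup>2" by simp
        then show ?thesis by (simp add: power2_eq_square algebra_simps)
      qed
      have "1 \<le> (1 - y + y\<^sup>2 / 2) * (1 + y + y\<^sup>2 / 2)" unfolding eq by simp
      also have "\<dots> \<le> (1 - y + y\<^sup>2 / 2) * exp y" by (rule mult_left_mono[OF e q])
      finally have "1 * exp (- y) \<le> (1 - y + y\<^sup>2 / 2) * exp y * exp (- y)" by (rule mult_right_mono) simp
      also have "\<dots> = 1 - y + y\<^sup>2 / 2" by (simp add: mult.assoc exp_add[symmetric])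
      finally show ?thesis by simp
    qed
    moreover have "y\<^sup>2 / 2 = x ^ 4 / 8" by (simp add: y_def power_divide)
    ultimately show ?thesis by (simp add: y_def)
  qed
  moreover have "x ^ 4 \<ge> 0" by simp
  ultimately show ?thesis by linarith
qed

context rademacher
begin

lemma char_rsum:
  assumes I: "finite I" "\<And>p. p \<in> I \<Longrightarrow> prime p"
  shows "char (distr M borel (rsum I a)) u = of_real (\<Prod>p\<in>I. cos (u * a p))"
proof -
  have m: "rsum I a \<in> borel_measurable M" by (rule measurable_rsum) (use I in auto)
  have "char (distr M borel (rsum I a)) u = expectation (\<lambda>\<omega>. iexp (u * rsum I a \<omega>))"
    unfolding char_def by (rule integral_distr) (use m in auto)
  also have "\<dots> = expectation (\<lambda>\<omega>. \<Prod>p\<in>I. iexp (u * a p * \<epsilon> p \<omega>))"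
    using I(1) by (simp add: rsum_def sum_distrib_left exp_sum mult.assoc)
  also have "\<dots> = (\<Prod>p\<in>I. (iexp (u * a p * 1) + iexp (u * a p * (-1))) / 2)"
    by (rule expectation_prod_sign(2)[OF I, of "\<lambda>p x. iexp (u * a p * x)"]) auto
  also have "\<dots> = (\<Prod>p\<in>I. of_real (cos (u * a p)))"
    by (intro prod.cong refl) (simp add: complex_eq_iff Re_exp Im_exp)
  finally show ?thesis by simp
qed

text \<open>The characteristic function is a product of cosines, which differs from the product of Gaussian factors by at most the
  sum of the fourth powers.\<close>

lemma clt_rsum:
  assumes I: "\<And>n. finite (I n)" "\<And>n p. p \<in> I n \<Longrightarrow> prime p"
    and v: "(\<lambda>n. \<Sum>p\<in>I n. (a n p)\<^sup>2) \<longlonglongrightarrow> v"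
    and small: "(\<lambda>n. \<Sum>p\<in>I n. (a n p) ^ 4) \<longlonglongrightarrow> 0"
    and D: "real_distribution D" "\<And>u. char D u = of_real (exp (- (u\<^sup>2 * v / 2)))"
  shows "weak_conv_m (\<lambda>n. distr M borel (rsum (I n) (a n))) D"
proof (rule levy_continuity[OF _ D(1)])
  fix n show "real_distribution (distr M borel (rsum (I n) (a n)))"
    by (rule real_distribution_distr, rule measurable_rsum) (use I in auto)
next
  fix u
  have diff: "\<bar>(\<Prod>p\<in>I n. cos (u * a n p)) - (\<Prod>p\<in>I n. exp (- ((u * a n p)\<^sup>2 / 2)))\<bar> \<le> u ^ 4 * (\<Sum>p\<in>I n. (a n p) ^ 4)" for n
  proof -
    have "norm ((\<Prod>p\<in>I n. cos (u * a n p)) - (\<Prod>p\<in>I n. exp (- ((u * a n p)\<^sup>2 / 2))))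
      \<le> (\<Sum>p\<in>I n. norm (cos (u * a n p) - exp (- ((u * a n p)\<^sup>2 / 2))))"
      by (rule norm_prod_diff) auto
    also have "\<dots> \<le> (\<Sum>p\<in>I n. (u * a n p) ^ 4)"
      unfolding real_norm_def by (intro sum_mono cos_minus_gauss_le)
    finally show ?thesis by (simp add: power_mult_distrib sum_distrib_left)
  qed
  have prod: "(\<Prod>p\<in>I n. exp (- ((u * a n p)\<^sup>2 / 2))) = exp (- (u\<^sup>2 * (\<Sum>p\<in>I n. (a n p)\<^sup>2) / 2))" for n
    using I(1) by (simp add: exp_sum[symmetric] sum_negf power_mult_distrib sum_distrib_left sum_divide_distrib)
  have "(\<lambda>n. u ^ 4 * (\<Sum>p\<in>I n. (a n p) ^ 4)) \<longlonglongrightarrow> 0" using tendsto_mult_right_zero[OF small] by simp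
  then have "(\<lambda>n. (\<Prod>p\<in>I n. cos (u * a n p)) - exp (- (u\<^sup>2 * (\<Sum>p\<in>I n. (a n p)\<^sup>2) / 2))) \<longlonglongrightarrow> 0"
    by (rule Lim_null_comparison[rotated]) (use diff in \<open>auto simp: prod\<close>)
  moreover have "(\<lambda>n. exp (- (u\<^sup>2 * (\<Sum>p\<in>I n. (a n p)\<^sup>2) / 2))) \<longlonglongrightarrow> exp (- (u\<^sup>2 * v / 2))"
    by (intro tendsto_intros v) auto
  ultimately have "(\<lambda>n. \<Prod>p\<in>I n. cos (u * a n p)) \<longlonglongrightarrow> exp (- (u\<^sup>2 * v / 2))"
    using tendsto_add by fastforce
  then show "(\<lambda>n. char (distr M borel (rsum (I n) (a n))) u) \<longlonglongrightarrow> char D u"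
  proof -
    have "char (distr M borel (rsum (I n) (a n))) u = of_real (\<Prod>p\<in>I n. cos (u * a n p))" for n
      by (rule char_rsum) (use I in auto)
    then show ?thesis
      using tendsto_of_real[OF \<open>(\<lambda>n. \<Prod>p\<in>I n. cos (u * a n p)) \<longlonglongrightarrow> exp (- (u\<^sup>2 * v / 2))\<close>]
      by (simp only: D(2))
  qed
qed

end

lemma (in prob_space) char_distributed_normal:
  assumes X: "distributed M lborel X (normal_density 0 \<sigma>)" and \<sigma>: "\<sigma> > 0"
  shows "char (distr M borel X) u = of_real (exp (- (u\<^sup>2 * \<sigma>\<^sup>2 / 2)))"
proof -
  have m: "X \<in> borel_measurable M" using X by (simp add: distributed_def)
  have std: "distributed M lborel (\<lambda>x. X x / \<sigma>) std_normal_density"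
    using normal_standard_normal_convert[OF \<sigma>, of X 0] X by simp
  have "distr M borel (\<lambda>x. X x / \<sigma>) = distr M lborel (\<lambda>x. X x / \<sigma>)" by (rule distr_cong) auto
  also have "\<dots> = std_normal_distribution" using std by (simp add: distributed_def)
  finally have d: "distr M borel (\<lambda>x. X x / \<sigma>) = std_normal_distribution" .
  have "char (distr M borel X) u = expectation (\<lambda>\<omega>. iexp (u * X \<omega>))"
    unfolding char_def by (rule integral_distr) (use m in auto)
  also have "\<dots> = expectation (\<lambda>\<omega>. iexp (u * \<sigma> * (X \<omega> / \<sigma>)))" using \<sigma> by simp
  also have "\<dots> = char (distr M borel (\<lambda>x. X x / \<sigma>)) (u * \<sigma>)"
    unfolding char_def by (rule integral_distr[symmetric]) (use m in auto)
  also have "\<dots> = of_real (exp (- ((u * \<sigma>)\<^sup>2) / 2))"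
    unfolding d char_std_normal_distribution ..
  finally show ?thesis by (simp add: power_mult_distrib)
qed

section \<open>Joint convergence of independent components\<close>

lemma measurable_PiM_component:
  assumes "i \<in> I" "f \<in> measurable (N i) L"
  shows "(\<lambda>\<omega>. f (\<omega> i)) \<in> measurable (PiM I N) L"
  using measurable_compose[of "\<lambda>\<omega>. \<omega> i" "PiM I N" "N i" f L] assms(2)
    measurable_component_singleton[OF assms(1), of N] by simp

lemma distr_PiM_components:
  fixes \<Omega> :: "'i \<Rightarrow> 'b measure" and Y :: "'i \<Rightarrow> 'b \<Rightarrow> real"
  assumes I: "finite I" and \<Omega>: "\<And>i. prob_space (\<Omega> i)" and Y: "\<And>i. Y i \<in> borel_measurable (\<Omega> i)"
  shows "distr (PiM I \<Omega>) (PiM I (\<lambda>_. borel)) (\<lambda>\<omega>. \<lambda>i\<in>I. Y i (\<omega> i)) = PiM I (\<lambda>i. distr (\<Omega> i) borel (Y i))"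
proof -
  interpret P: product_prob_space \<Omega> I
    by (rule product_prob_spaceI) (rule \<Omega>)
  interpret Q: product_prob_space "\<lambda>i. distr (\<Omega> i) borel (Y i)" I
    by (rule product_prob_spaceI) (intro prob_space.prob_space_distr \<Omega> Y)
  have meas: "(\<lambda>\<omega>. \<lambda>i\<in>I. Y i (\<omega> i)) \<in> measurable (PiM I \<Omega>) (PiM I (\<lambda>_. borel))"
  proof (rule measurable_restrict)
    fix i assume "i \<in> I"
    then show "(\<lambda>\<omega>. Y i (\<omega> i)) \<in> borel_measurable (PiM I \<Omega>)"
      by (rule measurable_PiM_component[where f = "Y i" and i = i and N = \<Omega>]) (rule Y)
  qed
  show ?thesis
  proof (rule Q.PiM_eqI[OF I])
    show "sets (distr (PiM I \<Omega>) (PiM I (\<lambda>_. borel)) (\<lambda>\<omega>. \<lambda>i\<in>I. Y i (\<omega> i))) = sets (PiM I (\<lambda>i. distr (\<Omega> i) borel (Y i)))"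
      unfolding sets_distr by (rule sets_PiM_cong) auto
    fix A assume A: "\<And>i. i \<in> I \<Longrightarrow> A i \<in> sets (distr (\<Omega> i) borel (Y i))"
    have AP: "PiE I A \<in> sets (PiM I (\<lambda>_. borel))" using A I by (intro sets_PiM_I_finite) auto
    have eq: "(\<lambda>\<omega>. \<lambda>i\<in>I. Y i (\<omega> i)) -` PiE I A \<inter> space (PiM I \<Omega>) = PiE I (\<lambda>i. Y i -` A i \<inter> space (\<Omega> i))"
      by (auto simp: space_PiM PiE_iff extensional_def)
    have "emeasure (distr (PiM I \<Omega>) (PiM I (\<lambda>_. borel)) (\<lambda>\<omega>. \<lambda>i\<in>I. Y i (\<omega> i))) (PiE I A)
      = emeasure (PiM I \<Omega>) (PiE I (\<lambda>i. Y i -` A i \<inter> space (\<Omega> i)))"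
      unfolding emeasure_distr[OF meas AP] eq ..
    also have "\<dots> = (\<Prod>i\<in>I. emeasure (\<Omega> i) (Y i -` A i \<inter> space (\<Omega> i)))"
      using A I Y by (intro P.emeasure_PiM) (auto intro: measurable_sets)
    also have "\<dots> = (\<Prod>i\<in>I. emeasure (distr (\<Omega> i) borel (Y i)) (A i))"
      using A Y by (intro prod.cong refl) (auto simp: emeasure_distr)
    finally show "emeasure (distr (PiM I \<Omega>) (PiM I (\<lambda>_. borel)) (\<lambda>\<omega>. \<lambda>i\<in>I. Y i (\<omega> i))) (PiE I A)
      = (\<Prod>i\<in>I. emeasure (distr (\<Omega> i) borel (Y i)) (A i))" .
  qed
qed

text \<open>Skorohod representations of the components, placed on the factors of a product space, converge
  everywhere and have the right joint laws by independence; dominated convergence does the rest.\<close>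

lemma joint_weak_convergence:
  fixes Y :: "nat \<Rightarrow> nat \<Rightarrow> 'a \<Rightarrow> real" and D :: "nat \<Rightarrow> 'b \<Rightarrow> real" and H :: "(nat \<Rightarrow> real) \<Rightarrow> real"
  assumes M: "prob_space M" and N: "prob_space N" and J: "J > 0"
    and Y: "\<And>n. prob_space.indep_vars M (\<lambda>_. borel) (Y n) {..<J}"
    and D: "prob_space.indep_vars N (\<lambda>_. borel) D {..<J}"
    and conv: "\<And>j. j < J \<Longrightarrow> weak_conv_m (\<lambda>n. distr M borel (Y n j)) (distr N borel (D j))"
    and H: "H \<in> borel_measurable (PiM {..<J} (\<lambda>_. borel))" "\<And>v. \<bar>H v\<bar> \<le> C"
    and Hlip: "\<And>v w. \<bar>H v - H w\<bar> \<le> L * (\<Sum>j<J. \<bar>v j - w j\<bar>)"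
  shows "(\<lambda>n. \<integral>\<omega>. H (\<lambda>j. Y n j \<omega>) \<partial>M) \<longlonglongrightarrow> (\<integral>\<omega>. H (\<lambda>j. D j \<omega>) \<partial>N)"
proof -
  interpret M: prob_space M by fact
  interpret N: prob_space N by fact
  have Ym: "Y n j \<in> borel_measurable M" if "j < J" for n j using Y[of n] that by (auto simp: M.indep_vars_def)
  have Dm: "D j \<in> borel_measurable N" if "j < J" for j using D that by (auto simp: N.indep_vars_def)
  have ex: "\<exists>(\<Omega> :: real measure) Ys Yl. prob_space \<Omega> \<and> (\<forall>n. Ys n \<in> borel_measurable \<Omega>) \<and>
     (\<forall>n. distr \<Omega> borel (Ys n) = distr M borel (Y n j)) \<and> Yl \<in> borel_measurable \<Omega> \<and>
     distr \<Omega> borel Yl = distr N borel (D j) \<and> (\<forall>x\<in>space \<Omega>. (\<lambda>n. Ys n x) \<longlonglongrightarrow> Yl x)" if "j < J" for j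
  proof -
    have "real_distribution (distr M borel (Y n j))" for n by (rule M.real_distribution_distr[OF Ym[OF that]])
    moreover have "real_distribution (distr N borel (D j))" by (rule N.real_distribution_distr[OF Dm[OF that]])
    ultimately show ?thesis using Skorohod[OF _ _ conv[OF that]] by simp
  qed
  have "\<exists>(\<Omega> :: nat \<Rightarrow> real measure) Ys Yl. \<forall>j<J. prob_space (\<Omega> j) \<and> (\<forall>n. Ys j n \<in> borel_measurable (\<Omega> j)) \<and>
     (\<forall>n. distr (\<Omega> j) borel (Ys j n) = distr M borel (Y n j)) \<and> Yl j \<in> borel_measurable (\<Omega> j) \<and>
     distr (\<Omega> j) borel (Yl j) = distr N borel (D j) \<and> (\<forall>x\<in>space (\<Omega> j). (\<lambda>n. Ys j n x) \<longlonglongrightarrow> Yl j x)"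
    using ex by metis
  then obtain \<Omega>' :: "nat \<Rightarrow> real measure" and Ys' Yl' where S': "\<And>j. j < J \<Longrightarrow> prob_space (\<Omega>' j) \<and> (\<forall>n. Ys' j n \<in> borel_measurable (\<Omega>' j)) \<and>
     (\<forall>n. distr (\<Omega>' j) borel (Ys' j n) = distr M borel (Y n j)) \<and> Yl' j \<in> borel_measurable (\<Omega>' j) \<and>
     distr (\<Omega>' j) borel (Yl' j) = distr N borel (D j) \<and> (\<forall>x\<in>space (\<Omega>' j). (\<lambda>n. Ys' j n x) \<longlonglongrightarrow> Yl' j x)"
    by blast
  (* Padding by component 0, so that every factor of the product is a probability space. *)
  define i where "i j = (if j < J then j else 0)" for j
  have iJ: "i j < J" for j using J by (simp add: i_def)
  define \<Omega> where "\<Omega> j = \<Omega>' (i j)" for j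
  define Ys where "Ys j = Ys' (i j)" for j
  define Yl where "Yl j = Yl' (i j)" for j
  have S: "prob_space (\<Omega> j)" "Ys j n \<in> borel_measurable (\<Omega> j)" "Yl j \<in> borel_measurable (\<Omega> j)"
    "x \<in> space (\<Omega> j) \<Longrightarrow> (\<lambda>n. Ys j n x) \<longlonglongrightarrow> Yl j x" for j n x
    using S'[OF iJ[of j]] by (auto simp: \<Omega>_def Ys_def Yl_def)
  have S2: "distr (\<Omega> j) borel (Ys j n) = distr M borel (Y n j)" "distr (\<Omega> j) borel (Yl j) = distr N borel (D j)" if "j < J" for j n
    using S'[OF that] that by (auto simp: \<Omega>_def Ys_def Yl_def i_def)
  interpret P: product_prob_space \<Omega> "{..<J}" by (rule product_prob_spaceI) (rule S(1))
  let ?P = "PiM {..<J} \<Omega>" and ?B = "PiM {..<J} (\<lambda>_. borel) :: (nat \<Rightarrow> real) measure"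
  (* The Lipschitz bound makes H depend on the first J coordinates only. *)
  have Hr: "H (\<lambda>j\<in>{..<J}. v j) = H v" for v
    using Hlip[of "\<lambda>j\<in>{..<J}. v j" v] by simp
  have ne: "{..<J} \<noteq> {}" using J by auto
  have mr: "(\<lambda>\<omega>. \<lambda>j\<in>{..<J}. Z j (\<omega> j)) \<in> measurable ?P ?B"
    if Z: "\<And>j. Z j \<in> borel_measurable (\<Omega> j)" for Z
  proof (rule measurable_restrict)
    fix j assume "j \<in> {..<J}"
    then show "(\<lambda>\<omega>. Z j (\<omega> j)) \<in> borel_measurable ?P"
      by (rule measurable_PiM_component[where f = "Z j" and i = j and N = \<Omega>]) (rule Z)
  qed
  have transferM: "(\<integral>\<omega>. H (\<lambda>j. Y n j \<omega>) \<partial>M) = (\<integral>\<omega>. H (\<lambda>j. Ys j n (\<omega> j)) \<partial>?P)" for n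
  proof -
    have "(\<integral>\<omega>. H (\<lambda>j. Y n j \<omega>) \<partial>M) = (\<integral>\<omega>. H (\<lambda>j\<in>{..<J}. Y n j \<omega>) \<partial>M)" by (simp only: Hr)
    also have "\<dots> = integral\<^sup>L (distr M ?B (\<lambda>\<omega>. \<lambda>j\<in>{..<J}. Y n j \<omega>)) H"
      by (rule integral_distr[symmetric, OF _ H(1)]) (intro measurable_restrict Ym, simp)
    also have "distr M ?B (\<lambda>\<omega>. \<lambda>j\<in>{..<J}. Y n j \<omega>) = PiM {..<J} (\<lambda>j. distr M borel (Y n j))"
      using M.indep_vars_iff_distr_eq_PiM'[OF ne, where M' = "\<lambda>_. borel" and X = "Y n"] Y[of n] Ym by auto
    also have "\<dots> = PiM {..<J} (\<lambda>j. distr (\<Omega> j) borel (Ys j n))" by (intro PiM_cong refl) (simp add: S2)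
    also have "\<dots> = distr ?P ?B (\<lambda>\<omega>. \<lambda>j\<in>{..<J}. Ys j n (\<omega> j))"
      by (rule distr_PiM_components[symmetric]) (auto intro: S)
    also have "integral\<^sup>L \<dots> H = (\<integral>\<omega>. H (\<lambda>j\<in>{..<J}. Ys j n (\<omega> j)) \<partial>?P)"
      by (rule integral_distr[OF mr H(1)]) (rule S)
    finally show ?thesis by (simp only: Hr)
  qed
  have transferN: "(\<integral>\<omega>. H (\<lambda>j. D j \<omega>) \<partial>N) = (\<integral>\<omega>. H (\<lambda>j. Yl j (\<omega> j)) \<partial>?P)"
  proof -
    have "(\<integral>\<omega>. H (\<lambda>j. D j \<omega>) \<partial>N) = (\<integral>\<omega>. H (\<lambda>j\<in>{..<J}. D j \<omega>) \<partial>N)" by (simp only: Hr)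
    also have "\<dots> = integral\<^sup>L (distr N ?B (\<lambda>\<omega>. \<lambda>j\<in>{..<J}. D j \<omega>)) H"
      by (rule integral_distr[symmetric, OF _ H(1)]) (intro measurable_restrict Dm, simp)
    also have "distr N ?B (\<lambda>\<omega>. \<lambda>j\<in>{..<J}. D j \<omega>) = PiM {..<J} (\<lambda>j. distr N borel (D j))"
      using N.indep_vars_iff_distr_eq_PiM'[OF ne, where M' = "\<lambda>_. borel" and X = D] D Dm by auto
    also have "\<dots> = PiM {..<J} (\<lambda>j. distr (\<Omega> j) borel (Yl j))" by (intro PiM_cong refl) (simp add: S2)
    also have "\<dots> = distr ?P ?B (\<lambda>\<omega>. \<lambda>j\<in>{..<J}. Yl j (\<omega> j))"
      by (rule distr_PiM_components[symmetric]) (auto intro: S)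
    also have "integral\<^sup>L \<dots> H = (\<integral>\<omega>. H (\<lambda>j\<in>{..<J}. Yl j (\<omega> j)) \<partial>?P)"
      by (rule integral_distr[OF mr H(1)]) (rule S)
    finally show ?thesis by (simp only: Hr)
  qed
  have Hm: "(\<lambda>\<omega>. H (\<lambda>j. Z j (\<omega> j))) \<in> borel_measurable ?P" if "\<And>j. Z j \<in> borel_measurable (\<Omega> j)" for Z
  proof -
    have "(\<lambda>\<omega>. H (\<lambda>j\<in>{..<J}. Z j (\<omega> j))) \<in> borel_measurable ?P"
      by (rule measurable_compose[OF mr H(1)]) (rule that)
    then show ?thesis by (simp only: Hr)
  qed
  have "(\<lambda>n. \<integral>\<omega>. H (\<lambda>j. Ys j n (\<omega> j)) \<partial>?P) \<longlonglongrightarrow> (\<integral>\<omega>. H (\<lambda>j. Yl j (\<omega> j)) \<partial>?P)"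
  proof (rule integral_dominated_convergence[where w = "\<lambda>_. C"])
    show "AE \<omega> in ?P. (\<lambda>n. H (\<lambda>j. Ys j n (\<omega> j))) \<longlonglongrightarrow> H (\<lambda>j. Yl j (\<omega> j))"
    proof (rule AE_I2)
      fix \<omega> assume \<omega>: "\<omega> \<in> space ?P"
      have lim: "(\<lambda>n. Ys j n (\<omega> j)) \<longlonglongrightarrow> Yl j (\<omega> j)" if "j < J" for j
        using \<omega> that by (intro S(4)) (auto simp: space_PiM)
      have "(\<lambda>n. L * (\<Sum>j<J. \<bar>Ys j n (\<omega> j) - Yl j (\<omega> j)\<bar>)) \<longlonglongrightarrow> L * (\<Sum>j<J. \<bar>Yl j (\<omega> j) - Yl j (\<omega> j)\<bar>)"
        by (intro tendsto_intros lim) auto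
      then have "(\<lambda>n. L * (\<Sum>j<J. \<bar>Ys j n (\<omega> j) - Yl j (\<omega> j)\<bar>)) \<longlonglongrightarrow> 0" by simp
      then have "(\<lambda>n. H (\<lambda>j. Ys j n (\<omega> j)) - H (\<lambda>j. Yl j (\<omega> j))) \<longlonglongrightarrow> 0"
        by (rule Lim_null_comparison[rotated]) (auto intro!: always_eventually Hlip)
      then show "(\<lambda>n. H (\<lambda>j. Ys j n (\<omega> j))) \<longlonglongrightarrow> H (\<lambda>j. Yl j (\<omega> j))" by (rule LIM_zero_cancel)
    qed
    show "integrable ?P (\<lambda>_. C)" by (rule P.integrable_const)
  qed (auto intro!: Hm S H(2))
  then show ?thesis by (simp only: transferM transferN)
qed

section \<open>The functional central limit theorem\<close>

lemma (in prob_space) integral_diff_bound: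
  fixes f g :: "'a \<Rightarrow> real"
  assumes f: "f \<in> borel_measurable M" "\<And>\<omega>. \<bar>f \<omega>\<bar> \<le> C" and g: "g \<in> borel_measurable M" "\<And>\<omega>. \<bar>g \<omega>\<bar> \<le> C"
    and E: "E \<in> events" and ae: "AE \<omega> in M. \<omega> \<notin> E \<longrightarrow> \<bar>f \<omega> - g \<omega>\<bar> \<le> \<eta>" and \<eta>: "\<eta> \<ge> 0"
  shows "\<bar>expectation f - expectation g\<bar> \<le> \<eta> + 2 * C * prob E"
proof -
  have C: "C \<ge> 0" using f(2)[of undefined] by linarith
  have int: "integrable M f" "integrable M g"
    using f g by (auto intro!: integrable_const_bound[where B = C])
  have intE: "integrable M (\<lambda>\<omega>. \<eta> + 2 * C * indicat_real E \<omega>)"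
    using E by (auto simp: emeasure_eq_measure)
  have "\<bar>expectation f - expectation g\<bar> = \<bar>expectation (\<lambda>\<omega>. f \<omega> - g \<omega>)\<bar>" using int by simp
  also have "\<dots> \<le> expectation (\<lambda>\<omega>. \<bar>f \<omega> - g \<omega>\<bar>)" by (rule integral_abs_bound)
  also have "\<dots> \<le> expectation (\<lambda>\<omega>. \<eta> + 2 * C * indicat_real E \<omega>)"
  proof (rule integral_mono_AE)
    show "AE \<omega> in M. \<bar>f \<omega> - g \<omega>\<bar> \<le> \<eta> + 2 * C * indicat_real E \<omega>"
      using ae
    proof eventually_elim
      case (elim \<omega>)
      show ?case
      proof (cases "\<omega> \<in> E")
        case True
        then show ?thesis using f(2)[of \<omega>] g(2)[of \<omega>] \<eta> by (simp add: indicator_def)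
      next
        case False
        then show ?thesis using elim by simp
      qed
    qed
  qed (use int intE in auto)
  also have "\<dots> = \<eta> + 2 * C * prob E"
    using E by (subst Bochner_Integration.integral_add) (auto simp: emeasure_eq_measure prob_space)
  finally show ?thesis .
qed

lemma borel_lip_functional:
  assumes F: "lip_functional L T F"
  shows "F \<in> borel_measurable borel"
proof (rule borel_measurable_continuous_onI)
  have L: "L \<ge> 0" using F by (simp add: lip_functional_def)
  show "continuous_on UNIV F"
    unfolding continuous_on_open_vimage[OF open_UNIV]
  proof (intro allI impI)
    fix U :: "real set" assume U: "open U"
    show "open (F -` U \<inter> UNIV)"
      unfolding open_cpath_def
    proof
      fix x assume x: "x \<in> F -` U \<inter> UNIV"
      then obtain e where e: "e > 0" "\<And>z. \<bar>z - F x\<bar> < e \<Longrightarrow> z \<in> U"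
        using U unfolding open_dist by (auto simp: dist_real_def)
      define r where "r = e / (2 * (L + 1))"
      have r: "r > 0" using e L by (simp add: r_def)
      have "L * r \<le> (L + 1) * r" using r by (simp add: distrib_right)
      also have "\<dots> = e / 2" using L by (simp add: r_def field_simps)
      finally have Lr: "L * r < e" using e by simp
      have "y \<in> F -` U \<inter> UNIV" if "\<forall>t\<in>{0..real T}. \<bar>path_at y t - path_at x t\<bar> < r" for y
      proof -
        have "\<bar>F y - F x\<bar> \<le> L * r" by (rule lip_functionalD[OF F]) (use that r in \<open>auto intro: less_imp_le\<close>)
        then show ?thesis using e(2)[of "F y"] Lr by auto
      qed
      then show "\<exists>T\<ge>0. \<exists>e>0. \<forall>y. (\<forall>t\<in>{0..T}. \<bar>path_at y t - path_at x t\<bar> < e) \<longrightarrow> y \<in> F -` U \<inter> UNIV"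
        using r by (intro exI[of _ "real T"] conjI exI[of _ r]) auto
    qed
  qed
qed

lemma prob_space_path_law:
  assumes "prob_space M" "continuous_process M X"
  shows "prob_space (path_law M X)" "sets (path_law M X) = sets borel"
proof -
  obtain X' where X': "\<And>t. t \<ge> 0 \<Longrightarrow> X' t \<in> borel_measurable M"
    "\<And>\<omega>. \<omega> \<in> space M \<Longrightarrow> continuous_on {0..} (\<lambda>t. X' t \<omega>)"
    "path_law M X = distr M borel (\<lambda>\<omega>. to_cpath (\<lambda>t. X' t \<omega>))"
    using continuous_process_modification[OF assms(2)] by metis
  show "prob_space (path_law M X)"
    unfolding X'(3) by (rule prob_space.prob_space_distr[OF assms(1) measurable_to_cpath[OF X'(1,2)]])
  show "sets (path_law M X) = sets borel" by (simp add: X'(3))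
qed

context rademacher
begin

definition block_sum :: "real \<Rightarrow> nat \<Rightarrow> nat \<Rightarrow> 'a \<Rightarrow> real" where
  "block_sum L n j \<omega> = (walk (L * (real (Suc j) / 2 ^ n)) \<omega> - walk (L * (real j / 2 ^ n)) \<omega>) / sqrt L"

lemma grid_times:
  assumes "L > 0"
  shows "0 \<le> L * (real j / 2 ^ n)" "i \<le> j \<Longrightarrow> L * (real i / 2 ^ n) \<le> L * (real j / 2 ^ n)"
    "L * (real (Suc j) / 2 ^ n) - L * (real j / 2 ^ n) = L / 2 ^ n"
  using assms by (auto intro!: mult_left_mono divide_right_mono simp: field_simps)

lemma block_sum_rsum:
  assumes L: "L > 0"
  shows "block_sum L n j = rsum (early_primes (L * (real (Suc j) / 2 ^ n)) - early_primes (L * (real j / 2 ^ n)))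
           (\<lambda>p. prime_weight 0 p / sqrt L)"
proof
  fix \<omega>
  have le: "L * (real j / 2 ^ n) \<le> L * (real (Suc j) / 2 ^ n)" by (rule grid_times(2)[OF L]) simp
  show "block_sum L n j \<omega> = rsum (early_primes (L * (real (Suc j) / 2 ^ n)) - early_primes (L * (real j / 2 ^ n)))
           (\<lambda>p. prime_weight 0 p / sqrt L) \<omega>"
    unfolding block_sum_def walk_increment[OF le] rsum_def by (simp add: sum_divide_distrib)
qed

lemma indep_block_sum:
  assumes L: "L > 0"
  shows "indep_vars (\<lambda>_. borel) (block_sum L n) {..<J}"
  unfolding block_sum_rsum[OF L, abs_def]
proof (rule indep_rsum_blocks)
  show "disjoint_family_on (\<lambda>j. early_primes (L * (real (Suc j) / 2 ^ n)) - early_primes (L * (real j / 2 ^ n))) {..<J}"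
    by (rule disjoint_early_primes[where t = "\<lambda>j. L * (real j / 2 ^ n)"]) (rule grid_times(2)[OF L])
qed (auto simp: early_primes_prime)

text \<open>The weights are at most \<open>1\<close> before scaling, so the sum of fourth powers after scaling by \<open>1 / sqrt L\<close> is at most
  the variance divided by \<open>L\<close>.\<close>

lemma block_sum_clt:
  assumes L: "\<And>i. L i > 0" "filterlim L at_top sequentially"
    and D: "real_distribution D" "\<And>u. char D u = of_real (exp (- (u\<^sup>2 * (1 / 2 ^ n) / 2)))"
  shows "weak_conv_m (\<lambda>i. distr M borel (block_sum (L i) n j)) D"
  unfolding block_sum_rsum[OF L(1)]
proof (rule clt_rsum[OF _ _ _ _ D])
  let ?K = "\<lambda>i. early_primes (L i * (real (Suc j) / 2 ^ n)) - early_primes (L i * (real j / 2 ^ n))"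
  let ?V = "\<lambda>i. \<Sum>p\<in>?K i. (prime_weight 0 p)\<^sup>2"
  have V: "\<bar>?V i - L i / 2 ^ n\<bar> \<le> 2 * var_const" for i
  proof -
    have a: "0 \<le> L i * (real j / 2 ^ n)" by (rule grid_times(1)[OF L(1)])
    have b: "L i * (real j / 2 ^ n) \<le> L i * (real (Suc j) / 2 ^ n)" by (rule grid_times(2)[OF L(1)]) simp
    show ?thesis using early_primes_increment[OF a b] unfolding grid_times(3)[OF L(1)] .
  qed
  have Linv: "(\<lambda>i. 1 / L i) \<longlonglongrightarrow> 0"
    using tendsto_inverse_0_at_top[OF L(2)] by (simp add: inverse_eq_divide)
  have c0: "(\<lambda>i. 2 * var_const * (1 / L i)) \<longlonglongrightarrow> 0" using tendsto_mult_right_zero[OF Linv] by simp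
  have "(\<lambda>i. ?V i / L i - 1 / 2 ^ n) \<longlonglongrightarrow> 0"
  proof (rule Lim_null_comparison[OF _ c0], intro always_eventually allI)
    fix i
    have "?V i / L i - 1 / 2 ^ n = (?V i - L i / 2 ^ n) / L i" using L(1)[of i] by (simp add: diff_divide_distrib)
    then show "norm (?V i / L i - 1 / 2 ^ n) \<le> 2 * var_const * (1 / L i)"
      using V[of i] L(1)[of i] by (simp add: divide_right_mono)
  qed
  then have Vl: "(\<lambda>i. ?V i / L i) \<longlonglongrightarrow> 1 / 2 ^ n" by (rule LIM_zero_cancel)
  have sq: "(\<Sum>p\<in>?K i. (prime_weight 0 p / sqrt (L i))\<^sup>2) = ?V i / L i" for i
    using L(1)[of i] by (simp add: power_divide sum_divide_distrib)
  show "(\<lambda>i. \<Sum>p\<in>?K i. (prime_weight 0 p / sqrt (L i))\<^sup>2) \<longlonglongrightarrow> 1 / 2 ^ n" unfolding sq by (rule Vl)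
  show "(\<lambda>i. \<Sum>p\<in>?K i. (prime_weight 0 p / sqrt (L i)) ^ 4) \<longlonglongrightarrow> 0"
  proof (rule Lim_null_comparison)
    show "(\<lambda>i. ?V i / L i * (1 / L i)) \<longlonglongrightarrow> 0" using tendsto_mult[OF Vl Linv] by simp
    show "\<forall>\<^sub>F i in sequentially. norm (\<Sum>p\<in>?K i. (prime_weight 0 p / sqrt (L i)) ^ 4) \<le> ?V i / L i * (1 / L i)"
    proof (intro always_eventually allI)
      fix i
      have L0: "L i > 0" by (rule L(1))
      have "norm (\<Sum>p\<in>?K i. (prime_weight 0 p / sqrt (L i)) ^ 4) = (\<Sum>p\<in>?K i. (prime_weight 0 p / sqrt (L i)) ^ 4)"
        by (simp add: sum_nonneg)
      also have "\<dots> \<le> (\<Sum>p\<in>?K i. (prime_weight 0 p)\<^sup>2 * (1 / (L i * L i)))"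
      proof (rule sum_mono)
        fix p assume "p \<in> ?K i"
        then have w: "\<bar>prime_weight 0 p\<bar> \<le> 1" by (intro prime_weight_0_le_1) (auto simp: early_primes_prime)
        then have "(prime_weight 0 p)\<^sup>2 \<le> 1" by (simp add: abs_square_le_1)
        then have "(prime_weight 0 p)\<^sup>2 * (prime_weight 0 p)\<^sup>2 \<le> (prime_weight 0 p)\<^sup>2 * 1" by (intro mult_left_mono) auto
        then have le: "(prime_weight 0 p)\<^sup>2 * (prime_weight 0 p)\<^sup>2 / (L i * L i) \<le> (prime_weight 0 p)\<^sup>2 * 1 / (L i * L i)"
          by (rule divide_right_mono) (use L0 in simp)
        have e1: "(sqrt (L i)) ^ 4 = L i * L i"
        proof -
          have "(sqrt (L i)) ^ 4 = (sqrt (L i))\<^sup>2 * (sqrt (L i))\<^sup>2" by (simp only: power_add[symmetric]) simp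
          then show ?thesis using L0 by simp
        qed
        have e2: "(prime_weight 0 p) ^ 4 = (prime_weight 0 p)\<^sup>2 * (prime_weight 0 p)\<^sup>2"
          by (simp only: power_add[symmetric]) simp
        show "(prime_weight 0 p / sqrt (L i)) ^ 4 \<le> (prime_weight 0 p)\<^sup>2 * (1 / (L i * L i))"
          unfolding power_divide e1 e2 times_divide_eq_right by (rule le)
      qed
      also have "\<dots> = ?V i / L i * (1 / L i)" unfolding sum_distrib_right[symmetric] by simp
      finally show "norm (\<Sum>p\<in>?K i. (prime_weight 0 p / sqrt (L i)) ^ 4) \<le> ?V i / L i * (1 / L i)" .
    qed
  qed
qed (auto simp: early_primes_prime)

abbreviation scaled_process :: "nat \<Rightarrow> real \<Rightarrow> real \<Rightarrow> 'a \<Rightarrow> real" where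
  "scaled_process k s t \<omega> \<equiv> 1 / sqrt (ln (1/s)) * centred_log_sum k (\<lambda>p. \<epsilon> p \<omega>) (s powr t)"

lemma continuous_process_scaled:
  assumes k: "k \<ge> 3" and s: "0 < s" "s < 1"
  shows "continuous_process M (scaled_process k s)"
  unfolding continuous_process_def
proof (intro conjI allI impI)
  show "AE \<omega> in M. continuous_on {0..} (\<lambda>t. scaled_process k s t \<omega>)"
    using AE_centred_log_sum[OF k]
  proof eventually_elim
    case (elim \<omega>)
    have "continuous_on {0..} (\<lambda>t. centred_log_sum k (\<lambda>p. \<epsilon> p \<omega>) (s powr t))"
      by (rule continuous_on_compose2[OF conjunct1[OF conjunct2[OF elim]]]) (use s in \<open>auto intro!: continuous_intros\<close>)
    then show ?case by (intro continuous_intros)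
  qed
qed measurable

text \<open>The three errors \<open>\<delta>\<close> come from interpolation, twice, and from replacing the increments of the prime
  series by those of the walk; the deterministic error is the centring. The first bound for the
  probability is uniform in \<open>s\<close> and vanishes as the mesh \<open>1 / 2 ^ n\<close> tends to \<open>0\<close>; for fixed \<open>n\<close> the second vanishes as
  \<open>s\<close> tends to \<open>0\<close>.\<close>

lemma scaled_process_approximation:
  fixes n T :: nat and s \<delta> :: real
  assumes k: "k \<ge> 3" and s: "0 < s" "s < 1" and T: "T > 0" and \<delta>: "\<delta> > 0"
  defines "L \<equiv> ln (1/s)" and "J \<equiv> T * 2 ^ n"
  shows "\<exists>E\<in>events. prob E \<le> 5 * real T * chain_const 2 * 100\<^sup>2 * 2 ^ n * (1 / 2 ^ n / \<delta>\<^sup>2)\<^sup>2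
        + real (J + 2) * (2 * exp (- ((\<delta> / real (2 * J + 1))\<^sup>2 * L / (2 * var_const)))) \<and>
    (AE \<omega> in M. \<omega> \<notin> E \<longrightarrow> (\<forall>t. 0 \<le> t \<longrightarrow> t < real T \<longrightarrow>
       \<bar>scaled_process k s t \<omega> - polygon n J 0 (\<lambda>j. block_sum L n j \<omega>) t\<bar> \<le> 3 * \<delta> + centring_const / sqrt L))"
proof -
  have L: "L > 0" unfolding L_def using s by simp
  have sq: "sqrt L > 0" "(sqrt L)\<^sup>2 = L" using L by auto
  define G where "G t \<omega> = gproc (L * t) \<omega> / sqrt L" for t \<omega>
  define R where "R j \<omega> = (gproc (L * (real j / 2 ^ n)) \<omega> - walk (L * (real j / 2 ^ n)) \<omega>) / sqrt L" for j \<omega>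
  have [measurable]: "G t \<in> borel_measurable M" for t unfolding G_def by measurable
  have [measurable]: "R j \<in> borel_measurable M" for j unfolding R_def by measurable
  have "\<exists>E\<in>events. prob E \<le> 5 * real T * chain_const 2 * 100 ^ 2 * 2 ^ n * (1 / 2 ^ n / \<delta>\<^sup>2) ^ 2 \<and>
    (\<forall>\<omega>\<in>space M - E.
       (\<forall>j<T * 2 ^ n. \<bar>G (real (Suc j) / 2 ^ n) \<omega> - G (real j / 2 ^ n) \<omega>\<bar> \<le> \<delta>) \<and>
       (continuous_on {0..} (\<lambda>t. G t \<omega>) \<longrightarrow>
          (\<forall>t. 0 \<le> t \<longrightarrow> t < real T \<longrightarrow> \<bar>G t \<omega> - G (dyadic_floor n t) \<omega>\<bar> \<le> \<delta>)))"
  proof (rule chaining)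
    fix a b x :: real assume ab: "0 \<le> a" "a \<le> b" "b \<le> real T" "x > 0"
    have "{\<omega>\<in>space M. \<bar>G b \<omega> - G a \<omega>\<bar> \<ge> x} = {\<omega>\<in>space M. \<bar>gproc (L * b) \<omega> - gproc (L * a) \<omega>\<bar> \<ge> x * sqrt L}"
      using sq(1) by (auto simp: G_def diff_divide_distrib[symmetric] abs_divide le_divide_eq)
    then have "prob {\<omega>\<in>space M. \<bar>G b \<omega> - G a \<omega>\<bar> \<ge> x} \<le> chain_const 2 * ((L * b - L * a) / (x * sqrt L)\<^sup>2) ^ 2"
      using gproc_increment_tail[of "L * a" "L * b" "x * sqrt L" 2] ab L sq by (simp add: mult_left_mono)
    also have "(L * b - L * a) / (x * sqrt L)\<^sup>2 = 1 * (b - a) / x\<^sup>2"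
      using L sq(2) by (simp add: power_mult_distrib right_diff_distrib[symmetric])
    finally show "prob {\<omega>\<in>space M. \<bar>G b \<omega> - G a \<omega>\<bar> \<ge> x} \<le> chain_const 2 * (1 * (b - a) / x\<^sup>2) ^ 2" .
  qed (use \<delta> chain_const_nonneg in auto)
  then obtain E1 where E1: "E1 \<in> events" "prob E1 \<le> 5 * real T * chain_const 2 * 100\<^sup>2 * 2 ^ n * (1 / 2 ^ n / \<delta>\<^sup>2)\<^sup>2"
    "\<And>\<omega> j. \<omega> \<in> space M - E1 \<Longrightarrow> j < T * 2 ^ n \<Longrightarrow> \<bar>G (real (Suc j) / 2 ^ n) \<omega> - G (real j / 2 ^ n) \<omega>\<bar> \<le> \<delta>"
    "\<And>\<omega> t. \<omega> \<in> space M - E1 \<Longrightarrow> continuous_on {0..} (\<lambda>t. G t \<omega>) \<Longrightarrow> 0 \<le> t \<Longrightarrow> t < real T \<Longrightarrow> \<bar>G t \<omega> - G (dyadic_floor n t) \<omega>\<bar> \<le> \<delta>"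
    by blast
  (* There are 2 J + 1 errors of the walk approximation: two for each increment and one at time 0. *)
  define \<delta>' where "\<delta>' = \<delta> / real (2 * J + 1)"
  have \<delta>': "\<delta>' > 0" using \<delta> by (simp add: \<delta>'_def)
  let ?e = "2 * exp (- (\<delta>'\<^sup>2 * L / (2 * var_const)))"
  have tail: "prob {\<omega>\<in>space M. \<bar>Y \<omega> / sqrt L\<bar> \<ge> \<delta>'} \<le> ?e" if Y: "subgaussian M var_const Y" for Y
  proof -
    have "{\<omega>\<in>space M. \<bar>Y \<omega> / sqrt L\<bar> \<ge> \<delta>'} = {\<omega>\<in>space M. \<bar>Y \<omega>\<bar> \<ge> \<delta>' * sqrt L}"
      using sq(1) by (auto simp: abs_divide le_divide_eq)
    then have "prob {\<omega>\<in>space M. \<bar>Y \<omega> / sqrt L\<bar> \<ge> \<delta>'} \<le> 2 * exp (- ((\<delta>' * sqrt L)\<^sup>2 / (2 * var_const)))"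
      using subgaussian_tail_abs[OF Y var_const_pos(1), of "\<delta>' * sqrt L"] \<delta>' sq by simp
    then show ?thesis using sq(2) by (simp add: power_mult_distrib)
  qed
  define E0 where "E0 = {\<omega>\<in>space M. \<bar>G 0 \<omega>\<bar> \<ge> \<delta>'}"
  define ER where "ER = (\<Union>j\<le>J. {\<omega>\<in>space M. \<bar>R j \<omega>\<bar> \<ge> \<delta>'})"
  have [measurable]: "E0 \<in> events" "ER \<in> events" unfolding E0_def ER_def by measurable
  have p0: "prob E0 \<le> ?e"
  proof -
    have "subgaussian M var_const (gproc 0)" using subgaussian_gproc[of 0] by simp
    from tail[OF this] show ?thesis by (simp add: E0_def G_def)
  qed
  have pR: "prob ER \<le> real (J + 1) * ?e"
  proof -
    have "prob ER \<le> (\<Sum>j\<le>J. prob {\<omega>\<in>space M. \<bar>R j \<omega>\<bar> \<ge> \<delta>'})"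
      unfolding ER_def by (intro finite_measure_subadditive_finite) auto
    also have "\<dots> \<le> (\<Sum>j\<le>J. ?e)"
      unfolding R_def by (intro sum_mono tail subgaussian_gproc_walk grid_times(1)[OF L])
    finally show ?thesis by simp
  qed
  let ?E = "E1 \<union> E0 \<union> ER"
  have "prob ?E \<le> prob E1 + prob E0 + prob ER"
  proof -
    have "prob ?E \<le> prob (E1 \<union> E0) + prob ER" using E1(1) by (intro measure_Un_le) auto
    moreover have "prob (E1 \<union> E0) \<le> prob E1 + prob E0" using E1(1) by (intro measure_Un_le) auto
    ultimately show ?thesis by linarith
  qed
  also have "\<dots> \<le> 5 * real T * chain_const 2 * 100\<^sup>2 * 2 ^ n * (1 / 2 ^ n / \<delta>\<^sup>2)\<^sup>2 + real (J + 2) * ?e"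
  proof -
    have "real (J + 2) * ?e = ?e + real (J + 1) * ?e" by (simp add: algebra_simps)
    then show ?thesis using E1(2) p0 pR by linarith
  qed
  finally have pE: "prob ?E \<le> 5 * real T * chain_const 2 * 100\<^sup>2 * 2 ^ n * (1 / 2 ^ n / \<delta>\<^sup>2)\<^sup>2 + real (J + 2) * ?e" .
  have "AE \<omega> in M. \<omega> \<notin> ?E \<longrightarrow> (\<forall>t. 0 \<le> t \<longrightarrow> t < real T \<longrightarrow>
       \<bar>scaled_process k s t \<omega> - polygon n J 0 (\<lambda>j. block_sum L n j \<omega>) t\<bar> \<le> 3 * \<delta> + centring_const / sqrt L)"
    using AE_centred_log_sum[OF k] AE_space
  proof eventually_elim
    fix \<omega>
    assume c: "good_signs \<omega> \<and> continuous_on {0<..} (centred_log_sum k (\<lambda>p. \<epsilon> p \<omega>)) \<and>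
        (\<forall>h>0. \<bar>centred_log_sum k (\<lambda>p. \<epsilon> p \<omega>) h - prime_series \<omega> h\<bar> \<le> centring_const)"
      and sp: "\<omega> \<in> space M"
    show "\<omega> \<notin> ?E \<longrightarrow> (\<forall>t. 0 \<le> t \<longrightarrow> t < real T \<longrightarrow>
       \<bar>scaled_process k s t \<omega> - polygon n J 0 (\<lambda>j. block_sum L n j \<omega>) t\<bar> \<le> 3 * \<delta> + centring_const / sqrt L)"
    proof (intro impI allI)
      fix t assume \<omega>: "\<omega> \<notin> ?E" and t: "0 \<le> t" "t < real T"
      have \<omega>1: "\<omega> \<in> space M - E1" using \<omega> sp by auto
      have G0: "\<bar>G 0 \<omega>\<bar> \<le> \<delta>'" using \<omega> sp by (auto simp: E0_def)
      have Rj: "\<bar>R j \<omega>\<bar> \<le> \<delta>'" if "j \<le> J" for j using \<omega> sp that by (auto simp: ER_def not_le intro: less_imp_le)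
      have Gc: "continuous_on {0..} (\<lambda>t. G t \<omega>)"
        unfolding G_def using c sq(1)
        by (intro continuous_on_divide continuous_on_const continuous_on_compose2[OF continuous_on_gproc[of \<omega> UNIV]] continuous_intros) auto
      have st: "s powr t = exp (- (L * t))" using s by (simp add: powr_def L_def ln_div)
      have "\<bar>scaled_process k s t \<omega> - G t \<omega>\<bar> \<le> centring_const / sqrt L"
      proof -
        have "scaled_process k s t \<omega> - G t \<omega> = (centred_log_sum k (\<lambda>p. \<epsilon> p \<omega>) (s powr t) - prime_series \<omega> (s powr t)) / sqrt L"
          by (simp add: G_def gproc_def st L_def[symmetric] diff_divide_distrib)
        moreover have "\<bar>centred_log_sum k (\<lambda>p. \<epsilon> p \<omega>) (s powr t) - prime_series \<omega> (s powr t)\<bar> \<le> centring_const"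
          using c s by simp
        ultimately show ?thesis using sq(1) by (simp add: divide_right_mono)
      qed
      moreover have "\<bar>G t \<omega> - polygon n J (G 0 \<omega>) (grid_increment n (\<lambda>t. G t \<omega>)) t\<bar> \<le> 2 * \<delta>"
        unfolding J_def using E1(3)[OF \<omega>1] E1(4)[OF \<omega>1 Gc t] by (intro interpolation_close t) auto
      moreover have "\<bar>polygon n J (G 0 \<omega>) (grid_increment n (\<lambda>t. G t \<omega>)) t - polygon n J 0 (\<lambda>j. block_sum L n j \<omega>) t\<bar> \<le> \<delta>"
      proof -
        have "\<bar>polygon n J (G 0 \<omega>) (grid_increment n (\<lambda>t. G t \<omega>)) t - polygon n J 0 (\<lambda>j. block_sum L n j \<omega>) t\<bar>
          \<le> \<bar>G 0 \<omega> - 0\<bar> + (\<Sum>j<J. \<bar>(G (real (Suc j) / 2 ^ n) \<omega> - G (real j / 2 ^ n) \<omega>) - block_sum L n j \<omega>\<bar>)"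
          by (rule polygon_diff_le)
        also have "\<dots> \<le> \<delta>' + (\<Sum>j<J. 2 * \<delta>')"
        proof (intro add_mono sum_mono)
          fix j assume j: "j \<in> {..<J}"
          have "(G (real (Suc j) / 2 ^ n) \<omega> - G (real j / 2 ^ n) \<omega>) - block_sum L n j \<omega> = R (Suc j) \<omega> - R j \<omega>"
            by (simp add: G_def R_def block_sum_def diff_divide_distrib)
          moreover have "\<bar>R (Suc j) \<omega>\<bar> \<le> \<delta>'" "\<bar>R j \<omega>\<bar> \<le> \<delta>'" using j by (auto intro!: Rj)
          ultimately show "\<bar>(G (real (Suc j) / 2 ^ n) \<omega> - G (real j / 2 ^ n) \<omega>) - block_sum L n j \<omega>\<bar> \<le> 2 * \<delta>'" by linarith
        qed (use G0 in simp)
        also have "\<dots> = real (2 * J + 1) * \<delta>'" by (simp add: algebra_simps)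
        also have "\<dots> = \<delta>" by (simp add: \<delta>'_def)
        finally show ?thesis .
      qed
      ultimately show "\<bar>scaled_process k s t \<omega> - polygon n J 0 (\<lambda>j. block_sum L n j \<omega>) t\<bar> \<le> 3 * \<delta> + centring_const / sqrt L"
        by linarith
    qed
  qed
  then show ?thesis using pE E1(1) unfolding \<delta>'_def by (intro bexI[of _ ?E]) auto
qed

section \<open>Convergence to Brownian motion\<close>

context
  fixes k :: nat and N :: "'b measure" and B :: "real \<Rightarrow> 'b \<Rightarrow> real"
  assumes k: "k \<ge> 3" and BM: "standard_brownian_motion N B"
begin

lemma brownian_prob_space: "prob_space N"
  using BM unfolding standard_brownian_motion_def by (elim conjE)

lemma brownian_continuous: "continuous_process N B"
  using BM unfolding standard_brownian_motion_def by (elim conjE)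

lemma brownian_0: "AE \<omega> in N. B 0 \<omega> = 0"
  using BM unfolding standard_brownian_motion_def by (elim conjE)

abbreviation (input) brownian_increment :: "nat \<Rightarrow> nat \<Rightarrow> 'b \<Rightarrow> real" where
  "brownian_increment n j \<omega> \<equiv> B (real (Suc j) / 2 ^ n) \<omega> - B (real j / 2 ^ n) \<omega>"

lemma brownian_measurable: "t \<ge> 0 \<Longrightarrow> B t \<in> borel_measurable N"
  using brownian_continuous by (simp add: continuous_process_def)

lemma indep_brownian_increments:
  "prob_space.indep_vars N (\<lambda>_. borel) (\<lambda>j \<omega>. brownian_increment n j \<omega>) {..<J}"
proof -
  have "\<forall>(n::nat) (\<tau> :: nat \<Rightarrow> real). 0 \<le> \<tau> 0 \<and> strict_mono_on {..n} \<tau> \<longrightarrow>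
      prob_space.indep_vars N (\<lambda>_. borel) (\<lambda>i \<omega>. B (\<tau> (Suc i)) \<omega> - B (\<tau> i) \<omega>) {..<n}"
    using BM unfolding standard_brownian_motion_def by (elim conjE)
  from this[rule_format, of "\<lambda>j. real j / 2 ^ n" J] show ?thesis
    by (auto simp: strict_mono_on_def divide_strict_right_mono)
qed

lemma char_brownian_increment:
  "real_distribution (distr N borel (\<lambda>\<omega>. brownian_increment n j \<omega>))"
  "char (distr N borel (\<lambda>\<omega>. brownian_increment n j \<omega>)) u = of_real (exp (- (u\<^sup>2 * (1 / 2 ^ n) / 2)))"
proof -
  interpret N: prob_space N by (rule brownian_prob_space)
  have m: "(\<lambda>\<omega>. brownian_increment n j \<omega>) \<in> borel_measurable N"
    by (intro borel_measurable_diff brownian_measurable) auto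
  show "real_distribution (distr N borel (\<lambda>\<omega>. brownian_increment n j \<omega>))"
    by (rule N.real_distribution_distr[OF m])
  have "\<forall>s t. 0 \<le> s \<and> s < t \<longrightarrow>
      distributed N lborel (\<lambda>\<omega>. B t \<omega> - B s \<omega>) (normal_density 0 (sqrt (t - s)))"
    using BM unfolding standard_brownian_motion_def by (elim conjE)
  note incr = this[rule_format, of "real j / 2 ^ n" "real (Suc j) / 2 ^ n"]
  have lt: "0 \<le> real j / 2 ^ n \<and> real j / 2 ^ n < real (Suc j) / 2 ^ n"
    by (auto intro!: divide_strict_right_mono)
  have d: "real (Suc j) / 2 ^ n - real j / 2 ^ n = 1 / 2 ^ n" by (simp add: diff_divide_distrib[symmetric])
  have "distributed N lborel (\<lambda>\<omega>. brownian_increment n j \<omega>) (normal_density 0 (sqrt (1 / 2 ^ n)))"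
    using incr[OF lt] unfolding d .
  from N.char_distributed_normal[OF this]
  show "char (distr N borel (\<lambda>\<omega>. brownian_increment n j \<omega>)) u = of_real (exp (- (u\<^sup>2 * (1 / 2 ^ n) / 2)))"
    by simp
qed

lemma polygon_convergence:
  assumes F: "lip_functional Lp T F" "\<And>x. \<bar>F x\<bar> \<le> C" and T: "T > 0"
    and L: "\<And>i. L i > 0" "filterlim L at_top sequentially"
  shows "(\<lambda>i. expectation (\<lambda>\<omega>. F (polygon_path n (T * 2 ^ n) 0 (\<lambda>j. block_sum (L i) n j \<omega>))))
     \<longlonglongrightarrow> (\<integral>\<omega>. F (polygon_path n (T * 2 ^ n) 0 (\<lambda>j. brownian_increment n j \<omega>)) \<partial>N)"
proof (rule joint_weak_convergence[where J = "T * 2 ^ n" and Y = "\<lambda>i. block_sum (L i) n"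
      and D = "\<lambda>j \<omega>. brownian_increment n j \<omega>" and H = "\<lambda>v. F (polygon_path n (T * 2 ^ n) 0 v)"
      and C = C and L = Lp])
  show "prob_space M" by (rule prob_space_axioms)
  show "prob_space N" by (rule brownian_prob_space)
  show "0 < T * 2 ^ n" using T by simp
  show "indep_vars (\<lambda>_. borel) (block_sum (L i) n) {..<T * 2 ^ n}" for i by (rule indep_block_sum[OF L(1)])
  show "prob_space.indep_vars N (\<lambda>_. borel) (\<lambda>j \<omega>. brownian_increment n j \<omega>) {..<T * 2 ^ n}"
    by (rule indep_brownian_increments)
  show "weak_conv_m (\<lambda>i. distr M borel (block_sum (L i) n j)) (distr N borel (\<lambda>\<omega>. brownian_increment n j \<omega>))" for j
    by (rule block_sum_clt[OF L char_brownian_increment])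
  show "(\<lambda>v. F (polygon_path n (T * 2 ^ n) 0 v)) \<in> borel_measurable (PiM {..<T * 2 ^ n} (\<lambda>_. borel))"
    using borel_measurable_polygon_functional[OF F(1), where a = "\<lambda>_. 0" and y = "\<lambda>j v. v j"
        and M = "PiM {..<T * 2 ^ n} (\<lambda>_. borel)" and J = "T * 2 ^ n" and n = n] by simp
  show "\<bar>F (polygon_path n (T * 2 ^ n) 0 v)\<bar> \<le> C" for v by (rule F(2))
  show "\<bar>F (polygon_path n (T * 2 ^ n) 0 v) - F (polygon_path n (T * 2 ^ n) 0 w)\<bar> \<le> Lp * (\<Sum>j<T * 2 ^ n. \<bar>v j - w j\<bar>)" for v w
    using lip_polygon_path[OF F(1), of n "T * 2 ^ n" 0 v 0 w] by simp
qed

lemma brownian_polygon_convergence: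
  assumes F: "lip_functional Lp T F" "\<And>x. \<bar>F x\<bar> \<le> C"
  shows "(\<lambda>n. \<integral>\<omega>. F (polygon_path n (T * 2 ^ n) 0 (\<lambda>j. brownian_increment n j \<omega>)) \<partial>N)
     \<longlonglongrightarrow> integral\<^sup>L (path_law N B) F"
proof -
  interpret N: prob_space N by (rule brownian_prob_space)
  obtain B' where B': "\<And>t. t \<ge> 0 \<Longrightarrow> B' t \<in> borel_measurable N"
    "\<And>\<omega>. \<omega> \<in> space N \<Longrightarrow> continuous_on {0..} (\<lambda>t. B' t \<omega>)"
    "AE \<omega> in N. \<forall>t. B' t \<omega> = B t \<omega>"
    "path_law N B = distr N borel (\<lambda>\<omega>. to_cpath (\<lambda>t. B' t \<omega>))"
    by (rule continuous_process_modification[OF brownian_continuous]) (rule that)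
  have "integral\<^sup>L (path_law N B) F = (\<integral>\<omega>. F (to_cpath (\<lambda>t. B' t \<omega>)) \<partial>N)"
    unfolding B'(4) by (rule integral_distr[OF measurable_to_cpath[OF B'(1,2)] borel_lip_functional[OF F(1)]])
  moreover have "(\<lambda>n. \<integral>\<omega>. F (polygon_path n (T * 2 ^ n) 0 (\<lambda>j. brownian_increment n j \<omega>)) \<partial>N)
     \<longlonglongrightarrow> (\<integral>\<omega>. F (to_cpath (\<lambda>t. B' t \<omega>)) \<partial>N)"
  proof (rule integral_dominated_convergence[where w = "\<lambda>_. C"])
    show "(\<lambda>\<omega>. F (to_cpath (\<lambda>t. B' t \<omega>))) \<in> borel_measurable N"
      by (rule borel_measurable_lip_functional[OF F(1) B'(1,2)])
    show "(\<lambda>\<omega>. F (polygon_path n (T * 2 ^ n) 0 (\<lambda>j. brownian_increment n j \<omega>))) \<in> borel_measurable N" for n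
      by (rule borel_measurable_polygon_functional[OF F(1)]) (auto intro!: borel_measurable_diff brownian_measurable)
    show "AE \<omega> in N. (\<lambda>n. F (polygon_path n (T * 2 ^ n) 0 (\<lambda>j. brownian_increment n j \<omega>))) \<longlonglongrightarrow> F (to_cpath (\<lambda>t. B' t \<omega>))"
      using B'(3) brownian_0 AE_space
    proof eventually_elim
      case (elim \<omega>)
      from lip_functional_interpolation[OF F(1) B'(2)[OF elim(3)]]
      show ?case using elim(1,2) by simp
    qed
    show "integrable N (\<lambda>_. C)" by (rule N.integrable_const)
  qed (auto intro: F(2))
  ultimately show ?thesis by simp
qed

text \<open>The mesh \<open>n\<close> is fixed first, so fine that interpolation errors are small for the limit and, by chaining, for all \<open>s\<close> at
  once; then \<open>s\<close> tends to \<open>0\<close>.\<close>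

lemma fclt_lip_functional:
  assumes F: "lip_functional Lp T F" "\<And>x. \<bar>F x\<bar> \<le> C" and T: "T > 0"
    and s: "\<And>i. s i \<in> {0<..<1}" "s \<longlonglongrightarrow> 0"
  shows "(\<lambda>i. integral\<^sup>L (path_law M (scaled_process k (s i))) F) \<longlonglongrightarrow> integral\<^sup>L (path_law N B) F"
proof (rule LIMSEQ_I)
  fix e :: real assume e: "e > 0"
  have Lp: "Lp \<ge> 0" using F(1) by (simp add: lip_functional_def)
  have C: "C \<ge> 0" using F(2)[of undefined] by linarith
  define L where "L i = ln (1 / s i)" for i
  have s01: "0 < s i" "s i < 1" for i using s(1)[of i] by auto
  have L: "L i > 0" for i unfolding L_def using s01[of i] by simp
  have Llim: "filterlim L at_top sequentially"
  proof -
    have "filterlim s (at_right 0) sequentially"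
    proof -
      have "s i \<in> {0<..}" "s i \<noteq> 0" for i using s01[of i] by auto
      then show ?thesis unfolding filterlim_at using s(2) by simp
    qed
    moreover have "filterlim (\<lambda>u::real. ln (1 / u)) at_top (at_right 0)" by real_asymp
    ultimately show ?thesis unfolding L_def[abs_def] by (rule filterlim_compose[rotated])
  qed
  (* The factor 3 counts the errors of size delta, 8 leaves room for the other contributions. *)
  define \<delta> where "\<delta> = e / (24 * (Lp + 1))"
  have \<delta>: "\<delta> > 0" "Lp * (3 * \<delta>) \<le> e / 8"
  proof -
    show "\<delta> > 0" using e Lp by (simp add: \<delta>_def)
    have "Lp * (3 * \<delta>) \<le> (Lp + 1) * (3 * \<delta>)" using \<open>\<delta> > 0\<close> by (intro mult_right_mono) auto
    also have "\<dots> = e / 8" using Lp by (simp add: \<delta>_def field_simps)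
    finally show "Lp * (3 * \<delta>) \<le> e / 8" .
  qed
  define p1 where "p1 n = 5 * real T * chain_const 2 * 100\<^sup>2 * 2 ^ n * (1 / 2 ^ n / \<delta>\<^sup>2)\<^sup>2" for n :: nat
  have "p1 \<longlonglongrightarrow> 0"
  proof -
    have eq: "p1 = (\<lambda>n. 5 * real T * chain_const 2 * 100\<^sup>2 / (\<delta>\<^sup>2)\<^sup>2 * (1 / 2 ^ n))"
      by (rule ext) (simp add: p1_def power_divide power2_eq_square)
    show ?thesis unfolding eq by (rule tendsto_mult_right_zero) real_asymp
  qed
  then have p1: "\<forall>\<^sub>F n in sequentially. 2 * C * p1 n < e / 8"
    using order_tendstoD(2)[OF tendsto_mult_right_zero[of p1 sequentially "2 * C"], of "e / 8"] e by simp
  let ?bn = "\<lambda>n. \<integral>\<omega>. F (polygon_path n (T * 2 ^ n) 0 (\<lambda>j. brownian_increment n j \<omega>)) \<partial>N"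
  let ?b = "integral\<^sup>L (path_law N B) F"
  have bn: "\<forall>\<^sub>F n in sequentially. dist (?bn n) ?b < e / 8"
    by (rule tendstoD[OF brownian_polygon_convergence[OF F]]) (use e in simp)
  obtain n where n: "2 * C * p1 n < e / 8" "\<bar>?bn n - ?b\<bar> < e / 8"
    using eventually_happens[OF eventually_conj[OF p1 bn]] by (auto simp: dist_real_def)
  define J where "J = T * 2 ^ n"
  define c where "c = (\<delta> / real (2 * J + 1))\<^sup>2 / (2 * var_const)"
  have c: "c > 0" using \<delta>(1) var_const_pos by (simp add: c_def)
  define bad where "bad i = real (J + 2) * (2 * exp (- (c * L i)))" for i
  let ?Z = "\<lambda>i \<omega>. F (polygon_path n J 0 (\<lambda>j. block_sum (L i) n j \<omega>))"
  have ev1: "\<forall>\<^sub>F i in sequentially. 2 * C * bad i < e / 8"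
  proof -
    have "((\<lambda>x. 2 * C * (real (J + 2) * (2 * exp (- (c * x))))) \<longlongrightarrow> 0) at_top"
      by (intro tendsto_mult_right_zero) (use c in real_asymp)
    from filterlim_compose[OF this Llim] show ?thesis
      unfolding bad_def by (rule order_tendstoD(2)) (use e in simp)
  qed
  have ev2: "\<forall>\<^sub>F i in sequentially. Lp * (centring_const / sqrt (L i)) < e / 8"
  proof -
    have "((\<lambda>x. Lp * (centring_const / sqrt x)) \<longlongrightarrow> 0) at_top"
      by (intro tendsto_mult_right_zero) real_asymp
    from filterlim_compose[OF this Llim] show ?thesis by (rule order_tendstoD(2)) (use e in simp)
  qed
  have ev3: "\<forall>\<^sub>F i in sequentially. dist (expectation (?Z i)) (?bn n) < e / 8"
    unfolding J_def by (rule tendstoD[OF polygon_convergence[OF F T L Llim]]) (use e in simp)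
  have "\<forall>\<^sub>F i in sequentially. norm (integral\<^sup>L (path_law M (scaled_process k (s i))) F - ?b) < e"
    using ev1 ev2 ev3
  proof eventually_elim
    case (elim i)
    have cp: "continuous_process M (scaled_process k (s i))" by (rule continuous_process_scaled[OF k s01])
    obtain X' where X': "\<And>t. t \<ge> 0 \<Longrightarrow> X' t \<in> borel_measurable M"
      "\<And>\<omega>. \<omega> \<in> space M \<Longrightarrow> continuous_on {0..} (\<lambda>t. X' t \<omega>)"
      "AE \<omega> in M. \<forall>t. X' t \<omega> = scaled_process k (s i) t \<omega>"
      "path_law M (scaled_process k (s i)) = distr M borel (\<lambda>\<omega>. to_cpath (\<lambda>t. X' t \<omega>))"
      by (rule continuous_process_modification[OF cp]) (rule that)
    have law: "integral\<^sup>L (path_law M (scaled_process k (s i))) F = expectation (\<lambda>\<omega>. F (to_cpath (\<lambda>t. X' t \<omega>)))"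
      unfolding X'(4) by (rule integral_distr[OF measurable_to_cpath[OF X'(1,2)] borel_lip_functional[OF F(1)]])
    obtain E where E: "E \<in> events" "prob E \<le> p1 n + bad i"
      "AE \<omega> in M. \<omega> \<notin> E \<longrightarrow> (\<forall>t. 0 \<le> t \<longrightarrow> t < real T \<longrightarrow>
       \<bar>scaled_process k (s i) t \<omega> - polygon n J 0 (\<lambda>j. block_sum (L i) n j \<omega>) t\<bar> \<le> 3 * \<delta> + centring_const / sqrt (L i))"
    proof -
      have bad: "bad i = real (J + 2) * (2 * exp (- ((\<delta> / real (2 * J + 1))\<^sup>2 * L i / (2 * var_const))))"
        by (simp add: bad_def c_def)
      show ?thesis
        by (rule bexE[OF scaled_process_approximation[OF k s01 T \<delta>(1), of n i]], elim conjE, rule that)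
          (simp_all only: p1_def bad L_def J_def)
    qed
    let ?\<eta> = "3 * \<delta> + centring_const / sqrt (L i)"
    have cc: "centring_const \<ge> 0"
      using prime_zeta_nonneg[of 2] zeta_pos[of "3/2"] by (simp add: centring_const_def)
    have \<eta>: "?\<eta> \<ge> 0" using \<delta>(1) cc L[of i] by simp
    have "\<bar>expectation (\<lambda>\<omega>. F (to_cpath (\<lambda>t. X' t \<omega>))) - expectation (?Z i)\<bar> \<le> Lp * ?\<eta> + 2 * C * prob E"
    proof (rule integral_diff_bound)
      show "(\<lambda>\<omega>. F (to_cpath (\<lambda>t. X' t \<omega>))) \<in> borel_measurable M"
        by (rule borel_measurable_lip_functional[OF F(1) X'(1,2)])
      show "?Z i \<in> borel_measurable M"
      proof (rule borel_measurable_polygon_functional[OF F(1)])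
        show "block_sum (L i) n j \<in> borel_measurable M" for j unfolding block_sum_def[abs_def] by measurable
      qed simp
      show "AE \<omega> in M. \<omega> \<notin> E \<longrightarrow> \<bar>F (to_cpath (\<lambda>t. X' t \<omega>)) - ?Z i \<omega>\<bar> \<le> Lp * ?\<eta>"
        using E(3) X'(3) AE_space
      proof eventually_elim
        fix \<omega>
        assume close: "\<omega> \<notin> E \<longrightarrow> (\<forall>t. 0 \<le> t \<longrightarrow> t < real T \<longrightarrow>
            \<bar>scaled_process k (s i) t \<omega> - polygon n J 0 (\<lambda>j. block_sum (L i) n j \<omega>) t\<bar> \<le> ?\<eta>)"
          and eq: "\<forall>t. X' t \<omega> = scaled_process k (s i) t \<omega>" and sp: "\<omega> \<in> space M"
        show "\<omega> \<notin> E \<longrightarrow> \<bar>F (to_cpath (\<lambda>t. X' t \<omega>)) - ?Z i \<omega>\<bar> \<le> Lp * ?\<eta>"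
        proof
          assume \<omega>: "\<omega> \<notin> E"
          show "\<bar>F (to_cpath (\<lambda>t. X' t \<omega>)) - ?Z i \<omega>\<bar> \<le> Lp * ?\<eta>"
          proof (rule lip_functionalD[OF F(1) _ \<eta>])
            fix t assume t: "0 \<le> t" "t < real T"
            have "path_at (to_cpath (\<lambda>t. X' t \<omega>)) t = scaled_process k (s i) t \<omega>"
              using path_at_to_cpath[OF X'(2)[OF sp] t(1)] eq by simp
            moreover have "path_at (polygon_path n J 0 (\<lambda>j. block_sum (L i) n j \<omega>)) t = polygon n J 0 (\<lambda>j. block_sum (L i) n j \<omega>) t"
              by (rule path_at_polygon_path[OF t(1)])
            ultimately show "\<bar>path_at (to_cpath (\<lambda>t. X' t \<omega>)) t - path_at (polygon_path n J 0 (\<lambda>j. block_sum (L i) n j \<omega>)) t\<bar> \<le> ?\<eta>"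
              using close \<omega> t by simp
          qed
        qed
      qed
      show "0 \<le> Lp * ?\<eta>" using Lp \<eta> by simp
    qed (use E(1) F(2) in auto)
    moreover have "Lp * ?\<eta> + 2 * C * prob E < e / 2"
    proof -
      have "2 * C * prob E \<le> 2 * C * p1 n + 2 * C * bad i"
        using mult_left_mono[OF E(2), of "2 * C"] C by (simp add: distrib_left)
      moreover have "Lp * ?\<eta> = Lp * (3 * \<delta>) + Lp * (centring_const / sqrt (L i))" by (simp add: distrib_left)
      ultimately show ?thesis using elim(1,2) n(1) \<delta>(2) by linarith
    qed
    ultimately show ?case
      using elim(3) n(2) e unfolding law real_norm_def dist_real_def by linarith
  qed
  then show "\<exists>n0. \<forall>i\<ge>n0. norm (integral\<^sup>L (path_law M (scaled_process k (s i))) F - ?b) < e"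
    by (auto simp: eventually_sequentially)
qed

text \<open>Only the inequality \<open>inf_conv F n \<le> F\<close> is available before the limit, which yields one half of the
  convergence; the other half is the same statement for \<open>- F\<close>.\<close>

lemma fclt_lower_bound:
  fixes F :: "cpath \<Rightarrow> real"
  assumes F: "continuous_on UNIV F" "\<And>x. \<bar>F x\<bar> \<le> C" and e: "e > 0"
    and s: "\<And>i. s i \<in> {0<..<1}" "s \<longlonglongrightarrow> 0"
  shows "\<forall>\<^sub>F i in sequentially. integral\<^sup>L (path_law M (scaled_process k (s i))) F > integral\<^sup>L (path_law N B) F - e"
proof -
  interpret P: prob_space "path_law N B" by (rule prob_space_path_law(1)[OF brownian_prob_space brownian_continuous])
  have Ps: "sets (path_law N B) = sets borel" by (rule prob_space_path_law(2)[OF brownian_prob_space brownian_continuous])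
  have Fm: "F \<in> borel_measurable borel" by (rule borel_measurable_continuous_onI[OF F(1)])
  have Gm: "inf_conv F n \<in> borel_measurable borel" for n by (rule borel_lip_functional[OF lip_inf_conv[OF F(2)]])
  have "(\<lambda>n. integral\<^sup>L (path_law N B) (inf_conv F n)) \<longlonglongrightarrow> integral\<^sup>L (path_law N B) F"
  proof (rule integral_dominated_convergence[where w = "\<lambda>_. C"])
    show "F \<in> borel_measurable (path_law N B)" "inf_conv F n \<in> borel_measurable (path_law N B)" for n
      using Fm Gm measurable_cong_sets[OF Ps refl] by auto
    show "AE x in path_law N B. (\<lambda>n. inf_conv F n x) \<longlonglongrightarrow> F x"
      by (rule AE_I2) (rule inf_conv_tendsto[OF F(2) lsc_of_continuous[OF F(1)]])
    show "AE x in path_law N B. norm (inf_conv F n x) \<le> C" for n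
      by (rule AE_I2) (simp add: inf_conv_bounded[OF F(2)])
    show "integrable (path_law N B) (\<lambda>_. C)" by (rule P.integrable_const)
  qed
  from order_tendstoD(1)[OF this, of "integral\<^sup>L (path_law N B) F - e / 2"] e
  obtain n where n: "integral\<^sup>L (path_law N B) (inf_conv F n) > integral\<^sup>L (path_law N B) F - e / 2"
    by (auto simp: eventually_sequentially)
  have "(\<lambda>i. integral\<^sup>L (path_law M (scaled_process k (s i))) (inf_conv F n)) \<longlonglongrightarrow> integral\<^sup>L (path_law N B) (inf_conv F n)"
    by (rule fclt_lip_functional[OF lip_inf_conv[OF F(2)] inf_conv_bounded[OF F(2)] _ s]) simp
  from order_tendstoD(1)[OF this, of "integral\<^sup>L (path_law N B) (inf_conv F n) - e / 2"] e
  have "\<forall>\<^sub>F i in sequentially. integral\<^sup>L (path_law M (scaled_process k (s i))) (inf_conv F n) > integral\<^sup>L (path_law N B) (inf_conv F n) - e / 2"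
    by simp
  then show ?thesis
  proof eventually_elim
    case (elim i)
    have cp: "continuous_process M (scaled_process k (s i))"
      by (rule continuous_process_scaled[OF k]) (use s(1)[of i] in auto)
    interpret Q: prob_space "path_law M (scaled_process k (s i))"
      by (rule prob_space_path_law(1)[OF prob_space_axioms cp])
    have Qs: "sets (path_law M (scaled_process k (s i))) = sets borel"
      by (rule prob_space_path_law(2)[OF prob_space_axioms cp])
    have "integral\<^sup>L (path_law M (scaled_process k (s i))) (inf_conv F n) \<le> integral\<^sup>L (path_law M (scaled_process k (s i))) F"
    proof (rule integral_mono)
      show "integrable (path_law M (scaled_process k (s i))) (inf_conv F n)"
        using Gm measurable_cong_sets[OF Qs refl] inf_conv_bounded[OF F(2)]
        by (intro Q.integrable_const_bound[where B = C]) auto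
      show "integrable (path_law M (scaled_process k (s i))) F"
        using Fm measurable_cong_sets[OF Qs refl] F(2)
        by (intro Q.integrable_const_bound[where B = C]) auto
      show "inf_conv F n x \<le> F x" for x by (rule inf_conv_le_self[OF F(2)])
    qed
    then show ?case using elim n by linarith
  qed
qed

theorem weak_conv_scaled_process:
  "weak_conv_processes M (scaled_process k) {0<..<1} N B"
  unfolding weak_conv_processes_def weak_conv_measures_def
proof (intro conjI ballI allI impI)
  show "continuous_process M (scaled_process k s)" if "s \<in> {0<..<1}" for s
    by (rule continuous_process_scaled[OF k]) (use that in auto)
  show "continuous_process N B" by (rule brownian_continuous)
  fix F :: "cpath \<Rightarrow> real" assume F: "continuous_on UNIV F \<and> bounded (range F)"
  then obtain C where C: "\<And>x. \<bar>F x\<bar> \<le> C" by (auto simp: bounded_iff)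
  show "((\<lambda>s. integral\<^sup>L (path_law M (scaled_process k s)) F) \<longlongrightarrow> integral\<^sup>L (path_law N B) F) (at 0 within {0<..<1})"
    unfolding tendsto_at_iff_sequentially comp_def
  proof (intro allI impI)
    fix s :: "nat \<Rightarrow> real" assume "\<forall>i. s i \<in> {0<..<1} - {0}" "s \<longlonglongrightarrow> 0"
    then have s: "\<And>i. s i \<in> {0<..<1}" "s \<longlonglongrightarrow> 0" by auto
    show "(\<lambda>i. integral\<^sup>L (path_law M (scaled_process k (s i))) F) \<longlonglongrightarrow> integral\<^sup>L (path_law N B) F"
    proof (rule tendstoI)
      fix e :: real assume e: "e > 0"
      have F': "continuous_on UNIV (\<lambda>x. - F x)" using F by (intro continuous_intros) auto
      have "\<forall>\<^sub>F i in sequentially. integral\<^sup>L (path_law M (scaled_process k (s i))) F > integral\<^sup>L (path_law N B) F - e"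
        by (rule fclt_lower_bound[OF conjunct1[OF F] C e s])
      moreover have "\<forall>\<^sub>F i in sequentially. integral\<^sup>L (path_law M (scaled_process k (s i))) (\<lambda>x. - F x) > integral\<^sup>L (path_law N B) (\<lambda>x. - F x) - e"
        by (rule fclt_lower_bound[OF F' _ e s]) (use C in simp)
      ultimately show "\<forall>\<^sub>F i in sequentially. dist (integral\<^sup>L (path_law M (scaled_process k (s i))) F) (integral\<^sup>L (path_law N B) F) < e"
        by eventually_elim (simp add: dist_real_def abs_less_iff)
    qed
  qed
qed

end

end

theorem corollary3:
  fixes k :: nat
    and M :: "'a measure" and \<epsilon> :: "nat \<Rightarrow> 'a \<Rightarrow> real"
    and N :: "'b measure" and B :: "real \<Rightarrow> 'b \<Rightarrow> real"
  assumes "k \<ge> 3"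
    and "prob_space M"
    and "prob_space.indep_vars M (\<lambda>_. borel) \<epsilon> {p. prime p}"
    and "\<And>p. prime p \<Longrightarrow> measure M {\<omega> \<in> space M. \<epsilon> p \<omega> = 1} = 1/2"
    and "\<And>p. prime p \<Longrightarrow> measure M {\<omega> \<in> space M. \<epsilon> p \<omega> = -1} = 1/2"
    and "standard_brownian_motion N B"
  shows "weak_conv_processes M
           (\<lambda>s t \<omega>. 1 / sqrt (ln (1/s)) * centred_log_sum k (\<lambda>p. \<epsilon> p \<omega>) (s powr t))
           {0<..<1} N B \<and>
         (AE \<omega> in M.
           limit_points {0<..<exp (- exp 1)}
             (\<lambda>s. sqrt (1 / (2 * ln (1/s) * ln (ln (ln (1/s))))) *
                  centred_log_sum k (\<lambda>p. \<epsilon> p \<omega>) s)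
           = {-1..1})"
proof -
  interpret prob_space M by fact
  interpret rademacher M \<epsilon> by unfold_locales (use assms(3-5) in blast)+
  show ?thesis
    using weak_conv_scaled_process[OF assms(1,6)] AE_lil[OF assms(1)] by (rule conjI)
qed

end
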